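(* Let $p_0$ be a prime, $v\in\mathbb{Z}_{\ge 0}$, and let $f\in\mathscr{M}(A_1,A_2)$ with some $A_1>0$ and $A_2\colon\mathbb{R}_{>0}\to\mathbb{R}_{>0}$. For $x\ge2$ and every prime $p$ let $\mathcal{E}_p\subseteq(\mathbb{Z}/p\mathbb{Z})^{\times}$ with $\#\mathcal{E}_p=\nu(p)\le v$, and let $\mathcal{S}$ be the set of positive integers $n\le x$ such that $n\bmod p\notin\mathcal{E}_p$ for every prime $p$. Let $E\subseteq\mathbb{P}$ with $\min E\ge p_0$ and $g\in\{\omega,\Omega\}$. Let $D\ge1$ and let $\mathcal{P}$ be the set of primes $p$ with $\nu(p)>0$. Suppose that: (a) $\max\mathcal{P}\le D^{1/s_v}$, where $s_v=1+2/(e^{0.53/v}-1)$; (b) $\nu(p)<p-1$ for all $p\in\mathcal{P}$; (c) there are $c_0>0$ and $x_0\ge2$ with $M_f(x,E)\ge c_0$ whenever $x\ge x_0$; (d) there are constants $B>0$ and $\theta\in(1/2,1)$ such that $\sum_{p\le t}f(p)\ge B\,\frac{t}{\log 2t}$ for all $t\in[x^\theta,x]$; (e) as $x\to\infty$, \[\sum_{\substack{d\le D\\ d\mid\mathcal{P}}}\nu(d)\max_{\gcd(a,d)=1}\left|\sum_{\substack{n\le x\\ n\equiv a\,(\mathrm{mod}\,d)}}f(n)-\frac{F(d)}{\varphi(d)}\sum_{n\le x}f(n)\right|=o\left(\frac{x}{\log x}e^{M_f(x)-M_\nu(x)}\right),\] where $F(d)=\prod_{p\mid d}\left(\sum_{\ell\ge0}f(p^\ell)/p^\ell\right)^{-1}$.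 Then for any $x\ge x_0$ and $0<\lambda\le\sqrt{M_f(x,E)}/2$, \[\left(\sum_{n\in\mathcal{S}}f(n)\right)^{-1}\sum_{\substack{n\in\mathcal{S}\\ |g(n,E)-M_f(x,E)|\ge\lambda\sqrt{M_f(x,E)}}}f(n)\ll\lambda^{-1}\exp\left(-\frac{\lambda^2}{2}+O\left(\frac{\lambda^3}{\sqrt{M_f(x,E)}}\right)\right),\] where the implied constant in $\ll$ may depend on $A_1,A_2,B,c_0,v,x_0,\theta$ as well as on the implied constant (the rate of decay) in (e), while the implied constant in the big $O$ is absolute.
   Context: $\mathbb{N}$ is the set of positive integers, $\mathbb{P}$ the set of primes, $p$ always denotes a prime, $\varphi$ is Euler's function. $\Omega(n)$ is the number of prime factors of $n$ counted with multiplicity. For a constant $A_1>0$ and a function $A_2\colon\mathbb{R}_{>0}\to\mathbb{R}_{>0}$, $\mathscr{M}(A_1,A_2)$ is the class of functions $f\colon\mathbb{N}\to\mathbb{R}_{\ge0}$ that are multiplicative ($f(1)=1$ and $f(mn)=f(m)f(n)$ whenever $\gcd(m,n)=1$) and satisfy (i) $f(n)\le A_1^{\Omega(n)}$ for all $n$; (ii) for every $\epsilon>0$, $f(n)\le A_2(\epsilon)n^{\epsilon}$ for all $n$. For $E\subseteq\mathbb{P}$: $\omega(n,E)=\#\{p\in E: p\mid n\}$ and $\Omega(n,E)=\#\{(p,\ell)\in E\times\mathbb{N}: p^\ell\mid n\}$. For $h\colon\mathbb{P}\to\mathbb{R}_{\ge0}$, $M_h(x,E)=\sum_{p\le x,\,p\in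 E}h(p)/p$ and $M_h(x)=M_h(x,\mathbb{P})$; in particular $M_\nu(x)=\sum_{p\le x}\nu(p)/p$. The notation $d\mid\mathcal{P}$ means that $d$ is a squarefree positive integer all of whose prime factors lie in $\mathcal{P}$, and $\nu(d)=\prod_{p\mid d}\nu(p)$. The level $D$ and the classes $\mathcal{E}_p$ (hence $\nu$, $\mathcal{P}$, $\mathcal{S}$) are allowed to depend on $x$; hypotheses (a), (b), (d) are imposed for every $x\ge x_0$. If $\mathcal{P}$ is empty (in particular if $v=0$), condition (a) is vacuous. If $\sum_{n\in\mathcal{S}}f(n)=0$, the left-hand side of the conclusion is interpreted as $0$. *)

theory Defs
  imports "HOL-Number_Theory.Number_Theory" "HOL-Computational_Algebra.Squarefree"
    "HOL-Library.Landau_Symbols"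
begin

text \<open>
  Arithmetic functions are functions on \<open>nat\<close> of which only the values at positive integers
  are constrained or used.
\<close>

definition multiplicative :: "(nat \<Rightarrow> real) \<Rightarrow> bool" where
  "multiplicative f \<longleftrightarrow>
     f 1 = 1 \<and> (\<forall>m>0. \<forall>n>0. coprime m n \<longrightarrow> f (m * n) = f m * f n)"

text \<open>\<open>size (prime_factorization n)\<close> is the total number of prime factors with multiplicity.\<close>

definition mult_class :: "real \<Rightarrow> (real \<Rightarrow> real) \<Rightarrow> (nat \<Rightarrow> real) set" where
  "mult_class A1 A2 =
     {f. (\<forall>n>0. f n \<ge> 0) \<and> multiplicative f \<and>
         (\<forall>n>0. f n \<le> A1 ^ size (prime_factorization n)) \<and>
         (\<forall>\<epsilon>>0. \<forall>n>0. f n \<le> A2 \<epsilon> * real n powr \<epsilon>)}"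

definition omega_in :: "nat \<Rightarrow> nat set \<Rightarrow> nat" where
  "omega_in n E = card {p \<in> E. p dvd n}"

definition Omega_in :: "nat \<Rightarrow> nat set \<Rightarrow> nat" where
  "Omega_in n E = card {(p, l). p \<in> E \<and> 0 < l \<and> p ^ l dvd n}"

definition prime_mean :: "(nat \<Rightarrow> real) \<Rightarrow> real \<Rightarrow> nat set \<Rightarrow> real" where
  "prime_mean h x E = (\<Sum>p | prime p \<and> real p \<le> x \<and> p \<in> E. h p / real p)"

text \<open>
  A system of residue classes is a map \<open>R\<close> assigning to each prime \<open>p\<close> a set \<open>R p\<close> of
  representatives in \<open>totatives p\<close>, which stands for the units modulo \<open>p\<close>.
\<close>

definition residue_count :: "(nat \<Rightarrow> nat set) \<Rightarrow> nat \<Rightarrow> nat" where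
  "residue_count R p = card (R p)"

definition residue_count_prod :: "(nat \<Rightarrow> nat set) \<Rightarrow> nat \<Rightarrow> nat" where
  "residue_count_prod R d = (\<Prod>p\<in>prime_factors d. residue_count R p)"

definition sieving_primes :: "(nat \<Rightarrow> nat set) \<Rightarrow> nat set" where
  "sieving_primes R = {p. prime p \<and> residue_count R p > 0}"

definition sifted_set :: "real \<Rightarrow> (nat \<Rightarrow> nat set) \<Rightarrow> nat set" where
  "sifted_set x R = {n. 0 < n \<and> real n \<le> x \<and> (\<forall>p. prime p \<longrightarrow> n mod p \<notin> R p)}"

text \<open>For \<open>v = 0\<close> the value of \<open>sieve_exponent\<close> is junk; no prime is then sieved.\<close>

definition sieve_exponent :: "nat \<Rightarrow> real" where
  "sieve_exponent v = 1 + 2 / (exp (0.53 / real v) - 1)"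

definition local_density :: "(nat \<Rightarrow> real) \<Rightarrow> nat \<Rightarrow> real" where
  "local_density f d = (\<Prod>p\<in>prime_factors d. inverse (\<Sum>l. f (p ^ l) / real (p ^ l)))"

definition progression_error :: "(nat \<Rightarrow> real) \<Rightarrow> real \<Rightarrow> nat \<Rightarrow> nat \<Rightarrow> real" where
  "progression_error f x d a =
     \<bar>(\<Sum>n | 0 < n \<and> real n \<le> x \<and> [n = a] (mod d). f n)
        - local_density f d / real (totient d) * (\<Sum>n | 0 < n \<and> real n \<le> x. f n)\<bar>"

definition level_error :: "(nat \<Rightarrow> real) \<Rightarrow> (nat \<Rightarrow> nat set) \<Rightarrow> real \<Rightarrow> real \<Rightarrow> real" where
  "level_error f R D x =
     (\<Sum>d | squarefree d \<and> real d \<le> D \<and> prime_factors d \<subseteq> sieving_primes R.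
        real (residue_count_prod R d) * (MAX a\<in>totatives d. progression_error f x d a))"

text \<open>
  \<open>smallo_rate T u w\<close> is \<open>u \<in> o(w)\<close> at infinity with an explicit modulus \<open>T\<close>, so
  that constants may depend on the rate of decay but not otherwise on \<open>u\<close> and \<open>w\<close>.
\<close>

definition smallo_rate :: "(real \<Rightarrow> real) \<Rightarrow> (real \<Rightarrow> real) \<Rightarrow> (real \<Rightarrow> real) \<Rightarrow> bool" where
  "smallo_rate T u w \<longleftrightarrow> (\<forall>\<epsilon>>0. \<forall>x\<ge>T \<epsilon>. \<bar>u x\<bar> \<le> \<epsilon> * \<bar>w x\<bar>)"

lemma smallo_iff_rate: "u \<in> o(w) \<longleftrightarrow> (\<exists>T. smallo_rate T u w)"
proof -
  have "u \<in> o(w) \<longleftrightarrow> (\<forall>\<epsilon>>0. \<exists>t. \<forall>x\<ge>t. \<bar>u x\<bar> \<le> \<epsilon> * \<bar>w x\<bar>)"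
    by (auto simp: smallo_def eventually_at_top_linorder)
  also have "\<dots> \<longleftrightarrow> (\<exists>T. smallo_rate T u w)"
    unfolding smallo_rate_def by metis
  finally show ?thesis .
qed

end

theory Submission
  imports Defs "HOL-Number_Theory.Number_Theory" "HOL-Computational_Algebra.Squarefree"
    "HOL-Computational_Algebra.Polynomial" "HOL-Analysis.Harmonic_Numbers" "HOL-Real_Asymp.Real_Asymp"
begin

text \<open>Split off the largest prime \<open>p\<close> of \<open>n = m * p\<close>: for fixed \<open>m\<close> an upper bound sieve counts the admissible
  \<open>p\<close>, and the remaining sum over \<open>m\<close> is the coefficient of an Euler product, dominated termwise by a Poisson
  distribution of mean \<open>prime_mean f x E\<close>. The total mass of the sifted set is bounded below by a Brun-type sieve whose
  truncation is governed by partial sums of the densities (\<open>depth\<close>), which gives the level \<open>sieve_exponent v\<close>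
  after removing the primes below some \<open>a\<close> exactly.\<close>

text \<open>The value of \<open>sieve_exponent v\<close> comes from Brun's geometric truncation: if
  the primes in positions \<open>2k\<close> and \<open>2k+1\<close> of a modulus lie below
  \<open>z\<close> to the power \<open>exp (- 0.53 * k / v)\<close>, its logarithm is at most
  \<open>ln z\<close> times \<open>1 + 2 * (exp (- 0.53 / v) + exp (- 2 * 0.53 / v) + ...)\<close>,
  which sums to that exponent. The hypothesis leaves no room for a larger level and gives no lower
  bound on \<open>z\<close>; hence the explicit Mertens estimates and numerical checks. The
  thresholds are put on accumulated weight \<open>- ln (1 - w p)\<close>: the loss in the main term
  then does not depend on how the primes are distributed, only the size of the moduli does. The
  first threshold is 0.84; its surplus 0.31 over 0.53 pays for replacing the geometric sum by an
  integral. Two further obstacles: \<open>D\<close> is not bounded in terms of \<open>x\<close>, so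
  sieving primes may exceed \<open>x\<close> and are controlled by the error hypothesis itself; and
  a Chernoff bound loses the factor \<open>1 / lam\<close>, which is why coefficients of generating
  polynomials, not only moments, are compared with the Poisson distribution.\<close>

abbreviation sieve_mean :: "(nat => nat set) => real => real" where
 "sieve_mean R x \<equiv> prime_mean (%p. real (card (R p))) x UNIV"

abbreviation residue_system :: "nat => (nat => nat set) => bool" where
 "residue_system v R \<equiv> \<forall>p. prime p --> R p \<subseteq> totatives p & card (R p) <= v"

abbreviation total :: "(nat => real) => real => real" where
 "total f x \<equiv> \<Sum>n | 0 < n & real n <= x. f n"

section \<open>Explicit Chebyshev and Mertens bounds\<close>

definition theta :: "nat => real" where
 "theta n = (\<Sum>p | prime p & p <= n. ln (real p))"

definition mertens :: "nat => real" where
 "mertens n = (\<Sum>p | prime p & p <= n. ln (real p) / real p)"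

lemma primes_le_Suc: "{p. prime p & p <= Suc n} = (if prime (Suc n) then insert (Suc n) {p. prime p & p <= n} else {p. prime p & p <= n})"
 by (auto simp: le_Suc_eq)


lemma prod_primes_dvd:
 assumes "finite Q" "!!p. p : Q ==> prime p & p dvd (N::nat)"
 shows "\<Prod>Q dvd N"
 using assms
proof (induction Q)
 case (insert p Q)
 have "coprime p (\<Prod>Q)"
  using insert by (intro prod_coprime_right) (auto intro!: primes_coprime)
 thus ?case using insert by (auto intro!: divides_mult)
qed simp

lemma binomial_odd_le: "(2 * m + 1) choose m <= 4 ^ m"
proof -
 have "2 * ((2 * m + 1) choose m) = (\<Sum>k\<in>{m, m+1}. (2 * m + 1) choose k)"
  using binomial_symmetric[of m "2*m+1"] by simp
 also have "\<dots> <= (\<Sum>k\<le>2*m+1. (2 * m + 1) choose k)" by (intro sum_mono2) auto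
 also have "\<dots> = 2 ^ (2 * m + 1)" by (rule choose_row_sum)
 finally show ?thesis by (simp add: power_mult)
qed

text \<open>Erdos's argument: the primes in \<open>(m + 1, 2 * m + 1]\<close> all divide
  \<open>(2 * m + 1) choose m\<close>, which is at most \<open>4 ^ m\<close>; the primes up to
  \<open>m + 1\<close> come from the induction hypothesis, and an even number above 2 adds no
  prime.\<close>

lemma theta_le: "theta n <= n * ln 4"
proof (induction n rule: less_induct)
 case (less n)
 consider "n <= 1" | "n = 2" | "n > 2" "even n" | "n > 2" "odd n"
  by (cases "n <= 1"; cases "n = 2"; cases "even n"; simp)
 thus ?case
 proof cases
  case 1
  hence "\<not> (prime p & p <= n)" for p using prime_ge_2_nat[of p] by auto
  hence "{p. prime p & p <= n} = {}" by blast
  thus ?thesis unfolding theta_def by (simp only: sum.empty) simp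
 next
  case 2
  have "{p. prime p & p <= (2::nat)} = {2}" by (auto dest: prime_ge_2_nat)
  moreover have "ln 2 <= ln (4::real)" "0 <= ln (4::real)" by simp_all
  hence "ln 2 <= 2 * ln (4::real)" by linarith
  ultimately show ?thesis unfolding 2 theta_def by simp
 next
  case 3
  then obtain m where m: "n = Suc m" by (cases n) auto
  have "\<not> prime n" using 3 prime_odd_nat[of n] by auto
  hence "theta n = theta m" unfolding theta_def m by (simp add: primes_le_Suc)
  also have "\<dots> <= m * ln 4" using less m by auto
  also have "\<dots> <= n * ln 4" unfolding m by (intro mult_right_mono) auto
  finally show ?thesis .
 next
  case 4
  then obtain m where m: "n = 2 * m + 1" by (auto elim: oddE)
  have m1: "m >= 1" using 4 m by auto
  let ?Q = "{p. prime p & m + 1 < p & p <= n}"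
  have fQ: "finite ?Q" by (rule finite_subset[of _ "{..n}"]) auto
  have split: "{p. prime p & p <= n} = {p. prime p & p <= m + 1} \<union> ?Q" using m by auto
  have "\<Prod>?Q dvd (n choose m)"
  proof (rule prod_primes_dvd[OF fQ])
   fix p assume "p : ?Q"
   hence p: "prime p" "m + 1 < p" "p <= n" by auto
   have "fact m * fact (n - m) * (n choose m) = (fact n :: nat)"
   using m by (intro binomial_fact_lemma) auto
   moreover have "p dvd fact n" using p by (simp add: prime_dvd_fact_iff)
   ultimately have "p dvd fact m * fact (n - m) * (n choose m)" by simp
   moreover have "\<not> p dvd fact m" using p by (simp add: prime_dvd_fact_iff)
   moreover have "\<not> p dvd fact (n - m)" using p m by (subst prime_dvd_fact_iff) auto
   ultimately show "prime p & p dvd (n choose m)" using p(1) by (metis prime_dvd_mult_iff)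
  qed
  hence "\<Prod>?Q <= (n choose m)" using m by (intro dvd_imp_le) (auto simp: zero_less_binomial_iff)
  also have "\<dots> <= 4 ^ m" unfolding m by (rule binomial_odd_le)
  finally have le: "\<Prod>?Q <= 4 ^ m" .
  have "(\<Sum>p\<in>?Q. ln (real p)) = ln (real (\<Prod>?Q))"
   unfolding of_nat_prod by (subst ln_prod[OF fQ]) (auto simp: prime_gt_0_nat)
  also have "\<dots> <= ln (real (4 ^ m))"
  proof (subst ln_le_cancel_iff)
   show "0 < real (\<Prod>?Q)" unfolding of_nat_prod by (intro prod_pos) (auto simp: prime_gt_0_nat)
   show "real (\<Prod>?Q) <= real (4 ^ m)" using le unfolding of_nat_le_iff .
  qed auto
  also have "\<dots> = m * ln 4" by (simp add: ln_realpow)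
  finally have "(\<Sum>p\<in>?Q. ln (real p)) <= m * ln 4" .
  moreover have "theta (m + 1) <= (m + 1) * ln 4" using less[of "m+1"] 4 m by simp
  moreover have "theta n = theta (m + 1) + (\<Sum>p\<in>?Q. ln (real p))"
   unfolding theta_def split by (rule sum.union_disjoint) (use fQ in auto)
  ultimately show ?thesis unfolding m by (simp add: algebra_simps)
 qed
qed

text \<open>Stirling by induction: the midpoint rule underestimates the integral of
  \<open>1 / t\<close> over \<open>[n, n + 1]\<close>.\<close>

lemma ln_fact_upper: "n >= 1 ==> ln (fact n) <= real n * ln n - n + ln n / 2 + 1"
proof (induction n rule: dec_induct)
 case (step n)
 have "ln (real n + 1) - ln (real n) >= 2 * 1 / (2 * n + 1)"
  using ln_inverse_approx_ge[of "real n" "real n + 1"] step by (simp add: algebra_simps)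
 hence "(n + 1/2) * (ln (real n + 1) - ln (real n)) >= (n + 1/2) * (2 * 1 / (2 * n + 1))"
  by (intro mult_left_mono) auto
 also have "(n + 1/2) * (2 * 1 / (2 * n + 1)) = (1::real)" by (simp add: field_simps)
 finally have "(n + 1/2) * (ln (real n + 1) - ln (real n)) >= 1" .
 moreover have "ln (fact (Suc n)) = ln (real n + 1) + ln (fact n :: real)"
  by (simp add: ln_mult add_ac)
 ultimately show ?case using step.IH by (simp add: algebra_simps add_divide_distrib)
qed simp

text \<open>The trapezoidal companion. The rule overshoots by
  \<open>1 / (4 * n) - 1 / (4 * (n + 1))\<close> per step, which the last summand absorbs by
  telescoping; 3/4 is fixed by equality at \<open>n = 1\<close>.\<close>

lemma ln_fact_lower: "n >= 1 ==> ln (fact n) >= real n * ln n - n + ln n / 2 + 3/4 + 1 / (4 * n)"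
proof (induction n rule: dec_induct)
 case (step n)
 have n: "real n >= 1" using step by simp
 have "ln (real n + 1) - ln (real n) <= (inverse n + inverse (real n + 1)) / 2"
  using ln_inverse_approx_le[of "real n" 1] n by simp
 hence "(n + 1/2) * (ln (real n + 1) - ln (real n)) <= (n + 1/2) * ((inverse n + inverse (real n + 1)) / 2)"
  by (intro mult_left_mono) auto
 also have "(n + 1/2) * ((inverse n + inverse (real n + 1)) / 2) = 1 + 1 / (4 * real n) - 1 / (4 * (real n + 1))"
 proof -
  have h: "(y + 1/2) * ((inverse y + inverse (y + 1)) / 2) = 1 + 1 / (4 * y) - 1 / (4 * (y + 1))" if "y >= 1" for y :: real
  proof -
   have "y ~= 0" "y + 1 ~= 0" using that by auto
   thus ?thesis by (simp add: divide_simps) (simp add: algebra_simps)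
  qed
  show ?thesis by (rule h[OF n])
 qed
 finally have "(n + 1/2) * (ln (real n + 1) - ln (real n)) <= 1 + 1 / (4 * real n) - 1 / (4 * (real n + 1))" .
 moreover have "ln (fact (Suc n)) = ln (real n + 1) + ln (fact n :: real)"
  by (simp add: ln_mult add_ac)
 moreover have "real (Suc n) = real n + 1" by simp
 ultimately show ?case using step.IH by (simp only: of_nat_mult of_nat_numeral) (simp only: algebra_simps add_divide_distrib)
qed simp

lemma ln_eq_sum_multiplicity:
 assumes "m > 0"
 shows "ln (real m) = (\<Sum>p\<in>prime_factors m. multiplicity p m * ln (real p))"
proof -
 have "m = (\<Prod>p\<in>prime_factors m. p ^ multiplicity p m)" using assms by (rule prime_factorization_nat)
 hence "ln (real m) = ln (\<Prod>p\<in>prime_factors m. real p ^ multiplicity p m)"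
  by (metis (no_types, lifting) of_nat_power of_nat_prod prod.cong)
 also have "\<dots> = (\<Sum>p\<in>prime_factors m. ln (real p ^ multiplicity p m))"
  by (rule ln_prod) (auto simp: in_prime_factors_iff prime_gt_0_nat)
 also have "\<dots> = (\<Sum>p\<in>prime_factors m. multiplicity p m * ln (real p))"
  by (simp add: ln_realpow)
 finally show ?thesis .
qed

text \<open>Of the higher prime powers only 4, 8 and 9 are counted. In
  \<open>mertens_upper_aux\<close> they lower the coefficient of \<open>n\<close> from
  \<open>2 * ln 2 - 1\<close> to less than 0.0045, which is what keeps the constants of
  \<open>mertens_upper_13\<close> and \<open>mertens_upper_31\<close> small.\<close>

lemma ln_ge_sum_prime_factors:
 assumes "m > 0"
 shows "(\<Sum>p\<in>prime_factors m. ln (real p)) + ln 2 * (of_bool (4 dvd m) + of_bool (8 dvd m)) + ln 3 * of_bool (9 dvd m) <= ln (real m)"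
proof -
 define c where "c = (%p::nat. if p = 2 then of_bool (4 dvd m) + of_bool (8 dvd m) else if p = 3 then of_bool (9 dvd m) else (0::nat))"
 have pw: "k <= multiplicity p m" if "p ^ k dvd m" "prime p" for p k
  using that assms by (intro multiplicity_geI) (auto simp: prime_nat_iff)
 have 1: "1 + c p <= multiplicity p m" if "p : prime_factors m" for p
 proof -
  have p: "prime p" "p dvd m" using that by (auto simp: in_prime_factors_iff)
  have "4 dvd m" if "8 dvd m" using that by (rule dvd_trans[rotated]) simp
  thus ?thesis using pw[of p 1] pw[of 2 2] pw[of 2 3] pw[of 3 2] p by (auto simp: c_def)
 qed
 have f: "finite (prime_factors m)" by simp
 have "(\<Sum>p\<in>prime_factors m. c p * ln (real p)) = (\<Sum>p\<in>{2,3} \<inter> prime_factors m. c p * ln (real p))"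
  by (intro sum.mono_neutral_right) (auto simp: c_def)
 also have "\<dots> = (\<Sum>p\<in>{2,3}. c p * ln (real p))"
 proof (intro sum.mono_neutral_left ballI)
  fix p assume "p : {2,3} - {2,3} \<inter> prime_factors m"
  hence "p : {2,3}" "\<not> p dvd m" using assms by (auto simp: in_prime_factors_iff)
  moreover have "2 dvd m" if "4 dvd m \<or> 8 dvd m" using that by (auto elim!: dvd_trans[rotated])
  moreover have "3 dvd m" if "9 dvd m" using that by (auto elim!: dvd_trans[rotated])
  ultimately show "c p * ln (real p) = 0" by (auto simp: c_def)
 qed auto
 finally have 2: "(\<Sum>p\<in>prime_factors m. c p * ln (real p)) = ln 2 * (of_bool (4 dvd m) + of_bool (8 dvd m)) + ln 3 * of_bool (9 dvd m)"
  by (simp add: c_def)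
 have "(\<Sum>p\<in>prime_factors m. ln (real p)) + (\<Sum>p\<in>prime_factors m. c p * ln (real p)) = (\<Sum>p\<in>prime_factors m. real (1 + c p) * ln (real p))"
  by (simp add: algebra_simps sum.distrib)
 also have "\<dots> <= (\<Sum>p\<in>prime_factors m. multiplicity p m * ln (real p))"
  using 1 by (intro sum_mono mult_right_mono) (auto simp: in_prime_factors_iff prime_gt_0_nat Suc_leI simp del: of_nat_add of_nat_Suc)
 also have "\<dots> = ln (real m)" using ln_eq_sum_multiplicity[OF assms] by simp
 finally show ?thesis using 2 by simp
qed

lemma Suc_div_eq: "Suc n div p = n div p + of_bool (p dvd Suc n)"
 by (simp add: div_Suc dvd_eq_mod_eq_0)

lemma ln_fact_ge_sum_div:
 "n <= N ==> (\<Sum>p | prime p & p <= N. ln (real p) * real (n div p)) + ln 2 * real (n div 4 + n div 8) + ln 3 * real (n div 9) <= ln (fact n)"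
proof (induction n)
 case (Suc n)
 have pf: "prime_factors (Suc n) = {p\<in>{p. prime p & p <= N}. p dvd Suc n}"
  using Suc.prems by (auto simp: in_prime_factors_iff intro: order_trans[OF dvd_imp_le])
 have "(\<Sum>p | prime p & p <= N. ln (real p) * real (Suc n div p)) =
  (\<Sum>p | prime p & p <= N. ln (real p) * real (n div p)) + (\<Sum>p | prime p & p <= N. ln (real p) * of_bool (p dvd Suc n))"
  by (simp add: Suc_div_eq algebra_simps sum.distrib)
 also have "(\<Sum>p | prime p & p <= N. ln (real p) * of_bool (p dvd Suc n)) = (\<Sum>p\<in>prime_factors (Suc n). ln (real p))"
  unfolding pf by (rule sum.mono_neutral_cong_right) auto
 finally have "(\<Sum>p | prime p & p <= N. ln (real p) * real (Suc n div p)) + ln 2 * real (Suc n div 4 + Suc n div 8) + ln 3 * real (Suc n div 9)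
  <= ln (fact n) + ln (real (Suc n))"
  using Suc ln_ge_sum_prime_factors[of "Suc n"] by (simp add: Suc_div_eq algebra_simps)
 thus ?case by (simp add: ln_mult add_ac)
qed simp

lemma mertens_upper_aux:
 assumes n: "n >= 1"
 shows "(n + 1) * mertens n <= n * ln n - n + ln n / 2 + 1 + n * ln 4 - ln 2 * (3 * n / 8 - 13/8) - ln 3 * (n / 9 - 8/9)"
proof -
 \<comment> \<open>The remainder is at most \<open>k - 1\<close>, whence \<open>n + 1\<close> in
   place of \<open>n\<close>.\<close>
 have d: "real (n div k) >= (real n + 1) / k - 1" if "k > 0" for k
 proof -
  have "real n = real k * real (n div k) + real (n mod k)" by (metis mult_div_mod_eq of_nat_add of_nat_mult)
  moreover have "real (Suc (n mod k)) <= real k" using that by (simp only: of_nat_le_iff Suc_leI mod_less_divisor)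
  ultimately show ?thesis using that by (simp add: field_simps)
 qed
 have "(\<Sum>p | prime p & p <= n. ln (real p) * ((real n + 1) / p - 1)) <= (\<Sum>p | prime p & p <= n. ln (real p) * real (n div p))"
  by (intro sum_mono mult_left_mono d) (auto simp: prime_gt_0_nat Suc_leI)
 moreover have "(\<Sum>p | prime p & p <= n. ln (real p) * ((real n + 1) / p - 1)) = (n + 1) * mertens n - theta n"
  by (simp add: mertens_def theta_def algebra_simps sum_distrib_left sum_subtractf)
 moreover have "ln 2 * (3 * n / 8 - 13/8) <= ln 2 * real (n div 4 + n div 8)"
  using d[of 4] d[of 8] by (intro mult_left_mono) auto
 moreover have "ln 3 * (n / 9 - 8/9) <= ln 3 * real (n div 9)"
  using d[of 9] by (intro mult_left_mono) auto
 moreover have "real (n + 1) = real n + 1" by simp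
 ultimately show ?thesis
  using ln_fact_ge_sum_div[of n n, OF order_refl] theta_le[of n] ln_fact_upper[OF n]
  by (simp only: of_nat_mult of_nat_numeral)
qed

lemma ln2_bounds: "6931/10000 <= ln (2::real)" "ln (2::real) <= 6932/10000"
 using ln_approx_bounds[of 2 4] by (simp_all add: eval_nat_numeral)

lemma ln_quotient_bounds:
 fixes k :: real
 assumes "k > 0"
 shows "2 / (2 * k + 1) <= ln (k + 1) - ln k" "ln (k + 1) - ln k <= (1 / k + 1 / (k + 1)) / 2"
 using ln_inverse_approx_ge[of k "k + 1"] ln_inverse_approx_le[of k 1] assms
 by (auto simp: field_simps)

lemma ln3_bounds: "10984/10000 <= ln (3::real)" "ln (3::real) <= 10989/10000"
proof -
 have 1: "ln (9::real) = 2 * ln 3" "ln (8::real) = 3 * ln 2"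
  using ln_realpow[of 3 2] ln_realpow[of 2 3] by simp_all
 show "10984/10000 <= ln (3::real)" "ln (3::real) <= 10989/10000"
  using ln_quotient_bounds[of 8] ln2_bounds unfolding 1 by (simp_all add: 1)
qed

lemma mertens_upper:
 assumes "n >= 1"
 shows "mertens n <= ln n + 4"
proof -
 have l: "0 <= ln (real n)" using assms by simp
 have l4: "ln (4::real) = 2 * ln 2" using ln_realpow[of 2 2] by simp
 have "(real n + 1) * mertens n <= real n * ln n - n + ln n / 2 + 1 + real n * ln 4 - ln 2 * (3 * real n / 8 - 13/8) - ln 3 * (real n / 9 - 8/9)"
  by (rule mertens_upper_aux[OF assms])
 also have "\<dots> = real n * ln n + ln n / 2 + 1 + real n * (13/8 * ln 2 - 1 - ln 3 / 9) + 13/8 * ln 2 + 8/9 * ln 3"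
  unfolding l4 by (simp add: algebra_simps)
 also have "\<dots> <= real n * ln n + ln n / 2 + 1 + real n * 1 + 3"
 proof -
  have "real n * (13/8 * ln 2 - 1 - ln 3 / 9) <= real n * 1"
   using ln2_bounds ln3_bounds by (intro mult_left_mono) auto
  thus ?thesis using ln2_bounds ln3_bounds by linarith
 qed
 also have "\<dots> <= (real n + 1) * (ln n + 4)" using l assms by (simp add: algebra_simps)
 finally show ?thesis by simp
qed

text \<open>45/10000 bounds \<open>13/8 * ln 2 - 1 - ln 3 / 9\<close>, the slope of the remainder in
  \<open>n\<close>. The fourth assumption is the required inequality at \<open>n0\<close>; since
  \<open>H\<close> is at least the slope, it persists for all larger \<open>n\<close>.\<close>

lemma mertens_upper_num:
 assumes "n >= n0" "n0 >= 1" "lo <= ln (real n0)"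
  "45/10000 * real n0 + 3105/1000 - lo / 2 <= H * (real n0 + 1)" "45/10000 <= H"
 shows "mertens n <= ln n + H"
proof -
 have l4: "ln (4::real) = 2 * ln 2" using ln_realpow[of 2 2] by simp
 have lo: "lo <= ln (real n)" using assms by (intro order_trans[OF assms(3)]) auto
 have "(real n + 1) * mertens n <= real n * ln n - n + ln n / 2 + 1 + real n * ln 4 - ln 2 * (3 * real n / 8 - 13/8) - ln 3 * (real n / 9 - 8/9)"
  by (rule mertens_upper_aux) (use assms in auto)
 also have "\<dots> = (real n + 1) * ln n - ln n / 2 + 1 + real n * (13/8 * ln 2 - 1 - ln 3 / 9) + 13/8 * ln 2 + 8/9 * ln 3"
  unfolding l4 by (simp add: algebra_simps)
 also have "\<dots> <= (real n + 1) * ln n - lo / 2 + 1 + real n * (45/10000) + 2105/1000"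
 proof -
  have "real n * (13/8 * ln 2 - 1 - ln 3 / 9) <= real n * (45/10000)"
   using ln2_bounds ln3_bounds by (intro mult_left_mono) auto
  thus ?thesis using ln2_bounds ln3_bounds lo by linarith
 qed
 also have "\<dots> <= (real n + 1) * ln n + H * (real n + 1)"
 proof -
  have "(real n - real n0) * (45/10000) <= (real n - real n0) * H" using assms by (intro mult_left_mono) auto
  thus ?thesis using assms(4) by argo
 qed
 also have "\<dots> = (real n + 1) * (ln n + H)" by (simp add: algebra_simps)
 finally show ?thesis by simp
qed

lemma multiplicity_eq_sum:
 assumes "prime p" "0 < m" "m <= (N::nat)"
 shows "(\<Sum>k=1..N. of_bool (p ^ k dvd m)) = multiplicity p m"
proof -
 have "p ^ multiplicity p m <= m" using assms by (intro dvd_imp_le multiplicity_dvd)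
 hence "multiplicity p m <= N" using assms prime_gt_1_nat[of p]
  by (meson le_trans less_imp_le_nat less_exp power_mono self_le_ge2_pow prime_ge_2_nat)
 hence e: "{k\<in>{1..N}. p ^ k dvd m} = {1..multiplicity p m}"
  using assms prime_gt_1_nat[of p] by (auto simp: power_dvd_iff_le_multiplicity)
 have "(\<Sum>k=1..N. of_bool (p ^ k dvd m)) = card {k\<in>{1..N}. p ^ k dvd m}"
  by (simp add: Int_def)
 thus ?thesis unfolding e by simp
qed

lemma ln_fact_eq:
 "n <= N ==> ln (fact n) = (\<Sum>p | prime p & p <= N. ln (real p) * (\<Sum>k=1..N. real (n div p ^ k)))"
proof (induction n)
 case (Suc n)
 have "(\<Sum>p | prime p & p <= N. ln (real p) * (\<Sum>k=1..N. real (Suc n div p ^ k))) =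
  (\<Sum>p | prime p & p <= N. ln (real p) * (\<Sum>k=1..N. real (n div p ^ k)) + ln (real p) * real (\<Sum>k=1..N. of_bool (p ^ k dvd Suc n)))"
  by (intro sum.cong refl) (simp add: Suc_div_eq sum.distrib algebra_simps)
 also have "\<dots> = ln (fact n) + (\<Sum>p | prime p & p <= N. ln (real p) * real (\<Sum>k=1..N. of_bool (p ^ k dvd Suc n)))"
  unfolding sum.distrib using Suc by simp
 also have "(\<Sum>p | prime p & p <= N. ln (real p) * real (\<Sum>k=1..N. of_bool (p ^ k dvd Suc n))) =
   (\<Sum>p | prime p & p <= N. ln (real p) * multiplicity p (Suc n))"
 proof (intro sum.cong refl)
  fix p assume "p : {p. prime p & p <= N}"
  thus "ln (real p) * real (\<Sum>k=1..N. of_bool (p ^ k dvd Suc n)) = ln (real p) * multiplicity p (Suc n)"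
   using multiplicity_eq_sum[of p "Suc n" N] Suc.prems by (simp only: mem_Collect_eq zero_less_Suc)
 qed
 also have "\<dots> = (\<Sum>p\<in>prime_factors (Suc n). multiplicity p (Suc n) * ln (real p))"
  using Suc.prems by (intro sum.mono_neutral_cong_right)
   (auto simp: in_prime_factors_iff intro: order_trans[OF dvd_imp_le] simp: not_dvd_imp_multiplicity_0)
 also have "\<dots> = ln (real (Suc n))" by (rule ln_eq_sum_multiplicity[symmetric]) simp
 finally show ?case by (simp add: ln_mult add_ac)
qed simp

lemma geometric_sum_le:
 assumes "0 <= q" "q < (1::real)"
 shows "(\<Sum>k=1..N. q ^ k) <= q / (1 - q)"
proof -
 have "(1 - q) * (\<Sum>k=1..N. q ^ k) = q - q ^ Suc N"
  by (induction N) (simp_all add: distrib_left left_diff_distrib)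
 also have "\<dots> <= q" using assms by simp
 finally show ?thesis using assms by (simp add: field_simps)
qed

text \<open>The primes 2 and 3 enter exactly and from 5 on every integer is counted.
  \<open>G\<close> is modelled on the antiderivative \<open>- (ln x + 1) / x\<close> of
  \<open>ln x / x^2\<close>; raising 1 to 1.125, the value of \<open>(k / (k - 1) + 1) / 2\<close>
  at \<open>k = 5\<close>, makes its differences majorize the summands.\<close>

lemma prime_power_sum_le: "(\<Sum>p | prime p & p <= n. ln (real p) / (p * (real p - 1))) <= 116/100"
proof -
 define G where "G = (%x::real. (ln x + 1125/1000) / x)"
 have step: "ln (real k) / (k * (real k - 1)) <= G (real k - 1) - G k" if "k >= 5" for k :: nat
 proof -
  have k: "real k >= 5" using that by simp
  have "real k * (ln (real k) - ln (real k - 1)) <= real k * ((1 / (real k - 1) + 1 / k) / 2)"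
   using ln_quotient_bounds(2)[of "real k - 1"] k by (intro mult_left_mono) auto
  also have "\<dots> = (real k / (real k - 1) + 1) / 2" using k by (simp add: field_simps)
  also have "\<dots> <= 1125/1000" using k by (simp add: field_simps)
  finally have "real k * (ln (real k) - ln (real k - 1)) <= 1125/1000" .
  moreover have "G (real k - 1) - G k = (real k * ln (real k - 1) - real k * ln k + ln k + 1125/1000) / (k * (real k - 1))"
   using k unfolding G_def by (simp add: field_simps)
  ultimately show ?thesis using k by (auto intro!: divide_right_mono simp: algebra_simps)
 qed
 have tel: "(\<Sum>k\<in>{5..n}. ln (real k) / (k * (real k - 1))) <= G 4 - (if n < 5 then G 4 else G n)" for n
 proof (induction n)
  case (Suc n)
  consider "n < 4" | "n = 4" | "n >= 5" by linarith
  thus ?case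
  proof cases
   case 3
   thus ?thesis using Suc step[of "Suc n"] by simp
  qed (use step[of 5] in auto)
 qed simp
 have G0: "G n >= 0" if "n >= 1" for n :: nat using that by (simp add: G_def)
 have "(\<Sum>k\<in>{5..n}. ln (real k) / (k * (real k - 1))) <= G 4"
  using tel[of n] G0[of n] G0[of 4] by (auto split: if_splits)
 moreover have "(\<Sum>p | prime p & p <= n. ln (real p) / (p * (real p - 1))) \<le>
  (\<Sum>p\<in>{2,3} \<union> {5..n}. ln (real p) / (p * (real p - 1)))"
 proof (rule sum_mono2)
  show "{p. prime p & p <= n} \<subseteq> {2, 3} \<union> {5..n}"
  proof
   fix p assume p: "p : {p. prime p & p <= n}"
   hence "p ~= 2 * 2" using prime_product[of 2 2] by auto
   moreover have "p >= 2" using p prime_ge_2_nat by auto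
   ultimately show "p : {2, 3} \<union> {5..n}" using p by auto
  qed
 qed auto
 moreover have "(\<Sum>p\<in>{2,3} \<union> {5..n}. ln (real p) / (p * (real p - 1))) = ln 2 / 2 + ln 3 / 6 + (\<Sum>k\<in>{5..n}. ln (real k) / (k * (real k - 1)))"
  by (subst sum.union_disjoint) auto
 moreover have "G 4 = (2 * ln 2 + 1125/1000) / 4" using ln_realpow[of 2 2] by (simp add: G_def)
 ultimately show ?thesis using ln2_bounds ln3_bounds by simp
qed

text \<open>Legendre's formula with the integer parts dropped. The constant 2.16 is 1 from Stirling
  plus 1.16 from the higher prime powers.\<close>

lemma mertens_lower:
 assumes "n >= 1"
 shows "mertens n >= ln n - 216/100"
proof -
 have n: "real n > 0" using assms by simp
 have "ln (fact n) = (\<Sum>p | prime p & p <= n. ln (real p) * (\<Sum>k=1..n. real (n div p ^ k)))"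
  by (rule ln_fact_eq) simp
 also have "\<dots> <= (\<Sum>p | prime p & p <= n. ln (real p) * (n * (1 / (real p - 1))))"
 proof (intro sum_mono mult_left_mono)
  fix p assume "p : {p. prime p & p <= n}"
  hence p: "real p >= 2" using prime_ge_2_nat[of p] by simp
  have "(\<Sum>k=1..n. real (n div p ^ k)) <= (\<Sum>k=1..n. n * (1 / real p) ^ k)"
  proof (intro sum_mono)
   fix k
   have "real (n div p ^ k) <= real n / real (p ^ k)" by (rule of_nat_div_le_of_nat)
   thus "real (n div p ^ k) <= n * (1 / real p) ^ k" by (simp add: power_divide)
  qed
  also have "\<dots> = n * (\<Sum>k=1..n. (1 / real p) ^ k)" by (simp add: sum_distrib_left)
  also have "\<dots> <= n * ((1 / real p) / (1 - 1 / real p))"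
   using p by (intro mult_left_mono geometric_sum_le) auto
  also have "(1 / real p) / (1 - 1 / real p) = 1 / (real p - 1)" using p by (simp add: field_simps)
  finally show "(\<Sum>k=1..n. real (n div p ^ k)) <= n * (1 / (real p - 1))" .
  show "0 <= ln (real p)" using p by simp
 qed
 also have "\<dots> = n * (\<Sum>p | prime p & p <= n. ln (real p) / p + ln (real p) / (p * (real p - 1)))"
  unfolding sum_distrib_left
 proof (intro sum.cong refl)
  fix p assume "p : {p. prime p & p <= n}"
  hence p: "real p >= 2" using prime_ge_2_nat[of p] by simp
  show "ln (real p) * (n * (1 / (real p - 1))) = n * (ln (real p) / p + ln (real p) / (p * (real p - 1)))"
   using p by (simp add: field_simps)
 qed
 also have "\<dots> <= n * (mertens n + 116/100)"
  unfolding sum.distrib mertens_def using prime_power_sum_le[of n] by (intro mult_left_mono) auto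
 finally have "ln (fact n) <= n * (mertens n + 116/100)" .
 moreover have "ln (fact n) >= n * ln n - n" using ln_fact_lower[OF assms] assms
  by (smt (verit) divide_nonneg_nonneg ln_ge_zero of_nat_0_le_iff of_nat_1 of_nat_mono zero_le_mult_iff)
 ultimately have "n * (ln n - 1) <= n * (mertens n + 116/100)" by (simp add: algebra_simps)
 thus ?thesis using n by simp
qed

section \<open>Partial summation over primes\<close>

text \<open>Summation by parts as an induction on \<open>b\<close>. Keeping the boundary term
  \<open>(ln b + h - s b) * m b\<close> on the left makes each step cost exactly
  \<open>(ln b + h - s b) * (m b - m (Suc b))\<close>, which is nonnegative.\<close>

lemma abel_upper:
 fixes s m :: "nat => real"
 assumes "a <= b" "1 <= a" "!!n. a <= n ==> n <= b ==> s n <= ln n + h"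
  "!!n. a <= n ==> n < b ==> m (Suc n) <= m n" "!!n. a <= n ==> n <= b ==> 0 <= m n"
 shows "(\<Sum>n=a..b. (s n - s (n - 1)) * m n) + (ln b + h - s b) * m b
  <= (ln a + h - s (a - 1)) * m a + (\<Sum>n\<in>{a<..b}. (ln n - ln (real n - 1)) * m n)"
 using assms(1) assms(3-)
proof (induction b rule: dec_induct)
 case base
 then show ?case by (simp add: algebra_simps)
next
 case (step b)
 have i: "{a..Suc b} = insert (Suc b) {a..b}" "{a<..Suc b} = insert (Suc b) {a<..b}" using step by auto
 have "0 <= (ln b + h - s b) * (m b - m (Suc b))"
  using step by (intro mult_nonneg_nonneg) (auto simp: le_diff_eq)
 thus ?case using step unfolding i by (simp add: algebra_simps)
qed

lemma abel_lower:
 fixes s m :: "nat => real"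
 assumes "a <= b" "1 <= a" "!!n. a <= n ==> n <= b ==> s n >= ln n - l"
  "!!n. a <= n ==> n < b ==> m (Suc n) <= m n" "!!n. a <= n ==> n <= b ==> 0 <= m n"
 shows "(\<Sum>n=a..b. (s n - s (n - 1)) * m n) + (ln b - l - s b) * m b
  >= (ln a - l - s (a - 1)) * m a + (\<Sum>n\<in>{a<..b}. (ln n - ln (real n - 1)) * m n)"
 using assms(1) assms(3-)
proof (induction b rule: dec_induct)
 case base
 then show ?case by (simp add: algebra_simps)
next
 case (step b)
 have i: "{a..Suc b} = insert (Suc b) {a..b}" "{a<..Suc b} = insert (Suc b) {a<..b}" using step by auto
 have "0 <= (s b - (ln b - l)) * (m b - m (Suc b))"
  using step by (intro mult_nonneg_nonneg) auto
 thus ?case using step unfolding i by (simp add: algebra_simps)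
qed

lemma mertens_diff: "n >= 1 ==> mertens n - mertens (n - 1) = (if prime n then ln (real n) / n else 0)"
proof -
 assume "n >= 1"
 then obtain k where k: "n = Suc k" by (cases n) auto
 show ?thesis unfolding k by (auto simp: mertens_def primes_le_Suc)
qed

lemma sum_primes_mertens:
 assumes "1 <= a"
 shows "(\<Sum>p | prime p & a <= p & p <= b. ln (real p) / p * m p) = (\<Sum>n=a..b. (mertens n - mertens (n - 1)) * m n)"
proof -
 have "(\<Sum>n=a..b. (mertens n - mertens (n - 1)) * m n) = (\<Sum>n=a..b. if prime n then ln (real n) / n * m n else 0)"
  using assms by (intro sum.cong refl) (auto simp: mertens_diff simp del: One_nat_def)
 also have "\<dots> = (\<Sum>n\<in>{n\<in>{a..b}. prime n}. ln (real n) / n * m n)"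
  by (rule sum.inter_filter[symmetric]) simp
 finally show ?thesis by (simp add: conj_ac)
qed

lemma prime_sum_upper:
 fixes m :: "nat => real"
 assumes "a <= b" "1 <= a" "!!n. a <= n ==> mertens n <= ln n + h"
  "!!n. a <= n ==> n < b ==> m (Suc n) <= m n" "!!n. a <= n ==> n <= b ==> 0 <= m n"
 shows "(\<Sum>p | prime p & a <= p & p <= b. ln (real p) / p * m p)
  <= (ln a + h - mertens (a - 1)) * m a + (\<Sum>n\<in>{a<..b}. (ln n - ln (real n - 1)) * m n)"
proof -
 have "0 <= (ln b + h - mertens b) * m b" using assms by (intro mult_nonneg_nonneg) (auto simp: le_diff_eq)
 thus ?thesis unfolding sum_primes_mertens[OF assms(2)]
  using abel_upper[of a b mertens h m, OF assms(1,2)] assms(3-5) by (smt (verit))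
qed

section \<open>Numerical logarithms and small Mertens sums\<close>

text \<open>\<open>p^2\<close> exceeds by one the number \<open>p^2 - 1\<close>, which is built from
  smaller primes, and \<open>ln_quotient_bounds\<close> gives the ratio of the two with tiny error.
  The evaluations up to 31 all use this device.\<close>

lemma ln5_bounds: "16092/10000 <= ln (5::real)" "ln (5::real) <= 16097/10000"
proof -
 have "ln (24::real) = ln (2^3*3)" by simp
 also have "\<dots> = 3 * ln 2 + ln 3" by (simp only: ln_mult_pos ln_realpow zero_less_numeral zero_less_power mult_pos_pos; simp)
 finally have 1: "ln (24::real) = 3 * ln 2 + ln 3" .
 have 2: "ln (25::real) = 2 * ln 5" using ln_realpow[of 5 2] by simp
 have "ln (24::real) + 2 / (2 * 24 + 1) <= ln 25" "ln (25::real) <= ln 24 + (1 / 24 + 1 / 25) / 2"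
  using ln_quotient_bounds[of 24] by simp_all
 thus "16092/10000 <= ln (5::real)" "ln (5::real) <= 16097/10000"
  using ln2_bounds ln3_bounds unfolding 1 2 by simp_all
qed

lemma ln7_bounds: "19457/10000 <= ln (7::real)" "ln (7::real) <= 19462/10000"
proof -
 have "ln (48::real) = ln (2^4*3)" by simp
 also have "\<dots> = 4 * ln 2 + ln 3" by (simp only: ln_mult_pos ln_realpow zero_less_numeral zero_less_power mult_pos_pos; simp)
 finally have 1: "ln (48::real) = 4 * ln 2 + ln 3" .
 have 2: "ln (49::real) = 2 * ln 7" using ln_realpow[of 7 2] by simp
 have "ln (48::real) + 2 / (2 * 48 + 1) <= ln 49" "ln (49::real) <= ln 48 + (1 / 48 + 1 / 49) / 2"
  using ln_quotient_bounds[of 48] by simp_all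
 thus "19457/10000 <= ln (7::real)" "ln (7::real) <= 19462/10000"
  using ln2_bounds ln3_bounds unfolding 1 2 by simp_all
qed

lemma ln11_bounds: "23975/10000 <= ln (11::real)" "ln (11::real) <= 23983/10000"
proof -
 have "ln (120::real) = ln (2^3*3*5)" by simp
 also have "\<dots> = 3 * ln 2 + ln 3 + ln 5" by (simp only: ln_mult_pos ln_realpow zero_less_numeral zero_less_power mult_pos_pos; simp)
 finally have 1: "ln (120::real) = 3 * ln 2 + ln 3 + ln 5" .
 have 2: "ln (121::real) = 2 * ln 11" using ln_realpow[of 11 2] by simp
 have "ln (120::real) + 2 / (2 * 120 + 1) <= ln 121" "ln (121::real) <= ln 120 + (1 / 120 + 1 / 121) / 2"
  using ln_quotient_bounds[of 120] by simp_all
 thus "23975/10000 <= ln (11::real)" "ln (11::real) <= 23983/10000"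
  using ln2_bounds ln3_bounds ln5_bounds unfolding 1 2 by simp_all
qed

lemma ln13_bounds: "25646/10000 <= ln (13::real)" "ln (13::real) <= 25654/10000"
proof -
 have "ln (168::real) = ln (2^3*3*7)" by simp
 also have "\<dots> = 3 * ln 2 + ln 3 + ln 7" by (simp only: ln_mult_pos ln_realpow zero_less_numeral zero_less_power mult_pos_pos; simp)
 finally have 1: "ln (168::real) = 3 * ln 2 + ln 3 + ln 7" .
 have 2: "ln (169::real) = 2 * ln 13" using ln_realpow[of 13 2] by simp
 have "ln (168::real) + 2 / (2 * 168 + 1) <= ln 169" "ln (169::real) <= ln 168 + (1 / 168 + 1 / 169) / 2"
  using ln_quotient_bounds[of 168] by simp_all
 thus "25646/10000 <= ln (13::real)" "ln (13::real) <= 25654/10000"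
  using ln2_bounds ln3_bounds ln7_bounds unfolding 1 2 by simp_all
qed

lemma ln17_bounds: "28328/10000 <= ln (17::real)" "ln (17::real) <= 28337/10000"
proof -
 have "ln (288::real) = ln (2^5*3^2)" by simp
 also have "\<dots> = 5 * ln 2 + 2 * ln 3" by (simp only: ln_mult_pos ln_realpow zero_less_numeral zero_less_power mult_pos_pos; simp)
 finally have 1: "ln (288::real) = 5 * ln 2 + 2 * ln 3" .
 have 2: "ln (289::real) = 2 * ln 17" using ln_realpow[of 17 2] by simp
 have "ln (288::real) + 2 / (2 * 288 + 1) <= ln 289" "ln (289::real) <= ln 288 + (1 / 288 + 1 / 289) / 2"
  using ln_quotient_bounds[of 288] by simp_all
 thus "28328/10000 <= ln (17::real)" "ln (17::real) <= 28337/10000"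
  using ln2_bounds ln3_bounds unfolding 1 2 by simp_all
qed

lemma ln19_bounds: "29440/10000 <= ln (19::real)" "ln (19::real) <= 29450/10000"
proof -
 have "ln (360::real) = ln (2^3*3^2*5)" by simp
 also have "\<dots> = 3 * ln 2 + 2 * ln 3 + ln 5" by (simp only: ln_mult_pos ln_realpow zero_less_numeral zero_less_power mult_pos_pos; simp)
 finally have 1: "ln (360::real) = 3 * ln 2 + 2 * ln 3 + ln 5" .
 have 2: "ln (361::real) = 2 * ln 19" using ln_realpow[of 19 2] by simp
 have "ln (360::real) + 2 / (2 * 360 + 1) <= ln 361" "ln (361::real) <= ln 360 + (1 / 360 + 1 / 361) / 2"
  using ln_quotient_bounds[of 360] by simp_all
 thus "29440/10000 <= ln (19::real)" "ln (19::real) <= 29450/10000"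
  using ln2_bounds ln3_bounds ln5_bounds unfolding 1 2 by simp_all
qed

lemma ln23_bounds: "31350/10000 <= ln (23::real)" "ln (23::real) <= 31360/10000"
proof -
 have "ln (528::real) = ln (2^4*3*11)" by simp
 also have "\<dots> = 4 * ln 2 + ln 3 + ln 11" by (simp only: ln_mult_pos ln_realpow zero_less_numeral zero_less_power mult_pos_pos; simp)
 finally have 1: "ln (528::real) = 4 * ln 2 + ln 3 + ln 11" .
 have 2: "ln (529::real) = 2 * ln 23" using ln_realpow[of 23 2] by simp
 have "ln (528::real) + 2 / (2 * 528 + 1) <= ln 529" "ln (529::real) <= ln 528 + (1 / 528 + 1 / 529) / 2"
  using ln_quotient_bounds[of 528] by simp_all
 thus "31350/10000 <= ln (23::real)" "ln (23::real) <= 31360/10000"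
  using ln2_bounds ln3_bounds ln11_bounds unfolding 1 2 by simp_all
qed

lemma ln29_bounds: "33668/10000 <= ln (29::real)" "ln (29::real) <= 33678/10000"
proof -
 have "ln (840::real) = ln (2^3*3*5*7)" by simp
 also have "\<dots> = 3 * ln 2 + ln 3 + ln 5 + ln 7" by (simp only: ln_mult_pos ln_realpow zero_less_numeral zero_less_power mult_pos_pos; simp)
 finally have 1: "ln (840::real) = 3 * ln 2 + ln 3 + ln 5 + ln 7" .
 have 2: "ln (841::real) = 2 * ln 29" using ln_realpow[of 29 2] by simp
 have "ln (840::real) + 2 / (2 * 840 + 1) <= ln 841" "ln (841::real) <= ln 840 + (1 / 840 + 1 / 841) / 2"
  using ln_quotient_bounds[of 840] by simp_all
 thus "33668/10000 <= ln (29::real)" "ln (29::real) <= 33678/10000"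
  using ln2_bounds ln3_bounds ln5_bounds ln7_bounds unfolding 1 2 by simp_all
qed

lemma ln31_bounds: "34336/10000 <= ln (31::real)" "ln (31::real) <= 34345/10000"
proof -
 have "ln (960::real) = ln (2^6*3*5)" by simp
 also have "\<dots> = 6 * ln 2 + ln 3 + ln 5" by (simp only: ln_mult_pos ln_realpow zero_less_numeral zero_less_power mult_pos_pos; simp)
 finally have 1: "ln (960::real) = 6 * ln 2 + ln 3 + ln 5" .
 have 2: "ln (961::real) = 2 * ln 31" using ln_realpow[of 31 2] by simp
 have "ln (960::real) + 2 / (2 * 960 + 1) <= ln 961" "ln (961::real) <= ln 960 + (1 / 960 + 1 / 961) / 2"
  using ln_quotient_bounds[of 960] by simp_all
 thus "34336/10000 <= ln (31::real)" "ln (31::real) <= 34345/10000"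
  using ln2_bounds ln3_bounds ln5_bounds unfolding 1 2 by simp_all
qed

lemma primes_below_30: "{p. prime p & p <= (30::nat)} = {2,3,5,7,11,13,17,19,23,29}"
proof -
 have e: "{p. prime p & p <= (30::nat)} = Set.filter prime {0..30}" by auto
 show ?thesis unfolding e by code_simp
qed

lemma mertens_12: "mertens 12 >= 1529/1000"
proof -
 have e: "{p. prime p & p <= (12::nat)} = Set.filter (%p. p <= 12) {p. prime p & p <= 30}" by auto
 have "{p. prime p & p <= (12::nat)} = {2,3,5,7,11}" unfolding e primes_below_30 by code_simp
 thus ?thesis unfolding mertens_def using ln2_bounds ln3_bounds ln5_bounds ln7_bounds ln11_bounds by simp
qed

lemma mertens_30: "mertens 30 >= 2300/1000"
 unfolding mertens_def primes_below_30 using ln2_bounds ln3_bounds ln5_bounds ln7_bounds ln11_bounds ln13_bounds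
  ln17_bounds ln19_bounds ln23_bounds ln29_bounds by simp

lemma mertens_upper_13: "n >= 13 ==> mertens n <= ln n + 14/100"
 by (rule mertens_upper_num[of 13 n "25646/10000"]) (use ln13_bounds in auto)

lemma mertens_upper_31: "n >= 31 ==> mertens n <= ln n + 5/100"
 by (rule mertens_upper_num[of 31 n "34335/10000"]) (use ln31_bounds in auto)

section \<open>Prime sums up to a real bound\<close>

lemma real_le_iff_nat_floor: "0 <= x ==> real p <= x \<longleftrightarrow> p <= nat \<lfloor>x\<rfloor>"
 by (simp add: le_nat_iff le_floor_iff)

lemma finite_primes_real [simp]: "finite {p::nat. prime p & real p <= x}"
proof (cases "0 <= x")
 case True
 show ?thesis by (simp add: real_le_iff_nat_floor[OF True])
next
 case False
 hence "{p::nat. prime p & real p <= x} = {}" by (auto simp: not_le intro: order_less_le_trans)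
 thus ?thesis by (simp only: finite.emptyI)
qed

lemma finite_nat_real_le [simp]: "finite {n::nat. real n <= x}"
proof (cases "0 <= x")
 case True
 show ?thesis by (simp add: real_le_iff_nat_floor[OF True])
next
 case False
 hence "{n::nat. real n <= x} = {}" by (auto simp: not_le intro: order_less_le_trans)
 thus ?thesis by (simp only: finite.emptyI)
qed

lemma prime_log_sum_le:
 assumes "1 <= x"
 shows "(\<Sum>p | prime p & real p <= x. ln (real p) / p) <= ln x + 4"
proof -
 define n where "n = nat \<lfloor>x\<rfloor>"
 have n: "1 <= n" "real n <= x" using assms by (auto simp: n_def le_nat_floor)
 have "(\<Sum>p | prime p & real p <= x. ln (real p) / p) = mertens n"
  unfolding mertens_def n_def using assms by (simp add: real_le_iff_nat_floor)
 also have "\<dots> <= ln n + 4" by (rule mertens_upper[OF n(1)])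
 also have "ln n <= ln x" using n by auto
 finally show ?thesis by simp
qed

text \<open>\<open>ln y <= y - 1\<close> at \<open>y = ln (n - 1) / ln n\<close>. The weights that
  partial summation produces from \<open>1 / ln n\<close> thereby telescope to a difference of
  \<open>ln (ln n)\<close>.\<close>

lemma lnln_gap_upper:
 assumes "3 <= (n::nat)"
 shows "(ln n - ln (real n - 1)) / ln n <= ln (ln n) - ln (ln (real n - 1))"
proof -
 have L: "0 < ln (real n - 1)" "ln (real n - 1) < ln (real n)" using assms by auto
 have "ln (ln (real n - 1) / ln n) <= ln (real n - 1) / ln n - 1" using L by (intro ln_le_minus_one) auto
 moreover have "ln (ln (real n - 1) / ln n) = ln (ln (real n - 1)) - ln (ln n)" using L by (simp add: ln_div)
 moreover have "(ln n - ln (real n - 1)) / ln n = 1 - ln (real n - 1) / ln n" using L by (simp add: field_simps)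
 ultimately show ?thesis by linarith
qed

text \<open>The same at the quotient \<open>ln (n + 1) / ln n\<close>; the shift by one back to
  \<open>n - 1\<close> is \<open>(n + 1) * (n - 1) <= n^2\<close>.\<close>

lemma lnln_gap_lower:
 assumes "2 <= (n::nat)"
 shows "ln (ln (real n + 1)) - ln (ln n) <= (ln n - ln (real n - 1)) / ln n"
proof -
 have L: "0 < ln (real n)" "ln (real n) < ln (real n + 1)" using assms by auto
 have "ln (ln (real n + 1) / ln n) <= ln (real n + 1) / ln n - 1" using L assms by (intro ln_le_minus_one divide_pos_pos) auto
 moreover have "ln (ln (real n + 1) / ln n) = ln (ln (real n + 1)) - ln (ln n)" using L by (simp add: ln_div)
 moreover have "ln (real n + 1) / ln n - 1 = (ln (real n + 1) - ln n) / ln n" using L by (simp add: field_simps)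
 moreover have "(ln (real n + 1) - ln n) / ln n <= (ln n - ln (real n - 1)) / ln n"
 proof (intro divide_right_mono)
  have "1 < real n * real n" using assms by (intro less_1_mult) auto
  hence "ln ((real n + 1) * (real n - 1)) <= ln (real n * real n)" by (intro ln_mono) (auto simp: algebra_simps)
  thus "ln (real n + 1) - ln n <= ln n - ln (real n - 1)" using assms by (simp add: ln_mult)
 qed (use L in auto)
 ultimately show ?thesis by linarith
qed

lemma prime_recip_upper:
 assumes "2 <= a" "a <= b"
 shows "(\<Sum>p | prime p & a < real p & real p <= b. 1 / real p) <= ln (ln b / ln a) + 8"
proof -
 define n where "n = nat \<lfloor>a\<rfloor> + 1"
 define N where "N = nat \<lfloor>b\<rfloor>"
 have n: "3 <= n" "a < real n" "real (n - 1) <= a" using assms by (auto simp: n_def le_nat_floor) linarith+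
 have set: "{p. prime p & a < real p & real p <= b} = {p. prime p & n <= p & p <= N}"
 proof -
  have "a < real p \<longleftrightarrow> n <= p" for p using assms real_le_iff_nat_floor[of a p] by (auto simp: n_def)
  thus ?thesis using assms by (auto simp: N_def real_le_iff_nat_floor)
 qed
 have lab: "0 < ln a" "ln a <= ln b" using assms by auto
 have pos: "0 <= ln (ln b / ln a)" using lab by (intro ln_ge_zero) auto
 show ?thesis
 proof (cases "n <= N")
  case False
  hence e: "{p. prime p & n <= p & p <= N} = {}" by auto
  show ?thesis unfolding set e using pos by simp
 next
  case True
  have "(\<Sum>p | prime p & n <= p & p <= N. 1 / real p) = (\<Sum>p | prime p & n <= p & p <= N. ln (real p) / p * (1 / ln p))"
   using n by (intro sum.cong) auto
  also have "\<dots> <= (ln n + 4 - mertens (n - 1)) * (1 / ln n) + (\<Sum>k\<in>{n<..N}. (ln k - ln (real k - 1)) * (1 / ln k))"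
  proof (rule prime_sum_upper[OF True])
   fix k assume k: "n <= k" "k < N"
   show "1 / ln (real (Suc k)) <= 1 / ln (real k)" using n k by (intro divide_left_mono) auto
  qed (use n in \<open>auto intro!: mertens_upper\<close>)
  also have "(\<Sum>k\<in>{n<..N}. (ln k - ln (real k - 1)) * (1 / ln k)) <= (\<Sum>k\<in>{n<..N}. ln (ln (real k)) - ln (ln (real k - 1)))"
   using n lnln_gap_upper by (intro sum_mono) auto
  also have "\<dots> = ln (ln N) - ln (ln n)"
   using True
  proof (induction N rule: dec_induct)
   case (step m)
   have "{n<..Suc m} = insert (Suc m) {n<..m}" using step by auto
   thus ?case using step by simp
  qed simp
  \<comment> \<open>4 and 2.16 from the two Mertens bounds and 1 for passing from
    \<open>n - 1\<close> to \<open>n\<close> stay below 8; division by \<open>ln n\<close> is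
    harmless because \<open>n >= 3\<close>.\<close>
  also have "(ln n + 4 - mertens (n - 1)) * (1 / ln n) <= 8"
  proof -
   have "mertens (n - 1) >= ln (real (n - 1)) - 216/100" using n by (intro mertens_lower) auto
   moreover have "ln (real n) - ln (real (n - 1)) <= 1"
   proof -
   have "ln (real n) - ln (real (n - 1)) = ln (real n / (real n - 1))" using n by (simp add: ln_div of_nat_diff)
   also have "\<dots> <= real n / (real n - 1) - 1" using n by (intro ln_le_minus_one) auto
   also have "\<dots> <= 1" using n by (simp add: field_simps)
   finally show ?thesis .
   qed
   ultimately have "ln n + 4 - mertens (n - 1) <= 8" by linarith
   moreover have "1 <= ln (real n)"
   proof -
   have "ln 3 <= ln (real n)" using n by simp
   thus ?thesis using ln3_bounds by linarith
   qed
   ultimately show ?thesis by (simp add: field_simps)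
  qed
  also have "ln (ln N) - ln (ln n) <= ln (ln b / ln a)"
  proof -
   have "ln (ln N) <= ln (ln b)" using True n assms by (intro ln_mono) (auto simp: N_def le_nat_floor)
   moreover have "ln (ln a) <= ln (ln n)" using n assms by (intro ln_mono) auto
   ultimately show ?thesis using lab by (simp add: ln_div)
  qed
  finally show ?thesis unfolding set by simp
 qed
qed

lemma prime_recip_lower:
 assumes "2 <= b"
 shows "ln (ln b) - 4 <= (\<Sum>p | prime p & real p <= b. 1 / real p)"
proof -
 define N where "N = nat \<lfloor>b\<rfloor>"
 have N: "2 <= N" "b < real N + 1" using assms by (auto simp: N_def le_nat_floor)
 have set: "{p. prime p & real p <= b} = {p. prime p & 2 <= p & p <= N}"
  using assms by (auto simp: N_def real_le_iff_nat_floor prime_ge_2_nat)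
 have "(ln (real 2) - 216/100 - mertens (2 - 1)) * (1 / ln (real 2)) + (\<Sum>n\<in>{2<..N}. (ln n - ln (real n - 1)) * (1 / ln (real n)))
  <= (\<Sum>n=2..N. (mertens n - mertens (n - 1)) * (1 / ln (real n))) + (ln N - 216/100 - mertens N) * (1 / ln (real N))"
 proof (rule abel_lower[OF N(1)])
  fix k assume k: "2 <= k" "k < N"
  show "1 / ln (real (Suc k)) <= 1 / ln (real k)" using k by (intro divide_left_mono) auto
 qed (use N mertens_lower in auto)
 also have "(ln N - 216/100 - mertens N) * (1 / ln (real N)) <= 0"
  using mertens_lower[of N] N by (intro mult_nonpos_nonneg) auto
 also have "(\<Sum>n=2..N. (mertens n - mertens (n - 1)) * (1 / ln (real n))) = (\<Sum>p | prime p & 2 <= p & p <= N. ln (real p) / p * (1 / ln p))"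
  by (rule sum_primes_mertens[symmetric]) simp
 also have "\<dots> = (\<Sum>p | prime p & real p <= b. 1 / real p)" unfolding set by (intro sum.cong) auto
 finally have 1: "(ln (real 2) - 216/100 - mertens (2 - 1)) * (1 / ln (real 2)) + (\<Sum>n\<in>{2<..N}. (ln n - ln (real n - 1)) * (1 / ln (real n)))
  <= (\<Sum>p | prime p & real p <= b. 1 / real p)" by simp
 have "(\<Sum>n\<in>{2<..N}. ln (ln (real n + 1)) - ln (ln (real n))) <= (\<Sum>n\<in>{2<..N}. (ln n - ln (real n - 1)) * (1 / ln (real n)))"
  using lnln_gap_lower by (intro sum_mono) auto
 moreover have "(\<Sum>n\<in>{2<..N}. ln (ln (real n + 1)) - ln (ln (real n))) = ln (ln (real N + 1)) - ln (ln 3)"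
  using N(1)
 proof (induction N rule: dec_induct)
  case (step m)
  have "{2<..Suc m} = insert (Suc m) {2<..m}" using step by auto
  thus ?case using step by (simp add: add.commute)
 qed simp
 moreover have "ln (ln b) <= ln (ln (real N + 1))" using N assms by (intro ln_mono) auto
 moreover have "ln (ln (3::real)) <= 1/8"
  using ln_le_minus_one[of "ln (3::real)"] ln3_bounds by linarith
 moreover have "(ln (real 2) - 216/100 - mertens (2 - 1)) * (1 / ln (real 2)) >= - (22/10)"
 proof -
  have "{p. prime p & p <= Suc 0} = {}" by (auto dest: prime_gt_1_nat)
  hence "mertens (Suc 0) = 0" unfolding mertens_def by (simp only: sum.empty)
  hence "mertens (2 - 1) = 0" by simp
  thus ?thesis using ln2_bounds by (simp add: field_simps)
 qed
 ultimately show ?thesis using 1 by linarith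
qed

section \<open>Brun's sieve truncated by accumulated weight\<close>

text \<open>Sieve products become exponentials of sums of these weights, see \<open>exp_wt\<close>
  and \<open>prod_below\<close>.\<close>

definition wt :: "(nat => real) => nat => real" where
 "wt w p = - ln (1 - w p)"

definition below :: "nat set => nat => nat set" where
 "below P p = {q : P. q < p}"

definition depth :: "(nat => real) => nat set => nat => real" where
 "depth w P p = (\<Sum>q | q : P & p <= q. wt w q)"

text \<open>Unfolded, the condition on the \<open>k\<close>-th even entry is that the weight of all
  primes of the original \<open>P\<close> from that entry upwards is at least
  \<open>s + 53/100 * (k - 1)\<close>. Odd entries are restricted only by the ordering: a lower
  bound may discard in Buchstab's identity only terms of positive sign. Replacing \<open>P\<close>
  and shifting \<open>s\<close> makes the condition recursive, so that \<open>s\<close> can become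
  negative.\<close>

fun brun_ok :: "(nat => real) => nat set => real => nat list => bool" where
 "brun_ok w P s [] = True"
| "brun_ok w P s [p] = (p : P)"
| "brun_ok w P s (p # q # ds) =
  (p : P & q : P & q < p & s <= depth w P q \<and>
   brun_ok w (below P q) (s + 53/100 - depth w P q) ds)"

definition sift :: "('n => real) => (nat => 'n => bool) => 'n set => nat set => real" where
 "sift a hit S P = (\<Sum>n | n : S & (\<forall>p\<in>P. \<not> hit p n). a n)"

definition mass :: "('n => real) => (nat => 'n => bool) => 'n set => nat list => real" where
 "mass a hit S ds = (\<Sum>n | n : S & (\<forall>p\<in>set ds. hit p n). a n)"

lemma below_subset: "below P p \<subseteq> P" by (auto simp: below_def)
lemma finite_below [simp]: "finite P ==> finite (below P p)" by (simp add: below_def)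
lemma in_below [simp]: "q : below P p \<longleftrightarrow> q : P & q < p" by (auto simp: below_def)
lemma below_insert_max:
 assumes "!!a. a : A ==> a < (b::nat)"
 shows "below (insert b A) b = A" "p : A ==> below (insert b A) p = below A p"
 using assms by (force simp: below_def)+

lemma card_below: "finite P ==> q : P ==> card (below P q) < card P"
 by (rule psubset_card_mono) (auto simp: below_def)

lemma brun_ok_sorted: "brun_ok w P s ds ==> sorted_wrt (>) ds & set ds \<subseteq> P"
proof (induction w P s ds rule: brun_ok.induct)
 case (3 w P s p q ds)
 then show ?case by (force simp: below_def)
qed auto

lemma finite_brun_ok: "finite P ==> finite {ds. brun_ok w P s ds}"
proof -
 assume P: "finite P"
 have "{ds. brun_ok w P s ds} \<subseteq> {ds. set ds \<subseteq> P & distinct ds}"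
  using brun_ok_sorted by (fastforce simp: strict_sorted_iff sorted_wrt_iff_nth_less distinct_conv_nth nat_neq_iff)
 thus ?thesis using finite_subset_distinct[OF P] finite_subset by blast
qed

lemma sum_brun_ok:
 assumes "finite P"
 shows "(\<Sum>ds | brun_ok w P s ds. h ds) = h [] + (\<Sum>p\<in>P. h [p]) +
  (\<Sum>p\<in>P. \<Sum>q\<in>below P p. if s <= depth w P q then
   (\<Sum>ds | brun_ok w (below P q) (s + 53/100 - depth w P q) ds. h (p # q # ds)) else (0::real))"
proof -
 let ?L = "%q. {ds. brun_ok w (below P q) (s + 53/100 - depth w P q) ds}"
 let ?I = "{(p, q). p : P & q : P & q < p & s <= depth w P q}"
 let ?C = "%(p,q). (%ds. p # q # ds) ` ?L q"
 have fI: "finite ?I" by (rule finite_subset[of _ "P \<times> P"]) (use assms in auto)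
 have eq: "{ds. brun_ok w P s ds} = insert [] ((%p. [p]) ` P \<union> (\<Union>i\<in>?I. ?C i))"
 proof (intro equalityI subsetI)
  fix ds assume "ds : {ds. brun_ok w P s ds}"
  thus "ds : insert [] ((%p. [p]) ` P \<union> (\<Union>i\<in>?I. ?C i))"
   by (cases "(w,P,s,ds)" rule: brun_ok.cases) auto
 qed auto
 have fC: "\<forall>i\<in>?I. finite (?C i)" using assms by (auto intro!: finite_brun_ok)
 have "(\<Sum>ds | brun_ok w P s ds. h ds) = h [] + (\<Sum>ds\<in>(%p. [p]) ` P \<union> (\<Union>i\<in>?I. ?C i). h ds)"
  unfolding eq using fC fI assms by (subst sum.insert) auto
 also have "(\<Sum>ds\<in>(%p. [p]) ` P \<union> (\<Union>i\<in>?I. ?C i). h ds) =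
   (\<Sum>ds\<in>(%p. [p]) ` P. h ds) + (\<Sum>ds\<in>(\<Union>i\<in>?I. ?C i). h ds)"
  using fC fI assms by (subst sum.union_disjoint) auto
 also have "(\<Sum>ds\<in>(%p. [p]) ` P. h ds) = (\<Sum>p\<in>P. h [p])"
  by (subst sum.reindex) (auto simp: inj_on_def)
 also have "(\<Sum>ds\<in>(\<Union>i\<in>?I. ?C i). h ds) = (\<Sum>i\<in>?I. \<Sum>ds\<in>?C i. h ds)"
  using fC fI by (subst sum.UNION_disjoint) auto
 also have "\<dots> = (\<Sum>(p,q)\<in>?I. \<Sum>ds\<in>?L q. h (p # q # ds))"
  by (intro sum.cong refl) (auto simp: sum.reindex inj_on_def)
 also have "\<dots> = (\<Sum>(p,q)\<in>Sigma P (below P). if s <= depth w P q then (\<Sum>ds\<in>?L q. h (p # q # ds)) else 0)"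
  using assms by (intro sum.mono_neutral_cong_left) (auto split: if_splits)
 also have "\<dots> = (\<Sum>p\<in>P. \<Sum>q\<in>below P p. if s <= depth w P q then (\<Sum>ds\<in>?L q. h (p # q # ds)) else 0)"
  using assms by (subst sum.Sigma) auto
 finally show ?thesis by simp
qed

text \<open>The removed elements are sorted by the least prime of \<open>P\<close> that hits them.
  The induction adjoins the largest prime, which leaves the other sets \<open>below\<close>
  unchanged.\<close>

lemma buchstab_sift:
 assumes "finite P" "finite S"
 shows "sift a hit S P = sum a S - (\<Sum>p\<in>P. sift a hit {n\<in>S. hit p n} (below P p))"
 using assms(1)
proof (induction P rule: finite_linorder_max_induct)
 case empty
 then show ?case by (simp add: sift_def)
next
 case (insert b A)
 have "sift a hit S (insert b A) + sift a hit {n\<in>S. hit b n} A = sift a hit S A"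
  unfolding sift_def using assms(2)
  by (subst sum.union_disjoint[symmetric]) (auto intro!: sum.cong)
 moreover have "(\<Sum>p\<in>insert b A. sift a hit {n\<in>S. hit p n} (below (insert b A) p)) =
  sift a hit {n\<in>S. hit b n} A + (\<Sum>p\<in>A. sift a hit {n\<in>S. hit p n} (below A p))"
  using insert by (subst sum.insert) (auto simp: below_insert_max)
 ultimately show ?case using insert.IH by simp
qed

lemma buchstab_prod:
 fixes w :: "nat => real"
 assumes "finite P"
 shows "(\<Prod>p\<in>P. 1 - w p) = 1 - (\<Sum>p\<in>P. w p * (\<Prod>q\<in>below P p. 1 - w q))"
 using assms
proof (induction P rule: finite_linorder_max_induct)
 case (insert b A)
 have "(\<Sum>p\<in>insert b A. w p * (\<Prod>q\<in>below (insert b A) p. 1 - w q)) =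
  w b * (\<Prod>q\<in>A. 1 - w q) + (\<Sum>p\<in>A. w p * (\<Prod>q\<in>below A p. 1 - w q))"
  using insert by (subst sum.insert) (auto simp: below_insert_max)
 moreover have "(\<Prod>p\<in>insert b A. 1 - w p) = (1 - w b) * (\<Prod>p\<in>A. 1 - w p)"
  using insert by (subst prod.insert) auto
 ultimately show ?case using insert.IH by (simp add: algebra_simps)
qed simp

lemma depth_insert_min:
 assumes "finite A" "!!a. a : A ==> (b::nat) < a"
 shows "depth w (insert b A) b = wt w b + sum (wt w) A"
  and "q : A ==> depth w (insert b A) q = depth w A q"
proof -
 have 1: "{q. q : insert b A & b <= q} = insert b A" and 2: "b \<notin> A" using assms by force+
 show "depth w (insert b A) b = wt w b + sum (wt w) A"
  unfolding depth_def 1 using assms 2 by simp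
 show "q : A ==> depth w (insert b A) q = depth w A q"
  unfolding depth_def by (intro sum.cong) (use assms in force)+
qed

text \<open>As \<open>q\<close> runs down through \<open>P\<close>, the values
  \<open>depth w P q\<close> partition the interval from 0 to \<open>sum (wt w) P\<close> into steps
  of length \<open>wt w q\<close>. This replaces integration over the depth.\<close>

lemma sum_telescope_depth:
 assumes "finite P"
 shows "(\<Sum>q\<in>P. G (depth w P q) - G (depth w P q - wt w q)) = (G (sum (wt w) P) - G 0 :: real)"
 using assms
proof (induction P rule: finite_linorder_min_induct)
 case (insert b A)
 have "(\<Sum>q\<in>insert b A. G (depth w (insert b A) q) - G (depth w (insert b A) q - wt w q)) =
  (G (wt w b + sum (wt w) A) - G (sum (wt w) A)) + (\<Sum>q\<in>A. G (depth w A q) - G (depth w A q - wt w q))"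
  using insert by (subst sum.insert) (auto simp: depth_insert_min)
 moreover have "sum (wt w) (insert b A) = wt w b + sum (wt w) A" using insert by (subst sum.insert) auto
 ultimately show ?case using insert.IH by simp
qed simp

lemma wt_ge: assumes "0 <= w p" "w p < 1" shows "w p <= wt w p"
 using ln_le_minus_one[of "1 - w p"] assms by (simp add: wt_def)

lemma wt_nonneg: assumes "0 <= w p" "w p < 1" shows "0 <= wt w p"
 using wt_ge[of w p] assms by simp

lemma exp_wt: assumes "0 <= w p" "w p < 1" shows "exp (- wt w p) = 1 - w p"
 using assms by (simp add: wt_def)

lemma prod_below:
 assumes "finite P" "!!p. p : P ==> 0 <= w p & w p < (1::real)"
 shows "(\<Prod>p\<in>below P q. 1 - w p) = (\<Prod>p\<in>P. 1 - w p) * exp (depth w P q)"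
proof -
 have P: "P = below P q \<union> {p. p : P & q <= p}" by auto
 have "(\<Prod>p\<in>P. 1 - w p) = (\<Prod>p\<in>below P q. 1 - w p) * (\<Prod>p | p : P & q <= p. 1 - w p)"
  by (subst P, subst prod.union_disjoint) (use assms in auto)
 also have "(\<Prod>p | p : P & q <= p. 1 - w p) = (\<Prod>p | p : P & q <= p. exp (- wt w p))"
  using assms by (intro prod.cong) (auto simp: exp_wt)
 also have "\<dots> = exp (- depth w P q)"
  unfolding depth_def using assms by (subst exp_sum[symmetric]) (auto simp: sum_negf)
 finally show ?thesis by (simp add: exp_minus field_simps)
qed

lemma sum_above:
 assumes "finite P" "q : P" "!!p. p : P ==> 0 <= w p & w p < (1::real)"
 shows "(\<Sum>p | p : P & q < p. w p) <= depth w P q - wt w q" "wt w q <= depth w P q"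
proof -
 have 1: "{p. p : P & q <= p} = insert q {p. p : P & q < p}" using assms by auto
 have 2: "depth w P q = wt w q + (\<Sum>p | p : P & q < p. wt w p)"
  unfolding depth_def 1 using assms by simp
 show "(\<Sum>p | p : P & q < p. w p) <= depth w P q - wt w q"
  unfolding 2 using assms by (auto intro!: sum_mono wt_ge)
 show "wt w q <= depth w P q" unfolding 2 using assms by (auto intro!: sum_nonneg wt_nonneg)
qed

section \<open>Relative loss of the truncated sieve\<close>

text \<open>A supersolution of the integral inequality for the relative loss at threshold
  \<open>s\<close>. The rate 5 makes \<open>u * exp u * brun_err (s + 53/100 - u)\<close> decay like
  \<open>u * exp (- 4 * u)\<close>; 0.034 is large enough for \<open>brun_err_numeric\<close> and
  small enough for \<open>brun_err_bound\<close>.\<close>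

definition brun_err :: "real => real" where
 "brun_err s = 34/1000 * exp (5 * s)"

lemma exp_ge_sum: "0 <= x ==> (\<Sum>m<n. x ^ m / fact m) <= exp (x::real)"
 using Maclaurin_exp_le[of x n] by force

lemma exp_le_sum: assumes "0 <= x" "x <= 1" shows "exp (x::real) <= (\<Sum>m<n. x ^ m / fact m) + 3 / fact n * x ^ n"
proof -
 obtain t where t: "\<bar>t\<bar> <= \<bar>x\<bar>" "exp x = (\<Sum>m<n. x ^ m / fact m) + exp t / fact n * x ^ n"
  using Maclaurin_exp_le[of x n] by blast
 have "exp t <= exp 1" using t assms by (subst exp_le_cancel_iff) auto
 hence "exp t <= 3" using exp_le by linarith
 thus ?thesis using assms unfolding t(2) by (auto intro!: mult_right_mono divide_right_mono)
qed

lemma exp_265: "exp (265/100::real) <= 1416/100"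
proof -
 have "exp (265/1000::real) <= 1303432/1000000"
  using exp_le_sum[of "265/1000" 6] by (simp add: eval_nat_numeral)
 hence "exp (265/1000::real) ^ 10 <= (1303432/1000000) ^ 10" by (rule power_mono) simp
 also have "exp (265/1000::real) ^ 10 = exp (265/100)" by (simp flip: exp_of_nat_mult)
 finally show ?thesis by (simp add: eval_nat_numeral)
qed

lemma brun_err_bound: "brun_err (53/100) <= 1"
 using exp_265 by (simp add: brun_err_def)

lemma brun_err_mono: "s <= t ==> brun_err s <= brun_err t"
 by (simp add: brun_err_def)

lemma brun_err_pos: "0 < brun_err s" by (simp add: brun_err_def)

text \<open>The left side is the total growth of \<open>brun_prim s\<close>: the integral of
  \<open>u * exp u\<close> up to \<open>s\<close> followed by the tail integral. Dividing by
  \<open>exp s\<close> and inserting Taylor polynomials leaves a quartic inequality.\<close>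

lemma brun_err_numeric:
 assumes "0 <= s" "s <= 53/100"
 shows "(s - 1) * exp s + 1 + 34/1000 * exp (265/100 + s) * (s/4 + 1/16) <= brun_err s"
proof -
 \<comment> \<open>Centres the quartic at \<open>s = 1/4\<close>, close to where its slack is
   smallest.\<close>
 define h where "h = 4 * s - 1"
 have h: "h >= -1" "s = (h + 1) / 4" using assms by (auto simp: h_def)
 have 1: "exp (-s) <= 1 - s + s^2/2"
 proof -
  obtain t where t: "\<bar>t\<bar> <= \<bar>-s\<bar>" "exp (-s) = (\<Sum>m<3. (-s) ^ m / fact m) + exp t / fact 3 * (-s) ^ 3"
   using Maclaurin_exp_le[of "-s" 3] by blast
  have "exp t / fact 3 * (-s) ^ 3 <= 0" using assms by (intro mult_nonneg_nonpos) auto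
  thus ?thesis unfolding t(2) by (simp add: eval_nat_numeral power2_eq_square)
 qed
 have 2: "1 + 4* s + (4* s)^2/2 + (4* s)^3/6 + (4* s)^4/24 <= exp (4 * s)"
  using exp_ge_sum[of "4* s" 5] assms by (simp add: eval_nat_numeral)
 have poly: "s^2/2 + 34/1000 * (1416/100) * (s/4 + 1/16) <= 34/1000 * (1 + 4* s + (4* s)^2/2 + (4* s)^3/6 + (4* s)^4/24)"
 proof -
  \<comment> \<open>The difference of the two sides, divided by 0.034, is an explicit square plus
    \<open>19/1000 - 57/1000 * h + h^2 * i\<close>.\<close>
  define i where "i = 1/24 * (h + 1)^2 + 1/4 * (h + 1) + 39/1000"
  have i: "i >= 0" using h(1) by (auto simp: i_def intro!: add_nonneg_nonneg)
  have "0 <= 19/1000 - 57/1000 * h + h^2 * i"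
  proof (cases "h <= 0")
   case True
   have "0 <= h^2 * i" using i by simp
   thus ?thesis using True by linarith
  next
   case False
   have "i = 1/24 * h^2 + 1/3 * h + (1/24 + 1/4 + 39/1000)" by (simp add: i_def power2_eq_square field_simps)
   moreover have "0 <= 1/24 * h^2 + 1/3 * h" using False by simp
   ultimately have "330/1000 <= i" by linarith
   hence "h^2 * (330/1000) <= h^2 * i" by (intro mult_left_mono) auto
   moreover have "19/1000 - 57/1000*h + h^2 * (330/1000) = 330/1000 * (h - 57/660)^2 + (19/1000 - 330/1000*(57/660)^2)"
   by (simp add: power2_eq_square algebra_simps)
   moreover have "0 <= (330/1000) * (h - 57/660)^2" by simp
   moreover have "(0::real) <= 19/1000 - 330/1000*(57/660)^2" by (simp add: power2_eq_square)
   ultimately show ?thesis by linarith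
  qed
  moreover have "(1 + 4* s + (4* s)^2/2 + (4* s)^3/6 + (4* s)^4/24) - (s^2/2 / (34/1000) + (1416/100) * (s/4 + 1/16)) =
   19/1000 - 57/1000 * h + h^2 * i + 11/51000 * (h + 1)^2"
   unfolding h(2) i_def by (simp add: field_simps eval_nat_numeral)
  moreover have "0 <= 11/51000 * (h + 1)^2" by simp
  ultimately have "s^2/2 / (34/1000) + (1416/100) * (s/4 + 1/16) <= (1 + 4* s + (4* s)^2/2 + (4* s)^3/6 + (4* s)^4/24)" by linarith
  thus ?thesis by (simp add: field_simps)
 qed
 have "(s - 1) + exp (-s) + 34/1000 * exp (265/100) * (s/4 + 1/16) <= 34/1000 * exp (4* s)"
 proof -
  have "34/1000 * exp (265/100) * (s/4 + 1/16) <= 34/1000 * (1416/100) * (s/4 + 1/16)"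
   using exp_265 assms by (intro mult_right_mono) auto
  moreover have "34/1000 * (1 + 4* s + (4* s)^2/2 + (4* s)^3/6 + (4* s)^4/24) <= 34/1000 * exp (4 * s)"
   using 2 by (intro mult_left_mono) auto
  ultimately show ?thesis using 1 poly by argo
 qed
 hence "exp s * ((s - 1) + exp (-s) + 34/1000 * exp (265/100) * (s/4 + 1/16)) <= exp s * (34/1000 * exp (4* s))"
  by (intro mult_left_mono) auto
 moreover have "exp s * exp (4 * s) = exp (5 * s)" by (simp flip: exp_add)
 moreover have "exp s * exp (-s) = 1" by (simp flip: exp_add)
 ultimately show ?thesis by (simp add: brun_err_def algebra_simps exp_add)
qed

text \<open>The initial threshold 0.84 lies outside the range of \<open>brun_err_numeric\<close> and
  is used only once. The relative loss 0.94 leaves the factor 6/100 of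
  \<open>sieve_lower_large_level\<close>.\<close>

lemma brun_start_numeric:
 "(84/100 - 1) * exp (84/100) + 1 + 34/1000 * exp (265/100 + 84/100) * ((84/100)/4 + 1/16) <= (94/100::real)"
proof -
 have "exp (84/100::real) >= 219/100" using exp_ge_sum[of "84/100" 3] by (simp add: eval_nat_numeral)
 moreover have "exp (265/100 + 84/100) <= 1416/100 * exp (84/100::real)"
  using exp_265 unfolding exp_add by (intro mult_right_mono) auto
 ultimately show ?thesis by argo
qed

text \<open>An antiderivative of \<open>u * exp u\<close> below \<open>max s 0\<close> and of
  \<open>u * exp u * brun_err (s + 53/100 - u)\<close> above it. It is the loss when the smaller
  prime of a pair is at depth \<open>u\<close>: the larger prime contributes at most
  \<open>u\<close>, and \<open>exp u\<close> is the ratio of the remaining product to the full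
  one.\<close>

definition brun_prim :: "real => real => real" where
 "brun_prim s u = (if u < max s 0 then (u - 1) * exp u
  else (max s 0 - 1) * exp (max s 0) + 34/1000 * exp (5 * (s + 53/100)) *
   (exp (-4 * max s 0) * (max s 0 / 4 + 1/16) - exp (-4 * u) * (u / 4 + 1/16)))"

lemma brun_prim_low:
 assumes "0 <= u0" "u0 <= (u1::real)"
 shows "u0 * (exp u1 - exp u0) <= (u1 - 1) * exp u1 - (u0 - 1) * exp u0"
proof -
 have "exp (u0 - u1) >= 1 + (u0 - u1)" by (rule exp_ge_add_one_self)
 hence "exp u1 * exp (u0 - u1) >= exp u1 * (1 + (u0 - u1))" by (rule mult_left_mono) simp
 moreover have "exp u1 * exp (u0 - u1) = exp u0" by (simp flip: exp_add)
 ultimately show ?thesis by (simp add: algebra_simps)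
qed

lemma exp_diff_bound:
 fixes u0 u1 :: real
 assumes "u0 <= u1"
 shows "(exp u1 - exp u0) * exp (-5 * u1) <= (exp (-4 * u0) - exp (-4 * u1)) / 4"
proof -
 have a: "1 - exp (u0 - u1) <= (exp (4 * (u1 - u0)) - 1) / 4"
  using exp_ge_add_one_self[of "u0 - u1"] exp_ge_add_one_self[of "4 * (u1 - u0)"] by argo
 have "exp (-4 * u1) * (1 - exp (u0 - u1)) <= exp (-4*u1) * ((exp (4 * (u1 - u0)) - 1) / 4)"
  using a by (rule mult_left_mono) simp
 moreover have "exp (-4 * u1) * exp (4 * (u1 - u0)) = exp (-4 * u0)" by (simp flip: exp_add)
 moreover have "exp (-4 * u1) * exp (u0 - u1) = exp u0 * exp (-5 * u1)" by (simp flip: exp_add)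
 moreover have "exp (-4 * u1) = exp u1 * exp (-5 * u1)" by (simp flip: exp_add)
 ultimately show ?thesis unfolding left_diff_distrib right_diff_distrib by argo
qed

lemma brun_prim_high:
 fixes u0 u1 :: real
 assumes "0 <= u0" "u0 <= u1"
 shows "u0 * (exp u1 - exp u0) * exp (-5 * u1) \<le>
  exp (-4 * u0) * (u0 / 4 + 1/16) - exp (-4 * u1) * (u1 / 4 + 1/16)"
proof -
 let ?e0 = "exp (-4 * u0)" and ?e1 = "exp (-4 * u1)"
 have "u0 * (exp u1 - exp u0) * exp (-5 * u1) <= u0 * ((?e0 - ?e1) / 4)"
  using exp_diff_bound[OF assms(2)] assms(1) by (metis mult.assoc mult_left_mono)
 moreover have "?e0 - ?e1 >= 4 * (u1 - u0) * ?e1"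
 proof -
  have "exp (4 * (u1 - u0)) >= 1 + 4 * (u1 - u0)" by (rule exp_ge_add_one_self)
  hence "?e1 * exp (4 * (u1 - u0)) >= ?e1 * (1 + 4 * (u1 - u0))" by (rule mult_left_mono) simp
  moreover have "?e1 * exp (4 * (u1 - u0)) = ?e0" by (simp flip: exp_add)
  ultimately show ?thesis by (simp add: algebra_simps)
 qed
 ultimately show ?thesis by (simp add: algebra_simps)
qed

text \<open>Increments lie below the integral because \<open>u0\<close> is the left endpoint while
  the decreasing error factor is taken at the right one. A step across the threshold is cut at
  \<open>s\<close>; on the left piece the factor may be raised to 1 by
  \<open>brun_err_bound\<close>.\<close>

lemma brun_prim_step:
 assumes "0 <= u0" "u0 <= u1"
 shows "u0 * (exp u1 - exp u0) * (if u1 < s then 1 else brun_err (s + 53/100 - u1))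
  <= brun_prim s u1 - brun_prim s u0"
proof -
 let ?s = "max s 0" and ?K = "34/1000 * exp (5 * (s + 53/100))"
 have E: "brun_err (s + 53/100 - u) = ?K * exp (-5 * u)" for u
  by (simp add: brun_err_def mult_exp_exp algebra_simps)
 have hi: "v * (exp u - exp v) * brun_err (s + 53/100 - u) <= brun_prim s u - brun_prim s v"
  if "?s <= v" "v <= u" for u v
 proof -
  have "?K * (v * (exp u - exp v) * exp (-5 * u)) \<le>
   ?K * (exp (-4 * v) * (v / 4 + 1/16) - exp (-4 * u) * (u / 4 + 1/16))"
   using brun_prim_high[of v u] that by (intro mult_left_mono) auto
  moreover have "brun_prim s u - brun_prim s v = ?K * (exp (-4 * v) * (v / 4 + 1/16) - exp (-4 * u) * (u / 4 + 1/16))"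
  proof -
   have "\<not> u < ?s" "\<not> v < ?s" using that by auto
   thus ?thesis unfolding brun_prim_def by (simp only: if_False right_diff_distrib)
  qed
  ultimately show ?thesis unfolding E by (simp only: mult_ac)
 qed
 have lo: "v * (exp u - exp v) <= brun_prim s u - brun_prim s v" if "0 <= v" "v <= u" "u <= ?s" for u v
 proof (cases "v < ?s")
  case True
  thus ?thesis using brun_prim_low[of v u] that unfolding brun_prim_def by (cases "u < ?s") auto
 next
  case False
  hence "u = v" using that by auto
  thus ?thesis by simp
 qed
 consider "u1 < s" | "?s <= u0" | "u0 < ?s" "s <= u1" by linarith
 thus ?thesis
 proof cases
  case 1 thus ?thesis using lo[of u0 u1] assms by simp
 next
  case 2 thus ?thesis using hi[of u0 u1] assms by simp
 next
  case 3
  have ss: "?s = s" "u0 < s" "0 < s" using 3 assms by auto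
  let ?e = "brun_err (s + 53/100 - u1)"
  have e: "?e <= 1" "?e > 0" using brun_err_mono[of "s + 53/100 - u1" "53/100"] brun_err_bound 3 brun_err_pos by auto
  have "u0 * (exp u1 - exp u0) * ?e = u0 * (exp s - exp u0) * ?e + u0 * (exp u1 - exp s) * ?e"
   by (simp add: algebra_simps)
  also have "u0 * (exp s - exp u0) * ?e <= u0 * (exp s - exp u0) * 1"
   using e ss assms by (intro mult_left_mono mult_nonneg_nonneg) auto
  also have "\<dots> <= brun_prim s s - brun_prim s u0" using lo[of u0 s] ss assms by simp
  also have "u0 * (exp u1 - exp s) * ?e <= s * (exp u1 - exp s) * ?e"
   using e ss assms 3 by (intro mult_right_mono) auto
  also have "\<dots> <= brun_prim s u1 - brun_prim s s" using hi[of s u1] ss 3 by simp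
  finally show ?thesis using 3 by simp
 qed
qed

lemma brun_prim_total:
 assumes "0 <= u"
 shows "0 <= s ==> brun_prim s u - brun_prim s 0 <= (s - 1) * exp s + 1 + 34/1000 * exp (265/100 + s) * (s/4 + 1/16)"
  and "s <= 0 ==> brun_prim s u - brun_prim s 0 <= brun_err s"
proof -
 let ?K = "34/1000 * exp (5 * (s + 53/100))"
 have nn: "0 <= ?K * (exp (-4 * u) * (u / 4 + 1/16))" using assms by simp
 show "brun_prim s u - brun_prim s 0 <= brun_err s" if "s <= 0"
 proof -
  have "brun_prim s u - brun_prim s 0 <= ?K * (1/16)"
   using that nn assms by (simp add: brun_prim_def max_def algebra_simps)
  also have "\<dots> = brun_err s * (exp (265/100) / 16)" by (simp add: brun_err_def exp_add algebra_simps)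
  also have "\<dots> <= brun_err s * 1" using exp_265 brun_err_pos[of s] by (intro mult_left_mono) auto
  finally show ?thesis by simp
 qed
 assume s: "0 <= s"
 have K: "?K * (exp (-4 * s) * (s/4+1/16)) = 34/1000 * exp (265/100 + s) * (s/4 + 1/16)"
  by (simp add: algebra_simps mult_exp_exp)
 have Kp: "?K * (exp (-4 * s) * (s/4+1/16)) >= 0" using s by simp
 have z: "brun_prim s 0 = -1" using s by (auto simp: brun_prim_def)
 show "brun_prim s u - brun_prim s 0 <= (s - 1) * exp s + 1 + 34/1000 * exp (265/100 + s) * (s/4 + 1/16)"
 proof (cases "u < s")
  case True
  have "(u - 1) * exp u <= (s - 1) * exp s"
   using brun_prim_low[of u s] True assms by (smt (verit) exp_less_mono mult_nonneg_nonneg)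
  moreover have "brun_prim s u = (u - 1) * exp u" using True s by (simp add: brun_prim_def max_def)
  ultimately show ?thesis using K Kp z by linarith
 next
  case False
  hence "brun_prim s u = (s - 1) * exp s + (?K * (exp (-4 * s) * (s / 4 + 1/16)) - ?K * (exp (-4 * u) * (u / 4 + 1/16)))"
   using s by (simp add: brun_prim_def right_diff_distrib)
  thus ?thesis using nn z K by linarith
 qed
qed

lemma sum_below_swap:
 assumes "finite (P::nat set)"
 shows "(\<Sum>p\<in>P. \<Sum>q\<in>below P p. h p q) = (\<Sum>q\<in>P. \<Sum>p | p : P & q < p. (h p q :: real))"
proof -
 have "(\<Sum>p\<in>P. \<Sum>q\<in>below P p. h p q) = (\<Sum>p\<in>P. \<Sum>q | q : P & q < p. h p q)"
  by (simp add: below_def)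
 also have "\<dots> = (\<Sum>q\<in>P. \<Sum>p | p : P & q < p. h p q)"
  by (rule sum.swap_restrict) (use assms in auto)
 finally show ?thesis .
qed

text \<open>After exchanging the sums put \<open>u = depth w P q\<close>. The primes above
  \<open>q\<close> contribute at most \<open>u - wt w q\<close>, and \<open>w q\<close> times the
  product below \<open>q\<close> is the full product times \<open>exp u - exp (u - wt w q)\<close>,
  so each \<open>q\<close> gives one increment for \<open>brun_prim_step\<close>.\<close>

lemma brun_loss:
 assumes P: "finite P" and w: "!!p. p : P ==> 0 <= w p & w p < (1::real)"
 shows "(\<Sum>p\<in>P. \<Sum>q\<in>below P p. w p * w q * (\<Prod>r\<in>below P q. 1 - w r) *
   (if depth w P q < s then 1 else brun_err (s + 53/100 - depth w P q)))
  <= (\<Prod>p\<in>P. 1 - w p) * (brun_prim s (sum (wt w) P) - brun_prim s 0)"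
proof -
 let ?V = "\<Prod>p\<in>P. 1 - w p" and ?D = "depth w P"
 let ?t = "%q. if ?D q < s then 1 else brun_err (s + 53/100 - ?D q)"
 have V: "?V > 0" using w by (intro prod_pos) auto
 have t: "?t q >= 0" for q using brun_err_pos[of "s + 53/100 - ?D q"] by simp
 have "(\<Sum>p\<in>P. \<Sum>q\<in>below P p. w p * w q * (\<Prod>r\<in>below P q. 1 - w r) * ?t q) =
   (\<Sum>q\<in>P. \<Sum>p | p : P & q < p. w p * w q * (\<Prod>r\<in>below P q. 1 - w r) * ?t q)"
  by (rule sum_below_swap[OF P])
 also have "\<dots> = (\<Sum>q\<in>P. ?V * ((\<Sum>p | p : P & q < p. w p) * (w q * exp (?D q)) * ?t q))"
  by (intro sum.cong refl) (use P w in \<open>simp add: prod_below sum_distrib_left sum_distrib_right mult_ac\<close>)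
 also have "\<dots> <= (\<Sum>q\<in>P. ?V * (brun_prim s (?D q) - brun_prim s (?D q - wt w q)))"
 proof (intro sum_mono mult_left_mono)
  fix q assume q: "q : P"
  let ?u0 = "?D q - wt w q" and ?u1 = "?D q"
  have e: "w q * exp ?u1 = exp ?u1 - exp ?u0"
  proof -
   have "exp ?u0 = exp ?u1 * exp (- wt w q)" by (simp flip: exp_add)
   hence "exp ?u0 = exp ?u1 * (1 - w q)" using exp_wt[of w q] w[OF q] by simp
   thus ?thesis by (simp add: algebra_simps)
  qed
  have "(\<Sum>p | p : P & q < p. w p) * (w q * exp (?D q)) * ?t q <= ?u0 * (exp ?u1 - exp ?u0) * ?t q"
   unfolding e[symmetric] using w q sum_above[OF P q, of w] t[of q]
   by (intro mult_right_mono) auto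
  also have "\<dots> <= brun_prim s ?u1 - brun_prim s ?u0"
   using sum_above[OF P q, of w] w q wt_nonneg[of w q] by (intro brun_prim_step) auto
  finally show "(\<Sum>p | p : P & q < p. w p) * (w q * exp (?D q)) * ?t q <= brun_prim s ?u1 - brun_prim s ?u0" .
 qed (use V in auto)
 also have "\<dots> = ?V * (brun_prim s (sum (wt w) P) - brun_prim s 0)"
  by (simp add: sum_distrib_left[symmetric] sum_telescope_depth[OF P])
 finally show ?thesis .
qed

lemma brun_loss_le:
 assumes P: "finite P" and w: "!!p. p : P ==> 0 <= w p & w p < (1::real)"
  and s: "s <= 53/100 & E = brun_err s \<or> s = 84/100 & E = 94/100"
 shows "(\<Sum>p\<in>P. \<Sum>q\<in>below P p. w p * w q * (\<Prod>r\<in>below P q. 1 - w r) *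
   (if depth w P q < s then 1 else brun_err (s + 53/100 - depth w P q)))
  <= (\<Prod>p\<in>P. 1 - w p) * E"
proof -
 have V: "0 <= (\<Prod>p\<in>P. 1 - w p)" using w by (intro prod_nonneg) force
 have L: "0 <= sum (wt w) P" using w by (intro sum_nonneg wt_nonneg) auto
 have "brun_prim s (sum (wt w) P) - brun_prim s 0 <= E"
 proof (cases "s <= 0")
  case True thus ?thesis using brun_prim_total(2)[OF L, of s] s by auto
 next
  case False
  note t = brun_prim_total(1)[OF L, of s]
  from s show ?thesis
  proof (elim disjE conjE)
   assume "s <= 53/100" "E = brun_err s"
   thus ?thesis using t brun_err_numeric[of s] False by linarith
  next
   assume h: "s = 84/100" "E = 94/100"
   show ?thesis using t False unfolding h using brun_start_numeric by linarith
  qed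
 qed
 hence "(\<Prod>p\<in>P. 1 - w p) * (brun_prim s (sum (wt w) P) - brun_prim s 0) <= (\<Prod>p\<in>P. 1 - w p) * E"
  using V by (rule mult_left_mono)
 thus ?thesis using brun_loss[where w = w and P = P and s = s, OF P w] by (simp add: order_trans)
qed

lemma mass_Cons: "mass a hit S (p # ds) = mass a hit {n\<in>S. hit p n} ds"
 by (auto simp: mass_def intro!: sum.cong)

text \<open>Two Buchstab steps. The sift belonging to a pair \<open>p, q\<close> is dropped as
  nonnegative when \<open>depth w P q < s\<close>, and otherwise bounded by induction. In that case
  the shifted threshold is at most 53/100, so the induction stays inside the range of
  \<open>brun_err_numeric\<close>; only the outermost call may use 84/100.\<close>

lemma brun_lower:
 assumes "finite P" "finite S" "!!n. n : S ==> 0 <= a n"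
  and w: "!!p. p : P ==> 0 <= w p & w p < (1::real)" and "0 <= X"
  and "s <= 53/100 & E = brun_err s \<or> s = 84/100 & E = 94/100"
 shows "sift a hit S P >= X * (\<Prod>p\<in>P. 1 - w p) * (1 - E) -
  (\<Sum>ds | brun_ok w P s ds. \<bar>mass a hit S ds - X * prod_list (map w ds)\<bar>)"
 using assms
proof (induction "card P" arbitrary: P S X s E rule: less_induct)
 case less
 note P = less.prems(1) and S = less.prems(2) and a = less.prems(3) and w = less.prems(4) and X = less.prems(5) and sE = less.prems(6)
 let ?V = "%P. \<Prod>p\<in>P. 1 - w p"
 let ?S = "%p. {n\<in>S. hit p n}"
 let ?SS = "%p q. {n\<in>?S p. hit q n}"
 let ?D = "depth w P"
 let ?s = "%q. s + 53/100 - ?D q"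
 let ?r = "%ds. \<bar>mass a hit S ds - X * prod_list (map w ds)\<bar>"
 let ?R = "%p q. \<Sum>ds | brun_ok w (below P q) (?s q) ds. ?r (p # q # ds)"
 have Vpos: "0 <= ?V (below P q)" for q using w by (intro prod_nonneg) (force simp: below_def)
 have pq: "(if s <= ?D q then - ?R p q else 0) +
   X * w p * w q * ?V (below P q) * (1 - (if ?D q < s then 1 else brun_err (?s q)))
   <= sift a hit (?SS p q) (below P q)" if "p : P" "q : below P p" for p q
 proof (cases "s <= ?D q")
  case True
  have q: "q : P" using that by auto
  have "X * w p * w q * ?V (below P q) * (1 - brun_err (?s q)) -
   (\<Sum>ds | brun_ok w (below P q) (?s q) ds. \<bar>mass a hit (?SS p q) ds - X * w p * w q * prod_list (map w ds)\<bar>)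
   <= sift a hit (?SS p q) (below P q)"
  proof (rule less.hyps)
   show "0 <= X * w p * w q" using X w[OF q] w[OF that(1)] by simp
  qed (use card_below[OF P q] P S a w True in auto)
  moreover have "\<bar>mass a hit (?SS p q) ds - X * w p * w q * prod_list (map w ds)\<bar> = ?r (p # q # ds)" for ds
   by (simp add: mass_Cons mult_ac)
  ultimately show ?thesis using True by simp
 next
  case False
  have "0 <= sift a hit (?SS p q) (below P q)" unfolding sift_def using a by (intro sum_nonneg) auto
  thus ?thesis using False by simp
 qed
 have 1: "sift a hit S P = sum a S - (\<Sum>p\<in>P. sum a (?S p)) + (\<Sum>p\<in>P. \<Sum>q\<in>below P p. sift a hit (?SS p q) (below P q))"
 proof -
  have "sift a hit S P = sum a S - (\<Sum>p\<in>P. sift a hit (?S p) (below P p))"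
   by (rule buchstab_sift[OF P S])
  also have "(\<Sum>p\<in>P. sift a hit (?S p) (below P p)) = (\<Sum>p\<in>P. sum a (?S p) - (\<Sum>q\<in>below P p. sift a hit (?SS p q) (below P q)))"
  proof (intro sum.cong refl)
   fix p assume "p : P"
   show "sift a hit (?S p) (below P p) = sum a (?S p) - (\<Sum>q\<in>below P p. sift a hit (?SS p q) (below P q))"
   by (subst buchstab_sift) (use P S in \<open>auto simp: below_def intro!: sum.cong arg_cong2[where f="sift a hit"]\<close>)
  qed
  finally show ?thesis by (simp add: sum_subtractf)
 qed
 have 2: "?V P = 1 - (\<Sum>p\<in>P. w p) + (\<Sum>p\<in>P. \<Sum>q\<in>below P p. w p * w q * ?V (below P q))"
 proof -
  have "?V P = 1 - (\<Sum>p\<in>P. w p * ?V (below P p))" by (rule buchstab_prod[OF P])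
  also have "(\<Sum>p\<in>P. w p * ?V (below P p)) = (\<Sum>p\<in>P. w p - (\<Sum>q\<in>below P p. w p * w q * ?V (below P q)))"
  proof (intro sum.cong refl)
   fix p assume "p : P"
   have "?V (below P p) = 1 - (\<Sum>q\<in>below P p. w q * ?V (below P q))"
   by (subst buchstab_prod) (use P in \<open>auto simp: below_def intro!: sum.cong prod.cong arg_cong2[where f="(*)"]\<close>)
   thus "w p * ?V (below P p) = w p - (\<Sum>q\<in>below P p. w p * w q * ?V (below P q))"
   by (simp add: right_diff_distrib sum_distrib_left mult_ac)
  qed
  finally show ?thesis by (simp add: sum_subtractf)
 qed
 have 3: "(\<Sum>ds | brun_ok w P s ds. ?r ds) = \<bar>sum a S - X\<bar> + (\<Sum>p\<in>P. \<bar>sum a (?S p) - X * w p\<bar>) +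
  (\<Sum>p\<in>P. \<Sum>q\<in>below P p. if s <= ?D q then ?R p q else 0)"
  by (subst sum_brun_ok[OF P]) (simp add: mass_def)
 have 4: "(\<Sum>p\<in>P. \<Sum>q\<in>below P p. sift a hit (?SS p q) (below P q)) \<ge>
  (\<Sum>p\<in>P. \<Sum>q\<in>below P p. (if s <= ?D q then - ?R p q else 0) +
   X * w p * w q * ?V (below P q) * (1 - (if ?D q < s then 1 else brun_err (?s q))))"
  by (intro sum_mono pq)
 have 5: "(\<Sum>p\<in>P. \<Sum>q\<in>below P p. (if s <= ?D q then - ?R p q else 0) +
   X * w p * w q * ?V (below P q) * (1 - (if ?D q < s then 1 else brun_err (?s q)))) =
   - (\<Sum>p\<in>P. \<Sum>q\<in>below P p. if s <= ?D q then ?R p q else 0) +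
   X * ((\<Sum>p\<in>P. \<Sum>q\<in>below P p. w p * w q * ?V (below P q)) -
   (\<Sum>p\<in>P. \<Sum>q\<in>below P p. w p * w q * ?V (below P q) * (if ?D q < s then 1 else brun_err (?s q))))"
  unfolding sum_distrib_left sum_subtractf[symmetric] sum_negf[symmetric] sum.distrib[symmetric] right_diff_distrib
  by (intro sum.cong refl) (auto simp: sum_negf mult_ac)
 have 6: "X * (\<Sum>p\<in>P. \<Sum>q\<in>below P p. w p * w q * ?V (below P q) * (if ?D q < s then 1 else brun_err (?s q)))
   <= X * (?V P * E)"
  by (intro mult_left_mono brun_loss_le) (use P w sE X in auto)
 have 7: "X * w p - sum a (?S p) >= - \<bar>sum a (?S p) - X * w p\<bar>" for p by simp
 have 8: "(\<Sum>p\<in>P. X * w p) - (\<Sum>p\<in>P. sum a (?S p)) >= - (\<Sum>p\<in>P. \<bar>sum a (?S p) - X * w p\<bar>)"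
  unfolding sum_subtractf[symmetric] sum_negf[symmetric] by (intro sum_mono 7)
 have 9: "X * ?V P = X - (\<Sum>p\<in>P. X * w p) + X * (\<Sum>p\<in>P. \<Sum>q\<in>below P p. w p * w q * ?V (below P q))"
  by (subst 2) (simp add: algebra_simps sum_distrib_left)
 have 10: "X * ((\<Sum>p\<in>P. \<Sum>q\<in>below P p. w p * w q * ?V (below P q)) -
   (\<Sum>p\<in>P. \<Sum>q\<in>below P p. w p * w q * ?V (below P q) * (if ?D q < s then 1 else brun_err (?s q))))
  >= X * ?V P - X + (\<Sum>p\<in>P. X * w p) - X * (?V P * E)"
  using 6 9 by (simp add: right_diff_distrib)
 have 11: "X * ?V P * (1 - E) = X * ?V P - X * (?V P * E)" by (simp add: algebra_simps)
 have 12: "sum a S - X >= - \<bar>sum a S - X\<bar>" by simp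
 show ?case unfolding 1 3 11 using 4[unfolded 5] 8 10 12 by linarith
qed


text \<open>One Buchstab step turns the task into lower bounds for the sets
  \<open>below P p\<close>. Started at threshold \<open>53/100 - depth w P p\<close>, they lose in
  total at most one further copy of the product, whence the factor 2.\<close>

lemma brun_upper:
 assumes P: "finite P" and S: "finite S" and a: "!!n. n : S ==> 0 <= a n"
  and w: "!!p. p : P ==> 0 <= w p & w p < (1::real)" and X: "0 <= X"
 shows "sift a hit S P <= 2 * X * (\<Prod>p\<in>P. 1 - w p) + \<bar>mass a hit S [] - X\<bar> +
  (\<Sum>p\<in>P. \<Sum>ds | brun_ok w (below P p) (53/100 - depth w P p) ds.
   \<bar>mass a hit S (p # ds) - X * prod_list (map w (p # ds))\<bar>)"
proof -
 let ?V = "%P. \<Prod>p\<in>P. 1 - w p"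
 let ?S = "%p. {n\<in>S. hit p n}"
 let ?D = "depth w P"
 let ?s = "%q. 53/100 - ?D q"
 let ?R = "%p. \<Sum>ds | brun_ok w (below P p) (?s p) ds. \<bar>mass a hit S (p # ds) - X * prod_list (map w (p # ds))\<bar>"
 have lo: "sift a hit (?S p) (below P p) >= X * w p * ?V (below P p) * (1 - brun_err (?s p)) - ?R p" if p: "p : P" for p
 proof -
  have "0 <= ?D p" using sum_above[OF P p, of w] wt_nonneg[of w p] w[OF p] w by force
  hence "X * w p * ?V (below P p) * (1 - brun_err (?s p)) -
   (\<Sum>ds | brun_ok w (below P p) (?s p) ds. \<bar>mass a hit (?S p) ds - X * w p * prod_list (map w ds)\<bar>)
   <= sift a hit (?S p) (below P p)"
   by (intro brun_lower) (use P S a w p X in auto)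
  thus ?thesis by (simp add: mass_Cons mult_ac)
 qed
 have Vb: "?V (below P p) = ?V P * exp (?D p)" for p by (rule prod_below[OF P w]) auto
 have V: "?V P > 0" using w by (intro prod_pos) auto
 have loss: "(\<Sum>p\<in>P. w p * ?V (below P p) * brun_err (?s p)) <= ?V P"
 proof -
  let ?K = "34/1000 * exp (265/100::real)"
  have "(\<Sum>p\<in>P. w p * ?V (below P p) * brun_err (?s p)) \<le>
   (\<Sum>p\<in>P. ?V P * ?K * ((- exp (-4 * ?D p) / 4) - (- exp (-4 * (?D p - wt w p)) / 4)))"
  proof (intro sum_mono)
   fix p assume p: "p : P"
   have e: "w p * exp (?D p) = exp (?D p) - exp (?D p - wt w p)"
   proof -
   have "exp (?D p - wt w p) = exp (?D p) * exp (- wt w p)" by (simp flip: exp_add)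
   hence "exp (?D p - wt w p) = exp (?D p) * (1 - w p)" using exp_wt[of w p] w[OF p] by simp
   thus ?thesis by (simp add: algebra_simps)
   qed
   have b: "brun_err (?s p) = ?K * exp (-5 * ?D p)" by (simp add: brun_err_def mult_exp_exp)
   have "w p * ?V (below P p) * brun_err (?s p) = ?V P * ?K * ((exp (?D p) - exp (?D p - wt w p)) * exp (-5 * ?D p))"
   unfolding Vb b e[symmetric] by (simp only: mult_ac)
   also have "\<dots> <= ?V P * ?K * ((exp (-4 * (?D p - wt w p)) - exp (-4 * ?D p)) / 4)"
   using exp_diff_bound[of "?D p - wt w p" "?D p"] V wt_nonneg[of w p] w[OF p]
   by (intro mult_left_mono) auto
   finally show "w p * ?V (below P p) * brun_err (?s p) <= ?V P * ?K * ((- exp (-4 * ?D p) / 4) - (- exp (-4 * (?D p - wt w p)) / 4))"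
   by (simp add: algebra_simps)
  qed
  also have "\<dots> = ?V P * ?K * ((- exp (-4 * sum (wt w) P) / 4) - (- exp (-4 * 0) / 4))"
   unfolding sum_distrib_left[symmetric] by (subst sum_telescope_depth[OF P, of "%u. - exp (-4 * u) / 4"]) simp
  also have "\<dots> <= ?V P * 1"
  proof -
   have "?K * ((- exp (-4 * sum (wt w) P) / 4) - (- exp (-4 * 0) / 4)) <= ?K * (1/4)"
   by (intro mult_left_mono) auto
   also have "\<dots> <= 1" using exp_265 by simp
   finally show ?thesis using V unfolding mult.assoc by (intro mult_left_mono) auto
  qed
  finally show ?thesis by simp
 qed
 have "sift a hit S P = mass a hit S [] - (\<Sum>p\<in>P. sift a hit (?S p) (below P p))"
  using buchstab_sift[OF P S] by (simp add: mass_def)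
 also have "\<dots> <= mass a hit S [] - (\<Sum>p\<in>P. X * w p * ?V (below P p) * (1 - brun_err (?s p)) - ?R p)"
  using lo by (intro diff_left_mono sum_mono) auto
 also have "(\<Sum>p\<in>P. X * w p * ?V (below P p) * (1 - brun_err (?s p)) - ?R p) =
  X * (\<Sum>p\<in>P. w p * ?V (below P p)) - X * (\<Sum>p\<in>P. w p * ?V (below P p) * brun_err (?s p)) - (\<Sum>p\<in>P. ?R p)"
  by (simp add: sum_subtractf sum_distrib_left right_diff_distrib mult_ac)
 also have "(\<Sum>p\<in>P. w p * ?V (below P p)) = 1 - ?V P" using buchstab_prod[OF P, of w] by simp
 also have "X * (\<Sum>p\<in>P. w p * ?V (below P p) * brun_err (?s p)) <= X * ?V P" using loss X by (rule mult_left_mono)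
 finally show ?thesis by (simp add: algebra_simps)
qed

section \<open>Logarithmic size of the sieve moduli\<close>

definition log_sum :: "nat list => real" where
 "log_sum ds = (\<Sum>d\<leftarrow>ds. ln (real d))"

lemma sum_split_below:
 assumes "finite P"
 shows "(\<Sum>r\<in>P. h r) = (\<Sum>r\<in>below P q. h r) + (\<Sum>r | r : P & q <= r. h r :: real)"
proof -
 have P: "P = below P q \<union> {p. p : P & q <= p}" by auto
 show ?thesis by (subst P, subst sum.union_disjoint) (use assms in auto)
qed

lemma sum_min_split:
 assumes "finite P" "!!p. p : P ==> p >= 1" "q : P"
 shows "(\<Sum>r\<in>P. wt w r * min (ln (real r)) (ln (real q))) =
  (\<Sum>r\<in>below P q. wt w r * ln (real r)) + depth w P q * ln (real q)"
proof -
 have "(\<Sum>r\<in>below P q. wt w r * min (ln (real r)) (ln (real q))) = (\<Sum>r\<in>below P q. wt w r * ln (real r))"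
  using assms(2) by (intro sum.cong) (auto simp: min_def dest!: assms(2))
 moreover have "(\<Sum>r | r : P & q <= r. wt w r * min (ln (real r)) (ln (real q))) = depth w P q * ln (real q)"
  unfolding depth_def sum_distrib_right using assms(2,3) by (intro sum.cong) (auto simp: min_def dest: assms(2))
 ultimately show ?thesis by (subst sum_split_below[OF assms(1), of _ q]) simp
qed

lemma depth_ln_le:
 assumes "finite P" "!!p. p : P ==> 0 <= w p & w p < (1::real) & p >= 1" "q : P"
 shows "(\<Sum>r\<in>below P q. wt w r * ln (real r)) + depth w P q * ln (real q) <= (\<Sum>r\<in>P. wt w r * ln (real r))"
proof -
 have "(\<Sum>r\<in>P. wt w r * min (ln (real r)) (ln (real q))) <= (\<Sum>r\<in>P. wt w r * ln (real r))"
  using assms by (intro sum_mono mult_left_mono) (auto intro!: wt_nonneg)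
 thus ?thesis using sum_min_split[OF assms(1), of q w] assms by auto
qed

text \<open>A potential argument. After a pair \<open>p, q\<close> the cap on logarithms drops from
  \<open>Z\<close> to \<open>ln q\<close>, so \<open>q\<close> and the next prime cost at most
  \<open>2 * ln q\<close>. The shift of the threshold by 53/100 releases
  \<open>53/100 * ln q\<close> in the bracket, hence the factor
  \<open>200/53 = 2 / (53/100)\<close>.\<close>

lemma brun_cost:
 assumes "brun_ok w P s ds" "finite P" "!!p. p : P ==> 0 <= w p & w p < (1::real) & p >= 1 & ln (real p) <= Z"
  "s <= 53/100" "0 <= Z"
 shows "log_sum ds <= Z + 200/53 * ((\<Sum>r\<in>P. wt w r * ln (real r)) + (53/100 - s) * Z)"
 using assms
proof (induction w P s ds arbitrary: Z rule: brun_ok.induct)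
 case (1 w P s)
 have "0 <= (\<Sum>r\<in>P. wt w r * ln (real r))" using 1 by (intro sum_nonneg mult_nonneg_nonneg wt_nonneg) auto
 thus ?case using 1 by (simp add: log_sum_def)
next
 case (2 w P s p)
 have "0 <= (\<Sum>r\<in>P. wt w r * ln (real r))" using 2 by (intro sum_nonneg mult_nonneg_nonneg wt_nonneg) auto
 moreover have "0 <= (53/100 - s) * Z" using 2 by simp
 moreover have "ln (real p) <= Z" using 2 by auto
 moreover have "log_sum [p] = ln (real p)" by (simp add: log_sum_def)
 ultimately have "log_sum [p] <= Z" "0 <= 200/53 * ((\<Sum>r\<in>P. wt w r * ln (real r)) + (53/100 - s) * Z)"
  by (simp_all only: mult_nonneg_nonneg add_nonneg_nonneg)
 thus ?case by argo
next
 case (3 w P s p q ds)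
 from 3(2) have h: "p : P" "q : P" "q < p" "s <= depth w P q" "brun_ok w (below P q) (s + 53/100 - depth w P q) ds"
  by auto
 have "log_sum ds <= ln (real q) + 200/53 * ((\<Sum>r\<in>below P q. wt w r * ln (real r)) + (53/100 - (s + 53/100 - depth w P q)) * ln (real q))"
  by (rule 3(1)) (use h 3 in \<open>auto dest: 3(4)\<close>)
 moreover have "(\<Sum>r\<in>below P q. wt w r * ln (real r)) + depth w P q * ln (real q) <= (\<Sum>r\<in>P. wt w r * ln (real r))"
  by (rule depth_ln_le) (use 3 h in auto)
 moreover have "(53/100 - s) * ln (real q) <= (53/100 - s) * Z" using 3 h by (intro mult_left_mono) auto
 moreover have "ln (real p) <= Z" using h 3 by auto
 ultimately show ?case by (simp add: log_sum_def algebra_simps)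
qed

text \<open>For the first pair \<open>s\<close> may exceed 53/100. The surplus is kept at
  \<open>ln q\<close> instead of being replaced by \<open>Z\<close>, because it now enters with a
  negative sign; likewise the logarithms above \<open>q\<close> stay cut at
  \<open>ln q\<close>.\<close>

lemma brun_cost_start:
 assumes "brun_ok w P s (p # q # ds)" "finite P"
  and P: "!!p. p : P ==> 0 <= w p & w p < (1::real) & p >= 1 & ln (real p) <= Z"
 shows "log_sum (p # q # ds) <= Z + 200/53 * ((\<Sum>r\<in>P. wt w r * min (ln (real r)) (ln (real q))) - (s - 53/100) * ln (real q))"
proof -
 from assms(1) have h: "p : P" "q : P" "q < p" "s <= depth w P q" "brun_ok w (below P q) (s + 53/100 - depth w P q) ds"
  by auto
 have "log_sum ds <= ln (real q) + 200/53 * ((\<Sum>r\<in>below P q. wt w r * ln (real r)) + (53/100 - (s + 53/100 - depth w P q)) * ln (real q))"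
  by (rule brun_cost) (use h assms in \<open>auto dest: P\<close>)
 moreover have "(\<Sum>r\<in>P. wt w r * min (ln (real r)) (ln (real q))) =
  (\<Sum>r\<in>below P q. wt w r * ln (real r)) + depth w P q * ln (real q)"
  using assms h by (intro sum_min_split) auto
 moreover have "ln (real p) <= Z" using h P by auto
 ultimately show ?thesis by (simp add: log_sum_def algebra_simps)
qed

lemma brun_cost_upper:
 assumes "p : P" "brun_ok w (below P p) (53/100 - depth w P p) ds" "finite P"
  and P: "!!p. p : P ==> 0 <= w p & w p < (1::real) & p >= 1 & ln (real p) <= Z"
 shows "log_sum (p # ds) <= 2 * Z + 200/53 * (\<Sum>r\<in>P. wt w r * ln (real r))"
proof -
 have "0 <= depth w P p" using sum_above[OF assms(3,1), of w] wt_nonneg[of w p] P[OF assms(1)] P by force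
 hence "log_sum ds <= ln (real p) + 200/53 * ((\<Sum>r\<in>below P p. wt w r * ln (real r)) + (53/100 - (53/100 - depth w P p)) * ln (real p))"
  by (intro brun_cost) (use assms in \<open>auto dest: P\<close>)
 moreover have "(\<Sum>r\<in>below P p. wt w r * ln (real r)) + depth w P p * ln (real p) <= (\<Sum>r\<in>P. wt w r * ln (real r))"
  by (rule depth_ln_le) (use assms in auto)
 moreover have "ln (real p) <= Z" using assms by auto
 moreover have "log_sum (p # ds) = ln (real p) + log_sum ds" by (simp add: log_sum_def)
 moreover have "53/100 - (53/100 - depth w P p) = depth w P p" by simp
 ultimately show ?thesis by argo
qed

lemma log_sum_eq: "\<forall>d\<in>set ds. d > 0 ==> log_sum ds = ln (real (prod_list ds))"
 by (induction ds) (auto simp: log_sum_def ln_mult prod_list_zero_iff)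

section \<open>The weight integral behind the level\<close>

text \<open>The trapezoidal rule for \<open>1 / t\<close> on \<open>[q - 1 - v, q - 1]\<close>,
  applied at the largest possible \<open>w q\<close>.\<close>

lemma wt_bound:
 assumes "0 <= w q" "w q <= v / (real q - 1)" "0 < v" "v < real q - 1"
 shows "wt w q <= v * ((1 / (real q - 1) + 1 / (real q - 1 - v)) / 2)"
proof -
 have "1 - v / (real q - 1) <= 1 - w q" using assms by simp
 moreover have "1 - v / (real q - 1) > 0" using assms by (simp add: field_simps)
 ultimately have "- ln (1 - w q) <= - ln (1 - v / (real q - 1))" by simp
 also have "1 - v / (real q - 1) = (real q - 1 - v) / (real q - 1)" using assms by (simp add: field_simps)
 also have "- ln ((real q - 1 - v) / (real q - 1)) = ln (real q - 1 - v + v) - ln (real q - 1 - v)"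
  using assms by (subst ln_div) auto
 also have "\<dots> <= v * (inverse (real q - 1 - v) + inverse (real q - 1 - v + v)) / 2"
  using assms by (intro ln_inverse_approx_le) auto
 finally show ?thesis by (simp add: wt_def inverse_eq_divide add.commute)
qed

lemma xln_quotient_decreasing:
 fixes x y :: real
 assumes "1 < x" "x <= y"
 shows "y * (ln y - ln (y - 1)) <= x * (ln x - ln (x - 1))"
proof (rule DERIV_nonpos_imp_nonincreasing[OF assms(2), of "%x. x * (ln x - ln (x - 1))"])
 fix t assume t: "x <= t" "t <= y"
 have "((%x. x * (ln x - ln (x - 1))) has_real_derivative ((ln t - ln (t - 1)) + t * (1 / t - 1 / (t - 1)))) (at t)"
  using t assms by (auto intro!: derivative_eq_intros)
 moreover have "(ln t - ln (t - 1)) + t * (1 / t - 1 / (t - 1)) <= 0"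
 proof -
  have "ln t - ln (t - 1) = ln (t / (t - 1))" using t assms by (simp add: ln_div)
  also have "\<dots> <= t / (t - 1) - 1" using t assms by (intro ln_le_minus_one) auto
  finally show ?thesis using t assms by (simp add: right_diff_distrib)
 qed
 ultimately show "\<exists>y. ((%x. x * (ln x - ln (x - 1))) has_real_derivative y) (at t) & y <= 0" by blast
qed

text \<open>Since \<open>x * (ln x - ln (x - 1))\<close> decreases, its values at \<open>n\<close>
  and \<open>n - c\<close> can be compared. The right side is an increment of
  \<open>ln (1 - c / x)\<close> and telescopes.\<close>

lemma ln_gap_weight:
 fixes n c :: real
 assumes "0 <= c" "c + 1 < n"
 shows "(ln n - ln (n - 1)) * (c / (n - c)) <= ln (1 - c / n) - ln (1 - c / (n - 1))"
proof -
 have n: "n - c > 1" "n > 1" using assms by auto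
 have 1: "ln (1 - c / n) = ln (n - c) - ln n"
 proof -
  have "1 - c / n = (n - c) / n" using n by (simp add: diff_divide_distrib)
  thus ?thesis using n by (simp add: ln_div)
 qed
 have 2: "ln (1 - c / (n - 1)) = ln (n - 1 - c) - ln (n - 1)"
 proof -
  have "1 - c / (n - 1) = (n - 1 - c) / (n - 1)" using n by (simp add: diff_divide_distrib)
  thus ?thesis using n by (simp add: ln_div)
 qed
 have "n * (ln n - ln (n - 1)) <= (n - c) * (ln (n - c) - ln (n - c - 1))"
  using xln_quotient_decreasing[of "n - c" n] n assms by simp
 hence "n * (ln n - ln (n - 1)) / (n - c) <= ln (n - c) - ln (n - c - 1)"
  using n by (simp add: field_simps)
 moreover have "n * (ln n - ln (n - 1)) / (n - c) = (ln n - ln (n - 1)) + (ln n - ln (n - 1)) * (c / (n - c))"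
  using n by (simp add: field_simps)
 moreover have "n - c - 1 = n - 1 - c" by simp
 ultimately show ?thesis unfolding 1 2 by simp
qed

text \<open>\<open>J\<close> integrates \<open>min 1 (t / ln x)\<close> with respect to
  \<open>ln x\<close>. The function is nonincreasing, so its value at the right endpoint
  underestimates the integral; the last case is the step that crosses
  \<open>ln x = t\<close>.\<close>

lemma ln_gap_min:
 fixes n :: nat and t :: real
 assumes "n >= 3" "t > 0"
 defines "J \<equiv> %x. if ln x <= t then ln x else t + t * ln (ln x / t)"
 shows "(ln n - ln (real n - 1)) * min 1 (t / ln n) <= J (real n) - J (real n - 1)"
proof -
 have L: "0 < ln (real n - 1)" "ln (real n - 1) < ln (real n)" using assms by auto
 have lb: "1 - 1 / y <= ln y" if "y > 0" for y :: real
  using ln_le_minus_one[of "1 / y"] that by (simp add: ln_div)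
 consider "ln (real n) <= t" | "t < ln (real n - 1)" | "ln (real n - 1) <= t" "t < ln (real n)" by linarith
 thus ?thesis
 proof cases
  case 1
  thus ?thesis using L by (simp add: J_def min_def)
 next
  case 2
  have "J (real n) - J (real n - 1) = t * (ln (ln n / t) - ln (ln (real n - 1) / t))"
   using 2 L by (simp add: J_def algebra_simps)
  also have "ln (ln n / t) - ln (ln (real n - 1) / t) = ln (ln n / ln (real n - 1))"
   using L assms by (simp add: ln_div)
  also have "t * \<dots> >= t * (1 - 1 / (ln n / ln (real n - 1)))"
   using L assms by (intro mult_left_mono lb) auto
  also have "t * (1 - 1 / (ln n / ln (real n - 1))) = (ln n - ln (real n - 1)) * (t / ln n)"
   using L by (simp add: field_simps)
  finally show ?thesis using 2 L by (simp add: min_def field_simps)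
 next
  case 3
  let ?l = "ln (real n - 1)" and ?L = "ln (real n)"
  have h1: "t * ln (?L / t) >= t * (1 - 1 / (?L / t))" using 3 L assms by (intro mult_left_mono lb) auto
  have h2: "0 <= (t - ?l) * (1 - t / ?L)" using 3 L assms by (intro mult_nonneg_nonneg) (auto simp: field_simps)
  have h3: "(t - ?l) * (1 - t / ?L) = t + t * (1 - 1 / (?L / t)) - ?l - (?L - ?l) * (t / ?L)"
   using L assms by (simp add: field_simps)
  have h4: "J (real n) = t + t * ln (?L / t)" "J (real n - 1) = ?l" using 3 by (auto simp: J_def)
  have h5: "min 1 (t / ?L) = t / ?L" using 3 L by (simp add: min_def)
  show ?thesis unfolding h4 h5 using h1 h2 unfolding h3 by argo
 qed
qed

lemma sum_telescope_greaterThan: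
 fixes f :: "real => real"
 assumes "a <= b"
 shows "(\<Sum>n\<in>{a<..b}. f (real n) - f (real n - 1)) = f (real b) - f (real a)"
 using assms
proof (induction b rule: dec_induct)
 case (step b)
 have "{a<..Suc b} = insert (Suc b) {a<..b}" using step by auto
 thus ?case using step by simp
qed simp

text \<open>Here \<open>W\<close> is the value at \<open>a\<close> of the weight \<open>(q / v) * w q\<close>-majorant, and \<open>K\<close> collects the part of
 the integral coming from the excess of that majorant over 1.\<close>

lemma sieve_weight_sum:
 fixes a b :: nat and v t h :: real
 defines "W \<equiv> 1 + (1 / (real a - 1) + (v + 1) / (real a - 1 - v)) / 2"
  and "K \<equiv> - (ln (1 - 1 / a) + ln (1 - (v + 1) / a)) / 2"
 assumes a: "3 <= a" "a <= b" and v: "1 <= v" "v + 1 < a" and t: "ln a <= t" "t <= ln b"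
  and h: "!!n. a <= n ==> mertens n <= ln n + h"
 shows "(\<Sum>p | prime p & a <= p & p <= b. (1 / (real p - 1) + 1 / (real p - 1 - v)) / 2 * min (ln p) t)
  <= W * (ln a + h - mertens (a - 1)) + K + (t - ln a) + t * ln (ln b / t)"
proof -
 \<comment> \<open>\<open>u n / n\<close> is the trapezoidal weight of \<open>wt_bound\<close>. It
   decreases to 1 and \<open>u a\<close> is \<open>W\<close>.\<close>
 define u where "u = (%n::nat. 1 + (1 / (real n - 1) + (v + 1) / (real n - 1 - v)) / 2)"
 define \<mu> where "\<mu> = (%n::nat. min 1 (t / ln n))"
 define m where "m = (%n. u n * \<mu> n)"
 have lna: "ln (real a) > 0" using a by simp
 have t0: "t > 0" using t lna by linarith
 have ln0: "ln (real n) > 0" if "a <= n" for n using that a by simp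
 have u1: "u n >= 1" if "a <= n" for n using that v a by (auto simp: u_def intro!: add_nonneg_nonneg divide_nonneg_nonneg)
 have \<mu>: "0 <= \<mu> n" "\<mu> n <= 1" if "a <= n" for n using ln0[OF that] t0 by (auto simp: \<mu>_def)
 have umono: "u (Suc n) <= u n" if "a <= n" for n using that v a
  by (auto simp: u_def intro!: divide_right_mono add_mono divide_left_mono)
 have \<mu>mono: "\<mu> (Suc n) <= \<mu> n" if "a <= n" for n
 proof -
  have "t / ln (real (Suc n)) <= t / ln (real n)" using ln0[OF that] that a t0 by (intro divide_left_mono) auto
  thus ?thesis by (auto simp: \<mu>_def)
 qed
 have c0: "0 <= ln a + h - mertens (a - 1)"
 proof -
  have "mertens (a - 1) <= mertens a" unfolding mertens_def
   by (intro sum_mono2) (auto simp: prime_gt_0_nat Suc_leI)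
  thus ?thesis using h[of a] by simp
 qed
 have "(\<Sum>p | prime p & a <= p & p <= b. (1 / (real p - 1) + 1 / (real p - 1 - v)) / 2 * min (ln p) t)
  = (\<Sum>p | prime p & a <= p & p <= b. ln (real p) / p * m p)"
 proof (intro sum.cong refl)
  fix p assume "p : {p. prime p & a <= p & p <= b}"
  hence p: "a <= p" by auto
  have p1: "real p - 1 > v" "v > 0" using p v by auto
  have "min (ln p) t = ln p * \<mu> p" using ln0[OF p] t0 by (auto simp: \<mu>_def min_def field_simps)
  moreover have "(1 / (real p - 1) + 1 / (real p - 1 - v)) / 2 = u p / p"
  proof -
   have "1 + 1 / (real p - 1) = p / (real p - 1)" "1 + (v + 1) / (real p - 1 - v) = p / (real p - 1 - v)"
   using p1 by (simp_all add: field_simps)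
   moreover have "u p = ((1 + 1 / (real p - 1)) + (1 + (v + 1) / (real p - 1 - v))) / 2"
   unfolding u_def by argo
   ultimately have "u p = (real p / (real p - 1) + real p / (real p - 1 - v)) / 2" by (simp only:)
   hence "u p = real p * ((1 / (real p - 1) + 1 / (real p - 1 - v)) / 2)" by argo
   thus ?thesis using p a by simp
  qed
  ultimately show "(1 / (real p - 1) + 1 / (real p - 1 - v)) / 2 * min (ln p) t = ln (real p) / p * m p"
   by (simp add: m_def)
 qed
 also have "\<dots> <= (ln a + h - mertens (a - 1)) * m a + (\<Sum>n\<in>{a<..b}. (ln n - ln (real n - 1)) * m n)"
 proof (rule prime_sum_upper)
  fix n assume "a <= n"
  thus "0 <= m n" "m (Suc n) <= m n" unfolding m_def using u1[of n] \<mu>[of n] umono[of n] \<mu>mono[of n] \<mu>[of "Suc n"]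
   by (auto intro!: mult_mono mult_nonneg_nonneg)
 qed (use a h in auto)
 also have "(ln a + h - mertens (a - 1)) * m a <= (ln a + h - mertens (a - 1)) * W"
  using c0 u1[of a] \<mu>[of a] unfolding m_def W_def u_def[symmetric]
  by (intro mult_left_mono) (auto simp: u_def mult_left_le)
 also have "(\<Sum>n\<in>{a<..b}. (ln n - ln (real n - 1)) * m n) \<le>
  (\<Sum>n\<in>{a<..b}. (ln n - ln (real n - 1)) * \<mu> n) + (\<Sum>n\<in>{a<..b}. (ln n - ln (real n - 1)) * (u n - 1))"
  unfolding sum.distrib[symmetric]
 proof (intro sum_mono)
  fix n assume n: "n : {a<..b}"
  \<comment> \<open>Separates the two effects: the cut-off at \<open>t\<close> and the excess of
    \<open>u\<close> over 1 are then summed independently, by \<open>J\<close> and by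
    \<open>G\<close>.\<close>
  have "m n <= \<mu> n + (u n - 1)"
  proof -
   have "0 <= (u n - 1) * (1 - \<mu> n)" using u1[of n] \<mu>[of n] n by (intro mult_nonneg_nonneg) auto
   thus ?thesis by (simp add: m_def algebra_simps)
  qed
  moreover have "ln n - ln (real n - 1) >= 0" using n a by auto
  ultimately have "(ln n - ln (real n - 1)) * m n <= (ln n - ln (real n - 1)) * (\<mu> n + (u n - 1))"
   by (intro mult_left_mono)
  thus "(ln n - ln (real n - 1)) * m n <= (ln n - ln (real n - 1)) * \<mu> n + (ln n - ln (real n - 1)) * (u n - 1)"
   by (simp add: algebra_simps)
 qed
 also have "(\<Sum>n\<in>{a<..b}. (ln n - ln (real n - 1)) * \<mu> n) <= (t - ln a) + t * ln (ln b / t)"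
 proof -
  define J where "J = (%x. if ln x <= t then ln x else t + t * ln (ln x / t))"
  have "(\<Sum>n\<in>{a<..b}. (ln n - ln (real n - 1)) * \<mu> n) <= (\<Sum>n\<in>{a<..b}. J (real n) - J (real n - 1))"
   unfolding \<mu>_def J_def using a t0 by (intro sum_mono ln_gap_min) auto
  also have "\<dots> = J b - J a" using a by (intro sum_telescope_greaterThan)
  also have "J b = t + t * ln (ln b / t)" using t t0 by (auto simp: J_def)
  also have "J a = ln a" using t by (simp add: J_def)
  finally show ?thesis by simp
 qed
 also have "(\<Sum>n\<in>{a<..b}. (ln n - ln (real n - 1)) * (u n - 1)) <= K"
 proof -
  define G where "G = (%x. (ln (1 - 1 / x) + ln (1 - (v + 1) / x)) / 2)"
  have "(\<Sum>n\<in>{a<..b}. (ln n - ln (real n - 1)) * (u n - 1)) <= (\<Sum>n\<in>{a<..b}. G (real n) - G (real n - 1))"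
  proof (intro sum_mono)
   fix n assume n: "n : {a<..b}"
   have n1: "real n >= real a + 1" using n by auto
   have "(ln n - ln (real n - 1)) * (1 / (real n - 1)) <= ln (1 - 1 / n) - ln (1 - 1 / (real n - 1))"
   using n1 a by (intro ln_gap_weight) auto
   moreover have "(ln n - ln (real n - 1)) * ((v + 1) / (real n - (v + 1))) <= ln (1 - (v + 1) / n) - ln (1 - (v + 1) / (real n - 1))"
   using n1 v by (intro ln_gap_weight) auto
   moreover have "real n - (v + 1) = real n - 1 - v" by simp
   ultimately show "(ln n - ln (real n - 1)) * (u n - 1) <= G n - G (real n - 1)"
   unfolding u_def G_def by argo
  qed
  also have "\<dots> = G b - G a" using a by (intro sum_telescope_greaterThan)
  finally have "(\<Sum>n\<in>{a<..b}. (ln n - ln (real n - 1)) * (u n - 1)) <= G b - G a" .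
  moreover have "G b <= 0"
  proof -
   have "ln (1 - c / b) <= 0" if "0 <= c" "c < real b" for c :: real
   proof -
   have "0 < 1 - c / b" "0 <= c / b" using that by (auto simp: field_simps)
   thus ?thesis using ln_le_minus_one[of "1 - c / b"] by linarith
   qed
   from this[of 1] this[of "v + 1"] show ?thesis using v a unfolding G_def by (auto simp: add_nonpos_nonpos)
  qed
  ultimately show ?thesis unfolding G_def K_def by argo
 qed
 finally show ?thesis by (simp add: mult.commute)
qed

text \<open>The left side is largest where \<open>ln (Z / t) = (31/100) / v\<close>, and the right
  side is its value there. Tangent-line form: \<open>ln y <= y - 1\<close> with \<open>y\<close> the
  ratio of the optimal \<open>t\<close> to \<open>t\<close>.\<close>

lemma level_optimize:
 fixes t Z v :: real
 assumes "t > 0" "Z > 0" "v > 0"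
 shows "v * (t + t * ln (Z / t)) - 31/100 * t <= v * Z * exp (- (31/100) / v)"
proof -
 define y where "y = Z * exp (- (31/100) / v) / t"
 have y: "y > 0" using assms by (simp add: y_def)
 have "ln y = ln (Z / t) - (31/100) / v" using assms by (simp add: y_def ln_mult ln_div)
 moreover have "ln y <= y - 1" using y by (rule ln_le_minus_one)
 ultimately have "ln (Z / t) - (31/100) / v + 1 <= y" by simp
 hence "v * t * (ln (Z / t) - (31/100) / v + 1) <= v * t * y" using assms by (intro mult_left_mono) auto
 moreover have "v * t * y = v * Z * exp (- (31/100) / v)" using assms by (simp add: y_def)
 moreover have "v * t * (ln (Z / t) - (31/100) / v + 1) = v * (t + t * ln (Z / t)) - 31/100 * t"
  using assms by (simp add: field_simps)
 ultimately show ?thesis by simp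
qed

text \<open>With \<open>h = 0.265 / v\<close> it suffices that
  \<open>exp (2 * h) - 1 <= 2 * h * exp (1.16 * h)\<close>. The left side is
  \<open>2 * exp h\<close> times a hyperbolic sine, so to first order the surplus need only exceed
  0.265, half of 0.53; 0.31 leaves room for the second order up to \<open>h = 0.265\<close>.\<close>

lemma sieve_exponent_ge:
 assumes "v >= 1"
 shows "1 + 200/53 * (real v * exp (- (31/100) / real v)) <= sieve_exponent v"
proof -
 define h where "h = (265/1000) / real v"
 have h: "0 < h" "h <= 265/1000" using assms by (auto simp: h_def field_simps)
 have E: "exp (2 * h) > 1" using h by simp
 have up: "exp (2 * h) <= 1 + 2*h + 2*h^2 + 4/3 * h^3 + 2 * h^4"
 proof -
  have "exp (2 * h) <= (\<Sum>m<4. (2*h) ^ m / fact m) + 3 / fact 4 * (2*h) ^ 4"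
   using h by (intro exp_le_sum) auto
  thus ?thesis by (simp add: eval_nat_numeral algebra_simps)
 qed
 have lo: "1 + 116/100*h + (116/100*h)^2/2 <= exp (116/100*h)" using exp_ge_sum[of "116/100*h" 3] h by (simp add: eval_nat_numeral)
 have "exp (2*h) - 1 <= 2 * h * exp (116/100 * h)"
 proof -
  have "2 * h * (1 + 116/100*h + (116/100*h)^2/2) <= 2 * h * exp (116/100*h)" using lo h by (intro mult_left_mono) auto
  moreover have "1 + 2*h + 2*h^2 + 4/3 * h^3 + 2 * h^4 - 1 <= 2 * h * (1 + 116/100*h + (116/100*h)^2/2)"
  proof -
   have "h^2 * h <= h^2 * (265/1000)" "h^3 * h <= h^3 * (265/1000)" using h by (intro mult_left_mono; simp)+
   hence "h ^ 3 <= 265/1000 * h^2" "h ^ 4 <= 265/1000 * h^3" by (simp_all add: eval_nat_numeral mult_ac)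
   moreover have "h ^ 2 >= 0" "h ^ 3 >= 0" using h by simp_all
   moreover have "2 * h * (1 + 116/100*h + (116/100*h)^2/2) = 2 * h + 232/100 * h^2 + (116/100)^2 * h^3"
   by (simp add: eval_nat_numeral algebra_simps)
   ultimately show ?thesis by (simp add: power2_eq_square; linarith)
  qed
  ultimately show ?thesis using up by linarith
 qed
 also have "2 * h * exp (116/100 * h) = 2 * h / exp (- (116/100) * h)" by (simp add: exp_minus field_simps)
 also have "\<dots> <= 2 * h / exp (- (31/100) / real v)"
 proof (intro divide_left_mono)
  show "exp (- (31/100) / real v) <= exp (- (116/100) * h)" using assms by (simp add: h_def field_simps)
 qed (use h in auto)
 finally have "(exp (2*h) - 1) * exp (- (31/100) / real v) <= 2 * h" by (simp add: field_simps)
 hence "(1/h) * exp (- (31/100) / real v) <= 2 / (exp (2*h) - 1)" using h E by (simp add: field_simps)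
 moreover have "1 / h = 200/53 * real v" using assms by (simp add: h_def)
 moreover have "2 * h = 0.53 / real v" by (simp add: h_def)
 ultimately show ?thesis unfolding sieve_exponent_def by simp
qed

lemma sieve_weight_sum':
 fixes a b :: nat and v t h :: real
 assumes a: "3 <= a" "a <= b" and v: "1 <= v" "v + 1 < a" and t: "ln a <= t" "t <= ln b"
  and h: "!!n. a <= n ==> mertens n <= ln n + h"
  and P: "finite P" "!!p. p : P ==> prime p & a <= p & p <= b & 0 <= w p & w p <= v / (real p - 1)"
 shows "(\<Sum>p\<in>P. wt w p * min (ln p) t) - 31/100 * t
  <= v * ((1 + (1 / (real a - 1) + (v + 1) / (real a - 1 - v)) / 2) * (ln a + h - mertens (a - 1))
   - (ln (real a - 1) + ln (real a - 1 - v)) / 2) + v * ln b * exp (- (31/100) / v)"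
proof -
 let ?W = "1 + (1 / (real a - 1) + (v + 1) / (real a - 1 - v)) / 2"
 let ?K = "- (ln (1 - 1 / a) + ln (1 - (v + 1) / a)) / 2"
 let ?g = "%p. (1 / (real p - 1) + 1 / (real p - 1 - v)) / 2"
 have "ln (real a) > 0" using a by simp
 hence t0: "t > 0" using t by linarith
 \<comment> \<open>The lower limit of the integral merges with the correction \<open>K\<close> into
   an average of two logarithms. This is the negative term that has to outweigh the primes below
   \<open>a\<close>.\<close>
 have K: "?K - ln a = - (ln (real a - 1) + ln (real a - 1 - v)) / 2"
 proof -
  have "1 - 1 / a = (real a - 1) / a" "1 - (v + 1) / a = (real a - 1 - v) / a" using a by (auto simp: field_simps)
  hence "ln (1 - 1 / a) = ln (real a - 1) - ln a" "ln (1 - (v + 1) / a) = ln (real a - 1 - v) - ln a"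
   using a v by (auto simp: ln_div)
  thus ?thesis by argo
 qed
 have "(\<Sum>p\<in>P. wt w p * min (ln p) t) <= (\<Sum>p\<in>P. v * (?g p * min (ln p) t))"
 proof (intro sum_mono)
  fix p assume p: "p : P"
  have "wt w p <= v * ?g p" using P(2)[OF p] v by (intro wt_bound) auto
  moreover have "0 <= min (ln p) t" using P(2)[OF p] t0 by (auto simp: prime_gt_0_nat Suc_leI)
  ultimately have "wt w p * min (ln p) t <= v * ?g p * min (ln p) t" by (rule mult_right_mono)
  thus "wt w p * min (ln p) t <= v * (?g p * min (ln p) t)" by (simp add: mult_ac)
 qed
 also have "\<dots> = v * (\<Sum>p\<in>P. ?g p * min (ln p) t)" by (simp add: sum_distrib_left)
 also have "(\<Sum>p\<in>P. ?g p * min (ln p) t) <= (\<Sum>p | prime p & a <= p & p <= b. ?g p * min (ln p) t)"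
 proof (rule sum_mono2)
  show "finite {p. prime p & a <= p & p <= b}" by (rule finite_subset[of _ "{..b}"]) auto
  fix p assume "p : {p. prime p & a <= p & p <= b} - P"
  thus "0 <= ?g p * min (ln p) t" using v a t0
   by (intro mult_nonneg_nonneg divide_nonneg_nonneg add_nonneg_nonneg) (auto simp: prime_gt_0_nat Suc_leI)
 qed (use P in auto)
 also have "\<dots> <= ?W * (ln a + h - mertens (a - 1)) + ?K + (t - ln a) + t * ln (ln b / t)"
  by (rule sieve_weight_sum) (use assms in auto)
 finally have "(\<Sum>p\<in>P. wt w p * min (ln p) t) <= v * (?W * (ln a + h - mertens (a - 1)) + ?K + (t - ln a) + t * ln (ln b / t))"
  using v by (simp add: mult_left_mono)
 moreover have "v * (t + t * ln (ln b / t)) - 31/100 * t <= v * ln b * exp (- (31/100) / v)"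
  using t0 t v by (intro level_optimize) auto
 moreover have "v * (?W * (ln a + h - mertens (a - 1)) + ?K + (t - ln a) + t * ln (ln b / t)) =
  v * (?W * (ln a + h - mertens (a - 1)) - (ln (real a - 1) + ln (real a - 1 - v)) / 2) + v * (t + t * ln (ln b / t))"
 proof -
  have "?W * (ln a + h - mertens (a - 1)) + ?K + (t - ln a) + t * ln (ln b / t) =
   (?W * (ln a + h - mertens (a - 1)) - (ln (real a - 1) + ln (real a - 1 - v)) / 2) + (t + t * ln (ln b / t))"
   using K by argo
  thus ?thesis by (simp only: distrib_left)
 qed
 ultimately show ?thesis by argo
qed

section \<open>Admissible cut-offs for every dimension v\<close>

text \<open>Here \<open>D\<close> is a set of primes below the cut-off, as it arises from
  inclusion-exclusion, and \<open>ds\<close> a Brun list of primes from \<open>a\<close> on; the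
  level must bound their joint modulus. Only odd primes occur because \<open>card (R 2) < 1\<close>
  forces \<open>R 2\<close> to be empty of sieving effect.\<close>

definition level_ok :: "nat => nat => bool" where
 "level_ok v a \<longleftrightarrow> real v + 1 < real a & (\<forall>w P z D ds. finite P --> 1 <= z -->
  (\<forall>p\<in>P. prime p & odd p & p <= z) --> (\<forall>p\<in>P. a <= p --> 0 <= w p & w p <= real v / (real p - 1)) -->
  D \<subseteq> {p\<in>P. p < a} --> brun_ok w {p\<in>P. a <= p} (84/100) ds -->
  (\<Sum>p\<in>D. ln (real p)) + log_sum ds <= sieve_exponent v * ln (real z))"

text \<open>\<open>card\<close> settles lists with at most one entry, where every prime costs at
  most \<open>ln z\<close>. Longer lists obey \<open>brun_cost_start\<close>, and \<open>num\<close>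
  says that the constants left by the primes from \<open>a\<close> on are negative enough to pay for
  all odd primes below \<open>a\<close>.\<close>

lemma level_okI:
 assumes v: "1 <= v" and a: "3 <= a" "real v + 1 < real a"
  and h: "!!n. a <= n ==> mertens n <= ln n + h"
  and card: "real (card {p. prime p & odd p & p < a}) + 1 <= sieve_exponent v"
  and num: "(\<Sum>p | prime p & odd p & p < a. ln (real p)) + 200/53 * (real v * ((1 + (1 / (real a - 1) + (real v + 1) / (real a - 1 - v)) / 2) * (ln a + h - mertens (a - 1))
   - (ln (real a - 1) + ln (real a - 1 - v)) / 2)) <= 0"
 shows "level_ok v a"
 unfolding level_ok_def
proof (intro conjI allI impI)
 show "real v + 1 < real a" by fact
 fix w :: "nat => real" and P z D ds
 assume P: "finite P" "1 <= z" "\<forall>p\<in>P. prime p & odd p & p <= z" "\<forall>p\<in>P. a <= p --> 0 <= w p & w p <= real v / (real p - 1)"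
  and D: "D \<subseteq> {p\<in>P. p < a}" and ds: "brun_ok w {p\<in>P. a <= p} (84/100) ds"
 let ?Z = "ln (real z)" and ?P = "{p\<in>P. a <= p}" and ?Q = "{p. prime p & odd p & p < a}"
 have fQ: "finite ?Q" by (rule finite_subset[of _ "{..a}"]) auto
 have DQ: "D \<subseteq> ?Q" using D P by auto
 have Z: "0 <= ?Z" using P by simp
 have lnp: "ln (real p) <= ?Z" if "p : P" for p using P that by (auto simp: prime_gt_0_nat)
 have w1: "w p < 1" if "p : ?P" for p
 proof -
  have "real v / (real p - 1) < 1" using that a by (auto simp: field_simps)
  thus ?thesis using P that by force
 qed
 have Dsum: "(\<Sum>p\<in>D. ln (real p)) <= card ?Q * ?Z"
 proof -
  have "(\<Sum>p\<in>D. ln (real p)) <= (\<Sum>p\<in>D. ?Z)" using D by (intro sum_mono lnp) auto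
  also have "\<dots> = card D * ?Z" by simp
  also have "\<dots> <= card ?Q * ?Z" using card_mono[OF fQ DQ] Z by (intro mult_right_mono) auto
  finally show ?thesis .
 qed
 have short: "(\<Sum>p\<in>D. ln (real p)) + log_sum ds <= sieve_exponent v * ?Z" if "log_sum ds <= ?Z"
 proof -
  have "(\<Sum>p\<in>D. ln (real p)) + log_sum ds <= (card ?Q + 1) * ?Z" using that Dsum by (simp add: algebra_simps)
  also have "\<dots> <= sieve_exponent v * ?Z" using card Z by (intro mult_right_mono) auto
  finally show ?thesis .
 qed
 consider "ds = []" | p where "ds = [p]" | p q es where "ds = p # q # es" by (metis list.exhaust)
 thus "(\<Sum>p\<in>D. ln (real p)) + log_sum ds <= sieve_exponent v * ?Z"
 proof cases
  case 1
  thus ?thesis using short Z by (simp add: log_sum_def)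
 next
  case (2 p)
  thus ?thesis using short lnp ds by (simp add: log_sum_def)
 next
  case e: (3 p q es)
  have q: "q : ?P" "p : ?P" using ds unfolding e by auto
  have "log_sum ds <= ?Z + 200/53 * ((\<Sum>r\<in>?P. wt w r * min (ln (real r)) (ln (real q))) - (84/100 - 53/100) * ln (real q))"
   unfolding e by (rule brun_cost_start[OF ds[unfolded e]]) (use P w1 lnp in \<open>auto simp: prime_gt_0_nat Suc_leI\<close>)
  also have "(84/100 - 53/100) = (31/100::real)" by simp
  also have "(\<Sum>r\<in>?P. wt w r * min (ln (real r)) (ln (real q))) - 31/100 * ln (real q) \<le>
   real v * ((1 + (1 / (real a - 1) + (real v + 1) / (real a - 1 - v)) / 2) * (ln a + h - mertens (a - 1))
   - (ln (real a - 1) + ln (real a - 1 - v)) / 2) + v * ln z * exp (- (31/100) / v)" (is "_ <= ?A + ?B")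
  proof (rule sieve_weight_sum')
   show "a <= z" using q P by auto
   show "ln a <= ln q" "ln q <= ln z" using q a lnp by auto
  qed (use P a v h in auto)
  finally have "log_sum ds <= ?Z + 200/53 * (?A + ?B)" by simp
  moreover have "(\<Sum>p\<in>D. ln (real p)) <= (\<Sum>p\<in>?Q. ln (real p))"
   by (intro sum_mono2 fQ DQ) (auto simp: prime_gt_0_nat Suc_leI)
  ultimately have "(\<Sum>p\<in>D. ln (real p)) + log_sum ds <= ?Z + 200/53 * ?B" using num by argo
  also have "\<dots> = (1 + 200/53 * (real v * exp (- (31/100) / real v))) * ?Z" by (simp add: algebra_simps)
  also have "\<dots> <= sieve_exponent v * ?Z" using sieve_exponent_ge[OF v] Z by (rule mult_right_mono)
  finally show ?thesis .
 qed
qed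

lemma sieve_exponent_ge_linear: "v >= 1 ==> 200/53 * real v - 17/100 <= sieve_exponent v"
proof -
 assume v: "v >= 1"
 have "exp (- (31/100) / real v) >= 1 - (31/100) / real v" using exp_ge_add_one_self[of "- (31/100) / real v"] by simp
 hence "real v * exp (- (31/100) / real v) >= real v * (1 - (31/100) / real v)" by (intro mult_left_mono) auto
 also have "real v * (1 - (31/100) / real v) = real v - 31/100" using v by (simp add: right_diff_distrib)
 finally show ?thesis using sieve_exponent_ge[OF v] by simp
qed

lemma odd_primes_below_31: "{p. prime p & odd p & p < (31::nat)} = {3,5,7,11,13,17,19,23,29}"
proof -
 have e: "{p. prime p & odd p & p < (31::nat)} = Set.filter odd {p. prime p & p <= 30}" by auto
 show ?thesis unfolding e primes_below_30 by code_simp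
qed

lemma odd_primes_below_13: "{p. prime p & odd p & p < (13::nat)} = {3,5,7,11}"
proof -
 have e: "{p. prime p & odd p & p < (13::nat)} = Set.filter (%p. p < 13) {p. prime p & odd p & p < 31}" by auto
 show ?thesis unfolding e odd_primes_below_31 by code_simp
qed

lemma level_2: "level_ok 2 13"
proof (rule level_okI[where h = "14/100"])
 show "real (card {p. prime p & odd p & p < (13::nat)}) + 1 <= sieve_exponent 2"
  unfolding odd_primes_below_13 using sieve_exponent_ge_linear[of 2] by simp
 have "ln (10::real) = ln 2 + ln 5" using ln_mult[of 2 5] by simp
 moreover have "ln (12::real) = 2 * ln 2 + ln 3" using ln_mult[of "2^2" 3] ln_realpow[of 2 2] by simp
 ultimately show "(\<Sum>p | prime p & odd p & p < (13::nat). ln (real p)) + 200/53 * (real 2 * ((1 + (1 / (real 13 - 1) + (real 2 + 1) / (real 13 - 1 - real 2)) / 2) * (ln (real 13) + 14/100 - mertens (13 - 1))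
   - (ln (real 13 - 1) + ln (real 13 - 1 - real 2)) / 2)) <= 0"
  unfolding odd_primes_below_13 using mertens_12 ln2_bounds ln3_bounds ln5_bounds ln7_bounds ln11_bounds ln13_bounds by (simp; argo)
qed (use mertens_upper_13 in auto)

lemma level_3_20:
 assumes v: "3 <= v" "v <= 20"
 shows "level_ok v 31"
proof (rule level_okI[where h = "5/100"])
 show "real (card {p. prime p & odd p & p < (31::nat)}) + 1 <= sieve_exponent v"
  unfolding odd_primes_below_31 using sieve_exponent_ge_linear[of v] v by simp
 have 30: "ln (30::real) = ln 2 + ln 3 + ln 5" using ln_mult[of "2*3" 5] ln_mult[of 2 3] by simp
 have 25: "ln (25::real) = 2 * ln 5" using ln_realpow[of 5 2] by simp
 have 15: "ln (15::real) = ln 3 + ln 5" using ln_mult[of 3 5] by simp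
 have 10: "ln (10::real) = ln 2 + ln 5" using ln_mult[of 2 5] by simp
 define c where "c = ln (31::real) + 5/100 - mertens 30"
 have c: "c <= 11845/10000" "0 <= c" using mertens_30 mertens_upper_31[of 31] ln31_bounds mertens_diff[of 31]
  by (auto simp: c_def split: if_splits)
 have ths: "(\<Sum>p | prime p & odd p & p < (31::nat). ln (real p)) <= 21902/1000"
  unfolding odd_primes_below_31 using ln3_bounds ln5_bounds ln7_bounds ln11_bounds ln13_bounds
   ln17_bounds ln19_bounds ln23_bounds ln29_bounds by simp
 \<comment> \<open>On a range \<open>l <= v <= u\<close> the singular weight and the logarithm are
   taken at \<open>u\<close>, the worst case, while the resulting gain \<open>e\<close> is
   multiplied only by \<open>l\<close>.\<close>
 have key: "(\<Sum>p | prime p & odd p & p < (31::nat). ln (real p)) + 200/53 * (real v * ((1 + (1 / (real 31 - 1) + (real v + 1) / (real 31 - 1 - real v)) / 2) * (ln (real 31) + 5/100 - mertens (31 - 1))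
   - (ln (real 31 - 1) + ln (real 31 - 1 - real v)) / 2)) <= 0"
  if b: "l <= v" "v <= u" "u < 30" "L <= ln (real (30 - u))" and e: "21902/1000 <= 200/53 * (real l * e)" "0 <= e"
   and n: "(1 + (1 / 30 + (real u + 1) / (30 - real u)) / 2) * (11845/10000) + e <= (34007/10000 + L) / 2" for l u :: nat and L e :: real
 proof -
  define x where "x = (real v + 1) / (30 - real v)"
  define y where "y = (real u + 1) / (30 - real u)"
  define W where "W = 1 + (1 / 30 + x) / 2"
  have "x <= y" "0 <= x" using b unfolding x_def y_def by (auto intro!: frac_le)
  hence "W * c <= (1 + (1 / 30 + y) / 2) * (11845/10000)"
   using c unfolding W_def by (intro mult_mono) argo+
  moreover have "L <= ln (30 - real v)" using b by (intro order_trans[OF b(4)]) (auto simp: of_nat_diff)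
  moreover have "34007/10000 <= ln (30::real)" unfolding 30 using ln2_bounds ln3_bounds ln5_bounds by simp
  ultimately have "W * c - (ln 30 + ln (30 - real v)) / 2 <= - e"
   using n unfolding y_def[symmetric] by argo
  hence "real v * (W * c - (ln 30 + ln (30 - real v)) / 2) <= real v * (- e)"
   by (intro mult_left_mono) auto
  moreover have "real l * e <= real v * e" using b e by (intro mult_right_mono) auto
  ultimately have 1: "200/53 * (real v * (W * c - (ln 30 + ln (30 - real v)) / 2)) <= - (21902/1000)"
   using e by argo
  have 2: "real 31 - 1 = 30" "31 - 1 = (30::nat)" "ln (real 31) = ln 31" by simp_all
  show ?thesis using ths 1 unfolding 2 W_def x_def c_def by argo
 qed
 \<comment> \<open>Three ranges, because \<open>(v + 1) / (30 - v)\<close> grows quickly as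
   \<open>v\<close> approaches 30.\<close>
 consider "v <= 5" | "6 <= v" "v <= 15" | "16 <= v" by linarith
 thus "(\<Sum>p | prime p & odd p & p < (31::nat). ln (real p)) + 200/53 * (real v * ((1 + (1 / (real 31 - 1) + (real v + 1) / (real 31 - 1 - real v)) / 2) * (ln (real 31) + 5/100 - mertens (31 - 1))
   - (ln (real 31 - 1) + ln (real 31 - 1 - real v)) / 2)) <= 0"
 proof cases
  case 1
  show ?thesis by (rule key[of 3 5 "32184/10000" "1940/1000"]) (use v 1 25 ln5_bounds in auto)
 next
  case 2
  show ?thesis by (rule key[of 6 15 "27076/10000" "1000/1000"]) (use v 2 15 ln3_bounds ln5_bounds in auto)
 next
  case 3
  show ?thesis by (rule key[of 16 20 "23023/10000" "380/1000"]) (use v 3 10 ln2_bounds ln5_bounds in auto)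
 qed
qed (use v mertens_upper_31 in auto)

text \<open>A cut-off proportional to \<open>v\<close> keeps the weights away from 1 uniformly. By
  Chebyshev the primes below \<open>4 * v\<close> cost at most \<open>5.5456 * v\<close>, and the
  integral gains at least \<open>200/53 * 1.62 * v\<close>, which is more.\<close>

lemma level_ge_21:
 assumes v: "21 <= v"
 shows "level_ok v (4 * v)"
proof (rule level_okI[where h = "5/100"])
 let ?Q = "{p. prime p & odd p & p < 4 * v}"
 have "card ?Q <= card ((%k. 2 * k + 1) ` {..<2 * v})"
 proof (intro card_mono)
  show "?Q \<subseteq> (%k. 2 * k + 1) ` {..<2 * v}"
  proof
   fix p assume "p : ?Q"
   then obtain k where "p = 2 * k + 1" "p < 4 * v" by (auto elim!: oddE)
   thus "p : (%k. 2 * k + 1) ` {..<2 * v}" by auto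
  qed
 qed auto
 also have "\<dots> <= 2 * v" using card_image_le[of "{..<2 * v}" "%k. 2 * k + 1"] by simp
 finally show "real (card ?Q) + 1 <= sieve_exponent v" using sieve_exponent_ge_linear[of v] v by simp
 have v': "real v >= 21" using v by simp
 have "(\<Sum>p\<in>?Q. ln (real p)) <= theta (4 * v)" unfolding theta_def
  by (intro sum_mono2) (auto simp: prime_gt_0_nat Suc_leI)
 also have "\<dots> <= (4 * v) * ln 4" by (rule theta_le)
 also have "\<dots> = real v * (8 * ln 2)" using ln_realpow[of 2 2] by simp
 also have "\<dots> <= real v * (55456/10000)" using ln2_bounds by (intro mult_left_mono) auto
 finally have 1: "(\<Sum>p\<in>?Q. ln (real p)) <= real v * (55456/10000)" .
 define c where "c = ln (real (4 * v)) + 5/100 - mertens (4 * v - 1)"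
 have c: "c <= 22221/10000"
 proof -
  have "mertens (4 * v - 1) >= ln (real (4 * v - 1)) - 216/100" using v by (intro mertens_lower) auto
  moreover have "ln (real (4 * v)) - ln (real (4 * v - 1)) <= 1 / 83"
  proof -
   have "ln (real (4 * v)) - ln (real (4 * v - 1)) = ln (4 * real v / (4 * real v - 1))" using v' by (simp add: of_nat_diff ln_div)
   also have "\<dots> <= 4 * real v / (4 * real v - 1) - 1" using v' by (intro ln_le_minus_one) auto
   also have "\<dots> <= 1 / 83" using v' by (simp add: field_simps)
   finally show ?thesis .
  qed
  ultimately show ?thesis by (simp add: c_def)
 qed
 define W where "W = 1 + (1 / (4 * real v - 1) + (real v + 1) / (4 * real v - 1 - v)) / 2"
 have W: "0 <= W" "W <= 11835/10000"
 proof -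
  have "1 / (4 * real v - 1) <= 1 / 83" "(real v + 1) / (4 * real v - 1 - v) <= 22 / 62"
   using v' by (auto simp: field_simps)
  thus "W <= 11835/10000" unfolding W_def by argo
  show "0 <= W" using v' by (auto simp: W_def intro!: add_nonneg_nonneg divide_nonneg_nonneg)
 qed
 have "W * c <= W * (22221/10000)" using W c by (intro mult_left_mono)
 also have "\<dots> <= 11835/10000 * (22221/10000)" using W by (intro mult_right_mono) auto
 finally have Wc: "W * c <= 263/100" by simp
 have "ln (80::real) = 4 * ln 2 + ln 5" using ln_mult[of "2^4" 5] ln_realpow[of 2 4] by simp
 moreover have "ln (62::real) = ln 2 + ln 31" using ln_mult[of 2 31] by simp
 moreover have "ln (80::real) <= ln (4 * real v - 1)" "ln (62::real) <= ln (4 * real v - 1 - v)" using v' by simp_all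
 ultimately have "W * c - (ln (4 * real v - 1) + ln (4 * real v - 1 - v)) / 2 <= - (162/100)"
  using Wc ln2_bounds ln5_bounds ln31_bounds by argo
 hence "real v * (W * c - (ln (4 * real v - 1) + ln (4 * real v - 1 - v)) / 2) <= real v * (- (162/100))"
  by (intro mult_left_mono) auto
 hence "(\<Sum>p\<in>?Q. ln (real p)) + 200/53 * (real v * (W * c - (ln (4 * real v - 1) + ln (4 * real v - 1 - v)) / 2)) <= 0"
  using 1 v' by linarith
 thus "(\<Sum>p\<in>?Q. ln (real p)) + 200/53 * (real v * ((1 + (1 / (real (4 * v) - 1) + (real v + 1) / (real (4 * v) - 1 - v)) / 2) * (ln (real (4 * v)) + 5/100 - mertens (4 * v - 1))
   - (ln (real (4 * v) - 1) + ln (real (4 * v) - 1 - v)) / 2)) <= 0"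
  by (simp add: W_def c_def)
qed (use v mertens_upper_31 in auto)

lemma wt_bound_1:
 assumes "0 <= w q" "w q <= 1 / (real q - 1)" "(3::nat) <= q" "(1 / (real q - 1) + 1 / (real q - 2)) / 2 * L <= B" "ln (real q) <= L"
 shows "wt w q * ln (real q) <= B"
proof -
 have "wt w q <= 1 * ((1 / (real q - 1) + 1 / (real q - 1 - 1)) / 2)" using assms by (intro wt_bound) auto
 hence "wt w q * ln (real q) <= ((1 / (real q - 1) + 1 / (real q - 2)) / 2) * L"
  using assms by (intro mult_mono) auto
 thus ?thesis using assms by linarith
qed

text \<open>Dimension 1 does not go through \<open>level_okI\<close>: the weights of the primes 7 to
  29 are bounded one by one and only the primes from 31 on are integrated. Since
  \<open>sieve_exponent 1 >= 3.859\<close>, beyond one prime of size \<open>z\<close> a budget of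
  \<open>2.859 * ln z\<close> remains, against \<open>ln 15 <= 2.7086\<close> for the primes 3 and
  5.\<close>

lemma level_1: "level_ok 1 7"
 unfolding level_ok_def
proof (intro conjI allI impI)
 fix w :: "nat => real" and P0 z D ds
 assume P0: "finite P0" "1 <= z" "\<forall>p\<in>P0. prime p & odd p & p <= z" "\<forall>p\<in>P0. 7 <= p --> 0 <= w p & w p <= real 1 / (real p - 1)"
  and D: "D \<subseteq> {p\<in>P0. p < 7}" and ds: "brun_ok w {p\<in>P0. 7 <= p} (84/100) ds"
 define P where "P = {p\<in>P0. 7 <= p}"
 have P: "finite P" "p : P ==> prime p & odd p & 7 <= p & p <= z & 0 <= w p & w p <= 1 / (real p - 1)" for p
  using P0 by (auto simp: P_def)
 let ?Z = "ln (real z)"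
 define s where "s = sieve_exponent 1"
 have Z: "0 <= ?Z" using P0 by simp
 have lnp: "ln (real p) <= ?Z" if "p : P" for p using P(2)[OF that] by auto
 have w1: "w p < 1" if "p : P" for p
 proof -
  have "1 / (real p - 1) < 1" using P(2)[OF that] by auto
  thus ?thesis using P(2)[OF that] by linarith
 qed
 have "exp (53/100::real) <= 16995/10000" using exp_le_sum[of "53/100" 6] by (simp add: eval_nat_numeral)
 hence "2 / (16995/10000 - 1) <= 2 / (exp (53/100::real) - 1)" by (intro divide_left_mono) auto
 hence s: "3859/1000 <= s" by (simp add: s_def sieve_exponent_def)
 have e31: "exp (- (31/100) / real 1) <= 7337/10000"
 proof -
  have "exp (31/100::real) >= 136301/100000" using exp_ge_sum[of "31/100" 4] by (simp add: eval_nat_numeral)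
  thus ?thesis by (simp add: exp_minus field_simps)
 qed
 have dec: "p = 3 \<or> p = 5" if "prime p" "odd p" "p < 7" for p :: nat
 proof -
  have "p : {p. prime p & odd p & p < 31}" using that by auto
  thus ?thesis unfolding odd_primes_below_31 using that by auto
 qed
 have D35: "D \<subseteq> {3, 5}"
 proof
  fix p assume "p : D"
  thus "p : {3, 5}" using D P0 dec[of p] by auto
 qed
 have Dl: "(\<Sum>p\<in>D. ln (real p)) <= 27086/10000"
 proof -
  have "(\<Sum>p\<in>D. ln (real p)) <= (\<Sum>p\<in>{3,5}. ln (real p))" using D35 by (intro sum_mono2) auto
  thus ?thesis using ln3_bounds ln5_bounds by simp
 qed
 have DZ: "(\<Sum>p\<in>D. ln (real p)) <= 2 * ?Z"
 proof -
  have "(\<Sum>p\<in>D. ln (real p)) <= (\<Sum>p\<in>D. ?Z)" using D P0 by (intro sum_mono) (auto simp: prime_gt_0_nat)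
  also have "\<dots> = card D * ?Z" by simp
  also have "\<dots> <= 2 * ?Z"
   using card_mono[OF _ D35] Z by (intro mult_right_mono) auto
  finally show ?thesis .
 qed
 have short: "(\<Sum>p\<in>D. ln (real p)) + log_sum ds <= s * ?Z" if "log_sum ds <= ?Z"
 proof -
  have "3 * ?Z <= s * ?Z" using s Z by (intro mult_right_mono) auto
  thus ?thesis using that DZ by linarith
 qed
 consider "ds = []" | p where "ds = [p]" | p q es where "ds = p # q # es" by (metis list.exhaust)
 hence "(\<Sum>p\<in>D. ln (real p)) + log_sum ds <= s * ?Z"
 proof cases
  case 1
  thus ?thesis using short Z by (simp add: log_sum_def)
 next
  case (2 p)
  thus ?thesis using short lnp ds by (simp add: log_sum_def P_def)
 next
  case e: (3 p q es)
  have pq: "p : P" "q : P" "q < p" using ds unfolding e P_def by auto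
  define t where "t = ln (real q)"
  have t0: "t > 0" using P(2)[OF pq(2)] by (simp add: t_def)
  define P1 where "P1 = {p\<in>P. p < 31}"
  define P2 where "P2 = {p\<in>P. 31 <= p}"
  have PP: "P = P1 \<union> P2" "P1 \<inter> P2 = {}" "finite P1" "finite P2" using P by (auto simp: P1_def P2_def)
  have wn: "0 <= wt w r" if "r : P" for r using P(2)[OF that] w1[OF that] by (intro wt_nonneg) auto
  have cost: "log_sum ds <= ?Z + 200/53 * ((\<Sum>r\<in>P. wt w r * min (ln (real r)) t) - (84/100 - 53/100) * t)"
   unfolding e t_def
  proof (rule brun_cost_start)
   show "brun_ok w P (84/100) (p # q # es)" using ds unfolding e P_def .
   show "0 <= w r & w r < 1 & 1 <= r & ln (real r) <= ?Z" if "r : P" for r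
   using P(2)[OF that] w1[OF that] lnp[OF that] by simp
  qed (rule P(1))
  define S1 where "S1 = (\<Sum>r\<in>P1. wt w r * min (ln (real r)) t)"
  define S2 where "S2 = (%t. \<Sum>r\<in>P2. wt w r * min (ln (real r)) t)"
  have "(\<Sum>r\<in>P. wt w r * min (ln (real r)) t) = S1 + S2 t"
   unfolding S1_def S2_def using PP by (simp add: sum.union_disjoint)
  hence cost: "log_sum ds <= ?Z + 200/53 * (S1 + S2 t - 31/100 * t)" using cost by simp
  have S1le: "S1 <= (\<Sum>r\<in>P1. wt w r * ln (real r))" unfolding S1_def
   using wn by (intro sum_mono mult_left_mono) (auto simp: P1_def)
  \<comment> \<open>Bounds for \<open>wt w r * ln r\<close> from \<open>wt_bound_1\<close>; over all
    seven primes they add up to 1.4539.\<close>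
  define B :: "nat => real" where "B = (%r. if r = 7 then 3569/10000 else if r = 11 then 2532/10000 else if r = 13 then 2236/10000
   else if r = 17 then 1831/10000 else if r = 19 then 1685/10000 else if r = 23 then 1460/10000 else 1226/10000)"
  have P1set: "P1 \<subseteq> {7,11,13,17,19,23,29}"
  proof
   fix r assume "r : P1"
   hence r: "r : P" "r < 31" by (auto simp: P1_def)
   have "r : {p. prime p & odd p & p < 31}" using P(2)[OF r(1)] r by auto
   thus "r : {7,11,13,17,19,23,29}" unfolding odd_primes_below_31 using P(2)[OF r(1)] by auto
  qed
  have trm: "wt w r * ln (real r) <= B r" if "r : P1" for r
  proof -
   have r: "0 <= w r" "w r <= 1 / (real r - 1)" using that P(2)[of r] by (auto simp: P1_def)
   have "r : {7,11,13,17,19,23,29}" using that P1set by auto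
   then consider "r = 7" | "r = 11" | "r = 13" | "r = 17" | "r = 19" | "r = 23" | "r = 29" by auto
   thus ?thesis
   proof cases
   case 1 thus ?thesis using r ln7_bounds by (intro wt_bound_1[of w r "19462/10000"]) (simp_all add: B_def)
   next
   case 2 thus ?thesis using r ln11_bounds by (intro wt_bound_1[of w r "23983/10000"]) (simp_all add: B_def)
   next
   case 3 thus ?thesis using r ln13_bounds by (intro wt_bound_1[of w r "25654/10000"]) (simp_all add: B_def)
   next
   case 4 thus ?thesis using r ln17_bounds by (intro wt_bound_1[of w r "28337/10000"]) (simp_all add: B_def)
   next
   case 5 thus ?thesis using r ln19_bounds by (intro wt_bound_1[of w r "2945/1000"]) (simp_all add: B_def)
   next
   case 6 thus ?thesis using r ln23_bounds by (intro wt_bound_1[of w r "3136/1000"]) (simp_all add: B_def)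
   next
   case 7 thus ?thesis using r ln29_bounds by (intro wt_bound_1[of w r "33678/10000"]) (simp_all add: B_def)
   qed
  qed
  have Bsum: "S1 <= sum B A" if "P1 \<subseteq> A" "finite A" for A
  proof -
   have "S1 <= sum B P1" using S1le trm by (meson order_trans sum_mono)
   also have "\<dots> <= sum B A" using that by (intro sum_mono2) (auto simp: B_def)
   finally show ?thesis .
  qed
  have S1a: "S1 <= 14539/10000" using Bsum[OF P1set] by (simp add: B_def)
  \<comment> \<open>A list with two distinct primes from 7 on guarantees
    \<open>ln z >= ln 11\<close>, which the smallest case needs.\<close>
  have p11: "p >= 11"
  proof (rule ccontr)
   assume h: "\<not> 11 <= p"
   hence "p : P1" "q : P1" using pq by (auto simp: P1_def)
   hence "p = 7" "q = 7" using P1set h pq(3) by auto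
   thus False using pq by simp
  qed
  have big: "(\<Sum>p\<in>D. ln (real p)) + log_sum ds <= s * ?Z"
   if X: "log_sum ds <= ?Z + 200/53 * X" "27086/10000 + 200/53 * X <= 2859/1000 * l" "l <= ?Z" for X l
  proof -
   have "(3859/1000) * ?Z <= s * ?Z" using s Z by (intro mult_right_mono) auto
   thus ?thesis using X Dl by argo
  qed
  show ?thesis
  proof (cases "P2 = {}")
   case True
   have "S2 t = 0" using True by (simp add: S2_def)
   hence c1: "log_sum ds <= ?Z + 200/53 * S1" using cost t0 by argo
   show ?thesis
   proof (cases "P1 \<subseteq> {7,11,13,17}")
   case True
   have "S1 <= 10168/10000" using Bsum[OF True] by (simp add: B_def)
   hence "log_sum ds <= ?Z + 200/53 * (10168/10000)" using c1 by argo
   moreover have "ln (11::real) <= ?Z" using p11 lnp[OF pq(1)] by (intro order_trans[OF _ lnp[OF pq(1)]]) auto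
   ultimately show ?thesis using ln11_bounds by (intro big[of "10168/10000" "ln 11"]) auto
   next
   case False
   then obtain r where r: "r : P1" "r \<notin> {7,11,13,17}" by blast
   hence "r >= 19" using P1set by auto
   hence "ln (19::real) <= ?Z" using r by (intro order_trans[OF _ lnp[of r]]) (auto simp: P1_def)
   moreover have "log_sum ds <= ?Z + 200/53 * (14539/10000)" using c1 S1a by argo
   ultimately show ?thesis using ln19_bounds by (intro big[of "14539/10000" "ln 19"]) auto
   qed
  next
   case False
   then obtain r where r: "r : P2" by blast
   have Z31: "ln (31::real) <= ?Z" using r by (intro order_trans[OF _ lnp[of r]]) (auto simp: P2_def)
   have z31: "31 <= z" using r P(2)[of r] by (auto simp: P2_def)
   define b where "b = 200/53 * (?Z * exp (- (31/100) / real 1))"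
   \<comment> \<open>With \<open>v = 1\<close> and \<open>a = 31\<close> the constants of
     \<open>sieve_weight_sum'\<close> evaluate to at most -2.138.\<close>
   define C where "C = ?Z * exp (- (31/100) / real 1) - 21380/10000"
   have c: "ln (31::real) + 5/100 - mertens 30 <= 11845/10000" using mertens_30 ln31_bounds by simp
   have l30: "ln (30::real) >= 34007/10000" using ln_mult[of "2*3" 5] ln_mult[of 2 3] ln2_bounds ln3_bounds ln5_bounds by simp
   have S2le: "S2 u - 31/100 * u <= C" if u: "ln 31 <= u" "u <= ?Z" for u
   proof -
   have "S2 u - 31/100 * u <= 1 * ((1 + (1 / (real 31 - 1) + (1 + 1) / (real 31 - 1 - 1)) / 2) * (ln (real 31) + 5/100 - mertens (31 - 1))
   - (ln (real 31 - 1) + ln (real 31 - 1 - 1)) / 2) + 1 * ?Z * exp (- (31/100) / 1)"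
   unfolding S2_def
   by (rule sieve_weight_sum') (use u z31 P mertens_upper_31 in \<open>auto simp: P2_def\<close>)
   also have "\<dots> <= C"
   using c l30 ln29_bounds unfolding C_def by (simp; argo)
   finally show ?thesis .
   qed
   have "S2 t - 31/100 * t <= max 0 C"
   proof (cases "ln 31 <= t")
   case True
   thus ?thesis using S2le[of t] lnp[OF pq(2)] by (simp add: t_def)
   next
   case False
   have l31: "ln (31::real) > 0" by simp
   \<comment> \<open>Below \<open>ln 31\<close> every minimum equals \<open>t\<close>, so
     \<open>S2\<close> is linear there and the bound at \<open>ln 31\<close> rescales.\<close>
   have "S2 t = t / ln 31 * S2 (ln 31)" unfolding S2_def sum_distrib_left
   proof (intro sum.cong refl)
   fix r assume "r : P2"
   hence "ln (31::real) <= ln (real r)" by (auto simp: P2_def)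
   thus "wt w r * min (ln (real r)) t = t / ln 31 * (wt w r * min (ln (real r)) (ln 31))"
   using False by (simp add: min_def)
   qed
   hence "S2 t - 31/100 * t = t / ln 31 * (S2 (ln 31) - 31/100 * ln 31)" using l31 by (simp add: field_simps)
   also have "\<dots> <= t / ln 31 * max 0 C"
   using S2le[of "ln 31"] Z31 t0 l31 by (intro mult_left_mono) auto
   also have "\<dots> <= 1 * max 0 C" using False t0 l31 by (intro mult_right_mono) auto
   finally show ?thesis by simp
   qed
   hence c2: "log_sum ds <= ?Z + 200/53 * (14539/10000 + max 0 C)" using cost S1a by argo
   show ?thesis
   proof (cases "C <= 0")
   case True
   hence "log_sum ds <= ?Z + 200/53 * (14539/10000)" using c2 by simp
   thus ?thesis using Z31 ln31_bounds by (intro big[of "14539/10000" "ln 31"]) auto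
   next
   case False
   have "?Z * exp (- (31/100) / real 1) <= ?Z * (7337/10000)" using e31 Z by (intro mult_left_mono)
   hence "14539/10000 + max 0 C <= ?Z * (7337/10000) - 6841/10000" using False by (simp add: C_def)
   hence "log_sum ds <= ?Z + 200/53 * (?Z * (7337/10000) - 6841/10000)" using c2 by argo
   moreover have "27086/10000 + 200/53 * (?Z * (7337/10000) - 6841/10000) <= 2859/1000 * ?Z" using Z31 ln31_bounds by argo
   ultimately show ?thesis by (intro big[of "?Z * (7337/10000) - 6841/10000" ?Z]) simp_all
   qed
  qed
 qed
 thus "(\<Sum>p\<in>D. ln (real p)) + log_sum ds <= sieve_exponent 1 * ?Z" by (simp add: s_def)
qed simp

theorem level_exists: "1 <= v ==> \<exists>a\<ge>2. level_ok v a"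
proof -
 assume "1 <= v"
 then consider "v = 1" | "v = 2" | "3 <= v" "v <= 20" | "21 <= v" by linarith
 thus ?thesis
 proof cases
  case 1 thus ?thesis using level_1 by (intro exI[of _ 7]) auto
 next
  case 2 thus ?thesis using level_2 by (intro exI[of _ 13]) auto
 next
  case 3 thus ?thesis using level_3_20 by (intro exI[of _ 31]) auto
 next
  case 4 thus ?thesis using level_ge_21 by (intro exI[of _ "4 * v"]) auto
 qed
qed

section \<open>Counting in residue classes and prime lists\<close>

lemma card_mod_class:
 assumes "0 < (d::nat)" "r < d"
 shows "\<bar>real (card {n\<in>{1..k}. n mod d = r}) - real k / d\<bar> <= 1"
proof (cases "r <= k")
 case False
 hence e: "{n\<in>{1..k}. n mod d = r} = {}" using assms by (auto simp: mod_less_divisor)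
 have "real k / d <= 1" using False assms by simp
 thus ?thesis unfolding e by simp
next
 case True
 define q where "q = (k - r) div d"
 define z where "z = (if r = 0 then 1 else 0::nat)"
 have im: "{n\<in>{1..k}. n mod d = r} = (%j. j * d + r) ` {z..q}"
 proof (intro equalityI subsetI)
  fix n assume n: "n : {n\<in>{1..k}. n mod d = r}"
  hence e: "n = (n div d) * d + r" by (metis (mono_tags, lifting) div_mult_mod_eq mem_Collect_eq)
  have "n div d <= q" unfolding q_def
  proof -
   have "(n div d) * d <= k - r" using n e by (metis (no_types, lifting) add_le_imp_le_diff atLeastAtMost_iff mem_Collect_eq)
   thus "n div d <= (k - r) div d" using assms by (simp add: less_eq_div_iff_mult_less_eq)
  qed
  moreover have "z <= n div d"
  proof (cases "r = 0")
   case True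
   hence "n div d ~= 0" using n e by (metis (no_types, lifting) add_0 atLeastAtMost_iff mem_Collect_eq mult_zero_left not_one_le_zero)
   thus ?thesis by (simp add: z_def)
  qed (simp add: z_def)
  ultimately show "n : (%j. j * d + r) ` {z..q}" using e by auto
 next
  fix n assume "n : (%j. j * d + r) ` {z..q}"
  then obtain j where j: "n = j * d + r" "z <= j" "j <= q" unfolding image_iff by (meson atLeastAtMost_iff)
  have "j * d <= k - r" using j(3) assms unfolding q_def by (simp add: less_eq_div_iff_mult_less_eq)
  hence "n <= k" using j True by simp
  moreover have "1 <= n" using j assms by (cases "r = 0") (auto simp: z_def)
  moreover have "n mod d = r" using j assms by simp
  ultimately show "n : {n\<in>{1..k}. n mod d = r}" by auto
 qed
 have "inj_on (%j. j * d + r) {z..q}" using assms by (auto simp: inj_on_def)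
 hence c: "card {n\<in>{1..k}. n mod d = r} = Suc q - z" unfolding im by (subst card_image) auto
 have q: "real q * d <= real k - r" "real k - r < (real q + 1) * d"
 proof -
  have "q * d <= k - r" unfolding q_def by (simp add: times_div_less_eq_dividend)
  hence "real (q * d) <= real (k - r)" by (simp only: of_nat_le_iff)
  thus "real q * d <= real k - r" using True by (simp add: of_nat_diff)
  have "k - r < (q + 1) * d" unfolding q_def using assms by (metis add.commute dividend_less_times_div mult.commute mult_Suc plus_1_eq_Suc)
  hence "real (k - r) < real ((q + 1) * d)" by (simp only: of_nat_less_iff)
  thus "real k - r < (real q + 1) * d" using True by (simp add: of_nat_diff distrib_right)
 qed
 have d: "real d > 0" "real r < d" using assms by auto
 show ?thesis
 proof (cases "r = 0")
  case True
  have "real q <= k / d" "k / d < real q + 1" using q d True by (auto simp: field_simps)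
  thus ?thesis unfolding c using True by (simp add: z_def abs_le_iff)
 next
  case False
  have "real q <= k / d" "k / d < real q + 2" using q d by (auto simp: field_simps)
  thus ?thesis unfolding c using False by (simp add: z_def abs_le_iff)
 qed
qed

lemma crt_card:
 assumes "finite L" "!!l. l : L ==> prime l" "!!l. l : L ==> H l \<subseteq> {..<(l::nat)}"
 shows "card {r. r < \<Prod>L & (\<forall>l\<in>L. r mod l : H l)} = (\<Prod>l\<in>L. card (H l))"
proof -
 let ?A = "{r. r < \<Prod>L & (\<forall>l\<in>L. r mod l : H l)}"
 have cop: "\<forall>i\<in>L. \<forall>j\<in>L. i ~= j --> coprime i j" using assms(2) by (auto intro: primes_coprime)
 have nz: "\<forall>i\<in>L. i ~= 0" using assms(2) by (auto dest: prime_gt_0_nat)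
 have U: "\<exists>!x. x < (\<Prod>i\<in>L. i) & (\<forall>i\<in>L. [x = u i] (mod i))" for u
  by (rule chinese_remainder_unique_nat[OF assms(1) nz cop])
 have "bij_betw (%r. \<lambda>l\<in>L. r mod l) ?A (PiE L H)"
 proof (rule bij_betwI')
  fix x y assume x: "x : ?A" and y: "y : ?A"
  show "((\<lambda>l\<in>L. x mod l) = (\<lambda>l\<in>L. y mod l)) = (x = y)"
  proof
   assume e: "(\<lambda>l\<in>L. x mod l) = (\<lambda>l\<in>L. y mod l)"
   have "x mod l = y mod l" if "l : L" for l using fun_cong[OF e, of l] that by simp
   hence "\<forall>l\<in>L. [x = y] (mod l)" by (simp add: unique_euclidean_semiring_class.cong_def)
   thus "x = y" using U[of "%_. y"] x y by auto
  qed simp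
 next
  fix x assume "x : ?A"
  thus "(\<lambda>l\<in>L. x mod l) : PiE L H" by auto
 next
  fix g assume g: "g : PiE L H"
  obtain x where x: "x < \<Prod>L" "\<forall>i\<in>L. [x = g i] (mod i)" using U[of g] by auto
  have e: "x mod l = g l" if "l : L" for l
  proof -
   have "g l : H l" using g that by auto
   hence "g l < l" using assms(3)[OF that] by auto
   thus ?thesis using x that by (auto simp: unique_euclidean_semiring_class.cong_def)
  qed
  have "(\<lambda>l\<in>L. x mod l) = g" using g e by (auto simp: PiE_def extensional_def fun_eq_iff)
  moreover have "x : ?A" using x e g by auto
  ultimately show "\<exists>x\<in>?A. g = (\<lambda>l\<in>L. x mod l)" by auto
 qed
 hence "card ?A = card (PiE L H)" by (rule bij_betw_same_card)
 thus ?thesis using assms(1) by (simp add: card_PiE)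
qed

text \<open>Each admissible class modulo the product contributes an error of at most 1, and
  \<open>crt_card\<close> counts the classes.\<close>

lemma crt_count:
 assumes "finite L" "!!l. l : L ==> prime l" "!!l. l : L ==> H l \<subseteq> {..<(l::nat)}"
 shows "\<bar>real (card {n\<in>{1..k}. \<forall>l\<in>L. n mod l : H l}) - real k * (\<Prod>l\<in>L. real (card (H l)) / l)\<bar> <= (\<Prod>l\<in>L. real (card (H l)))"
proof -
 let ?A = "{r. r < \<Prod>L & (\<forall>l\<in>L. r mod l : H l)}" and ?d = "\<Prod>L"
 have d: "?d > 0" using assms(2) by (intro prod_pos) (auto dest: prime_gt_0_nat)
 have fA: "finite ?A" by (rule finite_subset[of _ "{..<?d}"]) auto
 have mm: "n mod ?d mod l = n mod l" if "l : L" for n l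
  using assms(1) that by (intro mod_mod_cancel) (auto intro: dvd_prodI)
 have set: "{n\<in>{1..k}. \<forall>l\<in>L. n mod l : H l} = (\<Union>r\<in>?A. {n\<in>{1..k}. n mod ?d = r})"
  using d mm by auto
 have "card {n\<in>{1..k}. \<forall>l\<in>L. n mod l : H l} = (\<Sum>r\<in>?A. card {n\<in>{1..k}. n mod ?d = r})"
  unfolding set by (rule card_UN_disjoint) (use fA in auto)
 hence "real (card {n\<in>{1..k}. \<forall>l\<in>L. n mod l : H l}) - real k / ?d * card ?A = (\<Sum>r\<in>?A. real (card {n\<in>{1..k}. n mod ?d = r}) - real k / ?d)"
  by (simp add: sum_subtractf)
 also have "\<bar>\<dots>\<bar> <= (\<Sum>r\<in>?A. 1)"
  using d by (intro order_trans[OF sum_abs] sum_mono card_mod_class) auto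
 also have "\<dots> = (\<Prod>l\<in>L. real (card (H l)))" using crt_card[OF assms] by simp
 also have "real k / ?d * card ?A = real k * (\<Prod>l\<in>L. real (card (H l)) / l)"
  using crt_card[OF assms] by (simp add: prod_dividef)
 finally show ?thesis .
qed

lemma desc_prime_list:
 assumes "sorted_wrt (>) ds" "\<forall>p\<in>set ds. prime (p::nat)"
 shows "distinct ds" "prod_list ds = \<Prod>(set ds)" "prime_factors (prod_list ds) = set ds" "squarefree (prod_list ds)"
proof -
 show d: "distinct ds" using assms(1) by (induction ds) auto
 show p: "prod_list ds = \<Prod>(set ds)" using d prod.distinct_set_conv_list[of ds "%x. x"] by simp
 have "prime_factorization (\<Prod>(set ds)) = (\<Sum>p\<in>set ds. prime_factorization p)"
  by (rule prime_factorization_prod) (use assms in \<open>auto dest: prime_gt_0_nat\<close>)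
 also have "\<dots> = (\<Sum>p\<in>set ds. {#p#})" using assms(2) by (intro sum.cong) (auto simp: prime_factorization_prime)
 finally show "prime_factors (prod_list ds) = set ds" unfolding p by (simp add: set_mset_sum)
 show "squarefree (prod_list ds)" unfolding p
  using assms(2) by (intro squarefree_prod_coprime) (auto intro: primes_coprime squarefree_prime)
qed

lemma desc_list_unique:
 assumes "sorted_wrt (>) ds" "sorted_wrt (>) (es :: nat list)" "set ds = set es"
 shows "ds = es"
proof -
 have "sorted_wrt (<) (rev ds)" "sorted_wrt (<) (rev es)" using assms by (auto simp: sorted_wrt_rev)
 hence "rev ds = rev es" using assms(3) by (intro strict_sorted_equal) auto
 thus ?thesis by simp
qed

text \<open>Descending lists of primes are recovered from their products, so summing over Brun lists
  never repeats a modulus.\<close>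

lemma inj_prod_list_desc:
 "inj_on prod_list {ds. sorted_wrt (>) ds & (\<forall>p\<in>set ds. prime (p::nat))}"
proof (rule inj_onI)
 fix ds es :: "nat list"
 assume a: "ds : {ds. sorted_wrt (>) ds & (\<forall>p\<in>set ds. prime p)}" "es : {ds. sorted_wrt (>) ds & (\<forall>p\<in>set ds. prime p)}" "prod_list ds = prod_list es"
 hence "set ds = set es" using desc_prime_list(3)[of ds] desc_prime_list(3)[of es] by auto
 thus "ds = es" using a by (intro desc_list_unique) auto
qed

lemma sum_prime_recip_le:
 assumes "2 <= N"
 shows "(\<Sum>p | prime p & real p <= N. 1 / real p) <= ln (ln N) + 9"
proof -
 have split: "{p. prime p & real p <= N} = insert 2 {p. prime p & 2 < real p & real p <= N}"
  using assms prime_ge_2_nat by (auto simp: order_le_less)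
 have "(\<Sum>p | prime p & real p <= N. 1 / real p) = 1/2 + (\<Sum>p | prime p & 2 < real p & real p <= N. 1 / real p)"
  unfolding split by (subst sum.insert) (auto intro: finite_subset[OF _ finite_primes_real[of N]])
 also have "\<dots> <= 1/2 + (ln (ln N / ln 2) + 8)" using prime_recip_upper[of 2 N] assms by simp
 also have "ln (ln N / ln 2) = ln (ln N) - ln (ln 2)" using assms by (simp add: ln_div)
 finally have "(\<Sum>p | prime p & real p <= N. 1 / real p) <= 1/2 + (ln (ln N) - ln (ln 2) + 8)" .
 moreover have "ln (ln (2::real)) >= - (1/2)"
 proof -
  have "1 - 1 / ln (2::real) <= ln (ln 2)" using ln_le_minus_one[of "1 / ln (2::real)"] by (simp add: ln_div)
  moreover have "1 / ln (2::real) <= 3/2" using ln2_bounds by (simp add: field_simps)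
  ultimately show ?thesis by linarith
 qed
 ultimately show ?thesis by linarith
qed

text \<open>\<open>ln_powr_bound\<close> with exponent \<open>a / k\<close>, raised to the
  \<open>k\<close>-th power; \<open>max 1 k\<close> only serves \<open>k = 0\<close>.\<close>

lemma ln_power_le:
 assumes "1 <= x" "0 < a"
 shows "ln x ^ k <= (max 1 k / a) ^ k * x powr a"
proof (cases "k = 0")
 case True
 thus ?thesis using assms by (simp add: ge_one_powr_ge_zero)
next
 case False
 have "ln x <= x powr (a / k) / (a / k)" using assms False by (intro ln_powr_bound) auto
 hence "ln x ^ k <= (x powr (a / k) / (a / k)) ^ k" using assms by (intro power_mono) auto
 also have "\<dots> = (k / a) ^ k * (x powr (a / k)) ^ k" by (simp add: power_divide power_mult_distrib)
 also have "(x powr (a / k)) ^ k = x powr a" using assms False by (simp add: powr_realpow[symmetric] powr_powr)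
 finally show ?thesis using False by (simp add: max_def)
qed

lemma wt_le_2w:
 assumes "0 <= w p" "w p <= 1/2"
 shows "wt w p <= 2 * w p"
proof -
 have "1 - 2 * w p <= 1 - w p - w p * (1 - 2 * w p)" using assms mult_nonneg_nonneg[of "w p" "1 - 2 * w p"] by (simp add: algebra_simps)
 have "ln (1 / (1 - w p)) <= 1 / (1 - w p) - 1" using assms by (intro ln_le_minus_one) auto
 also have "\<dots> = w p / (1 - w p)" using assms by (simp add: field_simps)
 also have "\<dots> <= w p / (1/2)" using assms by (intro divide_left_mono) auto
 finally show ?thesis using assms by (simp add: wt_def ln_div)
qed

section \<open>Sieve bound for the prime cofactor\<close>

text \<open>The classes modulo \<open>l\<close> forbidden for a prime \<open>q > l\<close>: 0
  because \<open>q\<close> is prime, the others because \<open>m * q\<close> would land in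
  \<open>R l\<close>. When \<open>l\<close> divides \<open>m\<close> only 0 is left, which is the
  origin of the factor \<open>exp (\<Sum>p\<in>prime_factors m. v / p)\<close>.\<close>

definition twist_class :: "(nat => nat set) => nat => nat => nat set" where
 "twist_class R m l = {r. r < l & (r = 0 \<or> (\<not> l dvd m & (m * r) mod l : R l))}"

lemma finite_twist_class [simp]: "finite (twist_class R m l)"
 by (rule finite_subset[of _ "{..<l}"]) (auto simp: twist_class_def)

text \<open>Multiplication by \<open>m\<close> permutes the residues modulo \<open>l\<close> unless
  \<open>l\<close> divides \<open>m\<close>, and 0 is never in \<open>R l\<close>.\<close>

lemma card_twist_class:
 assumes "prime l" "R l \<subseteq> totatives l"
 shows "\<not> l dvd m ==> card (twist_class R m l) = 1 + card (R l)"
  and "card (twist_class R m l) <= 1 + card (R l)" "1 <= card (twist_class R m l)"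
proof -
 have l: "l > 1" using assms prime_gt_1_nat by auto
 show 1: "card (twist_class R m l) = 1 + card (R l)" if m: "\<not> l dvd m"
 proof -
  define \<phi> where "\<phi> = (%r. (m * r) mod l)"
  have cop: "coprime m l" using m assms(1) by (metis coprime_commute prime_imp_coprime)
  have inj: "inj_on \<phi> {..<l}"
  proof (rule inj_onI)
   fix x y assume "x : {..<l}" "y : {..<l}" "\<phi> x = \<phi> y"
   hence "[m * x = m * y] (mod l)" by (simp add: \<phi>_def unique_euclidean_semiring_class.cong_def)
   hence "[x = y] (mod l)" using cop by (simp add: cong_mult_lcancel_nat)
   thus "x = y" using \<open>x : {..<l}\<close> \<open>y : {..<l}\<close> by (simp add: unique_euclidean_semiring_class.cong_def)
  qed
  have surj: "\<phi> ` {..<l} = {..<l}"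
   using inj l by (intro endo_inj_surj) (auto simp: \<phi>_def)
  have Rl: "R l \<subseteq> {..<l}" "0 \<notin> R l"
  proof -
   show "0 \<notin> R l" using assms(2) by (meson subsetD zero_not_in_totatives)
   show "R l \<subseteq> {..<l}"
   proof
   fix t assume "t : R l"
   hence "t : totatives l" using assms(2) by (rule subsetD[rotated])
   thus "t : {..<l}" using l by (simp add: totatives_less)
   qed
  qed
  have "\<phi> ` {r\<in>{..<l}. \<phi> r : R l} = R l"
  proof (intro equalityI subsetI)
   fix t assume t: "t : R l"
   hence "t : \<phi> ` {..<l}" unfolding surj using Rl by auto
   thus "t : \<phi> ` {r\<in>{..<l}. \<phi> r : R l}" using t by auto
  qed auto
  moreover have "inj_on \<phi> {r\<in>{..<l}. \<phi> r : R l}" by (rule inj_on_subset[OF inj]) auto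
  ultimately have "card {r\<in>{..<l}. \<phi> r : R l} = card (R l)" by (metis card_image)
  moreover have "twist_class R m l = insert 0 {r\<in>{..<l}. \<phi> r : R l}" using m l by (auto simp: twist_class_def \<phi>_def)
  moreover have "0 \<notin> {r\<in>{..<l}. \<phi> r : R l}" using Rl by (simp add: \<phi>_def)
  ultimately show ?thesis by simp
 qed
 show "card (twist_class R m l) <= 1 + card (R l)"
 proof (cases "l dvd m")
  case True
  hence "twist_class R m l = {0}" using l by (auto simp: twist_class_def)
  thus ?thesis by simp
 qed (use 1 in auto)
 have "0 : twist_class R m l" using l by (auto simp: twist_class_def)
 hence "card {0::nat} <= card (twist_class R m l)" by (intro card_mono) auto
 thus "1 <= card (twist_class R m l)" by simp
qed

text \<open>The sieve has level \<open>T = N powr (1/3)\<close>: at most \<open>T\<close> moduli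
  with error at most \<open>2 * T\<close> each. The cost of a list is bounded by
  \<open>8 * (v + 2) * (ln u + 4) = ln N / 4 + 32 * (v + 2)\<close>, and 384 is 12 times 32, so this
  is at most \<open>ln N / 3\<close>. Primes below \<open>2 * v + 5\<close> are left aside to ensure
  \<open>w p <= 1/2\<close>.\<close>

lemma prime_sieve_large:
 fixes N :: real and v m :: nat
 assumes R: "!!p. prime p ==> R p \<subseteq> totatives p & card (R p) <= v" and m: "m >= 1"
  and N: "ln N >= 384 * (real v + 2)" "N >= 2"
  and P: "P = {p. prime p & 2 * v + 5 <= p & real p <= N powr (1 / (32 * (real v + 2)))}"
 shows "real (card {q. prime q & real q <= N & (\<forall>p. prime p --> (m * q) mod p \<notin> R p)})
  <= 2 * N * (\<Prod>p\<in>P. 1 - real (card (twist_class R m p)) / p) + 4 * N powr (2/3)"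
proof -
 define u where "u = N powr (1 / (32 * (real v + 2)))"
 define T where "T = N powr (1/3)"
 define k where "k = nat \<lfloor>N\<rfloor>"
 define w where "w = (%p. real (card (twist_class R m p)) / real p)"
 define hit where "hit = (%l n. n mod l : twist_class R m l)"
 have k: "real k <= N" "N < real k + 1" using N by (auto simp: k_def)
 have lnu: "ln u = ln N / (32 * (real v + 2))" using N by (simp add: u_def ln_powr)
 have u1: "1 <= u" unfolding u_def using N by (intro ge_one_powr_ge_zero) auto
 have uT: "u <= T" unfolding u_def T_def using N by (intro powr_mono) (auto simp: field_simps)
 have T1: "1 <= T" unfolding T_def using N by (intro ge_one_powr_ge_zero) auto
 have TT: "T * T = N powr (2/3)" unfolding T_def using N by (simp flip: powr_add)
 have fP: "finite P" unfolding P by (rule finite_subset[OF _ finite_primes_real[of u]]) (auto simp: u_def)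
 have Pp: "prime p" "2 * v + 5 <= p" "real p <= u" if "p : P" for p using that by (auto simp: P u_def)
 have w: "0 <= w p" "w p <= (real v + 1) / p" "w p <= 1/2" if "p : P" for p
 proof -
  have c: "card (twist_class R m p) <= v + 1" using card_twist_class(2)[of p R m] R[of p] Pp[OF that] by linarith
  show "0 <= w p" by (simp add: w_def)
  have "real (card (twist_class R m p)) <= real v + 1" using c by linarith
  thus 1: "w p <= (real v + 1) / p" unfolding w_def by (rule divide_right_mono) simp
  have "(real v + 1) / p <= 1/2" using Pp(2)[OF that] by (simp add: field_simps)
  thus "w p <= 1/2" using 1 by linarith
 qed
 \<comment> \<open>A prime \<open>q\<close> up to \<open>u\<close> may be removed by its own class
   0, so these are counted trivially.\<close>
 have sub: "{q. prime q & real q <= N & (\<forall>p. prime p --> (m * q) mod p \<notin> R p)} \<subseteq>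
  {1..nat \<lfloor>u\<rfloor>} \<union> {n\<in>{1..k}. \<forall>p\<in>P. \<not> hit p n}"
 proof
  fix q assume q: "q : {q. prime q & real q <= N & (\<forall>p. prime p --> (m * q) mod p \<notin> R p)}"
  hence q1: "1 <= q" "q <= k" using prime_ge_1_nat[of q] N real_le_iff_nat_floor[of N q] by (auto simp: k_def)
  show "q : {1..nat \<lfloor>u\<rfloor>} \<union> {n\<in>{1..k}. \<forall>p\<in>P. \<not> hit p n}"
  proof (cases "real q <= u")
   case True
   thus ?thesis using q1 u1 real_le_iff_nat_floor[of u q] by auto
  next
   case False
   have "\<not> hit p q" if p: "p : P" for p
   proof
   assume h: "hit p q"
   have "q mod p ~= 0"
   proof
   assume "q mod p = 0"
   hence "p = q" using q Pp(1)[OF p] primes_dvd_imp_eq by blast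
   thus False using False Pp(3)[OF p] by simp
   qed
   hence "(m * (q mod p)) mod p : R p" using h by (auto simp: hit_def twist_class_def)
   hence "(m * q) mod p : R p" by (simp add: mod_mult_right_eq)
   thus False using q Pp(1)[OF p] by auto
   qed
   thus ?thesis using q1 by auto
  qed
 qed
 have "real (card {q. prime q & real q <= N & (\<forall>p. prime p --> (m * q) mod p \<notin> R p)}) \<le>
  real (card ({1..nat \<lfloor>u\<rfloor>} \<union> {n\<in>{1..k}. \<forall>p\<in>P. \<not> hit p n}))"
  unfolding of_nat_le_iff by (intro card_mono sub) auto
 also have "\<dots> <= real (card {1..nat \<lfloor>u\<rfloor>}) + real (card {n\<in>{1..k}. \<forall>p\<in>P. \<not> hit p n})"
  unfolding of_nat_add[symmetric] of_nat_le_iff by (rule card_Un_le)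
 also have "real (card {1..nat \<lfloor>u\<rfloor>}) <= u" using u1 by simp
 also have "real (card {n\<in>{1..k}. \<forall>p\<in>P. \<not> hit p n}) = sift (%_. 1) hit {1..k} P" by (simp add: sift_def)
 also have "\<dots> <= 2 * N * (\<Prod>p\<in>P. 1 - w p) + \<bar>mass (%_. 1) hit {1..k} [] - N\<bar> +
  (\<Sum>p\<in>P. \<Sum>ds | brun_ok w (below P p) (53/100 - depth w P p) ds.
   \<bar>mass (%_. 1) hit {1..k} (p # ds) - N * prod_list (map w (p # ds))\<bar>)"
 proof (rule brun_upper[OF fP])
  show "0 <= w p & w p < 1" if "p : P" for p using w[OF that] by simp
 qed (use N in auto)
 also have "\<bar>mass (%_. 1) hit {1..k} [] - N\<bar> <= 1"
 proof -
  have "mass (%_. 1) hit {1..k} [] = real (card {1..k})" unfolding mass_def by (simp del: atLeastAtMost_iff)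
  thus ?thesis using k by simp
 qed
 also have "(\<Sum>p\<in>P. \<Sum>ds | brun_ok w (below P p) (53/100 - depth w P p) ds.
   \<bar>mass (%_. 1) hit {1..k} (p # ds) - N * prod_list (map w (p # ds))\<bar>) <= 2 * T * T"
 proof -
  let ?B = "%p. {ds. brun_ok w (below P p) (53/100 - depth w P p) ds}"
  let ?I = "Sigma P ?B"
  have fI: "finite ?I" using fP by (intro finite_SigmaI finite_brun_ok) auto
  have list: "sorted_wrt (>) (p # ds)" "set (p # ds) \<subseteq> P" if "(p, ds) : ?I" for p ds
   using brun_ok_sorted[of w "below P p" "53/100 - depth w P p" ds] that by (auto simp: below_def)
  have prm: "\<forall>q\<in>set (p # ds). prime q" if "(p, ds) : ?I" for p ds using list(2)[OF that] Pp(1) by blast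
  have T: "real (prod_list (p # ds)) <= T" if i: "(p, ds) : ?I" for p ds
  proof -
   have "log_sum (p # ds) <= 2 * ln u + 200/53 * (\<Sum>r\<in>P. wt w r * ln (real r))"
   proof (rule brun_cost_upper)
   show "0 <= w r & w r < 1 & 1 <= r & ln (real r) <= ln u" if "r : P" for r
   using w[OF that] Pp[OF that] u1 by (auto simp: prime_gt_0_nat Suc_leI)
   qed (use i fP in auto)
   also have "(\<Sum>r\<in>P. wt w r * ln (real r)) <= (\<Sum>r\<in>P. 2 * (real v + 1) * (ln (real r) / r))"
   proof (intro sum_mono)
   fix r assume r: "r : P"
   have "wt w r <= 2 * ((real v + 1) / r)" using wt_le_2w[of w r] w[OF r] by linarith
   hence "wt w r * ln (real r) <= 2 * ((real v + 1) / r) * ln (real r)" using Pp(1)[OF r] by (intro mult_right_mono) (auto simp: prime_gt_0_nat Suc_leI)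
   thus "wt w r * ln (real r) <= 2 * (real v + 1) * (ln (real r) / r)" by simp
   qed
   also have "\<dots> = 2 * (real v + 1) * (\<Sum>r\<in>P. ln (real r) / r)" by (simp add: sum_distrib_left)
   also have "(\<Sum>r\<in>P. ln (real r) / r) <= (\<Sum>p | prime p & real p <= u. ln (real p) / p)"
   by (intro sum_mono2) (auto simp: P u_def prime_gt_0_nat Suc_leI)
   also have "\<dots> <= ln u + 4" by (rule prime_log_sum_le[OF u1])
   finally have "log_sum (p # ds) <= 2 * ln u + 200/53 * (2 * (real v + 1) * (ln u + 4))" by simp
   also have "\<dots> <= 8 * (real v + 2) * (ln u + 4)"
   proof -
   have "0 <= (8 - 400/53) * ((real v + 1) * (ln u + 4)) + 6 * ln u + 32" using u1 by (intro add_nonneg_nonneg mult_nonneg_nonneg) auto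
   thus ?thesis by (simp add: algebra_simps; argo)
   qed
   also have "\<dots> = ln N / 4 + 32 * (real v + 2)" unfolding lnu by (simp add: field_simps)
   also have "\<dots> <= ln N / 3" using N by simp
   also have "\<dots> = ln T" using N by (simp add: T_def ln_powr)
   finally have "ln (real (prod_list (p # ds))) <= ln T"
   using log_sum_eq[of "p # ds"] prm[OF i] by (simp add: prime_gt_0_nat)
   moreover have "0 < real (prod_list (p # ds))" unfolding desc_prime_list(2)[OF list(1)[OF i] prm[OF i]] of_nat_prod
   using prm[OF i] by (intro prod_pos) (auto simp: prime_gt_0_nat)
   ultimately show ?thesis using T1 by (simp add: ln_le_cancel_iff)
  qed
  have "(\<Sum>p\<in>P. \<Sum>ds\<in>?B p. \<bar>mass (%_. 1) hit {1..k} (p # ds) - N * prod_list (map w (p # ds))\<bar>) =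
   (\<Sum>(p,ds)\<in>?I. \<bar>mass (%_. 1) hit {1..k} (p # ds) - N * prod_list (map w (p # ds))\<bar>)"
   using fP by (subst sum.Sigma) (auto intro: finite_brun_ok)
  also have "\<dots> <= (\<Sum>(p,ds)\<in>?I. 2 * T)"
  proof (intro sum_mono, clarify)
   fix p ds assume "p : P" "brun_ok w (below P p) (53/100 - depth w P p) ds"
   hence i: "(p, ds) : ?I" by simp
   let ?L = "set (p # ds)"
   have d: "distinct (p # ds)" using desc_prime_list(1)[OF list(1)[OF i] prm[OF i]] .
   have 1: "mass (%_. 1) hit {1..k} (p # ds) = real (card {n\<in>{1..k}. \<forall>l\<in>?L. n mod l : twist_class R m l})"
   by (simp add: mass_def hit_def)
   have 2: "prod_list (map w (p # ds)) = (\<Prod>l\<in>?L. real (card (twist_class R m l)) / l)"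
   using prod.distinct_set_conv_list[OF d, of w] by (simp add: w_def)
   have "\<bar>real (card {n\<in>{1..k}. \<forall>l\<in>?L. n mod l : twist_class R m l}) - real k * (\<Prod>l\<in>?L. real (card (twist_class R m l)) / l)\<bar>
   <= (\<Prod>l\<in>?L. real (card (twist_class R m l)))"
   by (rule crt_count) (use prm[OF i] in \<open>auto simp: twist_class_def\<close>)
   also have "\<dots> <= (\<Prod>l\<in>?L. real l)"
   proof (intro prod_mono conjI)
   fix l assume "l : ?L"
   have "card (twist_class R m l) <= card {..<l}" by (intro card_mono) (auto simp: twist_class_def)
   thus "real (card (twist_class R m l)) <= real l" by simp
   qed auto
   also have "\<dots> = real (prod_list (p # ds))" unfolding desc_prime_list(2)[OF list(1)[OF i] prm[OF i]] by simp
   also have "\<dots> <= T" by (rule T[OF i])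
   finally have a: "\<bar>mass (%_. 1) hit {1..k} (p # ds) - real k * prod_list (map w (p # ds))\<bar> <= T" unfolding 1 2 .
   have "0 <= prod_list (map w (p # ds))" "prod_list (map w (p # ds)) <= 1"
   proof -
   have w01: "0 <= w l" "w l <= 1" if "l : ?L" for l using w[OF subsetD[OF list(2)[OF i] that]] by linarith+
   have e: "prod_list (map w (p # ds)) = (\<Prod>l\<in>?L. w l)" using prod.distinct_set_conv_list[OF d, of w] by simp
   show "0 <= prod_list (map w (p # ds))" unfolding e using w01 by (intro prod_nonneg) auto
   show "prod_list (map w (p # ds)) <= 1" unfolding e using w01 by (intro prod_le_1) auto
   qed
   hence "\<bar>(real k - N) * prod_list (map w (p # ds))\<bar> <= 1 * 1"
   unfolding abs_mult using k by (intro mult_mono) auto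
   hence "\<bar>mass (%_. 1) hit {1..k} (p # ds) - N * prod_list (map w (p # ds))\<bar> <= T + 1"
   using a by (simp add: algebra_simps abs_le_iff)
   thus "\<bar>mass (%_. 1) hit {1..k} (p # ds) - N * prod_list (map w (p # ds))\<bar> <= 2 * T" using T1 by linarith
  qed
  also have "\<dots> = real (card ?I) * (2 * T)" by (simp add: case_prod_unfold)
  also have "real (card ?I) <= T"
  proof -
   have "inj_on (%(p,ds). prod_list (p # ds)) ?I"
   proof (rule inj_onI, clarify)
   fix p ds q es assume "p : P" "brun_ok w (below P p) (53/100 - depth w P p) ds"
   "q : P" "brun_ok w (below P q) (53/100 - depth w P q) es" and e: "prod_list (p # ds) = prod_list (q # es)"
   hence i: "(p, ds) : ?I" "(q, es) : ?I" by auto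
   have "p # ds = q # es"
   proof (rule inj_onD[OF inj_prod_list_desc e])
   show "p # ds : {ds. sorted_wrt (>) ds & (\<forall>p\<in>set ds. prime p)}"
   using list(1)[OF i(1)] prm[OF i(1)] unfolding mem_Collect_eq by blast
   show "q # es : {ds. sorted_wrt (>) ds & (\<forall>p\<in>set ds. prime p)}"
   using list(1)[OF i(2)] prm[OF i(2)] unfolding mem_Collect_eq by blast
   qed
   thus "p = q & ds = es" by simp
   qed
   moreover have "(%(p,ds). prod_list (p # ds)) ` ?I \<subseteq> {1..nat \<lfloor>T\<rfloor>}"
   proof clarify
   fix p ds assume "p : P" "brun_ok w (below P p) (53/100 - depth w P p) ds"
   hence i: "(p, ds) : ?I" by auto
   have "0 < prod_list (p # ds)" unfolding desc_prime_list(2)[OF list(1)[OF i] prm[OF i]]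
   using prm[OF i] by (intro prod_pos) (auto simp: prime_gt_0_nat)
   hence "1 <= prod_list (p # ds)" by (simp only: Suc_le_eq One_nat_def)
   moreover have "prod_list (p # ds) <= nat \<lfloor>T\<rfloor>" by (rule le_nat_floor[OF T[OF i]])
   ultimately show "prod_list (p # ds) : {1..nat \<lfloor>T\<rfloor>}" unfolding atLeastAtMost_iff by (rule conjI)
   qed
   ultimately have "card ?I <= card {1..nat \<lfloor>T\<rfloor>}" by (rule card_inj_on_le) (rule finite_atLeastAtMost)
   hence "real (card ?I) <= real (nat \<lfloor>T\<rfloor>)" by simp
   also have "\<dots> <= T" using T1 by simp
   finally show ?thesis .
  qed
  finally show ?thesis using T1 by (simp add: mult_ac)
 qed
 finally have "real (card {q. prime q & real q <= N & (\<forall>p. prime p --> (m * q) mod p \<notin> R p)}) \<le>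
  u + (2 * N * (\<Prod>p\<in>P. 1 - w p) + 1 + 2 * T * T)" by simp
 also have "T * 1 <= T * T" using T1 by (intro mult_left_mono) auto
 hence "u + (2 * N * (\<Prod>p\<in>P. 1 - w p) + 1 + 2 * T * T) <= 2 * N * (\<Prod>p\<in>P. 1 - w p) + 4 * (T * T)"
  using uT T1 by linarith
 finally show ?thesis unfolding TT w_def .
qed

lemma prime_mean_alt: "prime_mean h x UNIV = (\<Sum>p | prime p & real p <= x. h p / real p)"
 by (simp add: prime_mean_def)

lemma prime_mean_count_le:
 assumes "!!p. prime p ==> card (R p) <= v" "2 <= N"
 shows "sieve_mean R N <= v * (ln (ln N) + 9)"
proof -
 have "sieve_mean R N <= (\<Sum>p | prime p & real p <= N. v * (1 / real p))"
  unfolding prime_mean_alt using assms(1) by (intro sum_mono) (auto intro!: divide_right_mono)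
 also have "\<dots> = v * (\<Sum>p | prime p & real p <= N. 1 / real p)" by (simp add: sum_distrib_left)
 also have "\<dots> <= v * (ln (ln N) + 9)" using sum_prime_recip_le[OF assms(2)] by (intro mult_left_mono) auto
 finally show ?thesis .
qed

lemma sum_Un_le:
 fixes f :: "'a => real"
 assumes "finite A" "finite B" "!!x. 0 <= f x"
 shows "sum f (A \<union> B) <= sum f A + sum f B"
proof -
 have "sum f (A \<union> B) + sum f (A \<inter> B) = sum f A + sum f B" using assms by (intro sum.union_inter)
 moreover have "0 <= sum f (A \<inter> B)" using assms by (intro sum_nonneg) auto
 ultimately show ?thesis by linarith
qed

lemma sum_recip_small: "(\<Sum>p | prime p & p < k. 1 / real p) <= real k"
proof -
 have "(\<Sum>p | prime p & p < k. 1 / real p) <= (\<Sum>p | prime p & p < k. 1)"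
  by (intro sum_mono) (auto simp: prime_gt_0_nat Suc_leI field_simps)
 also have "\<dots> <= real (card {..<k})" unfolding sum_constant mult_1_right of_nat_le_iff
  by (intro card_mono) auto
 finally show ?thesis by simp
qed

text \<open>Passing from \<open>P\<close> to all primes up to \<open>N\<close> changes the exponent
  by a constant: the primes below \<open>2 * v + 5\<close> are finitely many, and those between
  \<open>u\<close> and \<open>N\<close> have bounded reciprocal sum because
  \<open>ln N / ln u\<close> is the constant \<open>c\<close>. The class 0 supplies
  \<open>1 / ln N\<close>, the other classes \<open>sieve_mean\<close>.\<close>

lemma prime_sieve_product:
 fixes N :: real and v m :: nat
 assumes R: "!!p. prime p ==> R p \<subseteq> totatives p & card (R p) <= v" and m: "m >= 1"
  and N: "ln N >= 384 * (real v + 2)" "N >= 2"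
  and P: "P = {p. prime p & 2 * v + 5 <= p & real p <= N powr (1 / (32 * (real v + 2)))}"
 shows "(\<Prod>p\<in>P. 1 - real (card (twist_class R m p)) / p) \<le>
  exp (4 + real (2 * v + 5) + ln (32 * (real v + 2)) + real v * (real (2 * v + 5) + ln (32 * (real v + 2)) + 8)) / ln N *
  exp (- sieve_mean R N + (\<Sum>p\<in>prime_factors m. real v / p))"
proof -
 define c where "c = 32 * (real v + 2)"
 define u where "u = N powr (1 / c)"
 define K where "K = real (2 * v + 5)"
 let ?w = "%p. real (card (twist_class R m p)) / real p"
 let ?M = "sieve_mean R N"
 have c: "c >= 64" by (simp add: c_def)
 have lnu: "ln u = ln N / c" using N by (simp add: u_def ln_powr)
 have lnN: "ln N > 0" using N by simp
 have u2: "2 <= u"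
 proof -
  have "ln 2 * c <= 1 * c" using c ln2_bounds by (intro mult_right_mono) auto
  also have "\<dots> <= ln N" using N(1) by (simp add: c_def)
  finally have "ln 2 <= ln u" unfolding lnu using c by (simp add: field_simps)
  moreover have "u > 0" using N by (simp add: u_def)
  ultimately show ?thesis by simp
 qed
 have uN: "u <= N"
 proof -
  have "u <= N powr 1" unfolding u_def using N c by (intro powr_mono) (auto simp: field_simps)
  thus ?thesis using N by simp
 qed
 have fP: "finite P" unfolding P by (rule finite_subset[OF _ finite_primes_real[of u]]) (auto simp: u_def c_def)
 have Pp: "prime p" "2 * v + 5 <= p" "real p <= u" if "p : P" for p using that by (auto simp: P u_def c_def)
 have w1: "?w p <= 1" if "p : P" for p
 proof -
  have "card (twist_class R m p) <= card {..<p}" by (intro card_mono) (auto simp: twist_class_def)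
  thus ?thesis using Pp(1)[OF that] by (simp add: prime_gt_0_nat)
 qed
 have "(\<Prod>p\<in>P. 1 - ?w p) <= (\<Prod>p\<in>P. exp (- ?w p))"
 proof (intro prod_mono conjI)
  fix p assume "p : P"
  show "0 <= 1 - ?w p" using w1[OF \<open>p : P\<close>] by simp
  show "1 - ?w p <= exp (- ?w p)" using exp_ge_add_one_self[of "- ?w p"] by simp
 qed
 also have "\<dots> = exp (- (\<Sum>p\<in>P. ?w p))" using fP by (simp add: exp_sum sum_negf[symmetric])
 finally have 1: "(\<Prod>p\<in>P. 1 - ?w p) <= exp (- (\<Sum>p\<in>P. ?w p))" .
 have "(\<Sum>p\<in>P. (1 + real (card (R p))) / p) - (\<Sum>p\<in>P. if p dvd m then real v / p else 0) <= (\<Sum>p\<in>P. ?w p)"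
  unfolding sum_subtractf[symmetric]
 proof (intro sum_mono)
  fix p assume p: "p : P"
  have p0: "real p > 0" using Pp(1)[OF p] by (simp add: prime_gt_0_nat)
  show "(1 + real (card (R p))) / p - (if p dvd m then real v / p else 0) <= ?w p"
  proof (cases "p dvd m")
   case True
   have "1 <= card (twist_class R m p)" "card (R p) <= v" using card_twist_class(3)[of p R m] R[OF Pp(1)[OF p]] Pp(1)[OF p] by auto
   hence "(1 + real (card (R p))) - real v <= real (card (twist_class R m p))" by linarith
   hence "((1 + real (card (R p))) - real v) / p <= ?w p" using p0 by (intro divide_right_mono) auto
   thus ?thesis using True by (simp add: diff_divide_distrib)
  next
   case False
   thus ?thesis using card_twist_class(1)[of p R m] R[OF Pp(1)[OF p]] Pp(1)[OF p] by simp
  qed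
 qed
 moreover have "(\<Sum>p\<in>P. if p dvd m then real v / p else 0) <= (\<Sum>p\<in>prime_factors m. real v / p)"
 proof -
  have "(\<Sum>p\<in>P. if p dvd m then real v / p else 0) = (\<Sum>p\<in>{p\<in>P. p dvd m}. real v / p)"
   using fP by (rule sum.inter_filter[symmetric])
  also have "\<dots> <= (\<Sum>p\<in>prime_factors m. real v / p)"
   using m Pp(1) by (intro sum_mono2) (auto simp: in_prime_factors_iff)
  finally show ?thesis .
 qed
 moreover have "(\<Sum>p\<in>P. (1 + real (card (R p))) / p) = (\<Sum>p\<in>P. 1 / p) + (\<Sum>p\<in>P. real (card (R p)) / p)"
  by (simp add: sum.distrib add_divide_distrib)
 moreover have "(\<Sum>p\<in>P. 1 / real p) >= ln (ln N) - ln c - 4 - K"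
 proof -
  have "{p. prime p & real p <= u} \<subseteq> P \<union> {p. prime p & p < 2 * v + 5}" by (auto simp: P u_def c_def)
  hence "(\<Sum>p | prime p & real p <= u. 1 / real p) <= (\<Sum>p\<in>P \<union> {p. prime p & p < 2 * v + 5}. 1 / real p)"
   using fP by (intro sum_mono2) auto
  also have "\<dots> <= (\<Sum>p\<in>P. 1 / real p) + (\<Sum>p | prime p & p < 2 * v + 5. 1 / real p)"
   using fP by (intro sum_Un_le) auto
  also have "(\<Sum>p | prime p & p < 2 * v + 5. 1 / real p) <= K" unfolding K_def by (rule sum_recip_small)
  finally have "ln (ln u) - 4 <= (\<Sum>p\<in>P. 1 / real p) + K" using prime_recip_lower[OF u2] by linarith
  moreover have "ln (ln u) = ln (ln N) - ln c" unfolding lnu using lnN c by (simp add: ln_div)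
  ultimately show ?thesis by linarith
 qed
 moreover have "(\<Sum>p\<in>P. real (card (R p)) / p) >= ?M - real v * (K + ln c + 8)"
 proof -
  let ?A = "{p. prime p & p < 2 * v + 5}" and ?B = "{p. prime p & u < real p & real p <= N}"
  have fB: "finite ?B" by (rule finite_subset[OF _ finite_primes_real[of N]]) auto
  have le: "(\<Sum>p\<in>A. real (card (R p)) / p) <= v * (\<Sum>p\<in>A. 1 / real p)" if "A \<subseteq> {p. prime p}" for A
   unfolding sum_distrib_left using that R by (intro sum_mono) (auto intro!: divide_right_mono)
  have "{p. prime p & real p <= N} \<subseteq> (P \<union> ?A) \<union> ?B" by (auto simp: P u_def c_def)
  hence "?M <= (\<Sum>p\<in>(P \<union> ?A) \<union> ?B. real (card (R p)) / p)"
   unfolding prime_mean_alt using fP fB by (intro sum_mono2) auto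
  also have "\<dots> <= (\<Sum>p\<in>P \<union> ?A. real (card (R p)) / p) + (\<Sum>p\<in>?B. real (card (R p)) / p)"
   using fP fB by (intro sum_Un_le) auto
  also have "(\<Sum>p\<in>P \<union> ?A. real (card (R p)) / p) <= (\<Sum>p\<in>P. real (card (R p)) / p) + (\<Sum>p\<in>?A. real (card (R p)) / p)"
   using fP by (intro sum_Un_le) auto
  also have "(\<Sum>p\<in>?A. real (card (R p)) / p) <= v * K"
   using le[of ?A] sum_recip_small[of "2 * v + 5"] by (auto simp: K_def intro!: order_trans[OF le] mult_left_mono)
  also have "(\<Sum>p\<in>?B. real (card (R p)) / p) <= v * (ln c + 8)"
  proof -
   have "(\<Sum>p\<in>?B. 1 / real p) <= ln (ln N / ln u) + 8" by (rule prime_recip_upper[OF u2 uN])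
   also have "ln N / ln u = c" unfolding lnu using lnN c by simp
   finally show ?thesis using le[of ?B] by (auto intro!: order_trans[OF le] mult_left_mono)
  qed
  finally show ?thesis by (simp add: algebra_simps)
 qed
 ultimately have "- (\<Sum>p\<in>P. ?w p) <= (4 + K + ln c + real v * (K + ln c + 8)) - ln (ln N) + (- ?M + (\<Sum>p\<in>prime_factors m. real v / p))"
  by linarith
 hence "exp (- (\<Sum>p\<in>P. ?w p)) <= exp ((4 + K + ln c + real v * (K + ln c + 8)) - ln (ln N) + (- ?M + (\<Sum>p\<in>prime_factors m. real v / p)))"
  by simp
 also have "\<dots> = exp (4 + K + ln c + real v * (K + ln c + 8)) / ln N * exp (- ?M + (\<Sum>p\<in>prime_factors m. real v / p))"
  using lnN by (subst exp_add, subst exp_diff) simp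
 finally show ?thesis using 1 unfolding K_def c_def by (meson order_trans)
qed

text \<open>Sieve upper bound for the primes \<open>q\<close> with \<open>m * q\<close> avoiding all the classes \<open>R p\<close>.\<close>

lemma prime_sieve_upper:
 fixes v :: nat
 shows "\<exists>C>0. \<forall>N (m::nat) R. 2 <= N --> 1 <= m --> residue_system v R -->
  real (card {q. prime q & real q <= N & (\<forall>p. prime p --> (m * q) mod p \<notin> R p)})
   <= C * (N / ln N) * exp (- sieve_mean R N + (\<Sum>p\<in>prime_factors m. real v / p))"
proof -
 define K where "K = exp (4 + real (2 * v + 5) + ln (32 * (real v + 2)) + real v * (real (2 * v + 5) + ln (32 * (real v + 2)) + 8))"
 define L where "L = 384 * (real v + 2)"
 define E where "E = exp (9 * real v)"
 define G where "G = (max 1 (real (v + 1)) / (1/3)) ^ (v + 1)"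
 define C where "C = 2 * K + 4 * (E * G) + L ^ (v + 1) * E"
 have pos: "K > 0" "E > 0" "G > 0" "L > 0" by (auto simp: K_def L_def E_def G_def intro!: divide_pos_pos)
 have C: "C > 0" using pos by (auto simp: C_def intro!: add_pos_pos)
 have "real (card {q. prime q & real q <= N & (\<forall>p. prime p --> (m * q) mod p \<notin> R p)})
   <= C * (N / ln N) * exp (- sieve_mean R N + (\<Sum>p\<in>prime_factors m. real v / p))"
  if N: "2 <= N" and m: "1 <= m" and R: "residue_system v R" for N :: real and m :: nat and R
 proof -
  let ?M = "sieve_mean R N"
  let ?S = "\<Sum>p\<in>prime_factors m. real v / p"
  have lnN: "ln N > 0" using N by simp
  have S: "?S >= 0" by (intro sum_nonneg) auto
  have e1: "exp (- ?M) <= exp (- ?M + ?S)" using S by simp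
  have "?M <= v * (ln (ln N) + 9)" using R N by (intro prime_mean_count_le) auto
  hence "exp ?M <= exp (v * (ln (ln N) + 9))" by simp
  also have "\<dots> = exp (v * ln (ln N)) * E" by (simp add: E_def algebra_simps exp_add)
  also have "exp (v * ln (ln N)) = ln N ^ v" using lnN by (simp add: exp_of_nat_mult)
  finally have eM: "exp ?M <= ln N ^ v * E" .
  \<comment> \<open>The claimed bound never falls below a constant times
    \<open>N / ln N ^ (v + 1)\<close>. This absorbs both the range of small \<open>N\<close> and the
    error \<open>N powr (2/3)\<close>.\<close>
  have base: "1 <= ln N ^ (v + 1) * E * (exp (- ?M + ?S) / ln N)"
  proof -
   have "1 = exp ?M * exp (- ?M)" by (simp flip: exp_add)
   also have "\<dots> <= (ln N ^ v * E) * exp (- ?M + ?S)" using eM e1 pos lnN by (intro mult_mono) auto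
   also have "\<dots> = ln N ^ (v + 1) * E * (exp (- ?M + ?S) / ln N)" using lnN by simp
   finally show ?thesis .
  qed
  show ?thesis
  proof (cases "ln N >= L")
   case False
   have "real (card {q. prime q & real q <= N & (\<forall>p. prime p --> (m * q) mod p \<notin> R p)}) <= real (card {1..nat \<lfloor>N\<rfloor>})"
   unfolding of_nat_le_iff
   by (intro card_mono) (use N real_le_iff_nat_floor[of N] in \<open>auto simp: prime_gt_0_nat Suc_leI\<close>)
   also have "\<dots> <= N * 1" using N by simp
   also have "\<dots> <= N * (ln N ^ (v + 1) * E * (exp (- ?M + ?S) / ln N))" using base N by (intro mult_left_mono) auto
   also have "\<dots> <= N * (L ^ (v + 1) * E * (exp (- ?M + ?S) / ln N))"
   using False lnN N pos by (intro mult_left_mono mult_right_mono power_mono) auto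
   also have "\<dots> = (L ^ (v + 1) * E) * (N / ln N) * exp (- ?M + ?S)" by simp
   also have "\<dots> <= C * (N / ln N) * exp (- ?M + ?S)"
   using pos lnN N by (intro mult_right_mono) (auto simp: C_def)
   finally show ?thesis .
  next
   case True
   have "real (card {q. prime q & real q <= N & (\<forall>p. prime p --> (m * q) mod p \<notin> R p)})
   <= 2 * N * (\<Prod>p\<in>{p. prime p & 2 * v + 5 <= p & real p <= N powr (1 / (32 * (real v + 2)))}. 1 - real (card (twist_class R m p)) / p) + 4 * N powr (2/3)"
   by (rule prime_sieve_large) (use R m N True in \<open>auto simp: L_def\<close>)
   also have "(\<Prod>p\<in>{p. prime p & 2 * v + 5 <= p & real p <= N powr (1 / (32 * (real v + 2)))}. 1 - real (card (twist_class R m p)) / p) \<le>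
   K / ln N * exp (- ?M + ?S)"
   unfolding K_def by (rule prime_sieve_product) (use R m N True in \<open>auto simp: L_def\<close>)
   also have "N powr (2/3) <= N powr (2/3) * (ln N ^ (v + 1) * E * (exp (- ?M + ?S) / ln N))"
   using base N mult_left_mono[of 1 _ "N powr (2/3)"] by simp
   also have "\<dots> <= N powr (2/3) * ((G * N powr (1/3)) * E * (exp (- ?M + ?S) / ln N))"
   using ln_power_le[of N "1/3" "v + 1"] N pos lnN unfolding G_def
   by (intro mult_left_mono mult_right_mono) auto
   also have "\<dots> = (E * G) * (N / ln N) * exp (- ?M + ?S)"
   proof -
   have "N powr (2/3) * N powr (1/3) = N" using N by (simp flip: powr_add)
   moreover have "N powr (2/3) * ((G * N powr (1/3)) * E * (exp (- ?M + ?S) / ln N)) =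
   (E * G) * ((N powr (2/3) * N powr (1/3)) / ln N) * exp (- ?M + ?S)" by simp
   ultimately show ?thesis by (simp only:)
   qed
   finally have "real (card {q. prime q & real q <= N & (\<forall>p. prime p --> (m * q) mod p \<notin> R p)})
   <= 2 * N * (K / ln N * exp (- ?M + ?S)) + 4 * ((E * G) * (N / ln N) * exp (- ?M + ?S))" using N by simp
   also have "\<dots> = (2 * K + 4 * (E * G)) * (N / ln N) * exp (- ?M + ?S)" by (simp add: algebra_simps add_divide_distrib)
   also have "\<dots> <= C * (N / ln N) * exp (- ?M + ?S)"
   using pos lnN N by (intro mult_right_mono) (auto simp: C_def)
   finally show ?thesis .
  qed
 qed
 thus ?thesis using C by blast
qed

section \<open>Smooth numbers and finite Euler products\<close>

text \<open>The cap \<open>A\<close> on exponents makes the set finite, so that Euler products are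
  finite identities. With \<open>A = nat \<lfloor>x\<rfloor>\<close> it excludes no integer up to
  \<open>x\<close>, see \<open>smooth_setI\<close>.\<close>

definition smooth_set :: "nat set => nat => nat set" where
 "smooth_set Q A = {m. 0 < m & prime_factors m \<subseteq> Q & (\<forall>p. prime p --> multiplicity p m <= A)}"

lemma smooth_set_insert:
 assumes "prime p" "p \<notin> Q"
 shows "bij_betw (%(a, m). p ^ a * m) ({..A} \<times> smooth_set Q A) (smooth_set (insert p Q) A)"
proof (rule bij_betwI')
 have p: "p > 0" "p ~= 1" using assms prime_gt_1_nat[of p] by auto
 have mult: "multiplicity p (p ^ a * m) = a" if "m : smooth_set Q A" for a m
 proof -
  have m: "m > 0" "\<not> p dvd m" using that assms by (auto simp: smooth_set_def in_prime_factors_iff)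
  thus ?thesis using assms p by (simp add: prime_elem_multiplicity_mult_distrib prime_elem_multiplicity_power_distrib not_dvd_imp_multiplicity_0 multiplicity_self)
 qed
 fix x y assume x: "x : {..A} \<times> smooth_set Q A" and y: "y : {..A} \<times> smooth_set Q A"
 obtain a m b n where xy: "x = (a, m)" "y = (b, n)" by (metis surj_pair)
 show "((%(a, m). p ^ a * m) x = (%(a, m). p ^ a * m) y) = (x = y)"
 proof
  assume e: "(%(a, m). p ^ a * m) x = (%(a, m). p ^ a * m) y"
  have "a = b" using mult[of m a] mult[of n b] e x y by (simp add: xy)
  thus "x = y" using e p by (simp add: xy)
 qed simp
next
 fix x assume "x : {..A} \<times> smooth_set Q A"
 then obtain a m where x: "x = (a, m)" "a <= A" "m : smooth_set Q A" by auto
 have p: "p > 0" using assms prime_gt_0_nat by auto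
 have m: "m > 0" "\<not> p dvd m" using x assms by (auto simp: smooth_set_def in_prime_factors_iff)
 have "prime_factors (p ^ a * m) \<subseteq> insert p Q"
 proof
  fix r assume "r : prime_factors (p ^ a * m)"
  hence r: "prime r" "r dvd p ^ a \<or> r dvd m" by (auto simp: in_prime_factors_iff prime_dvd_mult_iff)
  from r(2) show "r : insert p Q"
  proof
   assume "r dvd p ^ a"
   hence "r = p" using primes_dvd_imp_eq[OF r(1) assms(1)] prime_dvd_power[OF r(1)] by blast
   thus ?thesis by simp
  next
   assume "r dvd m"
   hence "r : prime_factors m" using r m by (simp add: in_prime_factors_iff)
   thus ?thesis using x by (auto simp: smooth_set_def)
  qed
 qed
 moreover have "multiplicity r (p ^ a * m) <= A" if r: "prime r" for r
 proof -
  have e: "multiplicity r (p ^ a * m) = a * multiplicity r p + multiplicity r m"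
   using r m p by (simp add: prime_elem_multiplicity_mult_distrib prime_elem_multiplicity_power_distrib)
  show ?thesis
  proof (cases "r = p")
   case True
   thus ?thesis unfolding e using m x p r by (simp add: not_dvd_imp_multiplicity_0 multiplicity_self)
  next
   case False
   hence "\<not> r dvd p" using primes_dvd_imp_eq[OF r assms(1)] by auto
   thus ?thesis unfolding e using x r by (simp add: not_dvd_imp_multiplicity_0 smooth_set_def)
  qed
 qed
 ultimately show "(%(a, m). p ^ a * m) x : smooth_set (insert p Q) A"
  using x p m by (auto simp: smooth_set_def)
next
 fix y assume y: "y : smooth_set (insert p Q) A"
 have p: "p > 0" "p ~= 1" using assms prime_gt_1_nat[of p] by auto
 define a where "a = multiplicity p y"
 have y0: "y > 0" using y by (simp add: smooth_set_def)
 obtain m where m: "y = p ^ a * m" "\<not> p dvd m"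
  using multiplicity_decompose'[of y p] y0 p unfolding a_def by auto
 have m0: "m > 0" using m y0 by (cases m) auto
 have "multiplicity r m <= A" if r: "prime r" for r
 proof -
  have "multiplicity r m <= multiplicity r y" using m y0 by (intro dvd_imp_multiplicity_le) auto
  also have "\<dots> <= A" using y r by (simp add: smooth_set_def)
  finally show ?thesis .
 qed
 moreover have "prime_factors m \<subseteq> Q"
 proof
  fix r assume r: "r : prime_factors m"
  hence "r : prime_factors y" using m y0 by (auto simp: in_prime_factors_iff)
  hence "r : insert p Q" using y by (auto simp: smooth_set_def)
  moreover have "r ~= p" using r m by (auto simp: in_prime_factors_iff)
  ultimately show "r : Q" by simp
 qed
 ultimately have "m : smooth_set Q A" using m0 by (auto simp: smooth_set_def)
 moreover have "a <= A" using y assms by (auto simp: a_def smooth_set_def)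
 ultimately show "\<exists>x\<in>{..A} \<times> smooth_set Q A. y = (%(a, m). p ^ a * m) x"
  using m(1) by (intro bexI[of _ "(a, m)"]) auto
qed

lemma smooth_set_empty: "smooth_set {} A = {1}"
proof -
 have "m = 1" if "0 < m" "prime_factors m = {}" for m :: nat
  using that prime_factorization_empty_iff[of m] by (auto simp: set_mset_eq_empty_iff)
 thus ?thesis by (auto simp: smooth_set_def)
qed

lemma finite_smooth_set: "finite Q ==> (!!p. p : Q ==> prime p) ==> finite (smooth_set Q A)"
proof (induction Q rule: finite_induct)
 case (insert p Q)
 have "bij_betw (%(a, m). p ^ a * m) ({..A} \<times> smooth_set Q A) (smooth_set (insert p Q) A)"
  using insert by (intro smooth_set_insert) auto
 thus ?case using insert by (metis bij_betw_finite finite_SigmaI finite_atMost insertCI)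
qed (simp add: smooth_set_empty)

text \<open>Stated over a semiring so that \<open>G m = monom (F m) (g m)\<close> is allowed: this
  polynomial is multiplicative in \<open>m\<close> when \<open>F\<close> is multiplicative and
  \<open>g\<close> additive.\<close>

lemma euler_product:
 fixes G :: "nat => 'a :: comm_semiring_1"
 assumes "finite Q" "!!p. p : Q ==> prime p" "G 1 = 1"
  and mult: "!!m n. 0 < m ==> 0 < n ==> coprime m n ==> G (m * n) = G m * G n"
 shows "(\<Sum>m\<in>smooth_set Q A. G m) = (\<Prod>p\<in>Q. \<Sum>a\<le>A. G (p ^ a))"
 using assms(1,2)
proof (induction Q rule: finite_induct)
 case (insert p Q)
 have "(\<Sum>m\<in>smooth_set (insert p Q) A. G m) = (\<Sum>(a, m)\<in>{..A} \<times> smooth_set Q A. G (p ^ a * m))"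
  using insert by (subst sum.reindex_bij_betw[OF smooth_set_insert, symmetric]) (auto simp: case_prod_unfold)
 also have "\<dots> = (\<Sum>(a, m)\<in>{..A} \<times> smooth_set Q A. G (p ^ a) * G m)"
 proof (intro sum.cong refl, clarify)
  fix a m assume m: "m : smooth_set Q A"
  have "p > 0" using insert by (auto simp: prime_gt_0_nat)
  moreover have "\<not> p dvd m"
  proof
   assume "p dvd m"
   hence "p : prime_factors m" using m insert.prems by (auto simp: smooth_set_def in_prime_factors_iff)
   thus False using m insert.hyps by (auto simp: smooth_set_def)
  qed
  hence "coprime (p ^ a) m" using insert by (auto intro!: prime_imp_coprime)
  ultimately show "G (p ^ a * m) = G (p ^ a) * G m" using m by (intro mult) (auto simp: smooth_set_def)
 qed
 also have "\<dots> = (\<Sum>a\<le>A. G (p ^ a)) * (\<Sum>m\<in>smooth_set Q A. G m)"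
  by (simp add: sum_product sum.cartesian_product)
 finally show ?case using insert by simp
qed (use assms(3) in \<open>simp add: smooth_set_empty\<close>)

section \<open>Coefficient domination by the Poisson distribution\<close>

text \<open>Nonnegativity of the smaller polynomial is included because it makes the relation stable
  under products.\<close>

definition coeff_le :: "real poly => real poly => bool" where
 "coeff_le p q \<longleftrightarrow> (\<forall>i. 0 <= coeff p i & coeff p i <= coeff q i)"

lemma coeff_le_mult: "coeff_le p q ==> coeff_le r s ==> coeff_le (p * r) (q * s)"
 unfolding coeff_le_def coeff_mult
 by (intro allI conjI sum_nonneg sum_mono mult_nonneg_nonneg mult_mono) (auto intro: order_trans)

lemma coeff_le_prod: "(!!x. x : A ==> coeff_le (f x) (g x)) ==> coeff_le (prod f A) (prod g A)"
proof (induction A rule: infinite_finite_induct)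
 case (insert x A)
 thus ?case by (simp add: coeff_le_mult)
qed (auto simp: coeff_le_def coeff_1)

lemma power_add_ge:
 assumes "0 <= (S::real)" "0 <= F"
 shows "S ^ Suc k + real (Suc k) * F * S ^ k <= (S + F) ^ Suc k"
proof (induction k)
 case (Suc k)
 have "S ^ Suc (Suc k) + real (Suc (Suc k)) * F * S ^ Suc k <= (S + F) * (S ^ Suc k + real (Suc k) * F * S ^ k)"
  using assms by (simp add: algebra_simps)
 also have "\<dots> <= (S + F) * (S + F) ^ Suc k" using Suc assms by (intro mult_left_mono) auto
 finally show ?case by simp
qed simp

text \<open>The coefficientwise form of \<open>1 + F * z <= exp (F * z)\<close>. Each new prime in
  \<open>E\<close> is absorbed by the first two terms of the binomial expansion of
  \<open>(S + F) ^ k\<close>, which is \<open>power_add_ge\<close>.\<close>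

lemma coeff_linear_prod:
 fixes F :: "nat => real"
 assumes "finite Q" "!!p. p : Q ==> 0 <= F p"
 shows "coeff (\<Prod>p\<in>Q. 1 + monom (F p) (of_bool (p : E))) k <= exp (\<Sum>p\<in>Q - E. F p) * (\<Sum>p\<in>Q \<inter> E. F p) ^ k / fact k"
 using assms
proof (induction Q arbitrary: k rule: finite_induct)
 case empty
 show ?case by (cases k) (auto simp: coeff_1)
next
 case (insert p Q)
 let ?Y = "\<Prod>p\<in>Q. 1 + monom (F p) (of_bool (p : E))"
 let ?S = "\<Sum>p\<in>Q \<inter> E. F p" and ?X = "exp (\<Sum>p\<in>Q - E. F p)"
 have IH: "coeff ?Y k <= ?X * ?S ^ k / fact k" for k using insert by auto
 have F: "F p >= 0" and S: "?S >= 0" using insert by (auto intro!: sum_nonneg)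
 have P: "(\<Prod>p\<in>insert p Q. 1 + monom (F p) (of_bool (p : E))) = ?Y + monom (F p) (of_bool (p : E)) * ?Y"
  using insert by (simp add: algebra_simps)
 show ?case
 proof (cases "p : E")
  case False
  have e: "insert p Q - E = insert p (Q - E)" "insert p Q \<inter> E = Q \<inter> E" using False by auto
  have s: "(\<Sum>p\<in>insert p (Q - E). F p) = F p + (\<Sum>p\<in>Q - E. F p)" using insert by simp
  have "coeff ?Y k + F p * coeff ?Y k = (1 + F p) * coeff ?Y k" by (simp add: algebra_simps)
  also have "\<dots> <= (1 + F p) * (?X * ?S ^ k / fact k)" using IH F by (intro mult_left_mono) auto
  also have "\<dots> <= exp (F p) * (?X * ?S ^ k / fact k)"
   using S by (intro mult_right_mono) auto
  finally show ?thesis unfolding P e s using False by (simp add: coeff_monom_mult exp_add mult_ac)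
 next
  case True
  have e: "insert p Q - E = Q - E" "insert p Q \<inter> E = insert p (Q \<inter> E)" using True by auto
  have s: "(\<Sum>p\<in>insert p (Q \<inter> E). F p) = ?S + F p" using insert by simp
  show ?thesis
  proof (cases k)
   case 0
   thus ?thesis unfolding P e s using True IH[of 0] by (simp add: coeff_monom_mult)
  next
   case (Suc j)
   have "coeff ?Y k + F p * coeff ?Y j <= ?X * ?S ^ k / fact k + F p * (?X * ?S ^ j / fact j)"
   using IH F by (intro add_mono mult_left_mono) auto
   also have "\<dots> = ?X * ((?S ^ Suc j + real (Suc j) * F p * ?S ^ j) / fact k)"
   proof -
   have h: "?S ^ j / fact j = real (Suc j) * ?S ^ j / fact (Suc j)" by (simp add: divide_simps)
   have "F p * (?X * ?S ^ j / fact j) = F p * ?X * (real (Suc j) * ?S ^ j / fact (Suc j))"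
   unfolding h[symmetric] by simp
   thus ?thesis unfolding Suc by (simp add: add_divide_distrib algebra_simps del: fact_Suc)
   qed
   also have "\<dots> <= ?X * ((?S + F p) ^ Suc j / fact k)"
   using power_add_ge[OF S F, of j] by (intro mult_left_mono divide_right_mono) auto
   finally show ?thesis unfolding P e s using True Suc by (simp add: coeff_monom_mult)
  qed
 qed
qed

lemma poly_prod_one_plus_le:
 assumes "finite Q" "!!p. p : Q ==> 0 <= poly (R p) r"
 shows "poly (\<Prod>p\<in>Q. 1 + R p) r <= exp (\<Sum>p\<in>Q. poly (R p) (r::real))"
proof -
 have "poly (\<Prod>p\<in>Q. 1 + R p) r = (\<Prod>p\<in>Q. 1 + poly (R p) r)" by (simp add: poly_prod)
 also have "\<dots> <= (\<Prod>p\<in>Q. exp (poly (R p) r))" using assms by (intro prod_mono) (auto intro: add_nonneg_nonneg)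
 finally show ?thesis using assms(1) by (simp add: exp_sum)
qed

text \<open>Carrying \<open>F m\<close> and \<open>g m\<close> together in a monomial turns the mass
  of the \<open>m\<close> with \<open>g m = k\<close> into a coefficient of an Euler product. Only
  the value at primes is rigid, as both counting functions agree there; the squares and higher
  powers are collected in \<open>tail\<close>.\<close>

locale additive_weight =
 fixes F :: "nat => real" and g :: "nat => nat" and E Q :: "nat set" and A :: nat
 assumes Q: "finite Q" "!!p. p : Q ==> prime p" and A: "1 <= A"
  and F: "F 1 = 1" "!!m n. 0 < m ==> 0 < n ==> coprime m n ==> F (m * n) = F m * F n" "!!n. 0 < n ==> 0 <= F n"
  and g: "g 1 = 0" "!!m n. 0 < m ==> 0 < n ==> coprime m n ==> g (m * n) = g m + g n" "!!p. prime p ==> g p = of_bool (p : E)"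
begin

definition tail :: "nat => real poly" where
 "tail p = (\<Sum>a=2..A. monom (F (p ^ a)) (g (p ^ a)))"

lemma tail_nonneg: "p : Q ==> 0 <= coeff (tail p) i"
 unfolding tail_def coeff_sum using Q by (intro sum_nonneg) (auto simp: prime_gt_0_nat intro!: F(3))

lemma factor_split:
 assumes "p : Q"
 shows "(\<Sum>a\<le>A. monom (F (p ^ a)) (g (p ^ a))) = 1 + monom (F p) (of_bool (p : E)) + tail p"
proof -
 have "{..A} = {0, 1} \<union> {2..A}" using A by auto
 hence "(\<Sum>a\<le>A. monom (F (p ^ a)) (g (p ^ a))) = (\<Sum>a\<in>{0,1}. monom (F (p ^ a)) (g (p ^ a))) + tail p"
  unfolding tail_def by (simp only:) (rule sum.union_disjoint; auto)
 thus ?thesis using F(1) g(1) g(3)[OF Q(2)[OF assms]] by (simp add: one_pCons monom_0)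
qed

lemma weight_coeff:
 "(\<Sum>m | m : smooth_set Q A & g m = k. F m) = coeff (\<Prod>p\<in>Q. \<Sum>a\<le>A. monom (F (p ^ a)) (g (p ^ a))) k"
proof -
 have "(\<Prod>p\<in>Q. \<Sum>a\<le>A. monom (F (p ^ a)) (g (p ^ a))) = (\<Sum>m\<in>smooth_set Q A. monom (F m) (g m))"
  by (rule euler_product[symmetric, OF Q]) (use F g in \<open>auto simp: mult_monom one_pCons monom_0\<close>)
 hence "coeff (\<Prod>p\<in>Q. \<Sum>a\<le>A. monom (F (p ^ a)) (g (p ^ a))) k = (\<Sum>m\<in>smooth_set Q A. if g m = k then F m else 0)"
  by (simp add: coeff_sum)
 also have "\<dots> = (\<Sum>m\<in>{m\<in>smooth_set Q A. g m = k}. F m)"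
  using finite_smooth_set[OF Q] by (rule sum.inter_filter[symmetric])
 finally show ?thesis by simp
qed

lemma moment_le:
 assumes r: "0 <= r"
 shows "(\<Sum>m\<in>smooth_set Q A. F m * r ^ g m) \<le>
  exp ((\<Sum>p\<in>Q - E. F p) + r * (\<Sum>p\<in>Q \<inter> E. F p) + (\<Sum>p\<in>Q. poly (tail p) r))"
proof -
 have pos: "0 <= F p" if "p : Q" for p using F(3) Q that by (auto simp: prime_gt_0_nat)
 have tp: "0 <= poly (tail p) r" if "p : Q" for p
  unfolding poly_altdef using tail_nonneg[OF that] r by (intro sum_nonneg mult_nonneg_nonneg) auto
 have "(\<Sum>m\<in>smooth_set Q A. F m * r ^ g m) = (\<Prod>p\<in>Q. \<Sum>a\<le>A. F (p ^ a) * r ^ g (p ^ a))"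
  by (rule euler_product[OF Q]) (use F g in \<open>auto simp: power_add\<close>)
 also have "\<dots> = (\<Prod>p\<in>Q. poly (\<Sum>a\<le>A. monom (F (p ^ a)) (g (p ^ a))) r)"
  by (simp add: poly_sum poly_monom)
 also have "\<dots> = (\<Prod>p\<in>Q. 1 + (F p * r ^ of_bool (p : E) + poly (tail p) r))"
  by (intro prod.cong refl) (simp add: factor_split poly_monom)
 also have "\<dots> <= (\<Prod>p\<in>Q. exp (F p * r ^ of_bool (p : E) + poly (tail p) r))"
  using pos tp r by (intro prod_mono conjI) (auto intro!: add_nonneg_nonneg)
 also have "\<dots> = exp (\<Sum>p\<in>Q. F p * r ^ of_bool (p : E) + poly (tail p) r)" using Q by (simp add: exp_sum)
 also have "(\<Sum>p\<in>Q. F p * r ^ of_bool (p : E) + poly (tail p) r) =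
  (\<Sum>p\<in>Q. F p * r ^ of_bool (p : E)) + (\<Sum>p\<in>Q. poly (tail p) r)" by (rule sum.distrib)
 also have "(\<Sum>p\<in>Q. F p * r ^ of_bool (p : E)) = (\<Sum>p\<in>(Q - E) \<union> (Q \<inter> E). F p * r ^ of_bool (p : E))"
  by (rule sum.cong) auto
 also have "\<dots> = (\<Sum>p\<in>Q - E. F p) + r * (\<Sum>p\<in>Q \<inter> E. F p)"
  using Q by (subst sum.union_disjoint) (auto simp: sum_distrib_left mult.commute)
 finally show ?thesis .
qed

text \<open>The tails split off by \<open>1 + z + t <= (1 + z) * (1 + t)\<close>. Moving the index
  of the Poisson part down by \<open>j\<close> costs a factor at most \<open>r ^ j\<close> as long
  as \<open>k <= r * S\<close>, and these powers reassemble to the product of the tails evaluated at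
  \<open>r\<close>.\<close>

lemma coeff_weight_le:
 assumes r: "0 <= r" and S: "(\<Sum>p\<in>Q \<inter> E. F p) <= S" "0 < S" and k: "real k <= r * S"
 shows "(\<Sum>m | m : smooth_set Q A & g m = k. F m) \<le>
  exp ((\<Sum>p\<in>Q - E. F p) + (\<Sum>p\<in>Q. poly (tail p) r)) * (S ^ k / fact k)"
proof -
 let ?Y = "\<Prod>p\<in>Q. 1 + monom (F p) (of_bool (p : E))"
 let ?W = "\<Prod>p\<in>Q. 1 + tail p"
 let ?s = "\<Sum>p\<in>Q \<inter> E. F p" and ?X = "exp (\<Sum>p\<in>Q - E. F p)"
 have pos: "0 <= F p" if "p : Q" for p using F(3) Q that by (auto simp: prime_gt_0_nat)
 have tp: "0 <= poly (tail p) r" if "p : Q" for p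
  unfolding poly_altdef using tail_nonneg[OF that] r by (intro sum_nonneg mult_nonneg_nonneg) auto
 have s0: "0 <= ?s" using pos by (intro sum_nonneg) auto
 have "coeff_le (\<Prod>p\<in>Q. \<Sum>a\<le>A. monom (F (p ^ a)) (g (p ^ a))) (\<Prod>p\<in>Q. (1 + monom (F p) (of_bool (p : E))) * (1 + tail p))"
 proof (rule coeff_le_prod)
  fix p assume p: "p : Q"
  have "0 <= coeff (monom (F p) (of_bool (p : E)) * tail p) i" for i
   unfolding coeff_mult using tail_nonneg[OF p] pos[OF p] by (intro sum_nonneg mult_nonneg_nonneg) auto
  moreover have "0 <= coeff (1 + monom (F p) (of_bool (p : E)) + tail p) i" for i
   using tail_nonneg[OF p, of i] pos[OF p] by (simp add: coeff_1)
  ultimately show "coeff_le (\<Sum>a\<le>A. monom (F (p ^ a)) (g (p ^ a))) ((1 + monom (F p) (of_bool (p : E))) * (1 + tail p))"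
   unfolding factor_split[OF p] coeff_le_def by (simp add: algebra_simps)
 qed
 hence "coeff (\<Prod>p\<in>Q. \<Sum>a\<le>A. monom (F (p ^ a)) (g (p ^ a))) k <= coeff (?Y * ?W) k"
  by (simp add: coeff_le_def prod.distrib)
 also have "\<dots> = (\<Sum>j\<le>k. coeff ?W j * coeff ?Y (k - j))" unfolding mult.commute[of ?Y] by (rule coeff_mult)
 also have "\<dots> <= (\<Sum>j\<le>k. coeff ?W j * (?X * (S ^ k / fact k) * r ^ j))"
 proof (intro sum_mono mult_left_mono)
  fix j assume j: "j : {..k}"
  have "coeff ?Y (k - j) <= ?X * ?s ^ (k - j) / fact (k - j)" using coeff_linear_prod[OF Q(1) pos] .
  also have "\<dots> <= ?X * S ^ (k - j) / fact (k - j)"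
   using S s0 by (intro divide_right_mono mult_left_mono power_mono) auto
  finally have Y: "coeff ?Y (k - j) <= ?X * (S ^ (k - j) / fact (k - j))" by simp
  \<comment> \<open>\<open>fact k / fact (k - j)\<close> is a product of \<open>j\<close> factors,
    each at most \<open>k <= r * S\<close>.\<close>
  have "S ^ (k - j) / fact (k - j) <= S ^ k / fact k * r ^ j"
  proof -
   have "fact k <= fact (k - j) * real k ^ j" using j
   proof (induction j)
   case (Suc j)
   have e: "k - j = Suc (k - Suc j)" using Suc by simp
   have "fact k <= fact (k - j) * real k ^ j" using Suc by simp
   also have "\<dots> = fact (k - Suc j) * (real (k - j) * real k ^ j)" unfolding e by simp
   also have "\<dots> <= fact (k - Suc j) * (real k * real k ^ j)" by (intro mult_left_mono mult_right_mono) auto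
   finally show ?case by simp
   qed simp
   also have "\<dots> <= fact (k - j) * (r * S) ^ j" using k by (intro mult_left_mono power_mono) auto
   finally have "S ^ (k - j) * fact k <= S ^ (k - j) * (fact (k - j) * (r * S) ^ j)"
   using S by (intro mult_left_mono) auto
   also have "\<dots> = S ^ k * r ^ j * fact (k - j)"
   using j by (simp add: power_mult_distrib power_add[symmetric] mult_ac flip: power_add)
   finally show ?thesis by (simp add: field_simps)
  qed
  hence "?X * (S ^ (k - j) / fact (k - j)) <= ?X * (S ^ k / fact k * r ^ j)" by (rule mult_left_mono) simp
  thus "coeff ?Y (k - j) <= ?X * (S ^ k / fact k) * r ^ j" using Y by simp
  show "0 <= coeff ?W j"
  proof -
   have "coeff_le (\<Prod>p\<in>Q. 1) ?W" by (rule coeff_le_prod) (use tail_nonneg in \<open>auto simp: coeff_le_def coeff_1\<close>)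
   thus ?thesis unfolding coeff_le_def by (meson order_trans)
  qed
 qed
 also have "\<dots> = ?X * (S ^ k / fact k) * (\<Sum>j\<le>k. coeff ?W j * r ^ j)" by (simp add: sum_distrib_left mult_ac)
 finally have main: "coeff (\<Prod>p\<in>Q. \<Sum>a\<le>A. monom (F (p ^ a)) (g (p ^ a))) k <= ?X * (S ^ k / fact k) * (\<Sum>j\<le>k. coeff ?W j * r ^ j)" .
 have "(\<Sum>j\<le>k. coeff ?W j * r ^ j) <= poly ?W r"
 proof -
  have W0: "0 <= coeff ?W j" for j
  proof -
   have "coeff_le (\<Prod>p\<in>Q. 1) ?W" by (rule coeff_le_prod) (use tail_nonneg in \<open>auto simp: coeff_le_def coeff_1\<close>)
   thus ?thesis unfolding coeff_le_def by (meson order_trans)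
  qed
  have "(\<Sum>j\<le>k. coeff ?W j * r ^ j) <= (\<Sum>j\<le>max k (degree ?W). coeff ?W j * r ^ j)"
   using W0 r by (intro sum_mono2) auto
  also have "\<dots> = poly ?W r" unfolding poly_altdef
   by (intro sum.mono_neutral_right) (auto simp: coeff_eq_0 not_le)
  finally show ?thesis .
 qed
 also have "\<dots> <= exp (\<Sum>p\<in>Q. poly (tail p) r)" by (rule poly_prod_one_plus_le[OF Q(1) tp])
 finally have "?X * (S ^ k / fact k) * (\<Sum>j\<le>k. coeff ?W j * r ^ j) <= ?X * (S ^ k / fact k) * exp (\<Sum>p\<in>Q. poly (tail p) r)"
  using S by (intro mult_left_mono) auto
 with main show ?thesis unfolding weight_coeff by (simp add: exp_add mult_ac)
qed

end

section \<open>The class of f and the two counting functions\<close>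

lemma mult_classD:
 assumes "f : mult_class A1 A2"
 shows "f 1 = 1" "!!n. 0 < n ==> 0 <= f n" "!!m n. 0 < m ==> 0 < n ==> coprime m n ==> f (m * n) = f m * f n"
  "!!p. prime p ==> f p <= A1" "!!e n. 0 < e ==> 0 < n ==> f n <= A2 e * real n powr e"
proof -
 show "f p <= A1" if "prime p" for p
 proof -
  have "f p <= A1 ^ size (prime_factorization p)" using assms that by (auto simp: mult_class_def prime_gt_0_nat)
  thus ?thesis using that by (simp add: prime_factorization_prime)
 qed
qed (use assms in \<open>auto simp: mult_class_def multiplicative_def\<close>)

lemma omega_in_props:
 assumes E: "\<forall>p\<in>E. prime (p::nat)"
 shows "omega_in 1 E = 0" "!!p. prime p ==> omega_in p E = of_bool (p : E)"
  "!!m n. 0 < m ==> 0 < n ==> coprime m n ==> omega_in (m * n) E = omega_in m E + omega_in n E"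
  "!!p a. prime p ==> omega_in (p ^ a) E <= a"
proof -
 have fin: "finite {p\<in>E. p dvd n}" if "0 < n" for n
  by (rule finite_subset[of _ "{..n}"]) (use that in \<open>auto dest: dvd_imp_le\<close>)
 have "{p\<in>E. p dvd (1::nat)} = {}" using E by auto
 thus "omega_in 1 E = 0" unfolding omega_in_def by (simp only: card.empty)
 show "omega_in p E = of_bool (p : E)" if "prime p" for p
 proof -
  have "{q\<in>E. q dvd p} = (if p : E then {p} else {})" using E that by (auto dest: primes_dvd_imp_eq)
  thus ?thesis by (simp add: omega_in_def)
 qed
 show "omega_in (m * n) E = omega_in m E + omega_in n E" if "0 < m" "0 < n" "coprime m n" for m n
 proof -
  have e: "{p\<in>E. p dvd m * n} = {p\<in>E. p dvd m} \<union> {p\<in>E. p dvd n}" using E by (auto simp: prime_dvd_mult_iff)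
  have d: "{p\<in>E. p dvd m} \<inter> {p\<in>E. p dvd n} = {}"
  proof (rule ccontr)
   assume "{p\<in>E. p dvd m} \<inter> {p\<in>E. p dvd n} ~= {}"
   then obtain p where "p : E" "p dvd m" "p dvd n" by auto
   thus False using coprime_common_divisor_nat[OF that(3), of p] E by auto
  qed
  show ?thesis unfolding omega_in_def e by (rule card_Un_disjoint) (use fin that d in auto)
 qed
 show "omega_in (p ^ a) E <= a" if "prime p" for p a
 proof (cases "a = 0")
  case True
  thus ?thesis using \<open>omega_in 1 E = 0\<close> by simp
 next
  case False
  have "{q\<in>E. q dvd p ^ a} \<subseteq> {p}"
  proof clarify
   fix q assume "q : E" "q dvd p ^ a"
   thus "q = p" using E that prime_dvd_power[of q p a] primes_dvd_imp_eq[of q p] by auto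
  qed
  hence "omega_in (p ^ a) E <= card {p}" unfolding omega_in_def by (intro card_mono) auto
  thus ?thesis using False by simp
 qed
qed

lemma Omega_in_props:
 assumes E: "\<forall>p\<in>E. prime (p::nat)"
 shows "Omega_in 1 E = 0" "!!p. prime p ==> Omega_in p E = of_bool (p : E)"
  "!!m n. 0 < m ==> 0 < n ==> coprime m n ==> Omega_in (m * n) E = Omega_in m E + Omega_in n E"
  "!!p a. prime p ==> Omega_in (p ^ a) E <= a"
proof -
 let ?S = "%n. {(p, l). p : E & 0 < l & p ^ l dvd n}"
 have pw: "?S (p ^ a) = (%l. (p, l)) ` {l. p : E & 0 < l & l <= a}" if p: "prime p" for p a
 proof (intro equalityI subsetI)
  fix z assume "z : ?S (p ^ a)"
  then obtain q l where z: "z = (q, l)" "q : E" "0 < l" "q ^ l dvd p ^ a" by auto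
  have q: "prime q" using E z by auto
  have "q dvd q ^ l" using z by (simp add: dvd_power)
  hence "q dvd p ^ a" using z dvd_trans by blast
  hence "q = p" using q p prime_dvd_power primes_dvd_imp_eq by blast
  moreover have "l <= a" using z \<open>q = p\<close> p prime_gt_1_nat[OF p] by (simp add: power_dvd_imp_le)
  ultimately show "z : (%l. (p, l)) ` {l. p : E & 0 < l & l <= a}" using z by auto
 qed (auto intro: le_imp_power_dvd)
 have cpw: "Omega_in (p ^ a) E = card {l. p : E & 0 < l & l <= a}" if "prime p" for p a
  unfolding Omega_in_def pw[OF that] by (rule card_image) (auto simp: inj_on_def)
 show le: "Omega_in (p ^ a) E <= a" if "prime p" for p a
 proof -
  have "card {l. p : E & 0 < l & l <= a} <= card {1..a}" by (intro card_mono) auto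
  thus ?thesis unfolding cpw[OF that] by simp
 qed
 show "Omega_in 1 E = 0" using le[of 2 0] by simp
 show "Omega_in p E = of_bool (p : E)" if "prime p" for p
 proof -
  have "{l::nat. p : E & 0 < l & l <= 1} = (if p : E then {1} else {})" by auto
  hence "card {l::nat. p : E & 0 < l & l <= 1} = of_bool (p : E)" by (simp only:) simp
  thus ?thesis using cpw[OF that, of 1] by (simp only: power_one_right)
 qed
 show "Omega_in (m * n) E = Omega_in m E + Omega_in n E" if mn: "0 < m" "0 < n" "coprime m n" for m n
 proof -
  have fin: "finite (?S n)" if "0 < n" for n
  proof (rule finite_subset[of _ "{..n} \<times> {..n}"])
   show "?S n \<subseteq> {..n} \<times> {..n}"
   proof clarify
   fix p l assume h: "p : E" "0 < l" "p ^ l dvd n"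
   have p: "2 <= p" using E h prime_ge_2_nat by auto
   have "p ^ l <= n" using h that by (auto dest: dvd_imp_le)
   moreover have "p <= p ^ l" using h p by (simp add: self_le_power)
   moreover have "l <= p ^ l" using p self_le_ge2_pow by blast
   ultimately show "p : {..n} & l : {..n}" by auto
   qed
  qed simp
  have e: "?S (m * n) = ?S m \<union> ?S n"
  proof (intro equalityI subsetI)
   fix z assume "z : ?S (m * n)"
   then obtain q l where z: "z = (q, l)" "q : E" "0 < l" "q ^ l dvd m * n" by auto
   have q: "prime q" using E z by auto
   have "coprime q m \<or> coprime q n" using mn(3) q by (metis coprime_common_divisor_nat not_prime_1 prime_imp_coprime)
   thus "z : ?S m \<union> ?S n" using z by (auto simp: coprime_dvd_mult_left_iff coprime_dvd_mult_right_iff)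
  qed auto
  have d: "?S m \<inter> ?S n = {}"
  proof (rule ccontr)
   assume "?S m \<inter> ?S n ~= {}"
   then obtain q l where z: "q : E" "0 < l" "q ^ l dvd m" "q ^ l dvd n" by auto
   have "q dvd q ^ l" using z by (simp add: dvd_power)
   hence "q dvd m" "q dvd n" using z dvd_trans by blast+
   thus False using mn(3) E z(1) coprime_common_divisor_nat[of m n q] by auto
  qed
  show ?thesis unfolding Omega_in_def e by (rule card_Un_disjoint) (use fin mn d in auto)
 qed
qed

lemma sum_powr_bound:
 assumes "1 < s"
 shows "\<exists>C>0. \<forall>A. finite A --> (\<Sum>n\<in>A. real (n::nat) powr (-s)) <= C"
proof -
 have sm: "summable (%n. real n powr (-s))" using assms by (simp add: summable_real_powr_iff)
 have "(\<Sum>n\<in>A. real n powr (-s)) <= (\<Sum>n. real n powr (-s)) + 1" if "finite A" for A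
  using sum_le_suminf[OF sm that] by simp
 moreover have "0 <= (\<Sum>n. real n powr (-s))" by (intro suminf_nonneg sm) auto
 ultimately show ?thesis by (intro exI[of _ "(\<Sum>n. real n powr (-s)) + 1"]) auto
qed

section \<open>Rankin weights\<close>

text \<open>The loss in \<open>prime_sieve_upper\<close> caused by the primes dividing the
  cofactor.\<close>

definition rad_weight :: "nat => nat => real" where
 "rad_weight v m = exp (\<Sum>l\<in>prime_factors m. real v / real l)"

text \<open>What remains on the cofactor after its large prime has been summed out:
  \<open>f m / m\<close> with the sieve loss, times Rankin's factor \<open>m powr \<eta>\<close>,
  which exploits that a smooth cofactor is nevertheless large.\<close>

definition rankin_weight :: "(nat => real) => nat => real => nat => real" where
 "rankin_weight f v \<eta> m = f m * rad_weight v m * real m powr (\<eta> - 1)"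

lemma rad_weight_mult:
 assumes "0 < m" "0 < n" "coprime m n"
 shows "rad_weight v (m * n) = rad_weight v m * rad_weight v n"
proof -
 have e: "prime_factors (m * n) = prime_factors m \<union> prime_factors n" using assms by (simp add: prime_factors_product)
 have d: "prime_factors m \<inter> prime_factors n = {}"
  using assms(3) by (auto simp: in_prime_factors_iff dest: coprime_common_divisor_nat)
 show ?thesis unfolding rad_weight_def e by (subst sum.union_disjoint) (use d in \<open>auto simp: exp_add\<close>)
qed

lemma rad_weight_prime: "prime p ==> 0 < a ==> rad_weight v (p ^ a) = exp (real v / p)"
 by (simp add: rad_weight_def prime_factors_power prime_factorization_prime)

lemma rad_weight_ge_1: "1 <= rad_weight v m"
 by (auto simp: rad_weight_def intro!: sum_nonneg)

lemma rankin_weight_mult: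
 assumes f: "f : mult_class A1 A2"
 shows "rankin_weight f v \<eta> 1 = 1" "0 < n ==> 0 <= rankin_weight f v \<eta> n"
  "0 < m ==> 0 < n ==> coprime m n ==> rankin_weight f v \<eta> (m * n) = rankin_weight f v \<eta> m * rankin_weight f v \<eta> n"
 using mult_classD(1-3)[OF f] rad_weight_mult[of m n v]
 by (auto simp: rankin_weight_def powr_mult rad_weight_def)

lemma exp_minus_one_le: "0 <= u ==> exp u - 1 <= u * exp (u::real)"
proof -
 have "1 - u <= exp (-u)" using exp_ge_add_one_self[of "-u"] by simp
 hence "exp u * (1 - u) <= exp u * exp (-u)" by (intro mult_left_mono) auto
 thus ?thesis by (simp add: algebra_simps flip: exp_add)
qed

text \<open>For \<open>p <= y\<close> the condition \<open>\<eta> * ln y <= 1\<close> gives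
  \<open>p powr \<eta> = 1 + O(\<eta> * ln p)\<close>, and \<open>\<eta>\<close> times the sum of
  \<open>ln p / p\<close> is at most 5 by Mertens. The factor \<open>exp (v / p)\<close> costs a
  convergent sum of \<open>p powr (-2)\<close>.\<close>

lemma rankin_prime_sum:
 fixes A1 :: real and v :: nat
 assumes "0 < A1"
 shows "\<exists>C>0. \<forall>f A2 \<eta> y Q. f : mult_class A1 A2 --> 0 <= \<eta> --> 1 <= y --> \<eta> * ln y <= 1 --> \<eta> <= 1 --> Q \<subseteq> {p. prime p & real p <= y} -->
  (\<Sum>p\<in>Q. rankin_weight f v \<eta> p) <= (\<Sum>p\<in>Q. f p / p) + C"
proof -
 obtain C2 where C2: "C2 > 0" "!!A. finite A ==> (\<Sum>n\<in>A. real (n::nat) powr (-2)) <= C2"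
  using sum_powr_bound[of 2] by auto
 define C where "C = A1 * (exp 1 * (real v * exp v) * C2 + exp 1 * 5)"
 have C: "C > 0" using assms C2 by (auto simp: C_def intro!: mult_pos_pos add_nonneg_pos)
 have "(\<Sum>p\<in>Q. rankin_weight f v \<eta> p) <= (\<Sum>p\<in>Q. f p / p) + C"
  if f: "f : mult_class A1 A2" and e: "0 <= \<eta>" "1 <= y" "\<eta> * ln y <= 1" "\<eta> <= 1" and Q: "Q \<subseteq> {p. prime p & real p <= y}" for f A2 \<eta> y Q
 proof -
  have fQ: "finite Q" by (rule finite_subset[OF Q]) simp
  have "rankin_weight f v \<eta> p <= f p / p + A1 * (exp 1 * (real v * exp v) * real p powr (-2) + exp 1 * \<eta> * (ln p / p))" if "p : Q" for p
  proof -
   have p: "prime p" "real p <= y" "real p >= 1" using that Q by (auto simp: prime_gt_0_nat Suc_leI)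
   have f0: "0 <= f p" "f p <= A1" using mult_classD(2)[OF f, of p] mult_classD(4)[OF f, of p] p by (auto simp: prime_gt_0_nat)
   have u: "0 <= \<eta> * ln p" "\<eta> * ln p <= 1"
   proof -
   show "0 <= \<eta> * ln p" using e p by simp
   have "\<eta> * ln p <= \<eta> * ln y" using e p by (intro mult_left_mono) auto
   thus "\<eta> * ln p <= 1" using e by simp
   qed
   have vp: "real v / p <= real v" using p mult_left_mono[of 1 "real p" "real v"] by (simp add: divide_le_eq)
   have "real p powr (\<eta> - 1) = real p powr \<eta> / real p powr 1" by (rule powr_diff)
   moreover have "real p powr \<eta> = exp (\<eta> * ln p)" using p by (simp add: powr_def)
   ultimately have pe: "real p powr (\<eta> - 1) = exp (\<eta> * ln p) / p" using p by simp
   have "exp (\<eta> * ln p) <= exp 1" using u by simp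
   moreover have "exp (\<eta> * ln p) - 1 <= (\<eta> * ln p) * exp (\<eta> * ln p)" using u by (intro exp_minus_one_le) auto
   ultimately have 1: "exp (\<eta> * ln p) - 1 <= (\<eta> * ln p) * exp 1"
   using u by (smt (verit) mult_left_mono)
   have "exp (real v / p) - 1 <= (real v / p) * exp (real v / p)" by (intro exp_minus_one_le) auto
   also have "\<dots> <= (real v / p) * exp v" using vp by (intro mult_left_mono) auto
   finally have 2: "exp (real v / p) - 1 <= real v * exp v / p" by simp
   have "exp (real v / p) * exp (\<eta> * ln p) - 1 = (exp (real v / p) - 1) * exp (\<eta> * ln p) + (exp (\<eta> * ln p) - 1)" by (simp add: algebra_simps)
   also have "\<dots> <= (real v * exp v / p) * exp 1 + (\<eta> * ln p) * exp 1"
   using 1 2 \<open>exp (\<eta> * ln p) <= exp 1\<close> by (intro add_mono mult_mono) auto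
   finally have 3: "exp (real v / p) * exp (\<eta> * ln p) <= 1 + ((real v * exp v / p) * exp 1 + (\<eta> * ln p) * exp 1)" by simp
   have "rankin_weight f v \<eta> p = f p / p * (exp (real v / p) * exp (\<eta> * ln p))"
   using rad_weight_prime[OF p(1), of 1 v] pe by (simp add: rankin_weight_def)
   also have "\<dots> <= f p / p * (1 + ((real v * exp v / p) * exp 1 + (\<eta> * ln p) * exp 1))"
   using 3 f0 by (intro mult_left_mono) auto
   also have "\<dots> = f p / p + f p * (1 / p * ((real v * exp v / p) * exp 1 + (\<eta> * ln p) * exp 1))" by (simp add: algebra_simps add_divide_distrib)
   also have "\<dots> <= f p / p + A1 * (1 / p * ((real v * exp v / p) * exp 1 + (\<eta> * ln p) * exp 1))"
   proof -
   have "0 <= 1 / p * ((real v * exp v / p) * exp 1 + (\<eta> * ln p) * exp 1)"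
   using u p e by (intro mult_nonneg_nonneg add_nonneg_nonneg) auto
   thus ?thesis using f0 by (intro add_left_mono mult_right_mono)
   qed
   also have "1 / p * ((real v * exp v / p) * exp 1 + (\<eta> * ln p) * exp 1) = exp 1 * (real v * exp v) * real p powr (-2) + exp 1 * \<eta> * (ln p / p)"
   using p by (simp add: powr_minus powr_numeral power2_eq_square field_simps)
   finally show ?thesis .
  qed
  hence "(\<Sum>p\<in>Q. rankin_weight f v \<eta> p) <= (\<Sum>p\<in>Q. f p / p + A1 * (exp 1 * (real v * exp v) * real p powr (-2) + exp 1 * \<eta> * (ln p / p)))"
   by (rule sum_mono)
  also have "\<dots> = (\<Sum>p\<in>Q. f p / p) + A1 * (exp 1 * (real v * exp v) * (\<Sum>p\<in>Q. real p powr (-2)) + exp 1 * (\<eta> * (\<Sum>p\<in>Q. ln p / p)))"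
   by (simp add: sum.distrib sum_distrib_left mult_ac distrib_left)
  also have "\<dots> <= (\<Sum>p\<in>Q. f p / p) + A1 * (exp 1 * (real v * exp v) * C2 + exp 1 * 5)"
  proof (intro add_mono mult_left_mono order_refl)
   show "(\<Sum>p\<in>Q. real p powr (-2)) <= C2" by (rule C2(2)[OF fQ])
   have "(\<Sum>p\<in>Q. ln p / p) <= (\<Sum>p | prime p & real p <= y. ln (real p) / p)"
   by (intro sum_mono2 Q) (auto simp: prime_gt_0_nat Suc_leI)
   also have "\<dots> <= ln y + 4" by (rule prime_log_sum_le[OF e(2)])
   finally have "\<eta> * (\<Sum>p\<in>Q. ln p / p) <= \<eta> * (ln y + 4)" using e by (intro mult_left_mono)
   also have "\<dots> <= 5" using e by (simp add: algebra_simps)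
   finally show "\<eta> * (\<Sum>p\<in>Q. ln p / p) <= 5" .
  qed (use assms in auto)
  finally show ?thesis by (simp add: C_def)
 qed
 thus ?thesis using C by blast
qed

lemma two_powr_08: "172/100 <= (2::real) powr (4/5)"
proof -
 have "((172/100::real)) ^ 5 <= 2 ^ 4" by (simp add: eval_nat_numeral)
 also have "(2::real) ^ 4 = (2 powr (4/5)) ^ 5" by (simp add: powr_powr flip: powr_realpow)
 finally show ?thesis by (subst (asm) power_mono_iff) auto
qed

text \<open>A geometric series of ratio \<open>q = 3/2 * p powr (-4/5)\<close>, where 4/5 is 1 minus
  1/10 for the growth of \<open>f\<close> and 1/10 for \<open>\<eta>\<close>. At
  \<open>p = 2\<close> the ratio is still below 9/10. The cap on \<open>r\<close> reflects that
  \<open>Omega_in\<close> may count powers of 2, for which convergence fails at \<open>r = 2\<close>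
  in general.\<close>

lemma rankin_tail_sum:
 fixes v :: nat and K :: real
 assumes "0 < K"
 shows "\<exists>C>0. \<forall>f A1 A2 \<eta> Q A g r. f : mult_class A1 A2 --> A2 (1/10) = K --> 0 <= \<eta> --> \<eta> <= 1/10 --> finite Q --> Q \<subseteq> {p. prime p} -->
  (\<forall>p a. prime p --> g (p ^ a) <= (a::nat)) --> 0 <= r --> r <= 3/2 -->
  (\<Sum>p\<in>Q. \<Sum>a=2..A. rankin_weight f v \<eta> (p ^ a) * r ^ g (p ^ a)) <= C * (\<Sum>p\<in>Q. real p powr (-(8/5)))"
proof -
 define C where "C = K * exp v * 225/10"
 have C: "C > 0" using assms by (simp add: C_def)
 have "(\<Sum>p\<in>Q. \<Sum>a=2..A. rankin_weight f v \<eta> (p ^ a) * r ^ g (p ^ a)) <= C * (\<Sum>p\<in>Q. real p powr (-(8/5)))"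
  if f: "f : mult_class A1 A2" "A2 (1/10) = K" and e: "0 <= \<eta>" "\<eta> <= 1/10" and Q: "finite Q" "Q \<subseteq> {p. prime p}"
  and g: "\<forall>p a. prime p --> g (p ^ a) <= (a::nat)" and r: "0 <= r" "r <= 3/2" for f A1 A2 \<eta> Q A g r
  unfolding sum_distrib_left
 proof (intro sum_mono)
  fix p assume "p : Q"
  hence p: "prime p" "real p >= 2" using Q prime_ge_2_nat[of p] by auto
  define q where "q = 3/2 * real p powr (-(4/5))"
  have q0: "q > 0" using p by (simp add: q_def)
  have "real p powr (-(4/5)) <= 2 powr (-(4/5))" using p by (intro powr_mono2') auto
  also have "\<dots> <= 1 / (172/100)" using two_powr_08 by (simp add: powr_minus field_simps)
  finally have q9: "q <= 9/10" by (simp add: q_def)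
  have trm: "rankin_weight f v \<eta> (p ^ a) * r ^ g (p ^ a) <= K * exp v * q ^ a" if a: "a : {2..A}" for a
  proof -
   have pa: "0 < p ^ a" using p by simp
   have "f (p ^ a) <= K * real (p ^ a) powr (1/10)" using mult_classD(5)[OF f(1), of "1/10" "p ^ a"] f(2) pa by simp
   moreover have "rad_weight v (p ^ a) <= exp v"
   proof -
   have "real v / p <= real v" using p mult_left_mono[of 1 "real p" "real v"] by (simp add: divide_le_eq)
   thus ?thesis using rad_weight_prime[OF p(1), of a v] a by simp
   qed
   moreover have "real (p ^ a) powr (\<eta> - 1) <= real (p ^ a) powr (1/10 - 1)"
   proof (rule powr_mono)
   show "1 <= real (p ^ a)" using pa by (simp only: real_of_nat_ge_one_iff Suc_le_eq One_nat_def)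
   qed (use e in auto)
   moreover have "r ^ g (p ^ a) <= (3/2) ^ a"
   proof -
   have "r ^ g (p ^ a) <= (3/2) ^ g (p ^ a)" using r by (intro power_mono) auto
   also have "\<dots> <= (3/2) ^ a" using g p by (intro power_increasing) auto
   finally show ?thesis .
   qed
   ultimately have "rankin_weight f v \<eta> (p ^ a) * r ^ g (p ^ a) <= (K * real (p ^ a) powr (1/10)) * exp v * real (p ^ a) powr (1/10 - 1) * (3/2) ^ a"
   unfolding rankin_weight_def using mult_classD(2)[OF f(1) pa] rad_weight_ge_1[of v "p ^ a"] r assms
   by (intro mult_mono) (auto intro!: mult_nonneg_nonneg)
   also have "\<dots> = K * exp v * ((real (p ^ a) powr (1/10) * real (p ^ a) powr (1/10 - 1)) * (3/2) ^ a)" by (simp only: mult_ac)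
   also have "real (p ^ a) powr (1/10) * real (p ^ a) powr (1/10 - 1) = (real p powr (-(4/5))) ^ a"
   proof -
   have "real (p ^ a) powr (1/10) * real (p ^ a) powr (1/10 - 1) = real (p ^ a) powr (-(4/5))" by (simp flip: powr_add)
   also have "\<dots> = (real p powr (-(4/5))) ^ a" using p by (simp add: powr_powr mult.commute flip: powr_realpow)
   finally show ?thesis .
   qed
   also have "(real p powr (-(4/5))) ^ a * (3/2) ^ a = q ^ a" by (simp only: q_def mult.commute[of "3/2"] power_mult_distrib)
   finally show ?thesis .
  qed
  have geo: "(\<Sum>a=2..A. q ^ a) <= q ^ 2 / (1 - q)"
  proof (cases "2 <= A")
   case True
   have "(\<Sum>a=2..A. q ^ a) = (\<Sum>a=0..A - 2. q ^ (a + 2))" using sum.shift_bounds_cl_nat_ivl[of "%a. q ^ a" 0 2 "A - 2"] unfolding le_add_diff_inverse2[OF True] add_0 .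
   also have "\<dots> = q ^ 2 * (\<Sum>a=0..A - 2. q ^ a)" by (simp add: sum_distrib_left power_add power2_eq_square mult_ac)
   also have "(\<Sum>a=0..A - 2. q ^ a) <= 1 / (1 - q)"
   proof -
   have "(1 - q) * (\<Sum>a\<le>A - 2. q ^ a) = 1 - q ^ Suc (A - 2)" by (rule sum_gp_basic)
   also have "\<dots> <= 1" using q0 by simp
   finally show ?thesis using q9 by (simp add: field_simps atLeast0AtMost)
   qed
   finally show ?thesis using q0 by (simp add: mult_left_mono)
  qed (use q0 q9 in auto)
  have "(\<Sum>a=2..A. rankin_weight f v \<eta> (p ^ a) * r ^ g (p ^ a)) <= (\<Sum>a=2..A. K * exp v * q ^ a)" by (intro sum_mono trm)
  also have "\<dots> = K * exp v * (\<Sum>a=2..A. q ^ a)" by (simp add: sum_distrib_left)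
  also have "\<dots> <= K * exp v * (q ^ 2 / (1 - q))" using geo assms by (intro mult_left_mono) auto
  also have "\<dots> <= K * exp v * (q ^ 2 / (1/10))" using q9 assms by (intro mult_left_mono divide_left_mono) auto
  also have "q ^ 2 = 9/4 * real p powr (-(8/5))" using p by (simp add: q_def power_mult_distrib power2_eq_square flip: powr_add)
  finally show "(\<Sum>a=2..A. rankin_weight f v \<eta> (p ^ a) * r ^ g (p ^ a)) <= C * real p powr (-(8/5))" by (simp add: C_def)
 qed
 thus ?thesis using C by blast
qed

lemma powr_diff_one: "x powr (\<eta> - 1) = x powr \<eta> * x powr (- 1 :: real)" for x :: real
 using powr_add[of x \<eta> "- 1"] by (simp only: add_uminus_conv_diff)

lemma card_nat_real_le:
 assumes "A \<subseteq> {n. 0 < n & real n <= y}" "0 <= y"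
 shows "real (card A) <= y"
proof -
 have "card A <= card {1..nat \<lfloor>y\<rfloor>}" using assms by (intro card_mono) (auto simp: real_le_iff_nat_floor)
 hence "real (card A) <= real (nat \<lfloor>y\<rfloor>)" by simp
 also have "\<dots> <= y" using assms(2) by (rule of_nat_floor)
 finally show ?thesis .
qed

section \<open>Moments and coefficients over smooth numbers\<close>

text \<open>The common interface of \<open>omega_in\<close> and \<open>Omega_in\<close>. The zero
  function with empty \<open>E\<close> is included so that plain masses are a special case.\<close>

definition additive_fun :: "(nat => nat) => nat set => bool" where
 "additive_fun g E \<longleftrightarrow> g 1 = 0 & (\<forall>m>0. \<forall>n>0. coprime m n --> g (m * n) = g m + g n) \<and>
  (\<forall>p. prime p --> g p = of_bool (p : E)) & (\<forall>p a. prime p --> g (p ^ a) <= a)"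

lemma additive_fun_zero: "additive_fun (%_. 0) {}"
 by (simp add: additive_fun_def)

lemma additive_fun_omega: "\<forall>p\<in>E. prime p ==> additive_fun (%n. omega_in n E) E"
 using omega_in_props[of E] by (auto simp: additive_fun_def)

lemma smooth_weight_locale:
 assumes "f : mult_class A1 A2" "additive_fun g E" "Q \<subseteq> {p. prime p & real p <= y}" "1 <= A"
 shows "additive_weight (rankin_weight f v \<eta>) g E Q A"
proof
 show "finite Q" by (rule finite_subset[OF assms(3)]) simp
qed (use assms rankin_weight_mult[OF assms(1)] in \<open>auto simp: additive_fun_def\<close>)

lemma smooth_tail_bound:
 fixes A1 :: real and A2 :: "real => real" and v :: nat
 assumes "0 < A2 (1/10)"
 shows "\<exists>C>0. \<forall>f g E \<eta> y Q A r. f : mult_class A1 A2 --> additive_fun g E --> 0 <= \<eta> --> \<eta> <= 1/10 -->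
  Q \<subseteq> {p. prime p & real p <= y} --> 1 <= A --> 0 <= r --> r <= 3/2 -->
  (\<Sum>p\<in>Q. poly (additive_weight.tail (rankin_weight f v \<eta>) g A p) r) <= C"
proof -
 obtain C1 where C1: "C1 > 0" "!!f A1 A2' \<eta> Q A g r. f : mult_class A1 A2' ==> A2' (1/10) = A2 (1/10) ==> 0 <= \<eta> ==> \<eta> <= 1/10 ==> finite Q ==> Q \<subseteq> {p. prime p} ==>
  (\<forall>p a. prime p --> g (p ^ a) <= (a::nat)) ==> 0 <= r ==> r <= 3/2 ==>
  (\<Sum>p\<in>Q. \<Sum>a=2..A. rankin_weight f v \<eta> (p ^ a) * r ^ g (p ^ a)) <= C1 * (\<Sum>p\<in>Q. real p powr (-(8/5)))"
  using rankin_tail_sum[OF assms, of v] by atomize_elim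
 obtain C2 where C2: "C2 > 0" "!!A. finite A ==> (\<Sum>n\<in>A. real (n::nat) powr (-(8/5))) <= C2"
  using sum_powr_bound[of "8/5"] by auto
 have "(\<Sum>p\<in>Q. poly (additive_weight.tail (rankin_weight f v \<eta>) g A p) r) <= C1 * C2"
  if H: "f : mult_class A1 A2" "additive_fun g E" "0 <= \<eta>" "\<eta> <= 1/10" "Q \<subseteq> {p. prime p & real p <= y}" "1 <= A" "0 <= r" "r <= 3/2"
  for f g E \<eta> y Q A r
 proof -
  interpret additive_weight "rankin_weight f v \<eta>" g E Q A by (rule smooth_weight_locale[OF H(1,2,5,6)])
  have "(\<Sum>p\<in>Q. poly (tail p) r) = (\<Sum>p\<in>Q. \<Sum>a=2..A. rankin_weight f v \<eta> (p ^ a) * r ^ g (p ^ a))"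
   by (simp add: tail_def poly_sum poly_monom)
  also have "\<dots> <= C1 * (\<Sum>p\<in>Q. real p powr (-(8/5)))"
   by (rule C1(2)[OF H(1)]) (use H Q in \<open>auto simp: additive_fun_def\<close>)
  also have "\<dots> <= C1 * C2" using C1(1) C2(2)[OF Q(1)] by (intro mult_left_mono) auto
  finally show ?thesis .
 qed
 thus ?thesis using C1(1) C2(1) by (intro exI[of _ "C1 * C2"]) auto
qed

lemma smooth_moment:
 fixes A1 :: real and A2 :: "real => real" and v :: nat
 assumes "0 < A1" "0 < A2 (1/10)"
 shows "\<exists>C>0. \<forall>f g E \<eta> y Q A r. f : mult_class A1 A2 --> additive_fun g E --> 0 <= \<eta> --> \<eta> <= 1/10 --> 1 <= y --> \<eta> * ln y <= 1 -->
  Q \<subseteq> {p. prime p & real p <= y} --> 1 <= A --> 0 <= r --> r <= 3/2 -->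
  (\<Sum>m\<in>smooth_set Q A. rankin_weight f v \<eta> m * r ^ g m) <= C * exp ((\<Sum>p\<in>Q - E. f p / p) + r * (\<Sum>p\<in>Q \<inter> E. f p / p))"
proof -
 obtain C1 where C1: "C1 > 0" "!!f A2 \<eta> y Q. f : mult_class A1 A2 ==> 0 <= \<eta> ==> 1 <= y ==> \<eta> * ln y <= 1 ==> \<eta> <= 1 ==> Q \<subseteq> {p. prime p & real p <= y} ==>
  (\<Sum>p\<in>Q. rankin_weight f v \<eta> p) <= (\<Sum>p\<in>Q. f p / p) + C1"
  using rankin_prime_sum[OF assms(1), of v] by atomize_elim
 obtain C2 where C2: "C2 > 0" "!!f g E \<eta> y Q A r. f : mult_class A1 A2 ==> additive_fun g E ==> 0 <= \<eta> ==> \<eta> <= 1/10 ==>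
  Q \<subseteq> {p. prime p & real p <= y} ==> 1 <= A ==> 0 <= r ==> r <= 3/2 ==>
  (\<Sum>p\<in>Q. poly (additive_weight.tail (rankin_weight f v \<eta>) g A p) r) <= C2"
  using smooth_tail_bound[where ?A1.0 = A1 and ?A2.0 = A2 and v = v, OF assms(2)] by atomize_elim
 have "(\<Sum>m\<in>smooth_set Q A. rankin_weight f v \<eta> m * r ^ g m) <= exp (C1 + 3/2 * C1 + C2) * exp ((\<Sum>p\<in>Q - E. f p / p) + r * (\<Sum>p\<in>Q \<inter> E. f p / p))"
  if H: "f : mult_class A1 A2" "additive_fun g E" "0 <= \<eta>" "\<eta> <= 1/10" "1 <= y" "\<eta> * ln y <= 1" "Q \<subseteq> {p. prime p & real p <= y}" "1 <= A" "0 <= r" "r <= 3/2"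
  for f g E \<eta> y Q A r
 proof -
  interpret additive_weight "rankin_weight f v \<eta>" g E Q A by (rule smooth_weight_locale[OF H(1,2,7,8)])
  have a: "(\<Sum>p\<in>Q - E. rankin_weight f v \<eta> p) <= (\<Sum>p\<in>Q - E. f p / p) + C1"
   by (rule C1(2)[OF H(1,3,5,6)]) (use H in auto)
  have "(\<Sum>p\<in>Q \<inter> E. rankin_weight f v \<eta> p) <= (\<Sum>p\<in>Q \<inter> E. f p / p) + C1"
   by (rule C1(2)[OF H(1,3,5,6)]) (use H in auto)
  hence "r * (\<Sum>p\<in>Q \<inter> E. rankin_weight f v \<eta> p) <= r * ((\<Sum>p\<in>Q \<inter> E. f p / p) + C1)" using H by (intro mult_left_mono) auto
  also have "\<dots> <= r * (\<Sum>p\<in>Q \<inter> E. f p / p) + 3/2 * C1" using H(10) C1(1) by (simp add: distrib_left)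
  finally have b: "r * (\<Sum>p\<in>Q \<inter> E. rankin_weight f v \<eta> p) <= r * (\<Sum>p\<in>Q \<inter> E. f p / p) + 3/2 * C1" .
  have c: "(\<Sum>p\<in>Q. poly (tail p) r) <= C2" by (rule C2(2)[OF H(1-4,7-10)])
  show ?thesis
   by (rule order_trans[OF moment_le[OF H(9)]]) (use a b c in \<open>simp flip: exp_add\<close>)
 qed
 thus ?thesis by (intro exI[of _ "exp (C1 + 3/2 * C1 + C2)"]) auto
qed

text \<open>\<open>C'\<close> is the constant of \<open>rankin_prime_sum\<close>: the Poisson
  parameter must dominate the sum of the Rankin weights, which exceeds that of
  \<open>f p / p\<close> by a bounded amount. A bounded shift is harmless for \<open>k\<close> of
  the order of the mean.\<close>

lemma smooth_coeff:
 fixes A1 :: real and A2 :: "real => real" and v :: nat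
 assumes "0 < A1" "0 < A2 (1/10)"
 shows "\<exists>C>0. \<exists>C'>0. \<forall>f g E \<eta> y Q A S k. f : mult_class A1 A2 --> additive_fun g E --> 0 <= \<eta> --> \<eta> <= 1/10 --> 1 <= y --> \<eta> * ln y <= 1 -->
  Q \<subseteq> {p. prime p & real p <= y} --> 1 <= A --> 0 < S --> (\<Sum>p\<in>Q \<inter> E. f p / p) + C' <= S --> real k <= 3/2 * S -->
  (\<Sum>m | m : smooth_set Q A & g m = k. rankin_weight f v \<eta> m) <= C * exp (\<Sum>p\<in>Q - E. f p / p) * (S ^ k / fact k)"
proof -
 obtain C1 where C1: "C1 > 0" "!!f A2 \<eta> y Q. f : mult_class A1 A2 ==> 0 <= \<eta> ==> 1 <= y ==> \<eta> * ln y <= 1 ==> \<eta> <= 1 ==> Q \<subseteq> {p. prime p & real p <= y} ==>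
  (\<Sum>p\<in>Q. rankin_weight f v \<eta> p) <= (\<Sum>p\<in>Q. f p / p) + C1"
  using rankin_prime_sum[OF assms(1), of v] by atomize_elim
 obtain C2 where C2: "C2 > 0" "!!f g E \<eta> y Q A r. f : mult_class A1 A2 ==> additive_fun g E ==> 0 <= \<eta> ==> \<eta> <= 1/10 ==>
  Q \<subseteq> {p. prime p & real p <= y} ==> 1 <= A ==> 0 <= r ==> r <= 3/2 ==>
  (\<Sum>p\<in>Q. poly (additive_weight.tail (rankin_weight f v \<eta>) g A p) r) <= C2"
  using smooth_tail_bound[where ?A1.0 = A1 and ?A2.0 = A2 and v = v, OF assms(2)] by atomize_elim
 have "(\<Sum>m | m : smooth_set Q A & g m = k. rankin_weight f v \<eta> m) <= exp (C1 + C2) * exp (\<Sum>p\<in>Q - E. f p / p) * (S ^ k / fact k)"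
  if H: "f : mult_class A1 A2" "additive_fun g E" "0 <= \<eta>" "\<eta> <= 1/10" "1 <= y" "\<eta> * ln y <= 1" "Q \<subseteq> {p. prime p & real p <= y}" "1 <= A"
   "0 < S" "(\<Sum>p\<in>Q \<inter> E. f p / p) + C1 <= S" "real k <= 3/2 * S"
  for f g E \<eta> y Q A S k
 proof -
  interpret additive_weight "rankin_weight f v \<eta>" g E Q A by (rule smooth_weight_locale[OF H(1,2,7,8)])
  have a: "(\<Sum>p\<in>Q - E. rankin_weight f v \<eta> p) <= (\<Sum>p\<in>Q - E. f p / p) + C1"
   by (rule C1(2)[OF H(1,3,5,6)]) (use H in auto)
  have "(\<Sum>p\<in>Q \<inter> E. rankin_weight f v \<eta> p) <= (\<Sum>p\<in>Q \<inter> E. f p / p) + C1"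
   by (rule C1(2)[OF H(1,3,5,6)]) (use H in auto)
  hence b: "(\<Sum>p\<in>Q \<inter> E. rankin_weight f v \<eta> p) <= S" using H(10) by linarith
  have c: "(\<Sum>p\<in>Q. poly (tail p) (3/2)) <= C2" by (rule C2(2)[OF H(1-4,7,8)]) auto
  have "(\<Sum>m | m : smooth_set Q A & g m = k. rankin_weight f v \<eta> m) \<le>
   exp ((\<Sum>p\<in>Q - E. rankin_weight f v \<eta> p) + (\<Sum>p\<in>Q. poly (tail p) (3/2))) * (S ^ k / fact k)"
   by (rule coeff_weight_le) (use b H in auto)
  also have "\<dots> <= (exp (C1 + C2) * exp (\<Sum>p\<in>Q - E. f p / p)) * (S ^ k / fact k)"
   using a c H(9) by (intro mult_right_mono) (simp_all flip: exp_add)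
  finally show ?thesis .
 qed
 thus ?thesis using C1(1) by (intro exI[of _ "exp (C1 + C2)"] conjI exI[of _ C1]) auto
qed

section \<open>Lower bound for the sum of f\<close>

text \<open>Only squarefree \<open>w\<close>-smooth \<open>m\<close> are used, with
  \<open>x powr (1/4) = w powr \<kappa>\<close>. By Rankin's trick with
  \<open>\<eta> = 1 / ln w\<close> the part beyond this bound is at most
  \<open>exp (- \<kappa>)\<close> times a product that exceeds the full one by at most
  \<open>exp (5 * exp 1 * A1)\<close>. The primes between \<open>w\<close> and \<open>x\<close>
  change the mean by a bounded amount.\<close>

lemma sum_div_ge_of_mean:
 fixes A1 :: real
 assumes A1: "0 < A1"
 shows "\<exists>c>0. \<exists>X0\<ge>2. \<forall>f A2 x. f : mult_class A1 A2 --> X0 <= x -->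
  c * exp (prime_mean f x UNIV) <= (\<Sum>m | 0 < m & real m <= x powr (1/4). f m / m)"
proof -
 \<comment> \<open>One more than the exponent lost in the product, so that at most
   \<open>exp (-1) <= 1/2\<close> of the mass is cut off.\<close>
 define \<kappa> where "\<kappa> = 5 * exp 1 * A1 + 1"
 have k1: "\<kappa> >= 1" using A1 by (simp add: \<kappa>_def)
 obtain C2 where C2: "C2 > 0" "!!A. finite A ==> (\<Sum>n\<in>A. real (n::nat) powr (-2)) <= C2"
  using sum_powr_bound[of 2] by auto
 define c where "c = exp (- (A1 * (ln (4 * \<kappa>) + 8)) - A1\<^sup>2 * C2) / 2"
 have "c * exp (prime_mean f x UNIV) <= (\<Sum>m | 0 < m & real m <= x powr (1/4). f m / m)"
  if f: "f : mult_class A1 A2" and x: "exp (4 * \<kappa>) <= x" for f A2 x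
 proof -
  define z where "z = x powr (1/4)"
  define w where "w = x powr (1 / (4 * \<kappa>))"
  have x0: "x > 0" using x exp_gt_zero[of "4 * \<kappa>"] by linarith
  have lnx: "ln x >= 4 * \<kappa>" using x x0 by (simp add: ln_ge_iff)
  have lnw: "ln w = ln x / (4 * \<kappa>)" "ln w >= 1"
   using x0 lnx k1 by (simp_all add: w_def ln_powr)
  have lnz: "ln z = \<kappa> * ln w" "z > 0" "w > 0"
   using x0 k1 by (simp_all add: lnw(1) z_def w_def ln_powr)
  have w1: "w >= exp 1" using lnw(2) lnz(3) by (simp add: ln_ge_iff)
  have w2: "w >= 2" using w1 exp_ge_add_one_self[of "1::real"] by linarith
  have wx: "w <= x"
  proof -
   have "ln w <= ln x" unfolding lnw(1) using lnx k1 mult_left_mono[of 1 "4 * \<kappa>" "ln x"] by (simp add: divide_le_eq)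
   thus ?thesis using lnz x0 by simp
  qed
  define Q where "Q = {p. prime p & real p <= w}"
  have Q: "finite Q" "!!p. p : Q ==> prime p" by (auto simp: Q_def)
  have f0: "0 <= f p" "f p <= A1" if "prime p" for p using mult_classD(2,4)[OF f, of p] that by (auto simp: prime_gt_0_nat)
  define \<eta> where "\<eta> = 1 / ln w"
  define F where "F = (%m. f m * real m powr (-1))"
  define G where "G = (%m. f m * real m powr (\<eta> - 1))"
  have prodF: "(\<Sum>m\<in>smooth_set Q 1. F m) = (\<Prod>p\<in>Q. 1 + F p)"
  proof -
   have m: "F 1 = 1" "!!m n. 0 < m ==> 0 < n ==> coprime m n ==> F (m * n) = F m * F n"
   unfolding F_def using mult_classD(1)[OF f] mult_classD(3)[OF f] by (simp_all add: powr_mult)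
   have "(\<Sum>a\<le>1. F (p ^ a)) = 1 + F p" for p using m(1) by simp
   thus ?thesis using euler_product[OF Q m, of 1] by simp
  qed
  have prodG: "(\<Sum>m\<in>smooth_set Q 1. G m) = (\<Prod>p\<in>Q. 1 + G p)"
  proof -
   have m: "G 1 = 1" "!!m n. 0 < m ==> 0 < n ==> coprime m n ==> G (m * n) = G m * G n"
   unfolding G_def using mult_classD(1)[OF f] mult_classD(3)[OF f] by (simp_all add: powr_mult)
   have "(\<Sum>a\<le>1. G (p ^ a)) = 1 + G p" for p using m(1) by simp
   thus ?thesis using euler_product[OF Q m, of 1] by simp
  qed
  have pF: "0 < (\<Prod>p\<in>Q. 1 + F p)" using f0 Q by (intro prod_pos) (auto simp: F_def intro!: add_pos_nonneg)
  have GF: "(1 + G p) <= (1 + F p) * exp (A1 * (exp 1 * (\<eta> * (ln p / p))))" if "p : Q" for p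
  proof -
   have p: "prime p" "real p >= 1" "real p <= w" using that by (auto simp: Q_def prime_gt_0_nat Suc_leI)
   have u: "0 <= \<eta> * ln p" "\<eta> * ln p <= 1"
   proof -
   have "ln p <= ln w" using p by simp
   thus "\<eta> * ln p <= 1" using lnw(2) by (simp add: \<eta>_def)
   show "0 <= \<eta> * ln p" using p lnw(2) by (simp add: \<eta>_def)
   qed
   have "real p powr (\<eta> - 1) = real p powr \<eta> * real p powr (-1)" by (rule powr_diff_one)
   moreover have "real p powr \<eta> = exp (\<eta> * ln p)" using p by (simp add: powr_def)
   moreover have "real p powr (-1) = 1 / p" using p by (simp add: powr_minus_divide)
   ultimately have "G p = f p * (exp (\<eta> * ln p) * (1 / p))" "F p = f p * (1 / p)" by (simp_all only: G_def F_def)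
   hence e: "G p - F p = f p * ((exp (\<eta> * ln p) - 1) / p)" by (simp add: diff_divide_distrib algebra_simps)
   have "exp (\<eta> * ln p) - 1 <= (\<eta> * ln p) * exp (\<eta> * ln p)" using u by (intro exp_minus_one_le) auto
   also have "\<dots> <= (\<eta> * ln p) * exp 1" using u by (intro mult_left_mono) auto
   finally have "(exp (\<eta> * ln p) - 1) / p <= (\<eta> * ln p) * exp 1 / p" using p by (intro divide_right_mono) auto
   hence "G p - F p <= A1 * ((\<eta> * ln p) * exp 1 / p)" unfolding e using f0[OF p(1)] u A1 by (intro mult_mono) auto
   hence d: "G p <= F p + A1 * (exp 1 * (\<eta> * (ln p / p)))" by (simp add: mult_ac)
   have F0: "F p >= 0" using f0[OF p(1)] by (simp add: F_def)
   have d0: "0 <= A1 * (exp 1 * (\<eta> * (ln p / p)))"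
   proof -
   have "0 <= (\<eta> * ln p) / p" using u p by simp
   hence "0 <= A1 * (exp 1 * ((\<eta> * ln p) / p))" using A1 by (intro mult_nonneg_nonneg) auto
   thus ?thesis by simp
   qed
   have "1 + G p <= (1 + F p) * (1 + A1 * (exp 1 * (\<eta> * (ln p / p))))"
   proof -
   have "1 + g <= (1 + a) * (1 + b)" if "g <= a + b" "0 <= a" "0 <= b" for g a b :: real
   proof -
   have "(1 + a) * (1 + b) = 1 + a + b + a * b" by (simp add: algebra_simps)
   thus ?thesis using that(1) mult_nonneg_nonneg[OF that(2,3)] by linarith
   qed
   thus ?thesis using d F0 d0 by blast
   qed
   also have "\<dots> <= (1 + F p) * exp (A1 * (exp 1 * (\<eta> * (ln p / p))))" using F0 by (intro mult_left_mono) auto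
   finally show ?thesis .
  qed
  have "(\<Prod>p\<in>Q. 1 + G p) <= (\<Prod>p\<in>Q. (1 + F p) * exp (A1 * (exp 1 * (\<eta> * (ln p / p)))))"
   by (intro prod_mono conjI GF) (use f0 Q in \<open>auto simp: G_def intro!: add_nonneg_nonneg\<close>)
  also have "\<dots> = (\<Prod>p\<in>Q. 1 + F p) * exp (A1 * (exp 1 * (\<eta> * (\<Sum>p\<in>Q. ln p / p))))"
   using Q by (simp add: prod.distrib exp_sum sum_distrib_left)
  also have "\<dots> <= (\<Prod>p\<in>Q. 1 + F p) * exp (A1 * (exp 1 * 5))"
  proof (intro mult_left_mono)
   have "(\<Sum>p\<in>Q. ln p / p) <= ln w + 4" unfolding Q_def using w2 by (intro prime_log_sum_le) auto
   hence "\<eta> * (\<Sum>p\<in>Q. ln p / p) <= \<eta> * (ln w + 4)" using lnw(2) by (intro mult_left_mono) (auto simp: \<eta>_def)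
   also have "\<dots> <= 5" using lnw(2) by (simp add: \<eta>_def field_simps)
   finally show "exp (A1 * (exp 1 * (\<eta> * (\<Sum>p\<in>Q. ln p / p)))) <= exp (A1 * (exp 1 * 5))" using A1 by simp
  qed (use pF in auto)
  finally have PG: "(\<Prod>p\<in>Q. 1 + G p) <= (\<Prod>p\<in>Q. 1 + F p) * exp (A1 * (exp 1 * 5))" .
  have fin: "finite (smooth_set Q 1)" by (rule finite_smooth_set[OF Q])
  have m0: "0 < m" if "m : smooth_set Q 1" for m using that by (simp add: smooth_set_def)
  have F0: "0 <= F m" and G0: "0 <= G m" if "0 < m" for m using mult_classD(2)[OF f, of m] that by (auto simp: F_def G_def)
  have "(\<Sum>m | m : smooth_set Q 1 & z < real m. F m) <= (\<Sum>m | m : smooth_set Q 1 & z < real m. exp (- \<kappa>) * G m)"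
  proof (intro sum_mono, clarify)
   fix m assume m: "m : smooth_set Q 1" "z < real m"
   have m': "real m > 0" using m0 m by simp
   have "ln z <= ln m" using m lnz(2) m' by simp
   hence "\<kappa> <= \<eta> * ln m" using lnz(1) lnw(2) by (simp add: \<eta>_def field_simps)
   hence "1 <= exp (- \<kappa>) * real m powr \<eta>" using m' by (simp add: powr_def flip: exp_add)
   hence "f m * real m powr (-1) * 1 <= f m * real m powr (-1) * (exp (- \<kappa>) * real m powr \<eta>)"
   using mult_classD(2)[OF f, of m] m' by (intro mult_left_mono) auto
   also have "\<dots> = exp (- \<kappa>) * (f m * (real m powr \<eta> * real m powr (-1)))" by (simp add: mult_ac)
   also have "real m powr \<eta> * real m powr (-1) = real m powr (\<eta> - 1)" by (rule powr_diff_one[symmetric])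
   finally show "F m <= exp (- \<kappa>) * G m" by (simp add: F_def G_def)
  qed
  also have "\<dots> <= (\<Sum>m\<in>smooth_set Q 1. exp (- \<kappa>) * G m)" by (intro sum_mono2 fin) (use m0 G0 in auto)
  also have "\<dots> = exp (- \<kappa>) * (\<Prod>p\<in>Q. 1 + G p)" by (simp only: prodG sum_distrib_left[symmetric])
  also have "\<dots> <= exp (- \<kappa>) * ((\<Prod>p\<in>Q. 1 + F p) * exp (A1 * (exp 1 * 5)))" using PG by (intro mult_left_mono) auto
  also have "\<dots> = (\<Prod>p\<in>Q. 1 + F p) * exp (-1)" by (simp add: \<kappa>_def mult_ac flip: exp_add)
  also have "\<dots> <= (\<Prod>p\<in>Q. 1 + F p) * (1/2)"
  proof (intro mult_left_mono)
   have "exp (-1) * exp (1::real) = 1" by (simp flip: exp_add)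
   moreover have "exp (1::real) >= 2" using exp_ge_add_one_self[of "1::real"] by simp
   ultimately show "exp (-1::real) <= 1/2" using mult_left_mono[of 2 "exp (1::real)" "exp (-1)"] by simp
  qed (use pF in auto)
  finally have big: "(\<Sum>m | m : smooth_set Q 1 & z < real m. F m) <= (\<Prod>p\<in>Q. 1 + F p) / 2" by simp
  have "(\<Prod>p\<in>Q. 1 + F p) = (\<Sum>m | m : smooth_set Q 1 & real m <= z. F m) + (\<Sum>m | m : smooth_set Q 1 & z < real m. F m)"
   unfolding prodF[symmetric] by (subst sum.union_disjoint[symmetric]) (use fin in \<open>auto intro!: sum.cong\<close>)
  hence "(\<Prod>p\<in>Q. 1 + F p) / 2 <= (\<Sum>m | m : smooth_set Q 1 & real m <= z. F m)" using big by linarith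
  also have "\<dots> <= (\<Sum>m | 0 < m & real m <= z. F m)"
  proof (rule sum_mono2)
   show "finite {m. 0 < m & real m <= z}" by (rule finite_subset[OF _ finite_nat_real_le[of z]]) auto
  qed (use m0 F0 in auto)
  also have "\<dots> = (\<Sum>m | 0 < m & real m <= z. f m / m)" by (intro sum.cong) (auto simp: F_def powr_minus_divide)
  finally have low: "(\<Prod>p\<in>Q. 1 + F p) / 2 <= (\<Sum>m | 0 < m & real m <= z. f m / m)" .
  have "exp ((\<Sum>p\<in>Q. f p / p) - A1\<^sup>2 * C2) <= exp (\<Sum>p\<in>Q. F p - (F p)\<^sup>2)"
  proof -
   have "(\<Sum>p\<in>Q. (F p)\<^sup>2) <= (\<Sum>p\<in>Q. A1\<^sup>2 * real p powr (-2))"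
   proof (intro sum_mono)
   fix p assume "p : Q"
   hence p: "prime p" "real p > 0" using Q by (auto simp: prime_gt_0_nat)
   have "(F p)\<^sup>2 = (f p)\<^sup>2 * real p powr (-2)"
   proof -
   have "(real p powr (-1))\<^sup>2 = real p powr (-2)"
   using powr_add[of "real p" "-1" "-1"] by (simp add: power2_eq_square)
   thus ?thesis by (simp only: F_def power_mult_distrib)
   qed
   thus "(F p)\<^sup>2 <= A1\<^sup>2 * real p powr (-2)" using f0[OF p(1)] by (simp add: mult_right_mono power_mono)
   qed
   also have "\<dots> <= A1\<^sup>2 * C2" using C2(2)[OF Q(1)] by (simp add: sum_distrib_left[symmetric] mult_left_mono)
   finally have "(\<Sum>p\<in>Q. (F p)\<^sup>2) <= A1\<^sup>2 * C2" .
   moreover have "(\<Sum>p\<in>Q. F p) = (\<Sum>p\<in>Q. f p / p)" by (intro sum.cong refl) (simp add: F_def powr_minus_divide)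
   ultimately show ?thesis by (simp add: sum_subtractf)
  qed
  also have "\<dots> = (\<Prod>p\<in>Q. exp (F p - (F p)\<^sup>2))" using Q by (simp add: exp_sum)
  also have "\<dots> <= (\<Prod>p\<in>Q. 1 + F p)"
  proof (intro prod_mono conjI)
   fix p assume "p : Q"
   hence t: "0 <= F p" using F0 Q by (auto simp: prime_gt_0_nat)
   have "F p - (F p)\<^sup>2 <= ln (1 + F p)"
   proof (cases "F p <= 1")
   case True thus ?thesis using ln_one_plus_pos_lower_bound[of "F p"] t by simp
   next
   case False
   hence "F p * 1 <= F p * F p" by (intro mult_left_mono) auto
   hence "F p - (F p)\<^sup>2 <= 0" by (simp add: power2_eq_square)
   also have "0 <= ln (1 + F p)" using t by simp
   finally show ?thesis .
   qed
   thus "exp (F p - (F p)\<^sup>2) <= 1 + F p" using t by (simp add: ln_ge_iff)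
  qed auto
  finally have 1: "exp ((\<Sum>p\<in>Q. f p / p) - A1\<^sup>2 * C2) <= (\<Prod>p\<in>Q. 1 + F p)" .
  have "prime_mean f x UNIV <= (\<Sum>p\<in>Q. f p / p) + A1 * (ln (4 * \<kappa>) + 8)"
  proof -
   have s: "{p. prime p & real p <= x} = Q \<union> {p. prime p & w < real p & real p <= x}" using wx by (auto simp: Q_def)
   have fin2: "finite {p. prime p & w < real p & real p <= x}" by (rule finite_subset[OF _ finite_primes_real[of x]]) auto
   have "prime_mean f x UNIV = (\<Sum>p\<in>Q. f p / p) + (\<Sum>p | prime p & w < real p & real p <= x. f p / p)"
   unfolding prime_mean_alt s by (rule sum.union_disjoint) (use Q(1) fin2 in \<open>auto simp: Q_def\<close>)
   also have "(\<Sum>p | prime p & w < real p & real p <= x. f p / p) <= (\<Sum>p | prime p & w < real p & real p <= x. A1 * (1 / p))"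
   using f0 by (intro sum_mono) (auto intro!: divide_right_mono)
   also have "\<dots> = A1 * (\<Sum>p | prime p & w < real p & real p <= x. 1 / p)" by (simp add: sum_distrib_left)
   also have "\<dots> <= A1 * (ln (ln x / ln w) + 8)" using prime_recip_upper[OF w2 wx] A1 by (intro mult_left_mono) auto
   also have "ln x / ln w = 4 * \<kappa>" using lnw lnx k1 by simp
   finally show ?thesis by simp
  qed
  hence "c * exp (prime_mean f x UNIV) <= c * exp ((\<Sum>p\<in>Q. f p / p) + A1 * (ln (4 * \<kappa>) + 8))" by (simp add: c_def)
  also have "\<dots> = exp ((\<Sum>p\<in>Q. f p / p) - A1\<^sup>2 * C2) / 2" by (simp add: c_def flip: exp_add)
  also have "\<dots> <= (\<Prod>p\<in>Q. 1 + F p) / 2" using 1 by simp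
  finally show ?thesis using low by (simp add: z_def)
 qed
 moreover have "exp (4 * \<kappa>) >= 2" using exp_ge_add_one_self[of "4 * \<kappa>"] k1 by linarith
 ultimately show ?thesis by (intro exI[of _ c] conjI exI[of _ "exp (4 * \<kappa>)"]) (auto simp: c_def)
qed

text \<open>The integers \<open>m * p\<close> with \<open>m <= x powr (1/4)\<close> and
  \<open>p > x powr (1/2)\<close> determine \<open>m\<close> and \<open>p\<close>. For fixed
  \<open>m\<close> the lower bound for prime sums is used at \<open>t = x / m\<close>, which is at
  least \<open>x powr (3/4)\<close>; the primes up to \<open>x powr (1/2)\<close> removed from it
  are therefore less than half.\<close>

lemma mult_sum_lower:
 fixes A1 B x0 :: real
 assumes A1: "0 < A1" and B: "0 < B"
 shows "\<exists>c>0. \<exists>X0\<ge>2. \<forall>f A2 x. f : mult_class A1 A2 -->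
  (\<forall>t\<ge>x0. B * (t / ln (2 * t)) <= (\<Sum>p | prime p & real p <= t. f p)) --> X0 <= x -->
  c * (x / ln x) * exp (prime_mean f x UNIV) <= (total f x)"
proof -
 obtain c1 X1 where c1: "c1 > 0" "X1 >= 2" "!!f A2 x. f : mult_class A1 A2 ==> X1 <= x ==>
  c1 * exp (prime_mean f x UNIV) <= (\<Sum>m | 0 < m & real m <= x powr (1/4). f m / m)"
  using sum_div_ge_of_mean[OF A1] by atomize_elim blast
 have "eventually (%x::real. A1 * x powr (1/2) <= B / 2 * (x powr (3/4) / ln (2 * x))) at_top"
  using A1 B by real_asymp
 then obtain X2 where X2: "!!x. x >= X2 ==> A1 * x powr (1/2) <= B / 2 * (x powr (3/4) / ln (2 * x))"
  by (auto simp: eventually_at_top_linorder)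
 define X0 where "X0 = max (max X1 X2) (max x0 2 powr 2)"
 have "B / 4 * c1 * (x / ln x) * exp (prime_mean f x UNIV) <= (total f x)"
  if f: "f : mult_class A1 A2" and d: "\<forall>t\<ge>x0. B * (t / ln (2 * t)) <= (\<Sum>p | prime p & real p <= t. f p)" and x: "X0 <= x" for f A2 x
 proof -
  have xx: "x >= X1" "x >= X2" "x >= max x0 2 powr 2" using x by (auto simp: X0_def)
  have x2: "x >= 2" using xx c1 by linarith
  have sx: "max x0 2 <= x powr (1/2)"
  proof -
   have "max x0 2 = (max x0 2 powr 2) powr (1/2)" by (simp add: powr_powr)
   also have "\<dots> <= x powr (1/2)" using xx by (intro powr_mono2) auto
   finally show ?thesis .
  qed
  have f0: "0 <= f p" "f p <= A1" if "prime p" for p using mult_classD(2,4)[OF f, of p] that by (auto simp: prime_gt_0_nat)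
  define M where "M = {m. 0 < m & real m <= x powr (1/4)}"
  define P where "P = (%m. {p. prime p & x powr (1/2) < real p & real p <= x / real m})"
  have fM: "finite M" unfolding M_def by (rule finite_subset[OF _ finite_nat_real_le[of "x powr (1/4)"]]) auto
  have fP: "finite (P m)" for m unfolding P_def by (rule finite_subset[OF _ finite_primes_real[of "x / m"]]) auto
  have Pm: "\<not> p dvd m" "m < p" if "m : M" "p : P m'" for m m' p
  proof -
   have "real m <= x powr (1/4)" using that by (simp add: M_def)
   also have "\<dots> <= x powr (1/2)" using x2 by (intro powr_mono) auto
   also have "\<dots> < real p" using that by (simp add: P_def)
   finally show "m < p" by simp
   thus "\<not> p dvd m" using that by (auto simp: M_def dest: dvd_imp_le)
  qed
  have inner: "B / 2 * ((x / m) / ln (2 * x)) <= (\<Sum>p\<in>P m. f p)" if m: "m : M" for m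
  proof -
   have m': "real m >= 1" "real m <= x powr (1/4)" using m by (auto simp: M_def)
   have xm: "x powr (3/4) <= x / m"
   proof -
   have "x powr (3/4) * real m <= x powr (3/4) * x powr (1/4)" using m' by (intro mult_left_mono) auto
   also have "\<dots> = x" using x2 by (simp flip: powr_add)
   finally show ?thesis using m' by (simp add: field_simps)
   qed
   have "x powr (1/2) <= x powr (3/4)" using x2 by (intro powr_mono) auto
   hence xm2: "x powr (1/2) <= x / m" "x0 <= x / m" "2 <= x / m" using xm sx by linarith+
   have xm3: "x / m <= x" using m' x2 mult_left_mono[of 1 "real m" x] by (simp add: divide_le_eq)
   have "B * ((x / m) / ln (2 * x)) <= B * ((x / m) / ln (2 * (x / m)))"
   using xm2 xm3 x2 B by (intro mult_left_mono divide_left_mono mult_pos_pos) auto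
   also have "\<dots> <= (\<Sum>p | prime p & real p <= x / m. f p)" using d xm2 by blast
   also have "{p. prime p & real p <= x / m} = {p. prime p & real p <= x powr (1/2)} \<union> P m" using xm2 by (auto simp: P_def)
   also have "(\<Sum>p\<in>{p. prime p & real p <= x powr (1/2)} \<union> P m. f p) = (\<Sum>p | prime p & real p <= x powr (1/2). f p) + (\<Sum>p\<in>P m. f p)"
   by (rule sum.union_disjoint) (use fP in \<open>auto simp: P_def\<close>)
   finally have 1: "B * ((x / m) / ln (2 * x)) <= (\<Sum>p | prime p & real p <= x powr (1/2). f p) + (\<Sum>p\<in>P m. f p)" .
   have "(\<Sum>p | prime p & real p <= x powr (1/2). f p) <= (\<Sum>p | prime p & real p <= x powr (1/2). A1)" using f0 by (intro sum_mono) auto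
   also have "\<dots> = real (card {p. prime p & real p <= x powr (1/2)}) * A1" by simp
   also have "\<dots> <= x powr (1/2) * A1"
   using A1 by (intro mult_right_mono card_nat_real_le) (auto simp: prime_gt_0_nat)
   also have "x powr (1/2) * A1 <= B / 2 * ((x powr (3/4)) / ln (2 * x))" using X2[OF xx(2)] by (simp add: mult.commute)
   also have "\<dots> <= B / 2 * ((x / m) / ln (2 * x))" using xm B x2 by (intro mult_left_mono divide_right_mono) auto
   finally have "(\<Sum>p | prime p & real p <= x powr (1/2). f p) <= B / 2 * ((x / m) / ln (2 * x))" .
   moreover have "B * ((x / m) / ln (2 * x)) = B / 2 * ((x / m) / ln (2 * x)) + B / 2 * ((x / m) / ln (2 * x))"
   by (simp flip: distrib_right)
   ultimately show ?thesis using 1 by linarith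
  qed
  have inj: "inj_on (%(m, p). m * p) (Sigma M P)"
  proof (rule inj_onI, clarify)
   fix m p m' p' assume a: "m : M" "p : P m" "m' : M" "p' : P m'" "m * p = m' * p'"
   have "p dvd m' * p'" using a(5) by (metis dvd_triv_right)
   hence "p dvd m' \<or> p dvd p'" using a by (auto simp: P_def prime_dvd_mult_iff)
   hence pp: "p = p'" using Pm(1)[OF a(3,2)] a by (auto simp: P_def dest: primes_dvd_imp_eq)
   moreover have "p > 0" using a by (auto simp: P_def prime_gt_0_nat)
   ultimately show "m = m' & p = p'" using a(5) by simp
  qed
  have "B / 4 * c1 * (x / ln x) * exp (prime_mean f x UNIV) = B / 4 * (x / ln x) * (c1 * exp (prime_mean f x UNIV))" by (simp add: mult_ac)
  also have "\<dots> <= B / 4 * (x / ln x) * (\<Sum>m\<in>M. f m / m)" unfolding M_def using c1(3)[OF f xx(1)] B x2 by (intro mult_left_mono) auto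
  also have "\<dots> = (\<Sum>m\<in>M. f m * (B / 2 * ((x / m) / (2 * ln x))))"
   unfolding sum_distrib_left by (intro sum.cong refl) (simp add: mult_ac)
  also have "\<dots> <= (\<Sum>m\<in>M. f m * (\<Sum>p\<in>P m. f p))"
  proof (intro sum_mono mult_left_mono)
   fix m assume m: "m : M"
   have "B / 2 * ((x / m) / (2 * ln x)) <= B / 2 * ((x / m) / ln (2 * x))"
   using x2 B m by (intro mult_left_mono divide_left_mono) (auto simp: ln_mult intro!: mult_pos_pos add_pos_pos)
   also note inner[OF m]
   finally show "B / 2 * ((x / m) / (2 * ln x)) <= (\<Sum>p\<in>P m. f p)" .
   show "0 <= f m" using mult_classD(2)[OF f] m by (auto simp: M_def)
  qed
  also have "\<dots> = (\<Sum>(m, p)\<in>Sigma M P. f m * f p)" using fM fP by (simp add: sum_distrib_left sum.Sigma)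
  also have "\<dots> = (\<Sum>(m, p)\<in>Sigma M P. f (m * p))"
  proof (intro sum.cong refl, clarify)
   fix m p assume a: "m : M" "p : P m"
   have "coprime p m" using Pm(1)[OF a] a by (auto simp: P_def intro!: prime_imp_coprime)
   thus "f m * f p = f (m * p)" using mult_classD(3)[OF f, of m p] a by (auto simp: M_def P_def prime_gt_0_nat coprime_commute)
  qed
  also have "\<dots> = (\<Sum>n\<in>(%(m, p). m * p) ` Sigma M P. f n)" by (subst sum.reindex[OF inj]) (simp add: case_prod_unfold)
  also have "\<dots> <= (total f x)"
  proof (rule sum_mono2)
   show "finite {n. 0 < n & real n <= x}" by (rule finite_subset[OF _ finite_nat_real_le[of x]]) auto
   show "(%(m, p). m * p) ` Sigma M P \<subseteq> {n. 0 < n & real n <= x}"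
   proof clarify
   fix m p assume a: "m : M" "p : P m"
   thus "0 < m * p & real (m * p) <= x" by (auto simp: M_def P_def prime_gt_0_nat field_simps)
   qed
  qed (use mult_classD(2)[OF f] in auto)
  finally show ?thesis .
 qed
 moreover have "X0 >= 2" using c1(2) by (auto simp: X0_def)
 ultimately show ?thesis using B c1(1) by (intro exI[of _ "B / 4 * c1"] conjI exI[of _ X0]) auto
qed

section \<open>Exceptional integers\<close>

lemma sum_UN_le:
 fixes f :: "'a => real"
 assumes "finite I" "!!i. i : I ==> finite (A i)" "!!x. 0 <= f x"
 shows "sum f (\<Union>i\<in>I. A i) <= (\<Sum>i\<in>I. sum f (A i))"
 using assms(1,2)
proof (induction I rule: finite_induct)
 case (insert i I)
 have "sum f (A i \<union> (\<Union>i\<in>I. A i)) <= sum f (A i) + sum f (\<Union>i\<in>I. A i)"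
  using insert assms(3) by (intro sum_Un_le) auto
 thus ?case using insert by simp
qed simp

lemma multiplicity_less_self: "prime p ==> 0 < (n::nat) ==> multiplicity p n <= n"
proof -
 assume p: "prime p" and n: "0 < n"
 have "multiplicity p n < p ^ multiplicity p n" using prime_gt_1_nat[OF p] by (simp add: power_gt_expt)
 also have "\<dots> <= n" using multiplicity_dvd n by (intro dvd_imp_le)
 finally show ?thesis by simp
qed

lemma smooth_setI:
 assumes "0 < n" "real n <= x" "!!p. prime p ==> p dvd n ==> p : Q"
 shows "n : smooth_set Q (nat \<lfloor>x\<rfloor>)"
proof -
 have "n <= nat \<lfloor>x\<rfloor>" using assms by linarith
 thus ?thesis using assms multiplicity_less_self[of _ n] by (auto simp: smooth_set_def in_prime_factors_iff intro: order_trans)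
qed

lemma smooth_mass:
 fixes A1 :: real and A2 :: "real => real"
 assumes "0 < A1" "0 < A2 (1/10)"
 shows "\<exists>C>0. \<forall>f \<eta> y Q A. f : mult_class A1 A2 --> 0 <= \<eta> --> \<eta> <= 1/10 --> 2 <= y --> \<eta> * ln y <= 1 -->
  Q \<subseteq> {p. prime p & real p <= y} --> 1 <= A -->
  (\<Sum>m\<in>smooth_set Q A. f m * real m powr (\<eta> - 1)) <= C * ln y powr A1"
proof -
 obtain C where C: "C > 0" "!!f g E \<eta> y Q A r. f : mult_class A1 A2 ==> additive_fun g E ==> 0 <= \<eta> ==> \<eta> <= 1/10 ==> 1 <= y ==> \<eta> * ln y <= 1 ==>
  Q \<subseteq> {p. prime p & real p <= y} ==> 1 <= A ==> 0 <= r ==> r <= 3/2 ==>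
  (\<Sum>m\<in>smooth_set Q A. rankin_weight f 0 \<eta> m * r ^ g m) <= C * exp ((\<Sum>p\<in>Q - E. f p / p) + r * (\<Sum>p\<in>Q \<inter> E. f p / p))"
  using smooth_moment[where ?A1.0 = A1 and ?A2.0 = A2 and v = 0, OF assms] by atomize_elim
 have "(\<Sum>m\<in>smooth_set Q A. f m * real m powr (\<eta> - 1)) <= C * exp (9 * A1) * ln y powr A1"
  if H: "f : mult_class A1 A2" "0 <= \<eta>" "\<eta> <= 1/10" "2 <= y" "\<eta> * ln y <= 1" "Q \<subseteq> {p. prime p & real p <= y}" "1 <= A" for f \<eta> y Q A
 proof -
  have "(\<Sum>m\<in>smooth_set Q A. f m * real m powr (\<eta> - 1)) <= C * exp (\<Sum>p\<in>Q. f p / p)"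
   using C(2)[OF H(1) additive_fun_zero H(2,3) _ H(5-7), of 1] H by (simp add: rankin_weight_def rad_weight_def)
  also have "\<dots> <= C * (exp (9 * A1) * ln y powr A1)"
  proof (intro mult_left_mono)
   have f0: "0 <= f p" "f p <= A1" if "prime p" for p using mult_classD(2,4)[OF H(1), of p] that by (auto simp: prime_gt_0_nat)
   have "(\<Sum>p\<in>Q. f p / p) <= (\<Sum>p\<in>Q. A1 * (1 / p))" using f0 H by (intro sum_mono) (auto intro!: divide_right_mono)
   also have "\<dots> = A1 * (\<Sum>p\<in>Q. 1 / real p)" by (simp add: sum_distrib_left)
   also have "\<dots> <= A1 * (\<Sum>p | prime p & real p <= y. 1 / real p)" using H assms by (intro mult_left_mono sum_mono2) auto
   also have "\<dots> <= A1 * (ln (ln y) + 9)" using H assms by (intro mult_left_mono sum_prime_recip_le) auto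
   finally have "exp (\<Sum>p\<in>Q. f p / p) <= exp (A1 * (ln (ln y) + 9))" by simp
   also have "\<dots> = exp (9 * A1) * ln y powr A1" using H by (simp add: powr_def algebra_simps exp_add)
   finally show "exp (\<Sum>p\<in>Q. f p / p) <= exp (9 * A1) * ln y powr A1" .
  qed (use C in auto)
  finally show ?thesis by (simp add: mult_ac)
 qed
 thus ?thesis using C(1) by (intro exI[of _ "C * exp (9 * A1)"]) auto
qed

text \<open>Larger than every power of \<open>ln x\<close> and smaller than every positive power of
  \<open>x\<close>: squares of primes beyond it are negligible, and so are the integers that are
  smooth to this bound.\<close>

definition rough_bound :: "real => real" where
 "rough_bound x = exp (sqrt (ln x))"

definition exceptional :: "real => nat set" where
 "exceptional x = {n. 0 < n & real n <= x & (real n <= x powr (1/2) \<or> (\<forall>p. prime p --> p dvd n --> real p <= rough_bound x) \<or>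
  (\<exists>p. prime p & rough_bound x < real p & p ^ 2 dvd n))}"

text \<open>Unique splitting \<open>n = p ^ a * m\<close> with \<open>p\<close> not dividing
  \<open>m\<close>; divisibility by the square means \<open>a >= 2\<close>.\<close>

lemma square_factor_mass:
 assumes f: "f : mult_class A1 A2" and Q: "finite Q" "!!p. p : Q ==> prime p" and p: "p : Q"
 shows "(\<Sum>n | n : smooth_set Q A & p ^ 2 dvd n. f n / real n) \<le>
  (\<Sum>a=2..A. f (p ^ a) / real (p ^ a)) * (\<Sum>m\<in>smooth_set (Q - {p}) A. f m / real m)"
proof -
 have pp: "prime p" using p Q by auto
 have bij: "bij_betw (%(a, m). p ^ a * m) ({..A} \<times> smooth_set (Q - {p}) A) (smooth_set Q A)"
  using smooth_set_insert[OF pp, of "Q - {p}" A] p by (simp add: insert_absorb)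
 have fin: "finite (smooth_set (Q - {p}) A)" using Q by (intro finite_smooth_set) auto
 have cop: "0 < m" "coprime (p ^ a) m" if "m : smooth_set (Q - {p}) A" for a m
 proof -
  show m: "0 < m" using that by (simp add: smooth_set_def)
  have "\<not> p dvd m"
  proof
   assume "p dvd m"
   hence "p : prime_factors m" using m pp by (simp add: in_prime_factors_iff)
   thus False using that by (auto simp: smooth_set_def)
  qed
  thus "coprime (p ^ a) m" using pp by (auto intro!: prime_imp_coprime)
 qed
 have "{n. n : smooth_set Q A & p ^ 2 dvd n} \<subseteq> (%(a, m). p ^ a * m) ` ({2..A} \<times> smooth_set (Q - {p}) A)"
 proof clarify
  fix n assume n: "n : smooth_set Q A" "p ^ 2 dvd n"
  then obtain a m where am: "a <= A" "m : smooth_set (Q - {p}) A" "n = p ^ a * m"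
   using bij unfolding bij_betw_def by fastforce
  have "coprime (p ^ 2) m" using cop(2)[OF am(2)] .
  hence "p ^ 2 dvd p ^ a" using n(2) am(3) by (simp add: coprime_dvd_mult_left_iff)
  hence "2 <= a" using prime_gt_1_nat[OF pp] by (auto dest: power_dvd_imp_le)
  thus "n : (%(a, m). p ^ a * m) ` ({2..A} \<times> smooth_set (Q - {p}) A)" using am by (intro image_eqI[of _ _ "(a, m)"]) auto
 qed
 hence "(\<Sum>n | n : smooth_set Q A & p ^ 2 dvd n. f n / real n) <= (\<Sum>n\<in>(%(a, m). p ^ a * m) ` ({2..A} \<times> smooth_set (Q - {p}) A). f n / real n)"
 proof (intro sum_mono2)
  fix n assume "n : (%(a, m). p ^ a * m) ` ({2..A} \<times> smooth_set (Q - {p}) A) - {n : smooth_set Q A. p\<^sup>2 dvd n}"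
  hence "0 < n" using cop(1) pp by (auto simp: prime_gt_0_nat)
  thus "0 <= f n / real n" using mult_classD(2)[OF f, of n] by simp
 qed (use fin in auto)
 also have "\<dots> = (\<Sum>(a, m)\<in>{2..A} \<times> smooth_set (Q - {p}) A. f (p ^ a * m) / real (p ^ a * m))"
 proof (subst sum.reindex)
  show "inj_on (%(a, m). p ^ a * m) ({2..A} \<times> smooth_set (Q - {p}) A)"
   using bij unfolding bij_betw_def by (elim conjE inj_on_subset) auto
 qed (simp add: case_prod_unfold comp_def)
 also have "\<dots> = (\<Sum>(a, m)\<in>{2..A} \<times> smooth_set (Q - {p}) A. f (p ^ a) / real (p ^ a) * (f m / real m))"
 proof (intro sum.cong refl, clarify)
  fix a m assume "m : smooth_set (Q - {p}) A"
  thus "f (p ^ a * m) / real (p ^ a * m) = f (p ^ a) / real (p ^ a) * (f m / real m)"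
   using mult_classD(3)[OF f, of "p ^ a" m] cop(1)[of m] cop(2)[of m a] pp by (simp add: prime_gt_0_nat)
 qed
 also have "\<dots> = (\<Sum>a=2..A. f (p ^ a) / real (p ^ a)) * (\<Sum>m\<in>smooth_set (Q - {p}) A. f m / real m)"
  by (simp add: sum_product sum.cartesian_product)
 finally show ?thesis .
qed

text \<open>Each kind saves more than any power of \<open>ln x\<close>: integers up to
  \<open>x powr (1/2)\<close> carry at most \<open>x powr (3/4)\<close> by the bound with exponent
  1/4; smooth integers are treated by Rankin; and a square factor beyond \<open>Y\<close> costs the
  tail of a sum of \<open>p powr (-8/5)\<close>, which saves \<open>Y powr (-2/5)\<close>.\<close>

lemma exceptional_mass:
 fixes A1 N :: real and A2 :: "real => real"
 assumes A: "0 < A1" "!!e. 0 < e ==> 0 < A2 e"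
 shows "\<exists>C>0. \<exists>X0\<ge>2. \<forall>f x. f : mult_class A1 A2 --> X0 <= x --> (\<Sum>n\<in>exceptional x. f n) <= C * (x * ln x powr (-N))"
proof -
 have a2: "0 < A2 (1/10)" using A(2)[of "1/10"] by simp
 obtain C1 where C1: "C1 > 0" "!!f \<eta> y Q A. f : mult_class A1 A2 ==> 0 <= \<eta> ==> \<eta> <= 1/10 ==> 2 <= y ==> \<eta> * ln y <= 1 ==>
  Q \<subseteq> {p. prime p & real p <= y} ==> 1 <= A ==> (\<Sum>m\<in>smooth_set Q A. f m * real m powr (\<eta> - 1)) <= C1 * ln y powr A1"
  using smooth_mass[where ?A1.0 = A1 and ?A2.0 = A2, OF A(1) a2] by atomize_elim
 obtain C2 where C2: "C2 > 0" "!!f A1 A2' \<eta> Q A g r. f : mult_class A1 A2' ==> A2' (1/10) = A2 (1/10) ==> 0 <= \<eta> ==> \<eta> <= 1/10 ==> finite Q ==> Q \<subseteq> {p. prime p} ==>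
  (\<forall>p a. prime p --> g (p ^ a) <= (a::nat)) ==> 0 <= r ==> r <= 3/2 ==>
  (\<Sum>p\<in>Q. \<Sum>a=2..A. rankin_weight f 0 \<eta> (p ^ a) * r ^ g (p ^ a)) <= C2 * (\<Sum>p\<in>Q. real p powr (-(8/5)))"
  using rankin_tail_sum[of "A2 (1/10)" 0, OF a2] by atomize_elim
 obtain C3 where C3: "C3 > 0" "!!A. finite A ==> (\<Sum>n\<in>A. real (n::nat) powr (-(6/5))) <= C3"
  using sum_powr_bound[of "6/5"] by auto
 define C where "C = A2 (1/4) + C1 + C2 * C3 * C1"
 have Cpos: "C > 0" using C1(1) C2(1) C3(1) A(2)[of "1/4"] by (simp add: C_def add_pos_pos)
 have "eventually (%x::real. x powr (3/4) <= x * ln x powr (-N)) at_top" by real_asymp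
 moreover have "eventually (%x::real. exp (- sqrt (ln x) / 2) * ln x powr A1 <= ln x powr (-N)) at_top" by real_asymp
 moreover have "eventually (%x::real. exp (- (2/5 * sqrt (ln x))) * ln x powr A1 <= ln x powr (-N)) at_top" by real_asymp
 moreover have "eventually (%x::real. x >= exp 100) at_top" by (rule eventually_ge_at_top)
 ultimately have "eventually (%x. x powr (3/4) <= x * ln x powr (-N) & exp (- sqrt (ln x) / 2) * ln x powr A1 <= ln x powr (-N) \<and>
   exp (- (2/5 * sqrt (ln x))) * ln x powr A1 <= ln x powr (-N) & x >= exp 100) at_top"
  by eventually_elim auto
 then obtain X0 where X0: "!!x. x >= X0 ==> x powr (3/4) <= x * ln x powr (-N)" "!!x. x >= X0 ==> exp (- sqrt (ln x) / 2) * ln x powr A1 <= ln x powr (-N)"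
   "!!x. x >= X0 ==> exp (- (2/5 * sqrt (ln x))) * ln x powr A1 <= ln x powr (-N)" "!!x. x >= X0 ==> x >= exp 100"
  by (auto simp: eventually_at_top_linorder)
 have "(\<Sum>n\<in>exceptional x. f n) <= C * (x * ln x powr (-N))" if f: "f : mult_class A1 A2" and x: "X0 <= x" for f x
 proof -
  have x0: "x >= exp 100" by (rule X0(4)[OF x])
  have "exp 100 >= (1::real) + 100" by (rule exp_ge_add_one_self)
  hence x1: "x >= 101" using x0 by linarith
  have L: "ln x >= 100" using x0 x1 by (simp add: ln_ge_iff)
  have sL: "sqrt (ln x) >= 10" using L real_sqrt_le_mono[of 100 "ln x"] by simp
  define Y where "Y = rough_bound x"
  have lnY: "ln Y = sqrt (ln x)" by (simp add: Y_def rough_bound_def)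
  have Y1: "Y >= 11" using exp_ge_add_one_self[of "sqrt (ln x)"] sL unfolding Y_def rough_bound_def by linarith
  have f0: "0 <= f n" if "0 < n" for n using mult_classD(2)[OF f that] .
  define A where "A = nat \<lfloor>x\<rfloor>"
  have A1': "1 <= A" using x1 by (simp add: A_def le_nat_iff)
  let ?G1 = "{n. 0 < n & real n <= x powr (1/2)}"
  let ?G2 = "{n. 0 < n & real n <= x & x powr (1/2) < real n & (\<forall>p. prime p --> p dvd n --> real p <= Y)}"
  let ?P = "{p. prime p & real p <= x & Y < real p}"
  let ?Q = "{p. prime p & real p <= x}"
  let ?G3 = "%p. {n. n : smooth_set ?Q A & p ^ 2 dvd n}"
  have fs: "finite (smooth_set ?Q A)" by (rule finite_smooth_set) auto
  have fP: "finite ?P" by (rule finite_subset[OF _ finite_primes_real[of x]]) auto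
  have fG1: "finite ?G1" by (rule finite_subset[OF _ finite_nat_real_le[of "x powr (1/2)"]]) auto
  have fG2: "finite ?G2" by (rule finite_subset[OF _ finite_nat_real_le[of x]]) auto
  have fG3: "finite (\<Union>p\<in>?P. {n : ?G3 p. real n <= x})" using fP fs by auto
  have sub: "exceptional x \<subseteq> ?G1 \<union> (?G2 \<union> (\<Union>p\<in>?P. {n : ?G3 p. real n <= x}))"
  proof
   fix n assume n: "n : exceptional x"
   have n0: "0 < n" "real n <= x" using n by (auto simp: exceptional_def)
   consider "real n <= x powr (1/2)" | "x powr (1/2) < real n" "\<forall>p. prime p --> p dvd n --> real p <= Y"
   | p where "prime p" "Y < real p" "p ^ 2 dvd n"
   using n unfolding exceptional_def Y_def by force
   thus "n : ?G1 \<union> (?G2 \<union> (\<Union>p\<in>?P. {n : ?G3 p. real n <= x}))"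
   proof cases
   case (3 p)
   have dx: "real q <= x" if "q dvd n" for q using dvd_imp_le[OF that n0(1)] n0(2) by linarith
   have "p dvd p ^ 2" by simp
   hence "p dvd n" using 3(3) dvd_trans by blast
   hence "p : ?P" using 3 dx by simp
   moreover have "n : smooth_set ?Q A" unfolding A_def by (rule smooth_setI) (use n0 dx in auto)
   ultimately show ?thesis using 3(3) n0 by blast
   qed (use n0 in auto)
  qed
  have pos3: "0 <= f n" if "n : ?G1 \<union> (?G2 \<union> (\<Union>p\<in>?P. {n : ?G3 p. real n <= x}))" for n
   using that f0 by (auto simp: smooth_set_def)
  define f' where "f' = (%n. if 0 < n then f n else 0)"
  have f'0: "0 <= f' n" for n using f0 by (simp add: f'_def)
  have "(\<Sum>n\<in>exceptional x. f n) = (\<Sum>n\<in>exceptional x. f' n)" by (intro sum.cong) (auto simp: f'_def exceptional_def)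
  also have "\<dots> <= (\<Sum>n\<in>?G1 \<union> (?G2 \<union> (\<Union>p\<in>?P. {n : ?G3 p. real n <= x})). f' n)"
   by (intro sum_mono2 sub) (use fG1 fG2 fG3 f'0 in auto)
  also have "\<dots> <= sum f' ?G1 + (sum f' ?G2 + (\<Sum>p\<in>?P. sum f' {n : ?G3 p. real n <= x}))"
  proof -
   have "sum f' (?G1 \<union> (?G2 \<union> (\<Union>p\<in>?P. {n : ?G3 p. real n <= x}))) <= sum f' ?G1 + sum f' (?G2 \<union> (\<Union>p\<in>?P. {n : ?G3 p. real n <= x}))"
   by (rule sum_Un_le) (use fG1 fG2 fG3 f'0 in auto)
   moreover have "sum f' (?G2 \<union> (\<Union>p\<in>?P. {n : ?G3 p. real n <= x})) <= sum f' ?G2 + sum f' (\<Union>p\<in>?P. {n : ?G3 p. real n <= x})"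
   by (rule sum_Un_le) (use fG2 fG3 f'0 in auto)
   moreover have "sum f' (\<Union>p\<in>?P. {n : ?G3 p. real n <= x}) <= (\<Sum>p\<in>?P. sum f' {n : ?G3 p. real n <= x})"
   by (rule sum_UN_le) (use fP fs f'0 in auto)
   ultimately show ?thesis by linarith
  qed
  finally have tot: "(\<Sum>n\<in>exceptional x. f n) <= sum f' ?G1 + (sum f' ?G2 + (\<Sum>p\<in>?P. sum f' {n : ?G3 p. real n <= x}))" .
  have g1: "sum f' ?G1 <= A2 (1/4) * (x * ln x powr (-N))"
  proof -
   have "sum f' ?G1 <= (\<Sum>n\<in>?G1. A2 (1/4) * x powr (1/4))"
   proof (intro sum_mono)
   fix n assume n: "n : ?G1"
   have "x powr (1/2) <= x powr 1" using x1 by (intro powr_mono) auto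
   hence nx: "real n <= x" using n x1 by simp
   have "f' n <= A2 (1/4) * real n powr (1/4)" using mult_classD(5)[OF f, of "1/4" n] n by (simp add: f'_def)
   also have "\<dots> <= A2 (1/4) * x powr (1/4)" using nx A(2)[of "1/4"] by (intro mult_left_mono powr_mono2) auto
   finally show "f' n <= A2 (1/4) * x powr (1/4)" .
   qed
   also have "\<dots> = real (card ?G1) * (A2 (1/4) * x powr (1/4))" by simp
   also have "\<dots> <= x powr (1/2) * (A2 (1/4) * x powr (1/4))"
   using A(2)[of "1/4"] by (intro mult_right_mono card_nat_real_le) auto
   also have "\<dots> = A2 (1/4) * x powr (3/4)" using x1 by (simp flip: powr_add)
   also have "\<dots> <= A2 (1/4) * (x * ln x powr (-N))" using X0(1)[OF x] A(2)[of "1/4"] by (intro mult_left_mono) auto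
   finally show ?thesis .
  qed
  have g2: "sum f' ?G2 <= C1 * (x * ln x powr (-N))"
  proof -
   \<comment> \<open>The largest value with \<open>\<eta> * ln Y <= 1\<close>. For
     \<open>n > x powr (1/2)\<close> it saves the factor
     \<open>exp (- sqrt (ln x) / 2)\<close>.\<close>
   define \<eta> where "\<eta> = 1 / sqrt (ln x)"
   have \<eta>: "0 <= \<eta>" "\<eta> <= 1/10" "\<eta> * ln Y = 1" "\<eta> * ln x = sqrt (ln x)"
   using sL L by (auto simp: \<eta>_def lnY divide_simps)
   let ?SY = "smooth_set {p. prime p & real p <= Y} A"
   have fSY: "finite ?SY" by (rule finite_smooth_set) auto
   have "sum f' ?G2 <= (\<Sum>n\<in>?G2. x * exp (- sqrt (ln x) / 2) * (f n * real n powr (\<eta> - 1)))"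
   proof (intro sum_mono, clarify)
   fix n assume n: "0 < n" "real n <= x" "x powr (1/2) < real n"
   have "ln (x powr (1/2)) <= ln n" using n x1 by (subst ln_le_cancel_iff) auto
   hence "ln x / 2 <= ln n" using x1 by (simp add: ln_powr)
   hence "\<eta> * (ln x / 2) <= \<eta> * ln n" using \<eta> by (intro mult_left_mono) auto
   hence "1 <= exp (- sqrt (ln x) / 2) * real n powr \<eta>" using n \<eta>(4) by (simp add: powr_def flip: exp_add)
   moreover have "1 <= x * real n powr (-1)" using n by (simp add: powr_minus divide_simps)
   ultimately have "1 * 1 <= (x * real n powr (-1)) * (exp (- sqrt (ln x) / 2) * real n powr \<eta>)" by (intro mult_mono) auto
   also have "\<dots> = x * exp (- sqrt (ln x) / 2) * (real n powr \<eta> * real n powr (-1))" by (simp only: mult_ac)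
   also have "real n powr \<eta> * real n powr (-1) = real n powr (\<eta> - 1)" by (rule powr_diff_one[symmetric])
   finally have "f n * 1 <= f n * (x * exp (- sqrt (ln x) / 2) * real n powr (\<eta> - 1))" using f0[OF n(1)] by (intro mult_left_mono) auto
   thus "f' n <= x * exp (- sqrt (ln x) / 2) * (f n * real n powr (\<eta> - 1))" using n by (simp add: f'_def mult_ac)
   qed
   also have "\<dots> = x * exp (- sqrt (ln x) / 2) * (\<Sum>n\<in>?G2. f n * real n powr (\<eta> - 1))" by (simp add: sum_distrib_left)
   also have "\<dots> <= x * exp (- sqrt (ln x) / 2) * (\<Sum>n\<in>?SY. f n * real n powr (\<eta> - 1))"
   proof (intro mult_left_mono sum_mono2 fSY)
   show "?G2 \<subseteq> ?SY" unfolding A_def by (intro subsetI smooth_setI) auto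
   show "0 <= f n * real n powr (\<eta> - 1)" if "n : ?SY - ?G2" for n using that f0[of n] by (auto simp: smooth_set_def)
   qed (use x1 in auto)
   also have "\<dots> <= x * exp (- sqrt (ln x) / 2) * (C1 * ln Y powr A1)"
   by (intro mult_left_mono C1(2)[OF f]) (use \<eta> Y1 A1' x1 in auto)
   also have "\<dots> <= x * exp (- sqrt (ln x) / 2) * (C1 * ln x powr A1)"
   proof -
   have "sqrt (ln x) * 1 <= sqrt (ln x) * sqrt (ln x)" using L by (intro mult_left_mono) auto
   also have "\<dots> = ln x" using L by simp
   finally have "ln Y <= ln x" by (simp only: lnY mult_1_right)
   moreover have "0 <= ln Y" using L by (simp add: lnY)
   ultimately show ?thesis using C1(1) x1 A(1) by (intro mult_left_mono powr_mono2) auto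
   qed
   also have "\<dots> = (C1 * x) * (exp (- sqrt (ln x) / 2) * ln x powr A1)" by (simp only: mult_ac)
   also have "\<dots> <= (C1 * x) * (ln x powr (-N))" using X0(2)[OF x] C1(1) x1 by (intro mult_left_mono) auto
   finally show ?thesis by (simp only: mult_ac)
  qed
  have g3: "(\<Sum>p\<in>?P. sum f' {n : ?G3 p. real n <= x}) <= C2 * C3 * C1 * (x * ln x powr (-N))"
  proof -
   let ?T = "%p. \<Sum>a=2..A. f (p ^ a) / real (p ^ a)"
   have "(\<Sum>p\<in>?P. sum f' {n : ?G3 p. real n <= x}) <= (\<Sum>p\<in>?P. x * (C1 * ln x powr A1) * ?T p)"
   proof (intro sum_mono)
   fix p assume p: "p : ?P"
   have "sum f' {n : ?G3 p. real n <= x} <= (\<Sum>n\<in>{n : ?G3 p. real n <= x}. x * (f n / real n))"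
   proof (intro sum_mono, clarify)
   fix n assume n: "n : smooth_set ?Q A" "real n <= x"
   hence n0: "0 < n" by (simp add: smooth_set_def)
   have "f n * real n <= f n * x" using f0[OF n0] n by (intro mult_left_mono) auto
   thus "f' n <= x * (f n / real n)" using n0 by (simp add: f'_def field_simps)
   qed
   also have "\<dots> <= (\<Sum>n\<in>?G3 p. x * (f n / real n))"
   proof (intro sum_mono2)
   show "0 <= x * (f n / real n)" if "n : ?G3 p - {n : ?G3 p. real n <= x}" for n using that f0[of n] x1 by (auto simp: smooth_set_def)
   qed (use fs in auto)
   also have "\<dots> = x * (\<Sum>n\<in>?G3 p. f n / real n)" by (simp add: sum_distrib_left)
   also have "\<dots> <= x * (?T p * (\<Sum>m\<in>smooth_set (?Q - {p}) A. f m / real m))"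
   using x1 p by (intro mult_left_mono square_factor_mass[OF f]) auto
   also have "\<dots> <= x * (?T p * (C1 * ln x powr A1))"
   proof (intro mult_left_mono)
   have "(\<Sum>m\<in>smooth_set (?Q - {p}) A. f m / real m) = (\<Sum>m\<in>smooth_set (?Q - {p}) A. f m * real m powr (0 - 1))"
   by (intro sum.cong refl) (simp add: powr_minus divide_inverse)
   also have "\<dots> <= C1 * ln x powr A1" by (rule C1(2)[OF f]) (use x1 A1' in auto)
   finally show "(\<Sum>m\<in>smooth_set (?Q - {p}) A. f m / real m) <= C1 * ln x powr A1" .
   show "0 <= ?T p" using f0 p by (intro sum_nonneg) (auto simp: prime_gt_0_nat)
   qed (use x1 in auto)
   finally show "sum f' {n : ?G3 p. real n <= x} <= x * (C1 * ln x powr A1) * ?T p" by (simp only: mult_ac)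
   qed
   also have "\<dots> = x * (C1 * ln x powr A1) * (\<Sum>p\<in>?P. ?T p)" by (simp add: sum_distrib_left)
   also have "\<dots> <= x * (C1 * ln x powr A1) * (C2 * (C3 * exp (- (2/5 * sqrt (ln x)))))"
   proof (intro mult_left_mono)
   have "(\<Sum>p\<in>?P. ?T p) = (\<Sum>p\<in>?P. \<Sum>a=2..A. rankin_weight f 0 0 (p ^ a) * 1 ^ (0::nat))"
   by (intro sum.cong refl) (simp add: rankin_weight_def rad_weight_def powr_minus divide_inverse)
   also have "\<dots> <= C2 * (\<Sum>p\<in>?P. real p powr (-(8/5)))"
   by (rule C2(2)[OF f, of 0 ?P "%_. 0" 1]) (use fP in auto)
   also have "\<dots> <= C2 * (\<Sum>p\<in>?P. Y powr (-(2/5)) * real p powr (-(6/5)))"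
   proof (intro mult_left_mono sum_mono)
   fix p assume p: "p : ?P"
   have "real p powr (-(8/5)) = real p powr (-(2/5)) * real p powr (-(6/5))" by (simp flip: powr_add)
   also have "\<dots> <= Y powr (-(2/5)) * real p powr (-(6/5))" using p Y1 by (intro mult_right_mono powr_mono2') auto
   finally show "real p powr (-(8/5)) <= Y powr (-(2/5)) * real p powr (-(6/5))" .
   qed (use C2 in auto)
   also have "\<dots> = C2 * (Y powr (-(2/5)) * (\<Sum>p\<in>?P. real p powr (-(6/5))))" by (simp add: sum_distrib_left)
   also have "\<dots> <= C2 * (Y powr (-(2/5)) * C3)" using C2(1) C3(2)[OF fP] by (intro mult_left_mono) auto
   also have "Y powr (-(2/5)) = exp (- (2/5 * sqrt (ln x)))" using Y1 by (simp add: powr_def lnY)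
   finally show "(\<Sum>p\<in>?P. ?T p) <= C2 * (C3 * exp (- (2/5 * sqrt (ln x))))" by (simp add: mult_ac)
   qed (use x1 C1(1) in auto)
   also have "\<dots> = (C2 * C3 * C1 * x) * (exp (- (2/5 * sqrt (ln x))) * ln x powr A1)" by (simp only: mult_ac)
   also have "\<dots> <= (C2 * C3 * C1 * x) * (ln x powr (-N))" using X0(3)[OF x] C1(1) C2(1) C3(1) x1 by (intro mult_left_mono) auto
   finally show ?thesis by (simp only: mult_ac)
  qed
  show ?thesis using tot g1 g2 g3 by (simp add: C_def algebra_simps)
 qed
 moreover have "max X0 2 >= 2" by simp
 ultimately show ?thesis using Cpos by (intro exI[of _ C] conjI exI[of _ "max X0 2"]) auto
qed

section \<open>Removing the largest prime\<close>

lemma sum_poly_exp_le: "\<exists>C>0. \<forall>J. finite J --> (\<Sum>j\<in>J. real (j + 1) ^ k * exp (- (real j / 2))) <= C"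
proof -
 define q :: real where "q = exp (- (1/4))"
 define K :: real where "K = (max 1 (real k) / (1/4)) ^ k * exp (1/4)"
 have q: "0 < q" "q < 1" by (auto simp: q_def)
 have K: "K > 0" by (auto simp: K_def intro!: mult_pos_pos zero_less_power)
 have sm: "summable (%j. q ^ j)" using q by (intro summable_geometric) auto
 have "(\<Sum>j\<in>J. real (j + 1) ^ k * exp (- (real j / 2))) <= K * (1 / (1 - q))" if "finite J" for J
 proof -
  have "(\<Sum>j\<in>J. real (j + 1) ^ k * exp (- (real j / 2))) <= (\<Sum>j\<in>J. K * q ^ j)"
  proof (intro sum_mono)
   fix j
   have "ln (exp (real j + 1)) ^ k <= (max 1 (real k) / (1/4)) ^ k * exp (real j + 1) powr (1/4)"
   using ln_power_le[of "exp (real j + 1)" "1/4" k] by (simp add: of_nat_max)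
   also have "exp (real j + 1) powr (1/4) = exp (1/4) * exp (real j / 4)" by (simp add: powr_def add_divide_distrib flip: exp_add)
   finally have "real (j + 1) ^ k <= K * exp (real j / 4)" by (simp add: K_def mult_ac add.commute)
   hence "real (j + 1) ^ k * exp (- (real j / 2)) <= K * exp (real j / 4) * exp (- (real j / 2))" by (intro mult_right_mono) auto
   also have "\<dots> = K * q ^ j" by (simp add: q_def mult.assoc flip: exp_add exp_of_nat_mult)
   finally show "real (j + 1) ^ k * exp (- (real j / 2)) <= K * q ^ j" .
  qed
  also have "\<dots> = K * (\<Sum>j\<in>J. q ^ j)" by (simp add: sum_distrib_left)
  also have "\<dots> <= K * (\<Sum>j. q ^ j)" using K q by (intro mult_left_mono sum_le_suminf[OF sm that]) auto
  also have "(\<Sum>j. q ^ j) = 1 / (1 - q)" using q by (intro suminf_geometric) auto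
  finally show ?thesis .
 qed
 moreover have "K * (1 / (1 - q)) > 0" using K q by simp
 ultimately show ?thesis by blast
qed

lemma prime_mean_count_diff:
 assumes R: "!!p. prime p ==> card (R p) <= v" and N: "2 <= N" "N <= x"
 shows "sieve_mean R x <= sieve_mean R N + v * (ln (ln x / ln N) + 8)"
proof -
 have s: "{p. prime p & real p <= x} = {p. prime p & real p <= N} \<union> {p. prime p & N < real p & real p <= x}" using N by auto
 have fin: "finite {p. prime p & N < real p & real p <= x}" by (rule finite_subset[OF _ finite_primes_real[of x]]) auto
 have "sieve_mean R x = sieve_mean R N + (\<Sum>p | prime p & N < real p & real p <= x. real (card (R p)) / p)"
  unfolding prime_mean_alt s by (rule sum.union_disjoint) (use fin in auto)
 also have "(\<Sum>p | prime p & N < real p & real p <= x. real (card (R p)) / p) <= (\<Sum>p | prime p & N < real p & real p <= x. v * (1 / real p))"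
  using R by (intro sum_mono) (auto intro!: divide_right_mono)
 also have "\<dots> = v * (\<Sum>p | prime p & N < real p & real p <= x. 1 / real p)" by (simp add: sum_distrib_left)
 also have "\<dots> <= v * (ln (ln x / ln N) + 8)" using prime_recip_upper[OF N] by (intro mult_left_mono) auto
 finally show ?thesis by simp
qed

lemma largest_prime_decomp:
 assumes n: "0 < n" "real n <= x" and ne: "n \<notin> exceptional x" and x: "1 < x"
 shows "\<exists>m p. n = m * p & prime p & \<not> p dvd m & rough_bound x < real p & (\<forall>q. prime q --> q dvd m --> q < p) & x powr (1/2) < real n"
proof -
 have 1: "x powr (1/2) < real n" and 2: "\<exists>p. prime p & p dvd n & rough_bound x < real p"
  and 3: "!!p. prime p ==> rough_bound x < real p ==> \<not> p ^ 2 dvd n"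
  using n ne unfolding exceptional_def by (auto simp: not_le)
 obtain q where q: "prime q" "q dvd n" "rough_bound x < real q" using 2 by blast
 define p where "p = Max (prime_factors n)"
 have qn: "q : prime_factors n" using q n by (simp add: in_prime_factors_iff)
 have "p : prime_factors n" unfolding p_def using qn by (intro Max_in) auto
 hence p: "prime p" "p dvd n" by (auto simp: in_prime_factors_iff)
 have qp: "q <= p" unfolding p_def using qn by (intro Max_ge) auto
 hence pY: "rough_bound x < real p" using q by linarith
 obtain m where m: "n = m * p" using p(2) by (metis dvd_def mult.commute)
 have pm: "\<not> p dvd m"
 proof
  assume "p dvd m"
  hence "p ^ 2 dvd n" unfolding m power2_eq_square by (intro mult_dvd_mono) auto
  thus False using 3[OF p(1) pY] by simp
 qed
 have "r < p" if r: "prime r" "r dvd m" for r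
 proof -
  have "r : prime_factors n" using r m n by (auto simp: in_prime_factors_iff)
  hence "r <= p" unfolding p_def by (intro Max_ge) auto
  moreover have "r ~= p" using r pm by auto
  ultimately show ?thesis by simp
 qed
 thus ?thesis using m p pm pY 1 by blast
qed

text \<open>With \<open>p\<close> about \<open>x powr (1 / j)\<close> the cofactor is
  \<open>x powr (1 / j)\<close>-smooth but exceeds \<open>x powr (1/2 - 1 / j)\<close>, so Rankin
  with \<open>\<eta> = j / ln x\<close> gains \<open>exp (1 - j / 2)\<close>. The sieve for primes
  up to \<open>x / m\<close> loses only \<open>(j + 1) ^ (v + 1)\<close>, since
  \<open>ln (x / m) >= ln x / (j + 1)\<close>, and the sum over \<open>j\<close> converges. Both
  \<open>\<phi> (g m)\<close> and \<open>\<phi> (g m + 1)\<close> occur because \<open>p\<close> may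
  or may not lie in \<open>E\<close>.\<close>

lemma good_mass:
 fixes A1 :: real and v :: nat
 assumes A1: "0 < A1"
 shows "\<exists>C>0. \<exists>X0\<ge>2. \<forall>f A2 g E R x \<phi> Z. f : mult_class A1 A2 --> additive_fun g E -->
  residue_system v R --> X0 <= x --> (\<forall>k::nat. 0 <= \<phi> k) -->
  (\<forall>j\<ge>1. real j <= sqrt (ln x) --> (\<Sum>m\<in>smooth_set {p. prime p & real p <= x powr (1 / real j)} (nat \<lfloor>x\<rfloor>). rankin_weight f v (real j / ln x) m * (\<phi> (g m) + \<phi> (g m + 1))) <= Z) -->
  (\<Sum>n\<in>sifted_set x R - exceptional x. f n * \<phi> (g n)) <= C * (x / ln x * exp (- sieve_mean R x)) * Z"
proof -
 obtain Cs where Cs: "Cs > 0" "\<forall>N (m::nat) R. 2 <= N --> 1 <= m --> residue_system v R -->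
  real (card {q. prime q & real q <= N & (\<forall>p. prime p --> (m * q) mod p \<notin> R p)})
   <= Cs * (N / ln N) * exp (- sieve_mean R N + (\<Sum>p\<in>prime_factors m. real v / p))"
  using prime_sieve_upper[of v] by blast
 obtain Cj where Cj: "Cj > 0" "!!J. finite J ==> (\<Sum>j\<in>J. real (j + 1) ^ (v + 1) * exp (- (real j / 2))) <= Cj"
  using sum_poly_exp_le[of "v + 1"] by blast
 define C0 where "C0 = A1 * Cs * exp (8 * real v) * exp 1"
 have C0: "C0 > 0" using A1 Cs by (simp add: C0_def)
 have "(\<Sum>n\<in>sifted_set x R - exceptional x. f n * \<phi> (g n)) <= C0 * Cj * (x / ln x * exp (- sieve_mean R x)) * Z"
  if f: "f : mult_class A1 A2" and g: "additive_fun g E" and R: "residue_system v R"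
  and x: "exp 100 <= x" and \<phi>: "\<forall>k::nat. 0 <= \<phi> k"
  and Z: "\<forall>j\<ge>1. real j <= sqrt (ln x) --> (\<Sum>m\<in>smooth_set {p. prime p & real p <= x powr (1 / real j)} (nat \<lfloor>x\<rfloor>). rankin_weight f v (real j / ln x) m * (\<phi> (g m) + \<phi> (g m + 1))) <= Z"
  for f A2 g E R x \<phi> Z
 proof -
  have x1: "x >= 101" using x exp_ge_add_one_self[of "100::real"] by linarith
  have L: "ln x >= 100" using x x1 by (simp add: ln_ge_iff)
  have sL: "sqrt (ln x) >= 10" using L real_sqrt_le_mono[of 100 "ln x"] by simp
  have sL2: "sqrt (ln x) * sqrt (ln x) = ln x" using L by simp
  define A where "A = nat \<lfloor>x\<rfloor>"
  define Mx where "Mx = sieve_mean R x"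
  define J where "J = {j::nat. 1 <= j & real j <= sqrt (ln x)}"
  have fJ: "finite J" unfolding J_def by (rule finite_subset[OF _ finite_nat_real_le[of "sqrt (ln x)"]]) auto
  define SM where "SM = (%j::nat. smooth_set {p. prime p & real p <= x powr (1 / real j)} A)"
  have fSM: "finite (SM j)" for j unfolding SM_def by (rule finite_smooth_set) auto
  define Mj where "Mj = (%j. {m : SM j. x powr (1 / real (j + 1)) <= x / real m & x powr (1/2) < real m * x powr (1 / real j)})"
  have fMj: "finite (Mj j)" for j unfolding Mj_def using fSM by auto
  define P where "P = (%m. {q. prime q & real q <= x / real m & (\<forall>p. prime p --> (m * q) mod p \<notin> R p)})"
  have fP: "finite (P m)" for m unfolding P_def by (rule finite_subset[OF _ finite_primes_real[of "x / real m"]]) auto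
  define P' where "P' = (%m. {p : P m. \<not> p dvd m})"
  have fP': "finite (P' m)" for m unfolding P'_def using fP by auto
  define I where "I = Sigma J (%j. Sigma (Mj j) P')"
  have fI: "finite I" unfolding I_def by (intro finite_SigmaI fJ fMj fP')
  define \<psi> where "\<psi> = (%m. \<phi> (g m) + \<phi> (g m + 1))"
  have \<psi>0: "0 <= \<psi> m" for m using \<phi> by (simp add: \<psi>_def)
  have f0: "0 <= f n" if "0 < n" for n using mult_classD(2)[OF f that] .
  have sub: "sifted_set x R - exceptional x \<subseteq> (%(j, m, p). m * p) ` I"
  proof
   fix n assume n: "n : sifted_set x R - exceptional x"
   have n0: "0 < n" "real n <= x" and nR: "!!p. prime p ==> n mod p \<notin> R p" using n by (auto simp: sifted_set_def)
   obtain m p where mp: "n = m * p" "prime p" "\<not> p dvd m" "rough_bound x < real p" "!!q. prime q ==> q dvd m ==> q < p" "x powr (1/2) < real n"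
   using largest_prime_decomp[OF n0] n x1 by fastforce
   have m0: "0 < m" "0 < p" using mp(1) n0 by (auto intro: Nat.gr0I)
   have "exp (sqrt (ln x)) < real p" using mp(4) by (simp add: rough_bound_def)
   hence lnp: "sqrt (ln x) < ln p" using ln_less_cancel_iff[of "exp (sqrt (ln x))" "real p"] m0 by simp
   have lnp0: "0 < ln (real p)" using lnp sL by linarith
   have "p <= n" "m <= n" using mp(1) m0 by auto
   hence px: "real p <= x" and mx: "real m <= x" using n0 by linarith+
   have lpx: "ln (real p) <= ln x" using px m0 x1 by simp
   \<comment> \<open>The dyadic-type parameter:
     \<open>x powr (1 / (j + 1)) <= p <= x powr (1 / j)\<close>. It stays below
     \<open>sqrt (ln x)\<close> because \<open>p\<close> exceeds
     \<open>rough_bound x\<close>.\<close>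
   define j where "j = nat \<lfloor>ln x / ln p\<rfloor>"
   have r1: "1 <= ln x / ln (real p)" using lpx lnp0 by simp
   have j1: "1 <= j" using r1 by (simp add: j_def le_nat_iff)
   have jr: "real j <= ln x / ln p" "ln x / ln p < real j + 1" using r1 unfolding j_def by linarith+
   have jl: "real j * ln p <= ln x" "ln x < real (j + 1) * ln p" using jr lnp0 by (simp_all add: field_simps)
   have "real j * sqrt (ln x) <= real j * ln p" using lnp by (intro mult_left_mono) auto
   hence "real j * sqrt (ln x) <= sqrt (ln x) * sqrt (ln x)" using jl sL2 by linarith
   hence "real j <= sqrt (ln x)" by (rule mult_right_le_imp_le) (use sL in linarith)
   hence jJ: "j : J" using j1 by (simp add: J_def)
   have "ln p <= ln x * (1 / real j)" using jl(1) j1 by (simp add: field_simps)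
   hence "exp (ln (real p)) <= exp (1 / real j * ln x)" by (simp add: mult.commute)
   hence pj: "real p <= x powr (1 / real j)" using m0 x1 by (simp add: powr_def)
   have "ln x * (1 / real (j + 1)) <= ln p" using jl(2) by (simp add: field_simps)
   hence "exp (1 / real (j + 1) * ln x) <= exp (ln (real p))" by (simp add: mult.commute)
   hence pj1: "x powr (1 / real (j + 1)) <= real p" using m0 x1 by (simp add: powr_def)
   have pxm: "real p <= x / real m" using n0 mp(1) m0 by (simp add: field_simps)
   have "m : SM j" unfolding SM_def A_def
   proof (rule smooth_setI)
   fix q assume "prime q" "q dvd m"
   thus "q : {p. prime p & real p <= x powr (1 / real j)}" using mp(5)[of q] pj by auto
   qed (use m0 mx in auto)
   moreover have "x powr (1/2) < real m * x powr (1 / real j)"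
   proof -
   have "real n = real m * real p" using mp(1) by simp
   also have "\<dots> <= real m * x powr (1 / real j)" using pj by (intro mult_left_mono) auto
   finally show ?thesis using mp(6) by linarith
   qed
   ultimately have "m : Mj j" using pj1 pxm by (simp add: Mj_def)
   moreover have "p : P' m" using mp(2,3) pxm nR unfolding mp(1) by (simp add: P'_def P_def)
   ultimately have "(j, m, p) : I" using jJ by (simp add: I_def)
   thus "n : (%(j, m, p). m * p) ` I" using mp(1) by (intro image_eqI[of _ _ "(j, m, p)"]) auto
  qed
  have mpos: "0 < m" if "m : Mj j" for m j using that by (auto simp: Mj_def SM_def smooth_set_def)
  have ppos: "0 < p" if "p : P' m" for p m using that by (auto simp: P'_def P_def prime_gt_0_nat)
  have nn: "0 <= f ((%(j, m, p). m * p) i) * \<phi> (g ((%(j, m, p). m * p) i))" if "i : I" for i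
   using that mpos ppos \<phi> by (auto simp: I_def intro!: mult_nonneg_nonneg f0)
  have "(\<Sum>n\<in>sifted_set x R - exceptional x. f n * \<phi> (g n)) <= (\<Sum>n\<in>(%(j, m, p). m * p) ` I. f n * \<phi> (g n))"
   by (rule sum_mono2) (use fI sub nn in auto)
  also have "\<dots> <= (\<Sum>(j, m, p)\<in>I. f (m * p) * \<phi> (g (m * p)))"
   using sum_image_le[OF fI, of "%n. f n * \<phi> (g n)" "%(j, m, p). m * p"] nn by (simp add: case_prod_unfold comp_def)
  also have "\<dots> <= (\<Sum>(j, m, p)\<in>I. A1 * f m * \<psi> m)"
  proof (intro sum_mono, clarify)
   fix j m p assume "(j, m, p) : I"
   hence h: "m : Mj j" "p : P' m" by (auto simp: I_def)
   have p: "prime p" "\<not> p dvd m" using h by (auto simp: P'_def P_def)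
   have cop: "coprime m p" using prime_imp_coprime[OF p] by (simp add: coprime_commute)
   have fe: "f (m * p) = f m * f p" by (rule mult_classD(3)[OF f mpos[OF h(1)] ppos[OF h(2)] cop])
   have "g (m * p) = g m + of_bool (p : E)" using g cop mpos[OF h(1)] ppos[OF h(2)] p by (auto simp: additive_fun_def)
   hence ge: "\<phi> (g (m * p)) <= \<psi> m" using \<phi> by (cases "p : E") (auto simp: \<psi>_def)
   have "f m * f p * \<phi> (g (m * p)) <= (f m * A1) * \<psi> m"
   using ge \<phi> f0[OF mpos[OF h(1)]] f0[OF ppos[OF h(2)]] mult_classD(4)[OF f p(1)] by (intro mult_mono mult_left_mono) auto
   thus "f (m * p) * \<phi> (g (m * p)) <= A1 * f m * \<psi> m" unfolding fe by (simp add: mult_ac)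
  qed
  also have "\<dots> = (\<Sum>j\<in>J. \<Sum>(m, p)\<in>Sigma (Mj j) P'. A1 * f m * \<psi> m)"
   unfolding I_def by (subst sum.Sigma) (use fJ fMj fP' in auto)
  also have "\<dots> = (\<Sum>j\<in>J. \<Sum>m\<in>Mj j. \<Sum>p\<in>P' m. A1 * f m * \<psi> m)"
   by (intro sum.cong refl, subst sum.Sigma) (use fMj fP' in auto)
  also have "\<dots> <= (\<Sum>j\<in>J. real (j + 1) ^ (v + 1) * exp (- (real j / 2)) * (C0 * (x / ln x * exp (- Mx)) * Z))"
  proof (intro sum_mono)
   fix j assume j: "j : J"
   have j1: "1 <= j" "real j <= sqrt (ln x)" using j by (auto simp: J_def)
   let ?c = "C0 * (x / ln x * exp (- Mx)) * (real (j + 1) ^ (v + 1) * exp (- (real j / 2)))"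
   have c0: "0 <= ?c" using C0 x1 by simp
   have "(\<Sum>m\<in>Mj j. \<Sum>p\<in>P' m. A1 * f m * \<psi> m) <= (\<Sum>m\<in>Mj j. ?c * (rankin_weight f v (real j / ln x) m * \<psi> m))"
   proof (intro sum_mono)
   fix m assume m: "m : Mj j"
   have m0: "0 < m" by (rule mpos[OF m])
   have mN: "x powr (1 / real (j + 1)) <= x / real m" and mh: "x powr (1/2) < real m * x powr (1 / real j)" using m by (auto simp: Mj_def)
   define N where "N = x / real m"
   have Npos: "0 < N" using m0 x1 by (simp add: N_def)
   have "ln (x powr (1 / real (j + 1))) <= ln N" using mN x1 Npos by (subst ln_le_cancel_iff) (auto simp: N_def)
   hence lN: "ln x / real (j + 1) <= ln N" using x1 by (simp add: ln_powr)
   have "real (j + 1) * 1 <= ln x"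
   proof -
   have "sqrt (ln x) * 2 <= sqrt (ln x) * sqrt (ln x)" using sL L by (intro mult_left_mono) auto
   thus ?thesis using j1 sL sL2 by simp
   qed
   hence "1 <= ln x / real (j + 1)" by (simp add: field_simps)
   hence lN1: "1 <= ln N" using lN by linarith
   have "exp 1 <= N" using lN1 Npos by (simp add: ln_ge_iff)
   hence N2: "2 <= N" using exp_ge_add_one_self[of "1::real"] by linarith
   have Nx: "N <= x" using m0 x1 mult_left_mono[of 1 "real m" x] by (simp add: N_def divide_le_eq)
   have ratio: "ln x / ln N <= real (j + 1)" using lN lN1 by (simp add: field_simps)
   have c1: "real (card (P m)) <= Cs * (N / ln N) * exp (- sieve_mean R N + (\<Sum>p\<in>prime_factors m. real v / p))"
   using Cs(2)[rule_format, of N m R] N2 m0 R unfolding P_def N_def by simp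
   have "N / ln N <= x / real m * (real (j + 1) / ln x)"
   proof -
   have "1 / ln N <= real (j + 1) / ln x" using lN lN1 L by (simp add: field_simps)
   hence "N * (1 / ln N) <= N * (real (j + 1) / ln x)" using Npos by (intro mult_left_mono) auto
   thus ?thesis by (simp add: N_def)
   qed
   hence c2: "Cs * (N / ln N) <= Cs * (x / real m * (real (j + 1) / ln x))" using Cs(1) by (intro mult_left_mono) auto
   have "Mx <= sieve_mean R N + v * (ln (ln x / ln N) + 8)"
   unfolding Mx_def by (rule prime_mean_count_diff) (use R N2 Nx in auto)
   also have "\<dots> <= sieve_mean R N + v * (ln (real (j + 1)) + 8)"
   proof -
   have "0 < ln x / ln N" using L lN1 by simp
   hence "ln (ln x / ln N) <= ln (real (j + 1))" using ratio by (subst ln_le_cancel_iff) auto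
   thus ?thesis by (intro add_left_mono mult_left_mono) auto
   qed
   finally have "exp (- sieve_mean R N + (\<Sum>p\<in>prime_factors m. real v / p)) <= exp ((- Mx + v * (ln (real (j + 1)) + 8)) + (\<Sum>p\<in>prime_factors m. real v / p))" by simp
   also have "\<dots> = exp (- Mx) * (real (j + 1) ^ v * exp (8 * real v)) * rad_weight v m"
   proof -
   have "exp (real v * ln (real (j + 1))) = real (j + 1) ^ v" by (subst exp_of_nat_mult) simp
   moreover have "exp ((- Mx + v * (ln (real (j + 1)) + 8)) + (\<Sum>p\<in>prime_factors m. real v / p)) =
   exp (- Mx) * (exp (real v * ln (real (j + 1))) * exp (8 * real v)) * exp (\<Sum>p\<in>prime_factors m. real v / p)"
   by (simp add: distrib_left mult.commute flip: exp_add)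
   ultimately show ?thesis by (simp only: rad_weight_def)
   qed
   finally have c3: "exp (- sieve_mean R N + (\<Sum>p\<in>prime_factors m. real v / p)) <= exp (- Mx) * (real (j + 1) ^ v * exp (8 * real v)) * rad_weight v m" .
   have c4: "real (card (P m)) <= (Cs * (x / real m * (real (j + 1) / ln x))) * (exp (- Mx) * (real (j + 1) ^ v * exp (8 * real v)) * rad_weight v m)"
   by (rule order_trans[OF c1], rule mult_mono[OF c2 c3]) (use Cs(1) x1 in auto)
   \<comment> \<open>Rankin's inequality for this \<open>j\<close>; the constant
     \<open>exp 1\<close> comes from \<open>m > x powr (1/2 - 1 / j)\<close> rather than
     \<open>m > x powr (1/2)\<close>.\<close>
   have c5: "1 <= exp 1 * exp (- (real j / 2)) * real m powr (real j / ln x)"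
   proof -
   have "ln (x powr (1/2)) < ln (real m * x powr (1 / real j))" using mh m0 x1 by (subst ln_less_cancel_iff) auto
   hence "ln x / 2 < ln m + ln x / real j" using m0 x1 by (simp add: ln_mult ln_powr)
   hence "real j / ln x * (ln x / 2) <= real j / ln x * (ln m + ln x / real j)" using L by (intro mult_left_mono) auto
   hence "real j / 2 <= real j / ln x * ln m + 1" using L j1 by (simp add: distrib_left)
   hence "0 <= 1 + - (real j / 2) + real j / ln x * ln (real m)" by linarith
   hence "1 <= exp (1 + - (real j / 2) + real j / ln x * ln (real m))" by (simp only: one_le_exp_iff)
   moreover have "real m powr (real j / ln x) = exp (real j / ln x * ln (real m))" using m0 by (simp add: powr_def)
   ultimately show ?thesis by (simp only: exp_add)
   qed
   let ?U = "A1 * f m * \<psi> m * ((Cs * (x / real m * (real (j + 1) / ln x))) * (exp (- Mx) * (real (j + 1) ^ v * exp (8 * real v)) * rad_weight v m))"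
   have pre0: "0 <= A1 * f m * \<psi> m" using A1 f0[OF m0] \<psi>0 by simp
   have U0: "0 <= ?U"
   by (rule mult_nonneg_nonneg[OF pre0]) (use Cs(1) x1 rad_weight_ge_1[of v m] in \<open>auto intro!: mult_nonneg_nonneg\<close>)
   have "(\<Sum>p\<in>P' m. A1 * f m * \<psi> m) = A1 * f m * \<psi> m * real (card (P' m))" by simp
   also have "\<dots> <= A1 * f m * \<psi> m * real (card (P m))"
   using pre0 fP by (intro mult_left_mono) (auto simp: P'_def intro!: card_mono)
   also have "\<dots> <= ?U" using pre0 c4 by (intro mult_left_mono)
   also have "\<dots> <= ?U * (exp 1 * exp (- (real j / 2)) * real m powr (real j / ln x))" using mult_left_mono[OF c5 U0] by simp
   also have "\<dots> = ?c * (f m * rad_weight v m * (real m powr (real j / ln x) * (1 / real m)) * \<psi> m)"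
   by (simp add: C0_def mult_ac)
   also have "1 / real m = real m powr (-1)" using m0 by (simp add: powr_minus_divide)
   also have "real m powr (real j / ln x) * real m powr (-1) = real m powr (real j / ln x - 1)" by (rule powr_diff_one[symmetric])
   finally show "(\<Sum>p\<in>P' m. A1 * f m * \<psi> m) <= ?c * (rankin_weight f v (real j / ln x) m * \<psi> m)"
   by (simp only: rankin_weight_def)
   qed
   also have "\<dots> = ?c * (\<Sum>m\<in>Mj j. rankin_weight f v (real j / ln x) m * \<psi> m)" by (simp only: sum_distrib_left)
   also have "\<dots> <= ?c * (\<Sum>m\<in>SM j. rankin_weight f v (real j / ln x) m * \<psi> m)"
   proof (intro mult_left_mono sum_mono2 fSM c0)
   fix m assume "m : SM j - Mj j"
   hence "0 < m" by (auto simp: SM_def smooth_set_def)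
   thus "0 <= rankin_weight f v (real j / ln x) m * \<psi> m" using rankin_weight_mult(2)[OF f, of m] \<psi>0 by simp
   qed (auto simp: Mj_def)
   also have "\<dots> <= ?c * Z" using Z[rule_format, OF j1] by (intro mult_left_mono c0) (simp add: SM_def A_def \<psi>_def)
   also have "\<dots> = real (j + 1) ^ (v + 1) * exp (- (real j / 2)) * (C0 * (x / ln x * exp (- Mx)) * Z)" by (simp only: mult_ac)
   finally show "(\<Sum>m\<in>Mj j. \<Sum>p\<in>P' m. A1 * f m * \<psi> m) <= real (j + 1) ^ (v + 1) * exp (- (real j / 2)) * (C0 * (x / ln x * exp (- Mx)) * Z)" .
  qed
  also have "\<dots> = (\<Sum>j\<in>J. real (j + 1) ^ (v + 1) * exp (- (real j / 2))) * (C0 * (x / ln x * exp (- Mx)) * Z)" by (simp only: sum_distrib_right)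
  also have "\<dots> <= Cj * (C0 * (x / ln x * exp (- Mx)) * Z)"
  proof (intro mult_right_mono Cj(2) fJ)
   have "0 <= (\<Sum>m\<in>SM 1. rankin_weight f v (real 1 / ln x) m * \<psi> m)"
   proof (rule sum_nonneg)
   fix m assume "m : SM 1"
   hence "0 < m" by (auto simp: SM_def smooth_set_def)
   thus "0 <= rankin_weight f v (real 1 / ln x) m * \<psi> m" using rankin_weight_mult(2)[OF f, of m] \<psi>0 by simp
   qed
   also have "\<dots> <= Z" using Z[rule_format, of 1] L unfolding SM_def A_def \<psi>_def by simp
   finally show "0 <= C0 * (x / ln x * exp (- Mx)) * Z" using C0 x1 by simp
  qed
  finally show ?thesis by (simp add: Mx_def mult_ac)
 qed
 moreover have "(2::real) <= exp 100" using exp_ge_add_one_self[of "100::real"] by linarith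
 ultimately show ?thesis using C0 Cj(1) by (intro exI[of _ "C0 * Cj"] conjI exI[of _ "exp 100"]) (auto simp: mult_ac)
qed

section \<open>Poisson tails\<close>

text \<open>For fixed \<open>k\<close> the ratio of \<open>y ^ k\<close> to \<open>exp y\<close>
  peaks at \<open>y = k\<close>, where Stirling supplies the factor
  \<open>1 / sqrt k\<close>.\<close>

lemma power_div_fact_le:
 assumes "0 < (y::real)" "1 <= k"
 shows "y ^ k / fact k <= exp y / sqrt (real k)"
proof -
 have k: "real k > 0" using assms by simp
 have "ln (y / k) <= y / k - 1" using assms k by (intro ln_le_minus_one) auto
 hence "real k * ln (y / k) <= real k * (y / k - 1)" using k by (intro mult_left_mono) auto
 hence "real k * (ln y - ln k) <= y - k" using assms k by (simp add: ln_div algebra_simps)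
 moreover have "real k * ln k - k + ln k / 2 <= ln (fact k)"
 proof -
  have "0 <= 1 / (4 * real k)" by simp
  thus ?thesis using ln_fact_lower[OF assms(2), unfolded of_nat_mult of_nat_numeral] by linarith
 qed
 ultimately have "real k * ln y - ln (fact k) <= y - ln k / 2" by (simp add: algebra_simps)
 moreover have "ln (y ^ k / fact k) = real k * ln y - ln (fact k)" using assms by (simp add: ln_div ln_realpow)
 moreover have "ln (exp y / sqrt (real k)) = y - ln k / 2" using k by (simp add: ln_div ln_sqrt)
 ultimately have "ln (y ^ k / fact k) <= ln (exp y / sqrt (real k))" by simp
 thus ?thesis using assms k by (subst (asm) ln_le_cancel_iff) auto
qed

lemma sum_geometric_inj_le:
 fixes q :: real
 assumes "0 <= q" "q < 1" "finite K" "inj_on i K"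
 shows "(\<Sum>k\<in>K. q ^ i k) <= 1 / (1 - q)"
proof -
 have "(\<Sum>k\<in>K. q ^ i k) = (\<Sum>j\<in>i ` K. q ^ j)" using assms by (simp add: sum.reindex)
 also have "\<dots> <= (\<Sum>j. q ^ j)" using assms by (intro sum_le_suminf summable_geometric) auto
 also have "\<dots> = 1 / (1 - q)" using assms by (intro suminf_geometric) auto
 finally show ?thesis .
qed

lemma ln_one_plus_ge:
 assumes "0 <= (u::real)"
 shows "u - u\<^sup>2 / 2 <= ln (1 + u)"
proof -
 have "ln (1 + 0) - 0 + 0\<^sup>2 / 2 <= ln (1 + u) - u + u\<^sup>2 / (2::real)"
 proof (rule DERIV_nonneg_imp_nondecreasing[OF assms])
  fix x :: real assume "0 <= x" "x <= u"
  hence "((%x. ln (1 + x) - x + x\<^sup>2 / 2) has_real_derivative (1 / (1 + x) - 1 + x)) (at x)"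
   by (auto intro!: derivative_eq_intros)
  moreover have "1 / (1 + x) - 1 + x = x\<^sup>2 / (1 + x)" using \<open>0 <= x\<close> by (simp add: field_simps power2_eq_square)
  hence "0 <= 1 / (1 + x) - 1 + x" using \<open>0 <= x\<close> by simp
  ultimately show "\<exists>y. ((%x. ln (1 + x) - x + x\<^sup>2 / 2) has_real_derivative y) (at x) & 0 <= y" by blast
 qed
 thus ?thesis by simp
qed

lemma entropy_upper_ge:
 assumes "0 <= (u::real)"
 shows "u + u\<^sup>2 / 2 - u ^ 3 / 2 <= (1 + u) * ln (1 + u)"
proof -
 have "(1 + u) * (u - u\<^sup>2 / 2) <= (1 + u) * ln (1 + u)" using ln_one_plus_ge[OF assms] assms by (intro mult_left_mono) auto
 moreover have "(1 + u) * (u - u\<^sup>2 / 2) = u + u\<^sup>2 / 2 - u ^ 3 / 2" by (simp add: field_simps power2_eq_square power3_eq_cube)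
 ultimately show ?thesis by linarith
qed

lemma entropy_lower_ge:
 assumes "0 <= (u::real)" "u < 1"
 shows "- u + u\<^sup>2 / 2 <= (1 - u) * ln (1 - u)"
proof -
 have "(1 - 0) * ln (1 - 0) + 0 - 0\<^sup>2 / 2 <= (1 - u) * ln (1 - u) + u - u\<^sup>2 / (2::real)"
 proof (rule DERIV_nonneg_imp_nondecreasing[OF assms(1)])
  fix x :: real assume x: "0 <= x" "x <= u"
  hence "((%x. (1 - x) * ln (1 - x) + x - x\<^sup>2 / 2) has_real_derivative (- ln (1 - x) - x)) (at x)"
   using assms(2) by (auto intro!: derivative_eq_intros)
  moreover have "0 <= - ln (1 - x) - x" using ln_le_minus_one[of "1 - x"] x assms by simp
  ultimately show "\<exists>y. ((%x. (1 - x) * ln (1 - x) + x - x\<^sup>2 / 2) has_real_derivative y) (at x) & 0 <= y" by blast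
 qed
 thus ?thesis by simp
qed

text \<open>In this range \<open>M >= 100 * lam^2\<close>, so any contribution of order
  \<open>exp (- M / 10)\<close> is below the Gaussian target.\<close>

lemma exp_minus_tenth_le:
 assumes "1 <= lam" "lam <= sqrt M / 10"
 shows "exp (- (M / 10)) <= inverse lam * exp (- (lam\<^sup>2 / 2))"
proof -
 have "10 * lam <= sqrt M" using assms by simp
 hence "(10 * lam)\<^sup>2 <= (sqrt M)\<^sup>2" using assms by (intro power_mono) auto
 moreover have M0: "0 <= M"
 proof -
  have "0 < sqrt M" using assms by linarith
  thus ?thesis by simp
 qed
 ultimately have M: "100 * lam\<^sup>2 <= M" by (simp add: power_mult_distrib)
 have l2: "lam <= lam\<^sup>2" using mult_left_mono[of 1 lam lam] assms by (simp add: power2_eq_square)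
 have "lam <= exp lam" using exp_ge_add_one_self[of lam] by linarith
 also have "lam <= M / 10 - lam\<^sup>2 / 2" using M l2 zero_le_power2[of lam] by linarith
 hence "exp lam <= exp (M / 10 - lam\<^sup>2 / 2)" by simp
 finally have "lam * exp (- (M / 10)) <= exp (M / 10 - lam\<^sup>2 / 2) * exp (- (M / 10))" by (intro mult_right_mono) auto
 also have "\<dots> = exp (- (lam\<^sup>2 / 2))" by (simp flip: exp_add)
 finally show ?thesis using assms by (simp add: field_simps)
qed

text \<open>Exponential tilting by \<open>r = 1 + \<delta>\<close> above and
  \<open>r = 1 - \<delta>\<close> below: \<open>M ^ k / fact k\<close> is
  \<open>(M * r) ^ k / fact k\<close> times \<open>(1 / r) ^ k\<close>. The first factor is bounded
  pointwise by Stirling, which supplies \<open>1 / sqrt M\<close>; the second sums geometrically to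
  about \<open>1 / \<delta>\<close>. Their product is \<open>1 / lam\<close>, the factor a Chernoff
  bound would miss.\<close>

lemma poisson_tail:
 assumes lam: "1 <= lam" "lam <= sqrt M / 10" and K: "finite K" "!!k. k : K ==> lam * sqrt M <= \<bar>real k - M\<bar>"
 shows "exp (- M) * (\<Sum>k\<in>K. M ^ k / fact k) <= 5 * (inverse lam * exp (- (lam\<^sup>2 / 2) + lam ^ 3 / sqrt M))"
proof -
 have sM: "10 <= sqrt M" using lam by simp
 hence "0 < sqrt M" by linarith
 hence M0: "0 < M" by simp
 define \<delta> where "\<delta> = lam / sqrt M"
 have \<delta>: "0 < \<delta>" "\<delta> <= 1/10" using lam sM M0 by (auto simp: \<delta>_def field_simps)
 have ss: "sqrt M * sqrt M = M" using M0 by simp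
 have Md: "M * \<delta> = lam * sqrt M" using ss M0 by (simp add: \<delta>_def field_simps)
 have Md2: "M * \<delta>\<^sup>2 = lam\<^sup>2" using M0 by (simp add: \<delta>_def power_divide)
 have Md3: "M * \<delta> ^ 3 = lam ^ 3 / sqrt M"
 proof -
  have "M * \<delta> ^ 3 = (M * \<delta>\<^sup>2) * \<delta>" by (simp add: power2_eq_square power3_eq_cube)
  also have "\<dots> = lam ^ 3 / sqrt M" unfolding Md2 by (simp add: \<delta>_def power2_eq_square power3_eq_cube)
  finally show ?thesis .
 qed
 have sd: "1 / (sqrt M * \<delta>) = inverse lam" using M0 by (simp add: \<delta>_def inverse_eq_divide)
 let ?e = "inverse lam * exp (- (lam\<^sup>2 / 2) + lam ^ 3 / sqrt M)"
 have mono_e: "inverse lam * exp (- (lam\<^sup>2 / 2)) <= ?e" using lam M0 by (intro mult_left_mono) auto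
 define A where "A = {k\<in>K. M * (1 + \<delta>) <= real k}"
 define B where "B = {k\<in>K. M / 2 <= real k & real k <= M * (1 - \<delta>)}"
 define C where "C = {k\<in>K. real k < M / 2}"
 have fin: "finite A" "finite B" "finite C" using K by (auto simp: A_def B_def C_def)
 have sub: "K \<subseteq> A \<union> (B \<union> C)"
 proof
  fix k assume k: "k : K"
  have "M * \<delta> <= \<bar>real k - M\<bar>" using K(2)[OF k] Md by simp
  thus "k : A \<union> (B \<union> C)" using k by (auto simp: A_def B_def C_def algebra_simps abs_if split: if_splits)
 qed
 have a: "exp (- M) * (\<Sum>k\<in>A. M ^ k / fact k) <= 2 * ?e"
 proof -
  define r where "r = 1 + \<delta>"
  have r: "1 < r" "r <= 2" using \<delta> by (auto simp: r_def)
  define k0 where "k0 = nat \<lceil>M * r\<rceil>"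
  have k0: "M * r <= real k0" using M0 r by (simp add: k0_def)
  have kA: "k0 <= k" "M <= real k" "1 <= k" if "k : A" for k
  proof -
   have h: "M * r <= real k" using that by (simp add: A_def r_def)
   thus "k0 <= k" by (simp add: k0_def ceiling_le_iff)
   have "M * 1 <= M * r" using r M0 by (intro mult_left_mono) auto
   thus "M <= real k" using h by simp
   thus "1 <= k" using M0 by (cases k) auto
  qed
  have "(\<Sum>k\<in>A. M ^ k / fact k) <= (\<Sum>k\<in>A. exp (M * r) / sqrt M * ((1 / r) ^ k0 * (1 / r) ^ (k - k0)))"
  proof (intro sum_mono)
   fix k assume k: "k : A"
   have "M ^ k / fact k = (M * r) ^ k / fact k * (1 / r) ^ k" using r by (simp add: power_mult_distrib power_divide)
   also have "\<dots> <= exp (M * r) / sqrt (real k) * (1 / r) ^ k"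
   using M0 r kA(3)[OF k] by (intro mult_right_mono power_div_fact_le) auto
   also have "\<dots> <= exp (M * r) / sqrt M * (1 / r) ^ k"
   using M0 r kA(2)[OF k] by (intro mult_right_mono divide_left_mono) auto
   also have "(1 / r) ^ k = (1 / r) ^ k0 * (1 / r) ^ (k - k0)" using kA(1)[OF k] by (simp flip: power_add)
   finally show "M ^ k / fact k <= exp (M * r) / sqrt M * ((1 / r) ^ k0 * (1 / r) ^ (k - k0))" .
  qed
  also have "\<dots> = exp (M * r) / sqrt M * ((1 / r) ^ k0 * (\<Sum>k\<in>A. (1 / r) ^ (k - k0)))" by (simp add: sum_distrib_left)
  also have "\<dots> <= exp (M * r) / sqrt M * (exp (- (M * r * ln r)) * (2 / \<delta>))"
  proof (intro mult_left_mono mult_mono)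
   have er: "exp (- ln r) = 1 / r" using r by (subst exp_minus) (simp add: divide_inverse)
   have "(1 / r) ^ k0 = exp (real k0 * (- ln r))" by (subst exp_of_nat_mult) (simp only: er)
   also have "\<dots> <= exp (M * r * (- ln r))" using k0 r by (subst exp_le_cancel_iff, intro mult_right_mono_neg) auto
   finally show "(1 / r) ^ k0 <= exp (- (M * r * ln r))" by simp
   have "(\<Sum>k\<in>A. (1 / r) ^ (k - k0)) <= 1 / (1 - 1 / r)"
   proof (rule sum_geometric_inj_le)
   show "inj_on (%k. k - k0) A"
   proof (rule inj_onI)
   fix k l assume "k : A" "l : A" "k - k0 = l - k0"
   thus "k = l" using kA(1)[of k] kA(1)[of l] by linarith
   qed
   qed (use r fin in auto)
   also have "1 - 1 / r = \<delta> / r" using r by (simp add: r_def diff_divide_distrib[symmetric] divide_simps)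
   also have "1 / (\<delta> / r) = r / \<delta>" by simp
   also have "\<dots> <= 2 / \<delta>" using r \<delta> by (intro divide_right_mono) auto
   finally show "(\<Sum>k\<in>A. (1 / r) ^ (k - k0)) <= 2 / \<delta>" .
  qed (use r M0 in \<open>auto intro!: sum_nonneg\<close>)
  finally have "exp (- M) * (\<Sum>k\<in>A. M ^ k / fact k) <= exp (- M) * (exp (M * r) / sqrt M * (exp (- (M * r * ln r)) * (2 / \<delta>)))"
   by (intro mult_left_mono) auto
  also have "\<dots> = 2 * (1 / (sqrt M * \<delta>) * (exp (- M) * exp (M * r) * exp (- (M * r * ln r))))" by (simp add: divide_inverse mult_ac)
  also have "exp (- M) * exp (M * r) * exp (- (M * r * ln r)) = exp (M * (\<delta> - (1 + \<delta>) * ln (1 + \<delta>)))"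
   by (simp add: r_def algebra_simps flip: exp_add)
  also have "2 * (1 / (sqrt M * \<delta>) * exp (M * (\<delta> - (1 + \<delta>) * ln (1 + \<delta>)))) <= 2 * ?e" unfolding sd
  proof (intro mult_left_mono)
   have "M * (\<delta> - (1 + \<delta>) * ln (1 + \<delta>)) <= M * (- (\<delta>\<^sup>2 / 2) + \<delta> ^ 3 / 2)"
   using entropy_upper_ge[of \<delta>] \<delta> M0 by (intro mult_left_mono) auto
   also have "\<dots> = - (M * \<delta>\<^sup>2 / 2) + M * \<delta> ^ 3 / 2" by (simp add: algebra_simps)
   also have "\<dots> <= - (lam\<^sup>2 / 2) + lam ^ 3 / sqrt M"
   proof -
   have "0 <= lam ^ 3 / sqrt M" using lam M0 by simp
   moreover have "t / 2 <= t" if "0 <= t" for t :: real using that by simp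
   ultimately show ?thesis unfolding Md2 Md3 by (intro add_left_mono) blast
   qed
   finally show "exp (M * (\<delta> - (1 + \<delta>) * ln (1 + \<delta>))) <= exp (- (lam\<^sup>2 / 2) + lam ^ 3 / sqrt M)" by simp
  qed (use lam in auto)
  finally show ?thesis .
 qed
 have b: "exp (- M) * (\<Sum>k\<in>B. M ^ k / fact k) <= 2 * ?e"
 proof -
  define r where "r = 1 - \<delta>"
  have r: "0 < r" "r < 1" using \<delta> by (auto simp: r_def)
  define k1 where "k1 = nat \<lfloor>M * r\<rfloor>"
  have Mr: "0 <= M * r" using M0 r by simp
  have k1: "real k1 <= M * r" using Mr by (simp add: k1_def)
  have kB: "k <= k1" "M / 4 <= real k" "1 <= k" if "k : B" for k
  proof -
   show "k <= k1" using that Mr by (simp add: B_def r_def k1_def le_nat_iff le_floor_iff)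
   show "M / 4 <= real k" using that M0 by (simp add: B_def)
   show "1 <= k" using that M0 by (cases k) (auto simp: B_def)
  qed
  have "(\<Sum>k\<in>B. M ^ k / fact k) <= (\<Sum>k\<in>B. exp (M * r) * (2 / sqrt M) * ((1 / r) ^ k1 * r ^ (k1 - k)))"
  proof (intro sum_mono)
   fix k assume k: "k : B"
   have "M ^ k / fact k = (M * r) ^ k / fact k * (1 / r) ^ k" using r by (simp add: power_mult_distrib power_divide)
   also have "\<dots> <= exp (M * r) / sqrt (real k) * (1 / r) ^ k"
   using M0 r kB(3)[OF k] by (intro mult_right_mono power_div_fact_le) auto
   also have "\<dots> <= exp (M * r) * (2 / sqrt M) * (1 / r) ^ k"
   proof -
   have "sqrt (M / 4) <= sqrt (real k)" using kB(2)[OF k] by simp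
   hence "sqrt M / 2 <= sqrt (real k)" by (simp add: real_sqrt_divide)
   hence "1 / sqrt (real k) <= 1 / (sqrt M / 2)" using M0 kB(3)[OF k] by (intro divide_left_mono) auto
   hence "exp (M * r) * (1 / sqrt (real k)) <= exp (M * r) * (2 / sqrt M)" by (intro mult_left_mono) auto
   thus ?thesis using r by (intro mult_right_mono) auto
   qed
   also have "(1 / r) ^ k = (1 / r) ^ k1 * r ^ (k1 - k)"
   proof -
   have "(1 / r) ^ k1 = (1 / r) ^ k * (1 / r) ^ (k1 - k)" using kB(1)[OF k] by (simp flip: power_add)
   thus ?thesis using r by (simp add: power_divide)
   qed
   finally show "M ^ k / fact k <= exp (M * r) * (2 / sqrt M) * ((1 / r) ^ k1 * r ^ (k1 - k))" .
  qed
  also have "\<dots> = exp (M * r) * (2 / sqrt M) * ((1 / r) ^ k1 * (\<Sum>k\<in>B. r ^ (k1 - k)))" by (simp add: sum_distrib_left)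
  also have "\<dots> <= exp (M * r) * (2 / sqrt M) * (exp (- (M * r * ln r)) * (1 / \<delta>))"
  proof (intro mult_left_mono mult_mono)
   have er: "exp (- ln r) = 1 / r" using r by (subst exp_minus) (simp add: divide_inverse)
   have "(1 / r) ^ k1 = exp (real k1 * (- ln r))" by (subst exp_of_nat_mult) (simp only: er)
   also have "\<dots> <= exp (M * r * (- ln r))" using k1 r by (subst exp_le_cancel_iff, intro mult_right_mono) auto
   finally show "(1 / r) ^ k1 <= exp (- (M * r * ln r))" by simp
   have "(\<Sum>k\<in>B. r ^ (k1 - k)) <= 1 / (1 - r)"
   proof (rule sum_geometric_inj_le)
   show "inj_on (%k. k1 - k) B"
   proof (rule inj_onI)
   fix k l assume "k : B" "l : B" "k1 - k = k1 - l"
   thus "k = l" using kB(1)[of k] kB(1)[of l] by linarith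
   qed
   qed (use r fin in auto)
   thus "(\<Sum>k\<in>B. r ^ (k1 - k)) <= 1 / \<delta>" by (simp add: r_def)
  qed (use r M0 in \<open>auto intro!: sum_nonneg\<close>)
  finally have "exp (- M) * (\<Sum>k\<in>B. M ^ k / fact k) <= exp (- M) * (exp (M * r) * (2 / sqrt M) * (exp (- (M * r * ln r)) * (1 / \<delta>)))"
   by (intro mult_left_mono) auto
  also have "\<dots> = 2 * (1 / (sqrt M * \<delta>) * (exp (- M) * exp (M * r) * exp (- (M * r * ln r))))" by (simp add: divide_inverse mult_ac)
  also have "exp (- M) * exp (M * r) * exp (- (M * r * ln r)) = exp (M * (- \<delta> - (1 - \<delta>) * ln (1 - \<delta>)))"
   by (simp add: r_def algebra_simps flip: exp_add)
  also have "2 * (1 / (sqrt M * \<delta>) * exp (M * (- \<delta> - (1 - \<delta>) * ln (1 - \<delta>)))) <= 2 * (inverse lam * exp (- (lam\<^sup>2 / 2)))" unfolding sd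
  proof (intro mult_left_mono)
   have "M * (- \<delta> - (1 - \<delta>) * ln (1 - \<delta>)) <= M * (- (\<delta>\<^sup>2 / 2))"
   using entropy_lower_ge[of \<delta>] \<delta> M0 by (intro mult_left_mono) auto
   also have "\<dots> = - (lam\<^sup>2 / 2)" using Md2 by simp
   finally show "exp (M * (- \<delta> - (1 - \<delta>) * ln (1 - \<delta>))) <= exp (- (lam\<^sup>2 / 2))" by simp
  qed (use lam in auto)
  also have "\<dots> <= 2 * ?e" using mono_e by simp
  finally show ?thesis .
 qed
 \<comment> \<open>Here \<open>k\<close> may be small and \<open>1 / sqrt k\<close> gives nothing,
   but a tilt by 1/2 already yields \<open>exp (- M / 10)\<close>.\<close>
 have c: "exp (- M) * (\<Sum>k\<in>C. M ^ k / fact k) <= ?e"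
 proof -
  have "(\<Sum>k\<in>C. M ^ k / fact k) <= (\<Sum>k\<in>C. exp (M / 2 * ln 2) * ((M / 2) ^ k / fact k))"
  proof (intro sum_mono)
   fix k assume k: "k : C"
   have "(2::real) ^ k = exp (real k * ln 2)" by (simp add: exp_of_nat_mult)
   also have "\<dots> <= exp (M / 2 * ln 2)" using k by (subst exp_le_cancel_iff, intro mult_right_mono) (auto simp: C_def)
   finally have "2 ^ k * ((M / 2) ^ k / fact k) <= exp (M / 2 * ln 2) * ((M / 2) ^ k / fact k)" using M0 by (intro mult_right_mono) auto
   thus "M ^ k / fact k <= exp (M / 2 * ln 2) * ((M / 2) ^ k / fact k)" by (simp add: power_divide)
  qed
  also have "\<dots> = exp (M / 2 * ln 2) * (\<Sum>k\<in>C. (M / 2) ^ k / fact k)" by (simp add: sum_distrib_left)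
  also have "\<dots> <= exp (M / 2 * ln 2) * exp (M / 2)"
  proof (intro mult_left_mono)
   have "(\<Sum>k\<in>C. (M / 2) ^ k / fact k) = (\<Sum>k\<in>C. (M / 2) ^ k /\<^sub>R fact k)"
   by (intro sum.cong refl) (simp only: real_scaleR_def divide_real_def mult.commute)
   also have "\<dots> <= (\<Sum>k. (M / 2) ^ k /\<^sub>R fact k)" using M0 fin by (intro sum_le_suminf summable_exp_generic) auto
   finally show "(\<Sum>k\<in>C. (M / 2) ^ k / fact k) <= exp (M / 2)" by (simp add: exp_def)
  qed auto
  finally have "exp (- M) * (\<Sum>k\<in>C. M ^ k / fact k) <= exp (- M) * (exp (M / 2 * ln 2) * exp (M / 2))" by (intro mult_left_mono) auto
  also have "\<dots> = exp (- (M / 2) + M / 2 * ln 2)" by (simp flip: exp_add)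
  also have "\<dots> <= exp (- (M / 10))"
  proof -
   have "ln 2 <= (7/10::real)" using ln2_le_25_over_36 by simp
   hence "M / 2 * ln 2 <= M / 2 * (7/10)" using M0 by (intro mult_left_mono) auto
   hence "- (M / 2) + M / 2 * ln 2 <= - (M / 10)" using M0 by linarith
   thus ?thesis by simp
  qed
  also have "\<dots> <= inverse lam * exp (- (lam\<^sup>2 / 2))" by (rule exp_minus_tenth_le[OF lam])
  also have "\<dots> <= ?e" by (rule mono_e)
  finally show ?thesis .
 qed
 have pos: "0 <= M ^ k / fact k" for k using M0 by simp
 have "(\<Sum>k\<in>K. M ^ k / fact k) <= (\<Sum>k\<in>A \<union> (B \<union> C). M ^ k / fact k)" by (rule sum_mono2) (use fin sub pos in auto)
 also have "\<dots> <= (\<Sum>k\<in>A. M ^ k / fact k) + ((\<Sum>k\<in>B. M ^ k / fact k) + (\<Sum>k\<in>C. M ^ k / fact k))"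
 proof -
  have un: "(\<Sum>k\<in>X \<union> Y. M ^ k / fact k) <= (\<Sum>k\<in>X. M ^ k / fact k) + (\<Sum>k\<in>Y. M ^ k / fact k)" if "finite X" "finite Y" for X Y
  proof -
   have "0 <= (\<Sum>k\<in>X \<inter> Y. M ^ k / fact k)" by (intro sum_nonneg pos)
   thus ?thesis using sum.union_inter[OF that, of "%k. M ^ k / fact k"] by linarith
  qed
  show ?thesis using un[OF fin(1) finite_UnI[OF fin(2,3)]] un[OF fin(2,3)] by linarith
 qed
 finally have "exp (- M) * (\<Sum>k\<in>K. M ^ k / fact k) <= exp (- M) * ((\<Sum>k\<in>A. M ^ k / fact k) + ((\<Sum>k\<in>B. M ^ k / fact k) + (\<Sum>k\<in>C. M ^ k / fact k)))"
  by (intro mult_left_mono) auto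
 thus ?thesis using a b c by (simp add: distrib_left)
qed

section \<open>Inclusion-exclusion and errors in progressions\<close>

lemma prod_one_minus_expand:
 fixes w :: "'a => real"
 assumes "finite Q"
 shows "(\<Prod>p\<in>Q. 1 - w p) = (\<Sum>T\<in>Pow Q. (-1) ^ card T * (\<Prod>p\<in>T. w p))"
proof -
 have "(\<Prod>p\<in>Q. 1 - w p) = (\<Prod>p\<in>Q. - w p + 1)" by (intro prod.cong refl) simp
 also have "\<dots> = (\<Sum>T\<in>Pow Q. (\<Prod>p\<in>T. - w p) * (\<Prod>p\<in>Q - T. 1))" by (rule prod_add[OF assms])
 also have "\<dots> = (\<Sum>T\<in>Pow Q. (-1) ^ card T * (\<Prod>p\<in>T. w p))" by (simp add: prod_uminus)
 finally show ?thesis .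
qed

lemma inclusion_exclusion_weighted:
 fixes f :: "'n => real"
 assumes Q: "finite Q" and N: "finite N"
 shows "(\<Sum>n | n : N & (\<forall>p\<in>Q. \<not> hit p n). f n) = (\<Sum>T\<in>Pow Q. (-1) ^ card T * (\<Sum>n | n : N & (\<forall>p\<in>T. hit p n). f n))"
proof -
 have "(\<Sum>n | n : N & (\<forall>p\<in>Q. \<not> hit p n). f n) = (\<Sum>n\<in>N. if \<forall>p\<in>Q. \<not> hit p n then f n else 0)"
  using sum.inter_filter[OF N, of f "%n. \<forall>p\<in>Q. \<not> hit p n"] by simp
 also have "\<dots> = (\<Sum>n\<in>N. f n * (\<Prod>p\<in>Q. 1 - of_bool (hit p n)))"
  using Q by (intro sum.cong refl) (auto simp: prod_zero_iff)
 also have "\<dots> = (\<Sum>n\<in>N. \<Sum>T\<in>Pow Q. (-1) ^ card T * (f n * (\<Prod>p\<in>T. of_bool (hit p n))))"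
  by (simp add: prod_one_minus_expand[OF Q] sum_distrib_left mult_ac)
 also have "\<dots> = (\<Sum>T\<in>Pow Q. (-1) ^ card T * (\<Sum>n\<in>N. f n * (\<Prod>p\<in>T. of_bool (hit p n))))"
  by (subst sum.swap) (simp add: sum_distrib_left)
 also have "\<dots> = (\<Sum>T\<in>Pow Q. (-1) ^ card T * (\<Sum>n | n : N & (\<forall>p\<in>T. hit p n). f n))"
 proof (rule sum.cong[OF refl])
  fix T assume "T : Pow Q"
  hence T: "finite T" using Q by (auto intro: finite_subset)
  have "(\<Sum>n\<in>N. f n * (\<Prod>p\<in>T. of_bool (hit p n))) = (\<Sum>n\<in>N. if \<forall>p\<in>T. hit p n then f n else 0)"
   using T by (intro sum.cong refl) (auto simp: prod_zero_iff)
  also have "\<dots> = (\<Sum>n | n : N & (\<forall>p\<in>T. hit p n). f n)"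
   using sum.inter_filter[OF N, of f "%n. \<forall>p\<in>T. hit p n"] by simp
  finally show "(-1) ^ card T * (\<Sum>n\<in>N. f n * (\<Prod>p\<in>T. of_bool (hit p n))) = (-1) ^ card T * (\<Sum>n | n : N & (\<forall>p\<in>T. hit p n). f n)"
   by (simp only:)
 qed
 finally show ?thesis .
qed

definition euler_inverse :: "(nat => real) => nat => real" where
 "euler_inverse f p = inverse (\<Sum>l. f (p ^ l) / real (p ^ l))"

text \<open>The series starts with \<open>f 1 = 1\<close> and has nonnegative terms, so its sum is
  at least 1 once it is known to converge; the growth bound with exponent 1/2 gives a geometric
  majorant.\<close>

lemma euler_inverse_bounds:
 assumes f: "f : mult_class A1 A2" and p: "prime p"
 shows "0 <= euler_inverse f p" "euler_inverse f p <= 1"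
proof -
 have p2: "real p >= 2" using prime_ge_2_nat[OF p] by simp
 have p0: "0 < p" using p by (simp add: prime_gt_0_nat)
 have nn: "0 <= f (p ^ l) / real (p ^ l)" for l using mult_classD(2)[OF f, of "p ^ l"] p0 by simp
 have "summable (%l. f (p ^ l) / real (p ^ l))"
 proof (rule summable_comparison_test)
  have "real p powr (-(1/2)) < 1" using p2 powr_less_mono[of "-(1/2)" 0 "real p"] by simp
  thus "summable (%l. A2 (1/2) * (real p powr (-(1/2))) ^ l)" by (intro summable_mult summable_geometric) simp
  have "f (p ^ l) / real (p ^ l) <= A2 (1/2) * (real p powr (-(1/2))) ^ l" for l
  proof -
   have "f (p ^ l) / real (p ^ l) <= A2 (1/2) * real (p ^ l) powr (1/2) / real (p ^ l)"
   using mult_classD(5)[OF f, of "1/2" "p ^ l"] p0 by (intro divide_right_mono) auto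
   also have "\<dots> = A2 (1/2) * (real (p ^ l) powr (1/2) * real (p ^ l) powr (-1))" using p0 by (simp add: powr_minus_divide)
   also have "real (p ^ l) powr (1/2) * real (p ^ l) powr (-1) = real (p ^ l) powr (-(1/2))" by (simp only: powr_add[symmetric]) simp
   also have "\<dots> = (real p powr (-(1/2))) ^ l" using p0 by (simp add: powr_powr mult.commute flip: powr_realpow)
   finally show ?thesis .
  qed
  thus "\<exists>N. \<forall>n\<ge>N. norm (f (p ^ n) / real (p ^ n)) <= A2 (1/2) * (real p powr (-(1/2))) ^ n"
   using nn by (intro exI[of _ 0] allI impI) (simp only: real_norm_def abs_of_nonneg)
 qed
 hence "(\<Sum>l\<in>{0}. f (p ^ l) / real (p ^ l)) <= (\<Sum>l. f (p ^ l) / real (p ^ l))" using nn by (intro sum_le_suminf) auto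
 hence 1: "1 <= (\<Sum>l. f (p ^ l) / real (p ^ l))" using mult_classD(1)[OF f] by simp
 show "0 <= euler_inverse f p" "euler_inverse f p <= 1" unfolding euler_inverse_def using 1 by (simp_all add: inverse_le_1_iff)
qed

lemma prod_primes:
 assumes "finite U" "!!p. p : U ==> prime (p::nat)"
 shows "prime_factors (\<Prod>U) = U" "squarefree (\<Prod>U)" "0 < \<Prod>U" "totient (\<Prod>U) = (\<Prod>p\<in>U. p - 1)"
proof -
 let ?ds = "rev (sorted_list_of_set U)"
 have "sorted_wrt (>) ?ds" using strict_sorted_list_of_set[of U] by (simp add: sorted_wrt_rev)
 moreover have "\<forall>p\<in>set ?ds. prime p" "set ?ds = U" using assms by auto
 ultimately show "prime_factors (\<Prod>U) = U" "squarefree (\<Prod>U)" using desc_prime_list[of ?ds] by auto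
 show "0 < \<Prod>U" using assms(2) by (intro prod_pos) (auto simp: prime_gt_0_nat)
 show "totient (\<Prod>U) = (\<Prod>p\<in>U. p - 1)" using assms
 proof (induction U rule: finite_induct)
  case (insert p U)
  have "coprime p (\<Prod>U)" using insert by (intro prod_coprime_right) (auto intro!: primes_coprime)
  thus ?case using insert by (simp add: totient_mult_coprime totient_prime)
 qed simp
qed

definition class_error :: "(nat => real) => (nat => nat set) => real => nat => real" where
 "class_error f R x d = real (residue_count_prod R d) * (MAX a\<in>totatives d. progression_error f x d a)"

lemma progression_error_le_Max: "a : totatives d ==> progression_error f x d a <= (MAX a\<in>totatives d. progression_error f x d a)"
 by (intro Max_ge) auto

lemma class_error_nonneg: "0 < d ==> 0 <= class_error f R x d"
proof -
 assume d: "0 < d"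
 have "0 <= progression_error f x d 1" by (simp add: progression_error_def)
 also have "\<dots> <= (MAX a\<in>totatives d. progression_error f x d a)" using d by (intro progression_error_le_Max) (auto simp: in_totatives_iff)
 finally show ?thesis by (simp add: class_error_def)
qed

text \<open>By the Chinese remainder theorem the conditions select
  \<open>\<Prod>p\<in>U. card (R p)\<close> classes, all coprime to the product; each contributes
  one progression error, bounded by the maximum.\<close>

lemma class_sum_error:
 assumes f: "f : mult_class A1 A2" and U: "finite U" "!!p. p : U ==> prime p" and R: "!!p. prime p ==> R p \<subseteq> totatives p"
 shows "\<bar>(\<Sum>n | n : {n. 0 < n & real n <= x} & (\<forall>p\<in>U. n mod p : R p). f n) -
   (total f x) * (\<Prod>p\<in>U. real (card (R p)) * euler_inverse f p / (real p - 1))\<bar> <= class_error f R x (\<Prod>U)"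
proof (cases "U = {}")
 \<comment> \<open>Modulo 1 the representative is 0, whereas \<open>totatives 1\<close> is
   \<open>{1}\<close>; the empty product is therefore treated apart.\<close>
 case True
 thus ?thesis using class_error_nonneg[of 1 f R x] by simp
next
 case False
 define d where "d = \<Prod>U"
 let ?X = "\<Sum>n | 0 < n & real n <= x. f n"
 have pf: "prime_factors d = U" "squarefree d" "0 < d" "totient d = (\<Prod>p\<in>U. p - 1)" unfolding d_def using prod_primes[OF U] by auto
 have pd: "p dvd d" if "p : U" for p using that U(1) unfolding d_def by (rule dvd_prodI[rotated])
 define \<A> where "\<A> = {r. r < d & (\<forall>p\<in>U. r mod p : R p)}"
 have fA: "finite \<A>" unfolding \<A>_def by (rule finite_subset[of _ "{..<d}"]) auto
 have Rl: "R p \<subseteq> {..<p}" if "p : U" for p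
  using R[OF U(2)[OF that]] prime_gt_1_nat[OF U(2)[OF that]] totatives_less by fastforce
 have cA: "card \<A> = (\<Prod>p\<in>U. card (R p))" unfolding \<A>_def d_def by (rule crt_card[OF U Rl])
 have At: "\<A> \<subseteq> totatives d"
 proof
  fix r assume r: "r : \<A>"
  have cop: "coprime r p" if p: "p : U" for p
  proof -
   have "r mod p : totatives p" using r p R[OF U(2)[OF p]] by (auto simp: \<A>_def)
   hence "coprime (r mod p) p" by (simp add: in_totatives_iff)
   thus ?thesis using U(2)[OF p] by (simp add: prime_gt_0_nat)
  qed
  obtain p where p: "p : U" using False by blast
  have "r ~= 0"
  proof
   assume "r = 0"
   hence "is_unit p" using cop[OF p] by simp
   thus False using U(2)[OF p] not_prime_unit by blast
  qed
  moreover have "coprime r d" unfolding d_def using cop by (intro prod_coprime_right) auto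
  ultimately show "r : totatives d" using r by (auto simp: in_totatives_iff \<A>_def)
 qed
 let ?S = "{n. n : {n. 0 < n & real n <= x} & (\<forall>p\<in>U. n mod p : R p)}"
 have fS: "finite ?S" by (rule finite_subset[OF _ finite_nat_real_le[of x]]) auto
 have mm: "n mod d mod p = n mod p" if "p : U" for n p using pd[OF that] by (rule mod_mod_cancel)
 have "(\<Sum>n\<in>?S. f n) = (\<Sum>r\<in>\<A>. \<Sum>n | n : ?S & n mod d = r. f n)"
  by (rule sum.group[symmetric, OF fS fA]) (use mm pf(3) in \<open>auto simp: \<A>_def\<close>)
 also have "\<dots> = (\<Sum>r\<in>\<A>. \<Sum>n | 0 < n & real n <= x & [n = r] (mod d). f n)"
 proof (rule sum.cong[OF refl])
  fix r assume r: "r : \<A>"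
  have "{n. n : ?S & n mod d = r} = {n. 0 < n & real n <= x & [n = r] (mod d)}"
  proof (intro subset_antisym subsetI)
   fix n assume "n : {n. n : ?S & n mod d = r}"
   thus "n : {n. 0 < n & real n <= x & [n = r] (mod d)}" by (auto simp: unique_euclidean_semiring_class.cong_def)
  next
   fix n assume n: "n : {n. 0 < n & real n <= x & [n = r] (mod d)}"
   hence nr: "n mod d = r" using r by (auto simp: unique_euclidean_semiring_class.cong_def \<A>_def)
   have "n mod p : R p" if p: "p : U" for p using r p mm[OF p, of n] unfolding nr by (auto simp: \<A>_def)
   thus "n : {n. n : ?S & n mod d = r}" using n nr by auto
  qed
  thus "(\<Sum>n | n : ?S & n mod d = r. f n) = (\<Sum>n | 0 < n & real n <= x & [n = r] (mod d). f n)" by simp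
 qed
 finally have S: "(\<Sum>n\<in>?S. f n) = (\<Sum>r\<in>\<A>. \<Sum>n | 0 < n & real n <= x & [n = r] (mod d). f n)" .
 have "real (card \<A>) * (local_density f d / real (totient d)) = (\<Prod>p\<in>U. real (card (R p))) * ((\<Prod>p\<in>U. euler_inverse f p) / (\<Prod>p\<in>U. real p - 1))"
 proof -
  have "real (totient d) = (\<Prod>p\<in>U. real p - 1)" unfolding pf(4) of_nat_prod using U(2) by (intro prod.cong refl) (auto simp: of_nat_diff prime_gt_0_nat Suc_leI)
  thus ?thesis by (simp add: cA local_density_def pf(1) euler_inverse_def)
 qed
 also have "\<dots> = (\<Prod>p\<in>U. real (card (R p)) * euler_inverse f p / (real p - 1))" by (simp add: prod.distrib prod_dividef)
 finally have D: "(\<Prod>p\<in>U. real (card (R p)) * euler_inverse f p / (real p - 1)) = real (card \<A>) * (local_density f d / real (totient d))" ..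
 have "(\<Sum>n\<in>?S. f n) - ?X * (\<Prod>p\<in>U. real (card (R p)) * euler_inverse f p / (real p - 1)) =
  (\<Sum>r\<in>\<A>. (\<Sum>n | 0 < n & real n <= x & [n = r] (mod d). f n) - local_density f d / real (totient d) * ?X)"
  unfolding S D sum_subtractf sum_constant by (simp only: mult_ac)
 hence "\<bar>(\<Sum>n\<in>?S. f n) - ?X * (\<Prod>p\<in>U. real (card (R p)) * euler_inverse f p / (real p - 1))\<bar> <= (\<Sum>r\<in>\<A>. progression_error f x d r)"
  unfolding progression_error_def by (simp only: sum_abs)
 also have "\<dots> <= (\<Sum>r\<in>\<A>. MAX a\<in>totatives d. progression_error f x d a)"
  using At by (intro sum_mono progression_error_le_Max) auto
 also have "\<dots> = class_error f R x d" by (simp add: class_error_def residue_count_prod_def pf(1) residue_count_def cA)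
 finally show ?thesis by (simp only: d_def)
qed

text \<open>Distinct sets of primes have distinct products, so no modulus of
  \<open>level_error\<close> is charged twice.\<close>

lemma sum_class_error_le:
 assumes \<U>: "finite \<U>" "!!U. U : \<U> ==> finite U & U \<subseteq> sieving_primes R & real (\<Prod>U) <= D"
 shows "(\<Sum>U\<in>\<U>. class_error f R x (\<Prod>U)) <= level_error f R D x"
proof -
 have pr: "finite U" "!!p. p : U ==> prime p" if "U : \<U>" for U using \<U>(2)[OF that] by (auto simp: sieving_primes_def)
 have inj: "inj_on Prod \<U>"
 proof (rule inj_onI)
  fix U V assume a: "U : \<U>" "V : \<U>" "\<Prod>U = \<Prod>V"
  have u: "prime_factors (\<Prod>U) = U" by (rule prod_primes(1)) (use pr[OF a(1)] in auto)
  have w: "prime_factors (\<Prod>V) = V" by (rule prod_primes(1)) (use pr[OF a(2)] in auto)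
  show "U = V" by (rule trans[OF u[symmetric] trans[OF _ w]]) (simp only: a(3))
 qed
 have "(\<Sum>U\<in>\<U>. class_error f R x (\<Prod>U)) = (\<Sum>d\<in>Prod ` \<U>. class_error f R x d)" by (simp add: sum.reindex[OF inj])
 also have "\<dots> <= (\<Sum>d | squarefree d & real d <= D & prime_factors d \<subseteq> sieving_primes R. class_error f R x d)"
 proof (rule sum_mono2)
  show "finite {d. squarefree d & real d <= D & prime_factors d \<subseteq> sieving_primes R}"
   by (rule finite_subset[OF _ finite_nat_real_le[of D]]) auto
  show "Prod ` \<U> \<subseteq> {d. squarefree d & real d <= D & prime_factors d \<subseteq> sieving_primes R}"
  proof (rule image_subsetI)
   fix U assume U: "U : \<U>"
   have "prime_factors (\<Prod>U) = U" "squarefree (\<Prod>U)" by (rule prod_primes; use pr[OF U] in auto)+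
   note p = this
   show "\<Prod>U : {d. squarefree d & real d <= D & prime_factors d \<subseteq> sieving_primes R}"
   using \<U>(2)[OF U] by (intro CollectI conjI) (simp_all only: p)
  qed
  show "0 <= class_error f R x d" if "d : {d. squarefree d & real d <= D & prime_factors d \<subseteq> sieving_primes R} - Prod ` \<U>" for d
   using that by (cases "d = 0") (auto intro: class_error_nonneg)
 qed
 finally show ?thesis by (simp add: level_error_def class_error_def)
qed

section \<open>Lower bound for the sifted sum\<close>

text \<open>Fewer than \<open>a\<close> primes lie below \<open>a\<close>, and each contributes at
  least \<open>1 / a\<close> because \<open>card (R p) < p - 1\<close>. From \<open>a\<close> on the
  weights are bounded away from 1 and \<open>- ln (1 - w p)\<close> is at most
  \<open>card (R p) / p + O(p^-2)\<close>. The product runs over all of \<open>P\<close> while the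
  mean stops at \<open>x\<close>, whence the condition on the primes beyond
  \<open>x\<close>.\<close>

lemma sieve_product_lower:
 assumes a: "real v + 1 < real a"
 shows "\<exists>c>0. \<forall>P (R :: nat => nat set) F x. finite P --> (\<forall>p\<in>P. prime p) --> (\<forall>p. prime p --> card (R p) <= v) -->
  (\<forall>p\<in>P. card (R p) < p - 1) --> (\<forall>p\<in>P. 0 <= F p & F p <= (1::real)) -->
  (\<Sum>p | p : P & x < real p. 1 / real p) <= 10 -->
  c * exp (- sieve_mean R x) <= (\<Prod>p\<in>P. 1 - real (card (R p)) * F p / (real p - 1))"
proof -
 obtain C2 where C2: "C2 > 0" "!!A. finite A ==> (\<Sum>n\<in>A. real (n::nat) powr (-2)) <= C2"
  using sum_powr_bound[of 2] by auto
 define K where "K = 2 * real v + (real v + 1) * (4 * (real v)\<^sup>2)"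
 have K0: "K >= 0" by (simp add: K_def)
 define c where "c = (1 / real a) ^ a * exp (- (real v * 10) - K * C2)"
 have a1: "real a > 1" using a by linarith
 have "c * exp (- sieve_mean R x) <= (\<Prod>p\<in>P. 1 - real (card (R p)) * F p / (real p - 1))"
  if P: "finite P" "\<forall>p\<in>P. prime p" and R: "\<forall>p. prime p --> card (R p) <= v" "\<forall>p\<in>P. card (R p) < p - 1"
  and F: "\<forall>p\<in>P. 0 <= F p & F p <= (1::real)" and t: "(\<Sum>p | p : P & x < real p. 1 / real p) <= 10" for P F x and R :: "nat => nat set"
 proof -
  define w where "w = (%p. real (card (R p)) * F p / (real p - 1))"
  have wle: "0 <= w p" "w p <= real (card (R p)) / (real p - 1)" "real p >= 2" if "p : P" for p
  proof -
   show p2: "real p >= 2" using that P(2) prime_ge_2_nat[of p] by auto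
   show "0 <= w p" using F that p2 by (simp add: w_def)
   have "real (card (R p)) * F p <= real (card (R p)) * 1" using F that by (intro mult_left_mono) auto
   thus "w p <= real (card (R p)) / (real p - 1)" using p2 unfolding w_def by (intro divide_right_mono) auto
  qed
  let ?P0 = "{p\<in>P. p < a}" and ?P1 = "{p\<in>P. a <= p}"
  have "(1 / real a) ^ a <= (1 / real a) ^ card ?P0"
  proof (rule power_decreasing)
   have "card ?P0 <= card {..<a}" by (intro card_mono) auto
   thus "card ?P0 <= a" by simp
  qed (use a1 in auto)
  also have "\<dots> = (\<Prod>p\<in>?P0. 1 / real a)" by simp
  also have "\<dots> <= (\<Prod>p\<in>?P0. 1 - w p)"
  proof (intro prod_mono conjI)
   fix p assume p: "p : ?P0"
   have "real (card (R p)) <= real p - 2" using R(2) p by force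
   hence "real (card (R p)) / (real p - 1) <= (real p - 2) / (real p - 1)" using wle(3)[of p] p by (intro divide_right_mono) auto
   moreover have "(real p - 2) / (real p - 1) + 1 / (real p - 1) = 1" using wle(3)[of p] p by (simp flip: add_divide_distrib)
   ultimately have "1 / (real p - 1) <= 1 - w p" using wle(2)[of p] p by simp
   moreover have "1 / real a <= 1 / (real p - 1)" using wle(3)[of p] p a1 by (intro divide_left_mono) auto
   ultimately show "1 / real a <= 1 - w p" by linarith
  qed (use a1 in auto)
  finally have 0: "(1 / real a) ^ a <= (\<Prod>p\<in>?P0. 1 - w p)" .
  have "(\<Sum>p\<in>?P1. real (card (R p)) / p + K * real p powr (-2)) <= sieve_mean R x + real v * 10 + K * C2"
  proof -
   have "(\<Sum>p\<in>?P1. real (card (R p)) / p) <= (\<Sum>p\<in>{p\<in>P. real p <= x} \<union> {p. p : P & x < real p}. real (card (R p)) / p)"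
   by (intro sum_mono2) (use P in auto)
   also have "\<dots> = (\<Sum>p | p : P & real p <= x. real (card (R p)) / p) + (\<Sum>p | p : P & x < real p. real (card (R p)) / p)"
   by (rule sum.union_disjoint) (use P in auto)
   also have "(\<Sum>p | p : P & real p <= x. real (card (R p)) / p) <= sieve_mean R x"
   unfolding prime_mean_alt by (intro sum_mono2) (use P in auto)
   also have "(\<Sum>p | p : P & x < real p. real (card (R p)) / p) <= (\<Sum>p | p : P & x < real p. real v * (1 / p))"
   using R(1) P by (intro sum_mono) (auto intro!: divide_right_mono)
   also have "\<dots> = real v * (\<Sum>p | p : P & x < real p. 1 / p)" by (simp add: sum_distrib_left)
   also have "\<dots> <= real v * 10" using t by (intro mult_left_mono) auto
   finally have "(\<Sum>p\<in>?P1. real (card (R p)) / p) <= sieve_mean R x + real v * 10" by simp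
   moreover have "K * (\<Sum>p\<in>?P1. real p powr (-2)) <= K * C2" using P K0 by (intro mult_left_mono C2(2)) auto
   ultimately show ?thesis by (simp add: sum.distrib sum_distrib_left)
  qed
  hence "exp (- sieve_mean R x - real v * 10 - K * C2) <= exp (- (\<Sum>p\<in>?P1. real (card (R p)) / p + K * real p powr (-2)))" by simp
  also have "\<dots> = (\<Prod>p\<in>?P1. exp (- (real (card (R p)) / p + K * real p powr (-2))))" unfolding sum_negf[symmetric] using P by (intro exp_sum) auto
  also have "\<dots> <= (\<Prod>p\<in>?P1. 1 - w p)"
  proof (intro prod_mono conjI)
   fix p assume p: "p : ?P1"
   have pP: "p : P" using p by simp
   note wl = wle[OF pP]
   have pv: "real p >= real v + 2"
   proof -
   have "v + 1 < a" using a by linarith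
   hence "v + 2 <= p" using p by simp
   thus ?thesis by linarith
   qed
   have cv: "real (card (R p)) <= real v" using R(1) P(2) pP by auto
   have wv: "w p <= real v / (real v + 1)"
   proof -
   have "real (card (R p)) / (real p - 1) <= real v / (real v + 1)" using cv pv by (intro frac_le) auto
   thus ?thesis using wl(2) by linarith
   qed
   have w1: "1 / (real v + 1) <= 1 - w p"
   proof -
   have "1 - real v / (real v + 1) = 1 / (real v + 1)" by (simp add: field_simps)
   thus ?thesis using wv by linarith
   qed
   have w1': "0 < 1 - w p"
   proof -
   have "0 < 1 / (real v + 1)" by simp
   thus ?thesis using w1 by linarith
   qed
   have rp2: "real p powr (-2) = 1 / (real p)\<^sup>2" using wl(3) by (simp add: powr_minus_divide powr_numeral)
   have "w p <= real (card (R p)) / real p + 2 * real v * real p powr (-2)"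
   proof -
   have "real (card (R p)) / (real p - 1) = real (card (R p)) / real p + real (card (R p)) * (1 / (real p * (real p - 1)))"
   using wl(3) by (simp add: field_simps)
   also have "real (card (R p)) * (1 / (real p * (real p - 1))) <= real v * (2 * (1 / (real p)\<^sup>2))"
   proof (intro mult_mono cv)
   have "real p * real p <= 2 * (real p * (real p - 1))" using mult_left_mono[of 2 "real p" "real p"] wl(3) by (simp add: algebra_simps)
   thus "1 / (real p * (real p - 1)) <= 2 * (1 / (real p)\<^sup>2)" using wl(3) by (simp add: power2_eq_square divide_simps)
   qed (use wl(3) in auto)
   finally have "w p <= real (card (R p)) / real p + real v * (2 * (1 / (real p)\<^sup>2))" using wl(2) by linarith
   also have "real v * (2 * (1 / (real p)\<^sup>2)) = 2 * real v * real p powr (-2)" unfolding rp2 by simp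
   finally show ?thesis .
   qed
   moreover have "(w p)\<^sup>2 <= 4 * (real v)\<^sup>2 * real p powr (-2)"
   proof -
   have "real (card (R p)) / (real p - 1) <= real v / (real p / 2)" using cv wl(3) by (intro frac_le) auto
   hence "w p <= real v / (real p / 2)" using wl(2) by linarith
   also have "\<dots> = 2 * real v / real p" by simp
   finally have "w p <= 2 * real v / real p" .
   hence "(w p)\<^sup>2 <= (2 * real v / real p)\<^sup>2" using wl(1) by (intro power_mono)
   thus ?thesis unfolding rp2 by (simp add: power_divide power_mult_distrib)
   qed
   hence "(real v + 1) * (w p)\<^sup>2 <= (real v + 1) * (4 * (real v)\<^sup>2 * real p powr (-2))" by (intro mult_left_mono) auto
   moreover have "K * real p powr (-2) = 2 * real v * real p powr (-2) + (real v + 1) * (4 * (real v)\<^sup>2 * real p powr (-2))"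
   by (simp only: K_def distrib_right mult.assoc)
   ultimately have wK: "w p + (real v + 1) * (w p)\<^sup>2 <= real (card (R p)) / p + K * real p powr (-2)" by linarith
   have "ln (1 / (1 - w p)) <= 1 / (1 - w p) - 1" using w1' by (intro ln_le_minus_one) auto
   also have "\<dots> = w p + (w p)\<^sup>2 * (1 / (1 - w p))" using w1' by (simp add: field_simps power2_eq_square)
   also have "\<dots> <= w p + (w p)\<^sup>2 * (real v + 1)"
   proof (intro add_left_mono mult_left_mono)
   show "1 / (1 - w p) <= real v + 1" using w1 w1' by (simp add: field_simps)
   qed auto
   finally have "- ln (1 - w p) <= real (card (R p)) / p + K * real p powr (-2)" using w1' wK by (simp add: ln_div mult.commute)
   hence "- (real (card (R p)) / p + K * real p powr (-2)) <= ln (1 - w p)" by linarith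
   thus "exp (- (real (card (R p)) / p + K * real p powr (-2))) <= 1 - w p" using w1' by (simp add: ln_ge_iff)
  qed auto
  finally have 1: "exp (- sieve_mean R x - real v * 10 - K * C2) <= (\<Prod>p\<in>?P1. 1 - w p)" .
  have "c * exp (- sieve_mean R x) = (1 / real a) ^ a * exp (- sieve_mean R x - real v * 10 - K * C2)"
  proof -
   have "exp (- (real v * 10) - K * C2) * exp (- sieve_mean R x) = exp (- sieve_mean R x - real v * 10 - K * C2)"
   by (simp flip: exp_add)
   thus ?thesis by (simp only: c_def mult.assoc)
  qed
  also have "\<dots> <= (\<Prod>p\<in>?P0. 1 - w p) * (\<Prod>p\<in>?P1. 1 - w p)"
   using 0 1 a1 by (intro mult_mono) (auto intro: order_trans[OF _ 0])
  also have "\<dots> = (\<Prod>p\<in>?P0 \<union> ?P1. 1 - w p)" by (rule prod.union_disjoint[symmetric]) (use P in auto)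
  also have "?P0 \<union> ?P1 = P" by auto
  finally show ?thesis by (simp only: w_def)
 qed
 moreover have "c > 0" using a1 by (simp add: c_def)
 ultimately show ?thesis by blast
qed

lemma mult_sum_upper:
 assumes f: "f : mult_class A1 A2" and A: "0 < A2 (1/2)" and x: "1 <= x"
 shows "(total f x) <= A2 (1/2) * x powr (3/2)"
proof -
 have "(total f x) <= (\<Sum>n | 0 < n & real n <= x. A2 (1/2) * x powr (1/2))"
 proof (intro sum_mono)
  fix n assume n: "n : {n. 0 < n & real n <= x}"
  have "f n <= A2 (1/2) * real n powr (1/2)" using mult_classD(5)[OF f, of "1/2" n] n by simp
  also have "\<dots> <= A2 (1/2) * x powr (1/2)" using n A by (intro mult_left_mono powr_mono2) auto
  finally show "f n <= A2 (1/2) * x powr (1/2)" .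
 qed
 also have "\<dots> = real (card {n. 0 < n & real n <= x}) * (A2 (1/2) * x powr (1/2))" by simp
 also have "\<dots> <= x * (A2 (1/2) * x powr (1/2))" using A x by (intro mult_right_mono card_nat_real_le) auto
 also have "\<dots> = A2 (1/2) * (x powr 1 * x powr (1/2))" using x by simp
 also have "x powr 1 * x powr (1/2) = x powr (3/2)" by (simp only: powr_add[symmetric]) simp
 finally show ?thesis .
qed

text \<open>The class of 1 modulo \<open>p\<close> contains only \<open>n = 1\<close>, with
  \<open>f 1 = 1\<close>, while its expected share is at most 1/2 when
  \<open>p > x^2\<close>.\<close>

lemma class_error_large_prime:
 assumes f: "f : mult_class A1 A2" and p: "prime p" "0 < card (R p)" "x < real p" "x\<^sup>2 < real p" and x: "2 <= x"
  and X: "(total f x) <= x\<^sup>2 / 4"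
 shows "1/2 <= class_error f R x p"
proof -
 let ?X = "\<Sum>n | 0 < n & real n <= x. f n"
 have p1: "p > 1" using prime_gt_1_nat[OF p(1)] .
 have X0: "0 <= ?X" using mult_classD(2)[OF f] by (intro sum_nonneg) auto
 have x4: "x\<^sup>2 >= 4" using x mult_mono[of 2 x 2 x] by (simp add: power2_eq_square)
 have "{n. 0 < n & real n <= x & [n = 1] (mod p)} = {1}"
 proof (intro subset_antisym subsetI)
  fix n assume n: "n : {n. 0 < n & real n <= x & [n = 1] (mod p)}"
  hence "n < p" using p(3) by simp
  thus "n : {1}" using n p1 by (auto simp: unique_euclidean_semiring_class.cong_def)
 qed (use x in auto)
 hence pe: "progression_error f x p 1 = \<bar>1 - euler_inverse f p / (real p - 1) * ?X\<bar>"
  using mult_classD(1)[OF f] p1 totient_prime[OF p(1)]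
  by (simp add: progression_error_def local_density_def prime_prime_factors[OF p(1)] euler_inverse_def of_nat_diff)
 have pp: "real p - 1 >= x\<^sup>2 / 2" "real p - 1 > 0" using p(4) x4 by linarith+
 have "euler_inverse f p / (real p - 1) * ?X <= 1 / (real p - 1) * ?X"
  using euler_inverse_bounds[OF f p(1)] X0 pp by (intro mult_right_mono divide_right_mono) auto
 also have "\<dots> <= 1 / (x\<^sup>2 / 2) * (x\<^sup>2 / 4)" using X X0 pp x by (intro mult_mono divide_left_mono) (auto intro!: mult_pos_pos)
 also have "\<dots> = 1/2" using x by (simp add: field_simps)
 finally have "1/2 <= progression_error f x p 1" unfolding pe by linarith
 also have "\<dots> <= (MAX a\<in>totatives p. progression_error f x p a)" using p1 by (intro progression_error_le_Max) (auto simp: in_totatives_iff)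
 finally have M: "1/2 <= (MAX a\<in>totatives p. progression_error f x p a)" .
 also have "\<dots> = 1 * (MAX a\<in>totatives p. progression_error f x p a)" by simp
 also have "\<dots> <= class_error f R x p" unfolding class_error_def
  using p(2) M by (intro mult_right_mono) (auto simp: residue_count_prod_def residue_count_def prime_prime_factors[OF p(1)])
 finally show ?thesis .
qed

text \<open>Between \<open>x\<close> and \<open>x^2\<close> Mertens bounds the reciprocals by 9.
  Each sieving prime beyond \<open>x^2\<close> spends at least 1/2 of \<open>level_error\<close>, so
  there are at most \<open>x^2 / 2\<close> of them and their reciprocals add at most 1/2.\<close>

lemma large_sieving_primes:
 assumes f: "f : mult_class A1 A2" and x: "2 <= x" and X: "(total f x) <= x\<^sup>2 / 4"
  and P: "finite (sieving_primes R)" "!!p. p : sieving_primes R ==> real p <= D"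
  and le: "level_error f R D x <= (total f x)"
 shows "(\<Sum>p | p : sieving_primes R & x < real p. 1 / real p) <= 10"
proof -
 let ?P = "sieving_primes R"
 let ?B = "{p : ?P. x < real p & x\<^sup>2 < real p}"
 have fB: "finite ?B" using P(1) by auto
 have xx: "x <= x\<^sup>2" using x mult_left_mono[of 1 x x] by (simp add: power2_eq_square)
 have fin: "finite {p. prime p & x < real p & real p <= x\<^sup>2}" by (rule finite_subset[OF _ finite_primes_real[of "x\<^sup>2"]]) auto
 have "real (card ?B) * (1/2) = (\<Sum>p\<in>?B. 1/2)" by simp
 also have "\<dots> <= (\<Sum>p\<in>?B. class_error f R x (\<Prod>{p}))"
  using class_error_large_prime[OF f _ _ _ _ x X, of _ R] by (intro sum_mono) (auto simp: sieving_primes_def residue_count_def)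
 also have "\<dots> = (\<Sum>U\<in>(%p. {p}) ` ?B. class_error f R x (\<Prod>U))" by (subst sum.reindex) (auto simp: inj_on_def)
 also have "\<dots> <= level_error f R D x" by (rule sum_class_error_le) (use P in auto)
 also have "\<dots> <= x\<^sup>2 / 4" using le X by linarith
 finally have cB: "real (card ?B) <= x\<^sup>2 / 2" by simp
 have "(\<Sum>p\<in>?B. 1 / real p) <= (\<Sum>p\<in>?B. 1 / x\<^sup>2)" using x by (intro sum_mono divide_left_mono) (auto intro!: mult_pos_pos simp: sieving_primes_def prime_gt_0_nat)
 also have "\<dots> = real (card ?B) * (1 / x\<^sup>2)" by simp
 also have "\<dots> <= x\<^sup>2 / 2 * (1 / x\<^sup>2)" using cB by (intro mult_right_mono) auto
 also have "\<dots> = 1/2" using x by simp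
 finally have b: "(\<Sum>p\<in>?B. 1 / real p) <= 1/2" .
 have "(\<Sum>p | prime p & x < real p & real p <= x\<^sup>2. 1 / real p) <= ln (ln (x\<^sup>2) / ln x) + 8" by (rule prime_recip_upper[OF x xx])
 also have "ln (x\<^sup>2) / ln x = 2" using x by (simp add: ln_realpow)
 also have "ln 2 + 8 <= (9::real)" using ln_2_less_1 by simp
 finally have s: "(\<Sum>p | prime p & x < real p & real p <= x\<^sup>2. 1 / real p) <= 9" .
 have "(\<Sum>p | p : ?P & x < real p. 1 / real p) <= (\<Sum>p\<in>{p. prime p & x < real p & real p <= x\<^sup>2} \<union> ?B. 1 / real p)"
  by (rule sum_mono2) (use fB fin in \<open>auto simp: sieving_primes_def\<close>)
 also have "\<dots> <= (\<Sum>p | prime p & x < real p & real p <= x\<^sup>2. 1 / real p) + (\<Sum>p\<in>?B. 1 / real p)"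
  by (rule sum_Un_le) (use fB fin in auto)
 finally show ?thesis using b s by linarith
qed

text \<open>Full inclusion-exclusion removes the primes below \<open>a\<close>, and Brun's sieve is
  applied to the set left over. A modulus is thus a subset of \<open>Q0\<close> joined with a Brun
  list; \<open>level_ok\<close> keeps it within \<open>D\<close>, and since the joined sets are
  pairwise distinct, all errors fit into one \<open>level_error\<close>.\<close>

lemma sieve_lower_large_level:
 fixes v :: nat
 assumes v: "1 <= v" and lvl: "level_ok v a"
  and f: "f : mult_class A1 A2" and R: "!!p. prime p ==> R p \<subseteq> totatives p & card (R p) <= v"
  and PD: "!!p. p : sieving_primes R ==> real p <= D powr (1 / sieve_exponent v)" and D: "1 <= D"
  and nu: "!!p. p : sieving_primes R ==> card (R p) < p - 1"
 shows "6/100 * ((total f x) * (\<Prod>p\<in>sieving_primes R. 1 - real (card (R p)) * euler_inverse f p / (real p - 1))) - level_error f R D x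
  <= (\<Sum>n\<in>sifted_set x R. f n)"
proof -
 define P where "P = sieving_primes R"
 define s where "s = sieve_exponent v"
 define w where "w = (%p. real (card (R p)) * euler_inverse f p / (real p - 1))"
 define hit where "hit = (%p n. n mod p : R p)"
 define N where "N = {n. 0 < n & real n <= x}"
 define Q0 where "Q0 = {p\<in>P. p < a}"
 define P1 where "P1 = {p\<in>P. a <= p}"
 define \<Omega> where "\<Omega> = {n. n : N & (\<forall>p\<in>Q0. \<not> hit p n)}"
 define X where "X = (\<Sum>n\<in>N. f n)"
 have s1: "s > 1"
 proof -
  have "0 < real v * exp (- (31/100) / real v)" using v by simp
  thus ?thesis using sieve_exponent_ge[OF v] unfolding s_def by linarith
 qed
 have Pp: "prime p" "0 < card (R p)" if "p : P" for p using that by (auto simp: P_def sieving_primes_def residue_count_def)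
 have fP: "finite P" by (rule finite_subset[OF _ finite_primes_real[of "D powr (1 / sieve_exponent v)"]]) (use PD Pp in \<open>auto simp: P_def\<close>)
 have fN: "finite N" unfolding N_def by (rule finite_subset[OF _ finite_nat_real_le[of x]]) auto
 have f\<Omega>: "finite \<Omega>" unfolding \<Omega>_def using fN by auto
 have fQ: "finite Q0" "finite P1" using fP by (auto simp: Q0_def P1_def)
 have split: "P = Q0 \<union> P1" "Q0 \<inter> P1 = {}" by (auto simp: Q0_def P1_def)
 have p2: "real p >= 2" if "p : P" for p using Pp(1)[OF that] prime_ge_2_nat[of p] by auto
 \<comment> \<open>\<open>card (R 2) < 2 - 1\<close> contradicts \<open>card (R 2) > 0\<close>, so 2
   is never a sieving prime.\<close>
 have podd: "odd p" if p: "p : P" for p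
 proof -
  have "p ~= 2" using nu[of p] Pp(2)[OF p] p by (auto simp: P_def)
  thus ?thesis using prime_odd_nat[OF Pp(1)[OF p]] prime_ge_2_nat[OF Pp(1)[OF p]] by simp
 qed
 have f0: "0 <= f n" if "n : N" for n using mult_classD(2)[OF f] that by (simp add: N_def)
 have X0: "0 <= X" unfolding X_def using f0 by (intro sum_nonneg)
 have w0: "0 <= w p" "w p <= real (card (R p)) / (real p - 1)" if "p : P" for p
 proof -
  note e = euler_inverse_bounds[OF f Pp(1)[OF that]]
  show "0 <= w p" using e p2[OF that] by (simp add: w_def)
  have "real (card (R p)) * euler_inverse f p <= real (card (R p)) * 1" using e by (intro mult_left_mono) auto
  thus "w p <= real (card (R p)) / (real p - 1)" using p2[OF that] unfolding w_def by (intro divide_right_mono) auto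
 qed
 have w1: "w p < 1" if "p : P" for p
 proof -
  have "real (card (R p)) < real p - 1" using nu[of p] that by (auto simp: P_def)
  hence "real (card (R p)) / (real p - 1) < 1" using p2[OF that] by simp
  thus ?thesis using w0(2)[OF that] by linarith
 qed
 have wv: "w p <= real v / (real p - 1)" if "p : P" for p
 proof -
  have "real (card (R p)) / (real p - 1) <= real v / (real p - 1)" using R[OF Pp(1)[OF that]] p2[OF that] by (intro divide_right_mono) auto
  thus ?thesis using w0(2)[OF that] by linarith
 qed
 have sifted: "sifted_set x R = {n. n : \<Omega> & (\<forall>p\<in>P1. \<not> hit p n)}"
 proof -
  have "R p = {}" if "prime p" "p \<notin> P" for p
  proof -
   have "R p \<subseteq> totatives p" using R[OF that(1)] by blast
   hence "finite (R p)" by (rule finite_subset) simp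
   moreover have "card (R p) = 0" using that by (simp add: P_def sieving_primes_def residue_count_def)
   ultimately show ?thesis by simp
  qed
  note e = this
  have "(\<forall>p. prime p --> n mod p \<notin> R p) \<longleftrightarrow> (\<forall>p\<in>Q0. \<not> hit p n) & (\<forall>p\<in>P1. \<not> hit p n)" for n
  proof
   assume h: "\<forall>p. prime p --> n mod p \<notin> R p"
   show "(\<forall>p\<in>Q0. \<not> hit p n) & (\<forall>p\<in>P1. \<not> hit p n)" using h Pp(1) by (simp add: hit_def Q0_def P1_def)
  next
   assume h: "(\<forall>p\<in>Q0. \<not> hit p n) & (\<forall>p\<in>P1. \<not> hit p n)"
   show "\<forall>p. prime p --> n mod p \<notin> R p"
   proof (intro allI impI)
   fix p :: nat assume p: "prime p"
   show "n mod p \<notin> R p"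
   proof (cases "p : P")
   case True
   hence "p : Q0 \<or> p : P1" using split(1) by blast
   thus ?thesis using h by (auto simp: hit_def)
   next
   case False
   thus ?thesis using e[OF p] by simp
   qed
   qed
  qed
  thus ?thesis by (simp only: sifted_set_def \<Omega>_def N_def mem_Collect_eq conj_assoc)
 qed
 have fPow: "finite T" if "T : Pow Q0" for T by (rule finite_subset[OF _ fQ(1)]) (use that in simp)
 define X' where "X' = X * (\<Prod>p\<in>Q0. 1 - w p)"
 have X'0: "0 <= X'" unfolding X'_def using X0 w1 by (intro mult_nonneg_nonneg prod_nonneg) (auto simp: Q0_def less_imp_le)
 define DS where "DS = {ds. brun_ok w P1 (84/100) ds}"
 have fDS: "finite DS" unfolding DS_def by (rule finite_brun_ok[OF fQ(2)])
 have ds: "sorted_wrt (>) ds" "set ds \<subseteq> P1" if "ds : DS" for ds using brun_ok_sorted[of w P1 "84/100" ds] that by (auto simp: DS_def)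
 have BL: "X' * (\<Prod>p\<in>P1. 1 - w p) * (1 - 94/100) - (\<Sum>ds\<in>DS. \<bar>mass f hit \<Omega> ds - X' * prod_list (map w ds)\<bar>) <= sift f hit \<Omega> P1"
  unfolding DS_def
 proof (rule brun_lower[where s = "84/100"])
  show "0 <= f n" if "n : \<Omega>" for n using that f0 by (simp add: \<Omega>_def)
  show "0 <= w p & w p < 1" if "p : P1" for p using that w0(1)[of p] w1[of p] by (simp add: P1_def)
 qed (use fQ f\<Omega> X'0 in simp_all)
 have err: "\<bar>mass f hit \<Omega> ds - X' * prod_list (map w ds)\<bar> <= (\<Sum>T\<in>Pow Q0. class_error f R x (\<Prod>(T \<union> set ds)))" if d: "ds : DS" for ds
 proof -
  have sd: "set ds \<subseteq> P" "\<forall>p\<in>set ds. prime p" using ds(2)[OF d] Pp by (auto simp: P1_def)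
  have dist: "distinct ds" using desc_prime_list(1)[OF ds(1)[OF d] sd(2)] .
  define A where "A = (%T. \<Sum>n | n : N & (\<forall>p\<in>T \<union> set ds. hit p n). f n)"
  have "mass f hit \<Omega> ds = (\<Sum>n | n : {n\<in>N. \<forall>p\<in>set ds. hit p n} & (\<forall>p\<in>Q0. \<not> hit p n). f n)"
   unfolding mass_def \<Omega>_def by (intro sum.cong) auto
  also have "\<dots> = (\<Sum>T\<in>Pow Q0. (-1) ^ card T * (\<Sum>n | n : {n\<in>N. \<forall>p\<in>set ds. hit p n} & (\<forall>p\<in>T. hit p n). f n))"
   by (rule inclusion_exclusion_weighted) (use fQ fN in auto)
  also have "\<dots> = (\<Sum>T\<in>Pow Q0. (-1) ^ card T * A T)"
  proof (rule sum.cong[OF refl])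
   fix T
   have "{n. n : {n\<in>N. \<forall>p\<in>set ds. hit p n} & (\<forall>p\<in>T. hit p n)} = {n. n : N & (\<forall>p\<in>T \<union> set ds. hit p n)}" by auto
   thus "(-1) ^ card T * (\<Sum>n | n : {n\<in>N. \<forall>p\<in>set ds. hit p n} & (\<forall>p\<in>T. hit p n). f n) = (-1) ^ card T * A T" by (simp only: A_def)
  qed
  finally have m: "mass f hit \<Omega> ds = (\<Sum>T\<in>Pow Q0. (-1) ^ card T * A T)" .
  have "X' * prod_list (map w ds) = X * (\<Sum>T\<in>Pow Q0. (-1) ^ card T * (\<Prod>p\<in>T. w p)) * (\<Prod>p\<in>set ds. w p)"
   using prod.distinct_set_conv_list[OF dist, of w] by (simp add: X'_def prod_one_minus_expand[OF fQ(1)])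
  also have "\<dots> = (\<Sum>T\<in>Pow Q0. (-1) ^ card T * (X * (\<Prod>p\<in>T \<union> set ds. w p)))"
  proof -
   have un: "(\<Prod>p\<in>T \<union> set ds. w p) = (\<Prod>p\<in>T. w p) * (\<Prod>p\<in>set ds. w p)" if "T : Pow Q0" for T
   by (rule prod.union_disjoint) (use that ds(2)[OF d] split(2) fPow in auto)
   have "X * (\<Sum>T\<in>Pow Q0. (-1) ^ card T * (\<Prod>p\<in>T. w p)) * (\<Prod>p\<in>set ds. w p) = (\<Sum>T\<in>Pow Q0. (-1) ^ card T * (X * ((\<Prod>p\<in>T. w p) * (\<Prod>p\<in>set ds. w p))))"
   unfolding sum_distrib_left sum_distrib_right by (intro sum.cong refl) (simp only: mult_ac)
   also have "\<dots> = (\<Sum>T\<in>Pow Q0. (-1) ^ card T * (X * (\<Prod>p\<in>T \<union> set ds. w p)))"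
   by (intro sum.cong refl) (simp only: un)
   finally show ?thesis .
  qed
  finally have "mass f hit \<Omega> ds - X' * prod_list (map w ds) = (\<Sum>T\<in>Pow Q0. (-1) ^ card T * (A T - X * (\<Prod>p\<in>T \<union> set ds. w p)))"
   unfolding m by (simp add: sum_subtractf right_diff_distrib)
  hence "\<bar>mass f hit \<Omega> ds - X' * prod_list (map w ds)\<bar> <= (\<Sum>T\<in>Pow Q0. \<bar>(-1) ^ card T * (A T - X * (\<Prod>p\<in>T \<union> set ds. w p))\<bar>)"
   by (simp only: sum_abs)
  also have "\<dots> = (\<Sum>T\<in>Pow Q0. \<bar>A T - X * (\<Prod>p\<in>T \<union> set ds. w p)\<bar>)" by (simp add: abs_mult power_abs)
  also have "\<dots> <= (\<Sum>T\<in>Pow Q0. class_error f R x (\<Prod>(T \<union> set ds)))"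
  proof (intro sum_mono)
   fix T assume T: "T : Pow Q0"
   show "\<bar>A T - X * (\<Prod>p\<in>T \<union> set ds. w p)\<bar> <= class_error f R x (\<Prod>(T \<union> set ds))"
   unfolding A_def X_def N_def hit_def w_def
   proof (rule class_sum_error[OF f])
   show "finite (T \<union> set ds)" using fPow[OF T] by simp
   show "prime p" if "p : T \<union> set ds" for p using that T sd Pp by (auto simp: Q0_def)
   qed (use R in auto)
  qed
  finally show ?thesis .
 qed
 \<comment> \<open>Inserting 1 covers the case of no sieving primes.\<close>
 define z where "z = Max (insert 1 P)"
 have z1: "1 <= z" and zP: "p <= z" if "p : insert 1 P" for p unfolding z_def using fP that by (auto intro!: Max_ge)
 have z1': "1 <= z" by (rule zP) simp
 have zD: "s * ln (real z) <= ln D"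
 proof -
  have "z : insert 1 P" unfolding z_def using fP by (intro Max_in) auto
  thus ?thesis
  proof
   assume "z : P"
   hence "ln (real z) <= ln (D powr (1 / s))" using PD[of z] p2[of z] D by (subst ln_le_cancel_iff) (auto simp: P_def s_def)
   also have "\<dots> = ln D / s" using D by (simp add: ln_powr)
   finally show ?thesis using s1 by (simp add: field_simps)
  qed (use D in simp)
 qed
 have prodle: "real (\<Prod>(T \<union> set ds)) <= D" if T: "T : Pow Q0" and d: "ds : DS" for T ds
 proof -
  have fT: "finite T" by (rule fPow[OF T])
  have sd: "\<forall>p\<in>set ds. prime p" using ds(2)[OF d] Pp by (auto simp: P1_def)
  have Tp: "prime p" if "p : T" for p using that T Pp by (auto simp: Q0_def)
  have "\<Prod>(T \<union> set ds) = \<Prod>T * \<Prod>(set ds)"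
   by (rule prod.union_disjoint) (use T ds(2)[OF d] split(2) fT in auto)
  also have "\<Prod>(set ds) = prod_list ds" using desc_prime_list(2)[OF ds(1)[OF d] sd] by simp
  finally have e: "\<Prod>(T \<union> set ds) = \<Prod>T * prod_list ds" .
  have pos: "0 < \<Prod>T" using Tp by (intro prod_pos) (auto simp: prime_gt_0_nat)
  have posd: "0 < prod_list ds" using desc_prime_list(2)[OF ds(1)[OF d] sd] sd by (auto intro!: prod_pos simp: prime_gt_0_nat)
  have posr: "0 < real (\<Prod>T)" "0 < real (prod_list ds)" using pos posd by (simp_all only: of_nat_0_less_iff)
  have pr: "0 < real (\<Prod>(T \<union> set ds))" unfolding e of_nat_mult using posr by (rule mult_pos_pos)
  have D0: "0 < D" using D by simp
  have "ln (real (\<Prod>T)) = (\<Sum>p\<in>T. ln (real p))" unfolding of_nat_prod using Tp fT by (intro ln_prod) (auto simp: prime_gt_0_nat)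
  moreover have "ln (real (prod_list ds)) = log_sum ds" using log_sum_eq[of ds] sd by (auto simp: prime_gt_0_nat)
  ultimately have "ln (real (\<Prod>(T \<union> set ds))) = (\<Sum>p\<in>T. ln (real p)) + log_sum ds" by (simp only: e of_nat_mult ln_mult_pos[OF posr])
  also have "\<dots> <= sieve_exponent v * ln (real z)"
  proof -
   have L: "finite P --> 1 <= z --> (\<forall>p\<in>P. prime p & odd p & p <= z) --> (\<forall>p\<in>P. a <= p --> 0 <= w p & w p <= real v / (real p - 1)) -->
   T \<subseteq> {p\<in>P. p < a} --> brun_ok w {p\<in>P. a <= p} (84/100) ds --> (\<Sum>p\<in>T. ln (real p)) + log_sum ds <= sieve_exponent v * ln (real z)"
   using lvl unfolding level_ok_def by blast
   have "\<forall>p\<in>P. prime p & odd p & p <= z" using Pp podd zP by auto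
   moreover have "\<forall>p\<in>P. a <= p --> 0 <= w p & w p <= real v / (real p - 1)" using w0 wv by auto
   moreover have "T \<subseteq> {p\<in>P. p < a}" using T by (simp add: Q0_def)
   moreover have "brun_ok w {p\<in>P. a <= p} (84/100) ds" using d by (simp add: DS_def P1_def)
   ultimately show ?thesis using L fP z1' by blast
  qed
  also have "\<dots> <= ln D" using zD by (simp add: s_def)
  finally show ?thesis using ln_le_cancel_iff[OF pr D0] by blast
 qed
 let ?h = "%(ds, T). T \<union> set ds"
 have inj: "inj_on ?h (DS \<times> Pow Q0)"
 proof (rule inj_onI, clarify)
  fix ds T ds' T' assume h: "ds : DS" "T \<subseteq> Q0" "ds' : DS" "T' \<subseteq> Q0" "T \<union> set ds = T' \<union> set ds'"
  have q: "set ds \<inter> Q0 = {}" "set ds' \<inter> Q0 = {}" using ds(2)[OF h(1)] ds(2)[OF h(3)] split(2) by auto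
  have a: "T = (T \<union> set ds) \<inter> Q0" "set ds = (T \<union> set ds) - Q0" using h(2) q(1) by auto
  have b: "T' = (T' \<union> set ds') \<inter> Q0" "set ds' = (T' \<union> set ds') - Q0" using h(4) q(2) by auto
  have "T = T'" by (rule trans[OF a(1) trans[OF arg_cong[of _ _ "%u. u \<inter> Q0", OF h(5)] b(1)[symmetric]]])
  moreover have "set ds = set ds'" by (rule trans[OF a(2) trans[OF arg_cong[of _ _ "%u. u - Q0", OF h(5)] b(2)[symmetric]]])
  ultimately show "ds = ds' & T = T'" using desc_list_unique[OF ds(1)[OF h(1)] ds(1)[OF h(3)]] by blast
 qed
 have "(\<Sum>ds\<in>DS. \<bar>mass f hit \<Omega> ds - X' * prod_list (map w ds)\<bar>) <= (\<Sum>ds\<in>DS. \<Sum>T\<in>Pow Q0. class_error f R x (\<Prod>(T \<union> set ds)))"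
  by (intro sum_mono err)
 also have "\<dots> = (\<Sum>i\<in>DS \<times> Pow Q0. class_error f R x (\<Prod>(?h i)))"
  by (simp only: sum.cartesian_product case_prod_unfold)
 also have "\<dots> = (\<Sum>U\<in>?h ` (DS \<times> Pow Q0). class_error f R x (\<Prod>U))"
  by (subst sum.reindex[OF inj]) (simp add: comp_def)
 also have "\<dots> <= level_error f R D x"
 proof (rule sum_class_error_le)
  show "finite (?h ` (DS \<times> Pow Q0))" using fDS fQ by auto
  fix U assume "U : ?h ` (DS \<times> Pow Q0)"
  then obtain d T where U: "U = T \<union> set d" "d : DS" "T : Pow Q0" by auto
  show "finite U & U \<subseteq> sieving_primes R & real (\<Prod>U) <= D"
  proof (intro conjI)
   show "finite U" using fPow[OF U(3)] U(1) by simp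
   have "U \<subseteq> Q0 \<union> P1" using U(3) ds(2)[OF U(2)] unfolding U(1) by blast
   thus "U \<subseteq> sieving_primes R" unfolding split(1)[symmetric] P_def .
   show "real (\<Prod>U) <= D" unfolding U(1) by (rule prodle[OF U(3,2)])
  qed
 qed
 finally have E: "(\<Sum>ds\<in>DS. \<bar>mass f hit \<Omega> ds - X' * prod_list (map w ds)\<bar>) <= level_error f R D x" .
 have "(\<Prod>p\<in>P. 1 - w p) = (\<Prod>p\<in>Q0. 1 - w p) * (\<Prod>p\<in>P1. 1 - w p)" unfolding split(1) by (rule prod.union_disjoint) (use fQ split(2) in auto)
 hence V: "X' * (\<Prod>p\<in>P1. 1 - w p) = X * (\<Prod>p\<in>P. 1 - w p)" by (simp add: X'_def)
 have S: "sift f hit \<Omega> P1 = (\<Sum>n\<in>sifted_set x R. f n)" by (simp only: sift_def sifted)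
 have "6/100 * (X * (\<Prod>p\<in>P. 1 - w p)) - level_error f R D x <= (\<Sum>n\<in>sifted_set x R. f n)"
 proof -
  have "X * (\<Prod>p\<in>P. 1 - w p) * (1 - 94/100) = 6/100 * (X * (\<Prod>p\<in>P. 1 - w p))" by simp
  thus ?thesis using BL E unfolding V S by linarith
 qed
 thus ?thesis by (simp only: X_def N_def P_def w_def)
qed

text \<open>For \<open>v = 0\<close> nothing is sieved and \<open>sieve_exponent 0\<close> carries
  no meaning, hence the separate case. Otherwise \<epsilon> has two duties: at most 1, so that
  \<open>large_sieving_primes\<close> applies, and at most \<open>3/100 * c0\<close>, so that the
  error takes at most half of the main term \<open>6/100 * c0\<close>.\<close>

lemma sieve_lower:
 fixes v :: nat and A1 :: real and A2 :: "real => real"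
 assumes A2: "0 < A2 (1/2)"
 shows "\<exists>c>0. \<exists>\<epsilon>>0. \<exists>X0\<ge>2. \<forall>f R D x. f : mult_class A1 A2 --> residue_system v R -->
  (\<forall>p\<in>sieving_primes R. real p <= D powr (1 / sieve_exponent v)) --> 1 <= D --> (\<forall>p\<in>sieving_primes R. card (R p) < p - 1) --> X0 <= x -->
  level_error f R D x <= \<epsilon> * ((total f x) * exp (- sieve_mean R x)) -->
  c * ((total f x) * exp (- sieve_mean R x)) <= (\<Sum>n\<in>sifted_set x R. f n)"
proof (cases "v = 0")
 case True
 have H: "1 * ((total f x) * exp (- sieve_mean R x)) <= (\<Sum>n\<in>sifted_set x R. f n)"
  if R: "residue_system v R" for f R x
 proof -
  have e: "R p = {}" if "prime p" for p
  proof -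
   have "R p \<subseteq> totatives p" using R that by blast
   hence "finite (R p)" by (rule finite_subset) simp
   moreover have "card (R p) = 0" using R that True by auto
   ultimately show ?thesis by simp
  qed
  hence "sifted_set x R = {n. 0 < n & real n <= x}" by (auto simp: sifted_set_def)
  moreover have "sieve_mean R x = 0" unfolding prime_mean_alt using e by (intro sum.neutral) auto
  ultimately show ?thesis by simp
 qed
 show ?thesis
  by (rule exI[of _ 1], rule conjI, simp, rule exI[of _ 1], rule conjI, simp, rule exI[of _ 2], rule conjI, simp, intro allI impI, rule H, assumption)
next
 case False
 hence v: "1 <= v" by simp
 obtain a where a: "level_ok v a" using level_exists[OF v] by blast
 hence va: "real v + 1 < real a" by (simp add: level_ok_def)
 obtain c0 where c0: "c0 > 0" "\<forall>P (R :: nat => nat set) F x. finite P --> (\<forall>p\<in>P. prime p) --> (\<forall>p. prime p --> card (R p) <= v) -->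
  (\<forall>p\<in>P. card (R p) < p - 1) --> (\<forall>p\<in>P. 0 <= F p & F p <= (1::real)) -->
  (\<Sum>p | p : P & x < real p. 1 / real p) <= 10 -->
  c0 * exp (- sieve_mean R x) <= (\<Prod>p\<in>P. 1 - real (card (R p)) * F p / (real p - 1))"
  using sieve_product_lower[OF va] by atomize_elim
 have "eventually (%x::real. A2 (1/2) * x powr (3/2) <= x\<^sup>2 / 4) at_top" using A2 by real_asymp
 then obtain X1 where X1: "!!x. X1 <= x ==> A2 (1/2) * x powr (3/2) <= x\<^sup>2 / 4" by (auto simp: eventually_at_top_linorder)
 define \<epsilon> where "\<epsilon> = min 1 (3/100 * c0)"
 have \<epsilon>: "0 < \<epsilon>" "\<epsilon> <= 1" "\<epsilon> <= 3/100 * c0" using c0 by (auto simp: \<epsilon>_def)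
 have H: "3/100 * c0 * ((total f x) * exp (- sieve_mean R x)) <= (\<Sum>n\<in>sifted_set x R. f n)"
  if f: "f : mult_class A1 A2" and R: "residue_system v R"
   and PD: "\<forall>p\<in>sieving_primes R. real p <= D powr (1 / sieve_exponent v)" and D: "1 <= D" and nu: "\<forall>p\<in>sieving_primes R. card (R p) < p - 1"
   and x: "max X1 2 <= x" and le: "level_error f R D x <= \<epsilon> * ((total f x) * exp (- sieve_mean R x))"
  for f R D x
 proof -
  define X where "X = (total f x)"
  define e where "e = exp (- sieve_mean R x)"
  have X0: "0 <= X" unfolding X_def using mult_classD(2)[OF f] by (intro sum_nonneg) auto
  have "0 <= sieve_mean R x" unfolding prime_mean_alt by (intro sum_nonneg) auto
  hence e: "0 < e" "e <= 1" by (auto simp: e_def)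
  have Xe: "0 <= X * e" "X * e <= X" using X0 e mult_left_mono[of e 1 X] by auto
  have xx: "2 <= x" "X1 <= x" using x by auto
  have Xx: "X <= x\<^sup>2 / 4" using mult_sum_upper[OF f A2, of x] X1[OF xx(2)] xx unfolding X_def by linarith
  have "0 < real v * exp (- (31/100) / real v)" using v by simp
  hence s1: "sieve_exponent v > 1" using sieve_exponent_ge[OF v] by linarith
  have PD': "real p <= D" if "p : sieving_primes R" for p
  proof -
   have "D powr (1 / sieve_exponent v) <= D powr 1" using s1 D by (intro powr_mono) auto
   also have "\<dots> = D" using D by simp
   finally show ?thesis using PD that by fastforce
  qed
  have fin: "finite (sieving_primes R)" by (rule finite_subset[OF _ finite_nat_real_le[of D]]) (use PD' in auto)
  have "\<epsilon> * (X * e) <= 1 * X" using Xe \<epsilon> by (intro mult_mono) auto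
  hence leX: "level_error f R D x <= X" using le unfolding X_def e_def by linarith
  have tail: "(\<Sum>p | p : sieving_primes R & x < real p. 1 / real p) <= 10"
   by (rule large_sieving_primes[OF f xx(1) Xx[unfolded X_def] fin PD' leX[unfolded X_def]])
  have V: "c0 * e <= (\<Prod>p\<in>sieving_primes R. 1 - real (card (R p)) * euler_inverse f p / (real p - 1))"
   unfolding e_def
  proof (rule c0(2)[rule_format])
   show "0 <= euler_inverse f p & euler_inverse f p <= 1" if "p : sieving_primes R" for p
   using euler_inverse_bounds[OF f, of p] that by (auto simp: sieving_primes_def)
   show "prime p" if "p : sieving_primes R" for p using that by (simp add: sieving_primes_def)
   show "card (R p) <= v" if "prime p" for p using R that by blast
   show "card (R p) < p - 1" if "p : sieving_primes R" for p using nu that by blast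
  qed (rule fin tail)+
  have main: "6/100 * (X * (\<Prod>p\<in>sieving_primes R. 1 - real (card (R p)) * euler_inverse f p / (real p - 1))) - level_error f R D x <= (\<Sum>n\<in>sifted_set x R. f n)"
   unfolding X_def by (rule sieve_lower_large_level[OF v a f]) (use R PD D nu in blast)+
  have "X * (c0 * e) <= X * (\<Prod>p\<in>sieving_primes R. 1 - real (card (R p)) * euler_inverse f p / (real p - 1))" using V X0 by (rule mult_left_mono)
  moreover have "level_error f R D x <= 3/100 * c0 * (X * e)"
   using le mult_right_mono[OF \<epsilon>(3) Xe(1)] unfolding X_def e_def by linarith
  moreover have "X * (c0 * e) = c0 * (X * e)" by simp
  ultimately have "3/100 * c0 * (X * e) <= (\<Sum>n\<in>sifted_set x R. f n)" using main by linarith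
  thus ?thesis by (simp only: X_def e_def)
 qed
 have pos: "0 < 3/100 * c0" "2 <= max X1 2" using c0(1) by simp_all
 show ?thesis
  by (rule exI[of _ "3/100 * c0"], rule conjI, rule pos(1), rule exI[of _ \<epsilon>], rule conjI, rule \<epsilon>(1),
   rule exI[of _ "max X1 2"], rule conjI, rule pos(2), intro allI impI, rule H, assumption+)
qed

section \<open>Large deviations on the sifted set\<close>

text \<open>Values up to \<open>3/2 * M\<close> are kept for coefficient bounds; the others are
  majorized exponentially, since \<open>ln (7/5) >= 1/3\<close> makes
  \<open>(7/5) ^ k >= exp (M / 2)\<close>. The factor 12/5 is \<open>1 + 7/5\<close>, from the
  arguments \<open>n\<close> and \<open>n + 1\<close>.\<close>

lemma deviation_indicator_le:
 fixes M lam :: real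
 assumes M: "0 <= M" and \<phi>: "!!k. \<phi> k = of_bool (lam * sqrt M <= \<bar>real k - M\<bar>)"
  and K: "K = {k. lam * sqrt M <= \<bar>real k - M\<bar> & real k <= 3/2 * M}" "finite K"
 shows "\<phi> n + \<phi> (n + 1) <= (\<Sum>k\<in>K. of_bool (n = k) + of_bool (n + 1 = k)) + 12/5 * exp (- (M / 2)) * (7/5) ^ n"
proof -
 have "(1::real) + 1/3 <= 7/5" by simp
 have l: "1/3 <= ln (7/5 :: real)"
 proof -
  have "exp (1::real) <= (7/5) ^ 3" using e_less_272 by (simp add: power3_eq_cube)
  hence "ln (exp (1::real)) <= ln ((7/5) ^ 3)" by (subst ln_le_cancel_iff) auto
  thus ?thesis by (simp add: ln_realpow)
 qed
 have b: "\<phi> k <= (\<Sum>i\<in>K. of_bool (k = i)) + exp (- (M / 2)) * (7/5) ^ k" for k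
 proof (cases "real k <= 3/2 * M")
  case True
  have s0: "0 <= exp (- (M / 2)) * (7/5 :: real) ^ k" by simp
  have "(\<Sum>i\<in>K. of_bool (k = i)) = (of_bool (k : K) :: real)" using K(2) by simp
  thus ?thesis using True s0 by (auto simp: \<phi> K(1))
 next
  case False
  have "M / 2 <= real k * (1/3)" using False by simp
  also have "\<dots> <= real k * ln (7/5)" using l by (intro mult_left_mono) auto
  finally have "exp 0 <= exp (- (M / 2) + real k * ln (7/5))" by (subst exp_le_cancel_iff) simp
  also have "\<dots> = exp (- (M / 2)) * (7/5) ^ k" by (simp only: exp_add exp_of_nat_mult) simp
  finally have "1 <= exp (- (M / 2)) * (7/5) ^ k" by simp
  moreover have "0 <= (\<Sum>i\<in>K. of_bool (k = i) :: real)" by (intro sum_nonneg) auto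
  moreover have "\<phi> k <= 1" by (simp add: \<phi>)
  ultimately show ?thesis by linarith
 qed
 have "\<phi> n + \<phi> (n + 1) <= (\<Sum>k\<in>K. of_bool (n = k)) + exp (- (M / 2)) * (7/5) ^ n + ((\<Sum>k\<in>K. of_bool (n + 1 = k)) + exp (- (M / 2)) * (7/5) ^ (n + 1))"
  by (intro add_mono b)
 also have "\<dots> = (\<Sum>k\<in>K. of_bool (n = k) + of_bool (n + 1 = k)) + 12/5 * exp (- (M / 2)) * (7/5) ^ n"
  by (simp add: sum.distrib)
 finally show ?thesis .
qed

lemma prime_mean_le:
 assumes f: "f : mult_class A1 A2" and A1: "0 < A1" and x: "2 <= x"
 shows "0 <= prime_mean f x E" "prime_mean f x E <= prime_mean f x UNIV" "prime_mean f x UNIV <= A1 * (ln (ln x) + 9)"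
proof -
 have f0: "0 <= f p" "f p <= A1" if "prime p" for p using mult_classD(2,4)[OF f, of p] that by (auto simp: prime_gt_0_nat)
 show "0 <= prime_mean f x E" unfolding prime_mean_def using f0 by (intro sum_nonneg) auto
 show "prime_mean f x E <= prime_mean f x UNIV" unfolding prime_mean_def
  by (intro sum_mono2) (use f0 finite_primes_real[of x] in auto)
 have "prime_mean f x UNIV <= (\<Sum>p | prime p & real p <= x. A1 * (1 / p))"
  unfolding prime_mean_alt using f0 by (intro sum_mono) (auto intro!: divide_right_mono)
 also have "\<dots> = A1 * (\<Sum>p | prime p & real p <= x. 1 / real p)" by (simp add: sum_distrib_left)
 also have "\<dots> <= A1 * (ln (ln x) + 9)" using sum_prime_recip_le[OF x] A1 by (intro mult_left_mono) auto
 finally show "prime_mean f x UNIV <= A1 * (ln (ln x) + 9)" .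
qed

text \<open>The primes of \<open>m\<close> stop at \<open>x powr (1 / j)\<close>, yet the Poisson
  parameter may be enlarged to the full mean \<open>M\<close>, because the coefficient bound
  increases with it; so all \<open>j\<close> share the same centre. Values above
  \<open>3/2 * M\<close> contribute \<open>exp (- M / 2 + 2/5 * M) = exp (- M / 10)\<close>.\<close>

lemma smooth_deviation:
 fixes A1 :: real and A2 :: "real => real" and v :: nat
 assumes A: "0 < A1" "0 < A2 (1/10)"
 shows "\<exists>C>0. \<forall>f g E x lam j. f : mult_class A1 A2 --> additive_fun g E --> exp 100 <= x --> 1 <= lam --> lam <= sqrt (prime_mean f x E) / 10 -->
  1 <= j --> real j <= sqrt (ln x) -->
  (\<Sum>m\<in>smooth_set {p. prime p & real p <= x powr (1 / real j)} (nat \<lfloor>x\<rfloor>). rankin_weight f v (real j / ln x) m *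
   (of_bool (lam * sqrt (prime_mean f x E) <= \<bar>real (g m) - prime_mean f x E\<bar>) +
   of_bool (lam * sqrt (prime_mean f x E) <= \<bar>real (g m + 1) - prime_mean f x E\<bar>)))
  <= C * exp (prime_mean f x UNIV) * (inverse lam * exp (- (lam\<^sup>2 / 2) + lam ^ 3 / sqrt (prime_mean f x E)))"
proof -
 obtain C2 where C2: "C2 > 0" "\<exists>C'>0. \<forall>f g E \<eta> y Q A S k. f : mult_class A1 A2 --> additive_fun g E --> 0 <= \<eta> --> \<eta> <= 1/10 --> 1 <= y --> \<eta> * ln y <= 1 -->
  Q \<subseteq> {p. prime p & real p <= y} --> 1 <= A --> 0 < S --> (\<Sum>p\<in>Q \<inter> E. f p / p) + C' <= S --> real k <= 3/2 * S -->
  (\<Sum>m | m : smooth_set Q A & g m = k. rankin_weight f v \<eta> m) <= C2 * exp (\<Sum>p\<in>Q - E. f p / p) * (S ^ k / fact k)"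
  using smooth_coeff[where ?A1.0 = A1 and ?A2.0 = A2 and v = v, OF A] by atomize_elim
 obtain C' where C': "C' > 0" "!!f g E \<eta> y Q A S k. f : mult_class A1 A2 ==> additive_fun g E ==> 0 <= \<eta> ==> \<eta> <= 1/10 ==> 1 <= y ==> \<eta> * ln y <= 1 ==>
  Q \<subseteq> {p. prime p & real p <= y} ==> 1 <= A ==> 0 < S ==> (\<Sum>p\<in>Q \<inter> E. f p / p) + C' <= S ==> real k <= 3/2 * S ==>
  (\<Sum>m | m : smooth_set Q A & g m = k. rankin_weight f v \<eta> m) <= C2 * exp (\<Sum>p\<in>Q - E. f p / p) * (S ^ k / fact k)"
  using C2(2) by atomize_elim
 obtain C3 where C3: "C3 > 0" "!!f g E \<eta> y Q A r. f : mult_class A1 A2 ==> additive_fun g E ==> 0 <= \<eta> ==> \<eta> <= 1/10 ==> 1 <= y ==> \<eta> * ln y <= 1 ==>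
  Q \<subseteq> {p. prime p & real p <= y} ==> 1 <= A ==> 0 <= r ==> r <= 3/2 ==>
  (\<Sum>m\<in>smooth_set Q A. rankin_weight f v \<eta> m * r ^ g m) <= C3 * exp ((\<Sum>p\<in>Q - E. f p / p) + r * (\<Sum>p\<in>Q \<inter> E. f p / p))"
  using smooth_moment[where ?A1.0 = A1 and ?A2.0 = A2 and v = v, OF A] by atomize_elim
 define C5 where "C5 = 5/2 * C2 * exp (3/2 * C')"
 define C where "C = C5 * 5 + 12/5 * C3"
 have C5: "C5 > 0" using C2(1) by (simp add: C5_def)
 have Cpos: "C > 0" using C5 C3(1) by (simp add: C_def)
 have "(\<Sum>m\<in>smooth_set {p. prime p & real p <= x powr (1 / real j)} (nat \<lfloor>x\<rfloor>). rankin_weight f v (real j / ln x) m *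
   (of_bool (lam * sqrt (prime_mean f x E) <= \<bar>real (g m) - prime_mean f x E\<bar>) +
   of_bool (lam * sqrt (prime_mean f x E) <= \<bar>real (g m + 1) - prime_mean f x E\<bar>)))
  <= C * exp (prime_mean f x UNIV) * (inverse lam * exp (- (lam\<^sup>2 / 2) + lam ^ 3 / sqrt (prime_mean f x E)))"
  if f: "f : mult_class A1 A2" and g: "additive_fun g E" and x: "exp 100 <= x" and lam: "1 <= lam" "lam <= sqrt (prime_mean f x E) / 10"
   and j: "1 <= j" "real j <= sqrt (ln x)" for f g E x lam j
 proof -
  define M where "M = prime_mean f x E"
  define Mf where "Mf = prime_mean f x UNIV"
  define y where "y = x powr (1 / real j)"
  define \<eta> where "\<eta> = real j / ln x"
  define Q where "Q = {p. prime p & real p <= y}"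
  define A where "A = nat \<lfloor>x\<rfloor>"
  define S where "S = smooth_set Q A"
  define K where "K = {k::nat. lam * sqrt M <= \<bar>real k - M\<bar> & real k <= 3/2 * M}"
  define \<phi> :: "nat => real" where "\<phi> = (%k. of_bool (lam * sqrt M <= \<bar>real k - M\<bar>))"
  let ?W = "rankin_weight f v \<eta>"
  let ?e = "inverse lam * exp (- (lam\<^sup>2 / 2) + lam ^ 3 / sqrt M)"
  have x1: "x >= 101" using x exp_ge_add_one_self[of "100::real"] by linarith
  have L: "ln x >= 100" using x x1 by (simp add: ln_ge_iff)
  have sL: "sqrt (ln x) >= 10" using L real_sqrt_le_mono[of 100 "ln x"] by simp
  have sL2: "sqrt (ln x) * sqrt (ln x) = ln x" using L by simp
  have fK: "finite K" unfolding K_def by (rule finite_subset[OF _ finite_nat_real_le[of "3/2 * M"]]) auto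
  have fQ: "finite Q" by (simp add: Q_def)
  have fS: "finite S" unfolding S_def by (rule finite_smooth_set) (auto simp: Q_def)
  have lam': "lam <= sqrt M / 10" using lam by (simp add: M_def)
  have "0 < sqrt M" using lam(1) lam' by linarith
  hence M0: "0 < M" by simp
  have f0: "0 <= f p" if "prime p" for p using mult_classD(2)[OF f, of p] that by (auto simp: prime_gt_0_nat)
  have \<eta>: "0 <= \<eta>" "\<eta> <= 1/10" "\<eta> * ln y <= 1"
  proof -
   show "0 <= \<eta>" using L by (simp add: \<eta>_def)
   have "real j * 10 <= sqrt (ln x) * sqrt (ln x)" using j sL L by (intro mult_mono) auto
   thus "\<eta> <= 1/10" using sL2 L by (simp add: \<eta>_def field_simps)
   show "\<eta> * ln y <= 1" using j L x1 by (simp add: \<eta>_def y_def ln_powr)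
  qed
  have yx: "1 <= y" "y <= x"
  proof -
   show "1 <= y" unfolding y_def using x1 by (intro ge_one_powr_ge_zero) auto
   have "x powr (1 / real j) <= x powr 1" using x1 j by (intro powr_mono) auto
   thus "y <= x" using x1 by (simp add: y_def)
  qed
  have A1': "1 <= A" using x1 by (simp add: A_def le_nat_iff)
  have QE: "(\<Sum>p\<in>Q \<inter> E. f p / p) <= M" unfolding M_def prime_mean_def
   by (intro sum_mono2) (use f0 yx finite_primes_real[of x] in \<open>auto simp: Q_def\<close>)
  have QN: "(\<Sum>p\<in>Q - E. f p / p) <= Mf - M"
  proof -
   have "Mf = (\<Sum>p\<in>{p. prime p & real p <= x & p : E} \<union> {p. prime p & real p <= x & p \<notin> E}. f p / p)"
   unfolding Mf_def prime_mean_def by (intro sum.cong) auto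
   also have "\<dots> = M + (\<Sum>p | prime p & real p <= x & p \<notin> E. f p / p)" unfolding M_def prime_mean_def
   by (intro sum.union_disjoint) (use finite_primes_real[of x] in auto)
   finally have e: "Mf - M = (\<Sum>p | prime p & real p <= x & p \<notin> E. f p / p)" by simp
   show ?thesis unfolding e
   by (intro sum_mono2) (use f0 yx finite_primes_real[of x] in \<open>auto simp: Q_def\<close>)
  qed
  have W0: "0 <= ?W m" if "m : S" for m using rankin_weight_mult(2)[OF f, of m] that by (auto simp: S_def smooth_set_def)
  have "(\<Sum>m\<in>S. ?W m * (\<phi> (g m) + \<phi> (g m + 1))) \<le>
   (\<Sum>m\<in>S. ?W m * ((\<Sum>k\<in>K. of_bool (g m = k) + of_bool (g m + 1 = k)) + 12/5 * exp (- (M / 2)) * (7/5) ^ g m))"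
  proof (intro sum_mono mult_left_mono W0)
   fix m
   show "\<phi> (g m) + \<phi> (g m + 1) <= (\<Sum>k\<in>K. of_bool (g m = k) + of_bool (g m + 1 = k)) + 12/5 * exp (- (M / 2)) * (7/5) ^ g m"
   by (rule deviation_indicator_le[where lam = lam]) (use M0 fK in \<open>auto simp: \<phi>_def K_def\<close>)
  qed
  also have "\<dots> = (\<Sum>k\<in>K. (\<Sum>m\<in>S. ?W m * of_bool (g m = k)) + (\<Sum>m\<in>S. ?W m * of_bool (g m + 1 = k))) + 12/5 * exp (- (M / 2)) * (\<Sum>m\<in>S. ?W m * (7/5) ^ g m)"
  proof -
   have "(\<Sum>m\<in>S. ?W m * (\<Sum>k\<in>K. of_bool (g m = k) + of_bool (g m + 1 = k))) = (\<Sum>k\<in>K. \<Sum>m\<in>S. ?W m * (of_bool (g m = k) + of_bool (g m + 1 = k)))"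
   unfolding sum_distrib_left by (rule sum.swap)
   also have "\<dots> = (\<Sum>k\<in>K. (\<Sum>m\<in>S. ?W m * of_bool (g m = k)) + (\<Sum>m\<in>S. ?W m * of_bool (g m + 1 = k)))"
   by (simp only: distrib_left sum.distrib)
   finally have 1: "(\<Sum>m\<in>S. ?W m * (\<Sum>k\<in>K. of_bool (g m = k) + of_bool (g m + 1 = k))) = \<dots>" .
   have 2: "(\<Sum>m\<in>S. ?W m * (12/5 * exp (- (M / 2)) * (7/5) ^ g m)) = 12/5 * exp (- (M / 2)) * (\<Sum>m\<in>S. ?W m * (7/5) ^ g m)"
   unfolding sum_distrib_left by (intro sum.cong refl) (simp only: mult_ac)
   show ?thesis by (simp only: distrib_left[of "?W _"] sum.distrib[of "%m. ?W m * (\<Sum>k\<in>K. of_bool (g m = k) + of_bool (g m + 1 = k))"] 1 2)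
  qed
  also have "\<dots> <= (\<Sum>k\<in>K. C5 * exp (Mf - M) * (M ^ k / fact k)) + 12/5 * exp (- (M / 2)) * (C3 * exp (Mf - M + 7/5 * M))"
  proof (intro add_mono sum_mono mult_left_mono)
   have "(\<Sum>m\<in>S. ?W m * (7/5) ^ g m) <= C3 * exp ((\<Sum>p\<in>Q - E. f p / p) + 7/5 * (\<Sum>p\<in>Q \<inter> E. f p / p))"
   unfolding S_def by (rule C3(2)[OF f g \<eta>(1,2) yx(1) \<eta>(3) _ A1']) (auto simp: Q_def)
   also have "\<dots> <= C3 * exp (Mf - M + 7/5 * M)" using QE QN C3(1) by simp
   finally show "(\<Sum>m\<in>S. ?W m * (7/5) ^ g m) <= C3 * exp (Mf - M + 7/5 * M)" .
   fix k assume k: "k : K"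
   \<comment> \<open>For \<open>k <= 3/2 * M\<close> the ratio \<open>(T / M) ^ k\<close> is at most
     \<open>exp (3/2 * C')\<close>, so the shift costs a constant.\<close>
   define T where "T = M + C'"
   have T: "0 < T" "(\<Sum>p\<in>Q \<inter> E. f p / p) + C' <= T" "M <= T" using M0 C'(1) QE by (auto simp: T_def)
   have kM: "real k <= 3/2 * M" using k by (simp add: K_def)
   hence kT: "real k <= 3/2 * T" using T by linarith
   have co: "(\<Sum>m | m : S & g m = i. ?W m) <= C2 * exp (Mf - M) * (T ^ i / fact i)" if "i <= k" for i
   proof -
   have "real i <= 3/2 * T" using that kT by linarith
   hence "(\<Sum>m | m : S & g m = i. ?W m) <= C2 * exp (\<Sum>p\<in>Q - E. f p / p) * (T ^ i / fact i)"
   unfolding S_def by (intro C'(2)[OF f g \<eta>(1,2) yx(1) \<eta>(3) _ A1' T(1,2)]) (auto simp: Q_def)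
   also have "\<dots> <= C2 * exp (Mf - M) * (T ^ i / fact i)" using QN C2(1) T by (intro mult_right_mono mult_left_mono) auto
   finally show ?thesis .
   qed
   have ind: "(\<Sum>m\<in>S. ?W m * of_bool (h m)) = (\<Sum>m | m : S & h m. ?W m)" for h
   using sum.inter_filter[OF fS, of ?W h] by (simp add: of_bool_def if_distrib cong: if_cong)
   have t1: "(\<Sum>m\<in>S. ?W m * of_bool (g m = k)) <= C2 * exp (Mf - M) * (T ^ k / fact k)" unfolding ind by (rule co) simp
   \<comment> \<open>Lowering the index by one multiplies the Poisson term by
     \<open>k / T <= 3/2\<close>.\<close>
   have t2: "(\<Sum>m\<in>S. ?W m * of_bool (g m + 1 = k)) <= 3/2 * (C2 * exp (Mf - M) * (T ^ k / fact k))"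
   proof (cases k)
   case 0
   thus ?thesis using C2(1) T by simp
   next
   case (Suc i)
   have "(\<Sum>m\<in>S. ?W m * of_bool (g m + 1 = k)) = (\<Sum>m | m : S & g m = i. ?W m)" unfolding ind Suc by simp
   also have "\<dots> <= C2 * exp (Mf - M) * (T ^ i / fact i)" by (rule co) (simp add: Suc)
   also have "T ^ i / fact i <= 3/2 * (T ^ k / fact k)"
   proof -
   have "real (Suc i) * T ^ i <= (3/2 * T) * T ^ i" using kT T Suc by (intro mult_right_mono) auto
   hence "real (Suc i) * T ^ i / fact (Suc i) <= (3/2 * T) * T ^ i / fact (Suc i)" by (intro divide_right_mono) auto
   moreover have "real (Suc i) * T ^ i / fact (Suc i) = T ^ i / fact i" by (simp add: divide_simps)
   ultimately show ?thesis unfolding Suc by (simp del: fact_Suc)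
   qed
   hence "C2 * exp (Mf - M) * (T ^ i / fact i) <= C2 * exp (Mf - M) * (3/2 * (T ^ k / fact k))" using C2(1) by (intro mult_left_mono) auto
   finally show ?thesis by (simp only: mult.left_commute)
   qed
   have "T ^ k <= M ^ k * exp (3/2 * C')"
   proof -
   have "T = M * (1 + C' / M)" using M0 by (simp add: T_def field_simps)
   hence "T ^ k = M ^ k * (1 + C' / M) ^ k" by (simp add: power_mult_distrib)
   also have "(1 + C' / M) ^ k <= exp (C' / M) ^ k" using M0 C'(1) by (intro power_mono) auto
   also have "exp (C' / M) ^ k = exp (real k * (C' / M))" by (rule exp_of_nat_mult[symmetric])
   also have "\<dots> <= exp (3/2 * C')"
   proof -
   have "real k * (C' / M) <= (3/2 * M) * (C' / M)" using kM M0 C'(1) by (intro mult_right_mono) auto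
   thus ?thesis using M0 by simp
   qed
   finally show ?thesis using M0 by (simp add: mult_left_mono)
   qed
   hence "T ^ k / fact k <= M ^ k * exp (3/2 * C') / fact k" by (intro divide_right_mono) auto
   hence "5/2 * (C2 * exp (Mf - M)) * (T ^ k / fact k) <= 5/2 * (C2 * exp (Mf - M)) * (M ^ k * exp (3/2 * C') / fact k)"
   using C2(1) by (intro mult_left_mono) auto
   moreover have "5/2 * (C2 * exp (Mf - M)) * (M ^ k * exp (3/2 * C') / fact k) = C5 * exp (Mf - M) * (M ^ k / fact k)" by (simp add: C5_def)
   ultimately show "(\<Sum>m\<in>S. ?W m * of_bool (g m = k)) + (\<Sum>m\<in>S. ?W m * of_bool (g m + 1 = k)) <= C5 * exp (Mf - M) * (M ^ k / fact k)"
   using t1 t2 by linarith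
  qed auto
  also have "(\<Sum>k\<in>K. C5 * exp (Mf - M) * (M ^ k / fact k)) = C5 * exp Mf * (exp (- M) * (\<Sum>k\<in>K. M ^ k / fact k))"
  proof -
   have "exp (Mf - M) = exp Mf * exp (- M)" by (simp flip: exp_add)
   thus ?thesis by (simp only: sum_distrib_left mult.assoc)
  qed
  also have "12/5 * exp (- (M / 2)) * (C3 * exp (Mf - M + 7/5 * M)) = 12/5 * C3 * exp Mf * exp (- (M / 10))"
  proof -
   have "exp (- (M / 2)) * exp (Mf - M + 7/5 * M) = exp Mf * exp (- (M / 10))" by (simp flip: exp_add)
   thus ?thesis by (simp only: mult.assoc mult.left_commute)
  qed
  also have "C5 * exp Mf * (exp (- M) * (\<Sum>k\<in>K. M ^ k / fact k)) + 12/5 * C3 * exp Mf * exp (- (M / 10)) <= C5 * exp Mf * (5 * ?e) + 12/5 * C3 * exp Mf * ?e"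
  proof (intro add_mono mult_left_mono)
   show "exp (- M) * (\<Sum>k\<in>K. M ^ k / fact k) <= 5 * ?e" by (rule poisson_tail[OF lam(1) lam' fK]) (auto simp: K_def)
   have "exp (- (M / 10)) <= inverse lam * exp (- (lam\<^sup>2 / 2))" by (rule exp_minus_tenth_le[OF lam(1) lam'])
   also have "\<dots> <= ?e" using lam M0 by (intro mult_left_mono) auto
   finally show "exp (- (M / 10)) <= ?e" .
  qed (use C5 C3(1) in auto)
  also have "\<dots> = C * exp Mf * ?e" by (simp add: C_def algebra_simps)
  finally show ?thesis by (simp only: M_def Mf_def \<phi>_def S_def Q_def y_def A_def \<eta>_def)
 qed
 thus ?thesis using Cpos by blast
qed

lemma additive_fun_Omega: "\<forall>p\<in>E. prime p ==> additive_fun (%n. Omega_in n E) E"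
 using Omega_in_props[of E] by (auto simp: additive_fun_def)

lemma finite_sifted_set: "finite (sifted_set x R)"
 by (rule finite_subset[OF _ finite_nat_real_le[of x]]) (auto simp: sifted_set_def)

lemma large_deviation_upper:
 fixes A1 :: real and A2 :: "real => real" and v :: nat
 assumes A': "0 < A1" "\<forall>e>0. 0 < A2 e"
 shows "\<exists>C>0. \<exists>X0\<ge>2. \<forall>f g E R x lam. f : mult_class A1 A2 --> additive_fun g E -->
  residue_system v R --> X0 <= x --> 1 <= lam --> lam <= sqrt (prime_mean f x E) / 10 -->
  (\<Sum>n | n : sifted_set x R & lam * sqrt (prime_mean f x E) <= \<bar>real (g n) - prime_mean f x E\<bar>. f n) \<le>
   C * (x / ln x * exp (prime_mean f x UNIV - sieve_mean R x)) *
   (inverse lam * exp (- (lam\<^sup>2 / 2) + lam ^ 3 / sqrt (prime_mean f x E)))"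
proof -
 have A: "0 < A1" "!!e. 0 < e ==> 0 < A2 e" using A' by blast+
 have a2: "0 < A2 (1/10)" using A(2)[of "1/10"] by simp
 \<comment> \<open>The exponent at which exceptional integers fall below the target: 1 for
   \<open>1 / ln x\<close>, \<open>v\<close> for \<open>exp (- sieve_mean R x)\<close>, and
   \<open>A1 / 10\<close> because the Gaussian factor is at least \<open>exp (- M / 10)\<close> with
   \<open>M <= A1 * (ln (ln x) + 9)\<close>.\<close>
 define N where "N = 1 + real v + A1 / 10"
 obtain C1 where C1: "C1 > 0" "\<exists>X0\<ge>2. \<forall>f A2 g E R x \<phi> Z. f : mult_class A1 A2 --> additive_fun g E -->
  residue_system v R --> X0 <= x --> (\<forall>k::nat. 0 <= \<phi> k) -->
  (\<forall>j\<ge>1. real j <= sqrt (ln x) --> (\<Sum>m\<in>smooth_set {p. prime p & real p <= x powr (1 / real j)} (nat \<lfloor>x\<rfloor>). rankin_weight f v (real j / ln x) m * (\<phi> (g m) + \<phi> (g m + 1))) <= Z) -->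
  (\<Sum>n\<in>sifted_set x R - exceptional x. f n * \<phi> (g n)) <= C1 * (x / ln x * exp (- sieve_mean R x)) * Z"
  using good_mass[OF A(1), of v] by atomize_elim
 obtain X1 where X1: "!!f A2 g E R x \<phi> Z. f : mult_class A1 A2 ==> additive_fun g E ==>
  residue_system v R ==> X1 <= x ==> (\<forall>k::nat. 0 <= \<phi> k) ==>
  (\<forall>j\<ge>1. real j <= sqrt (ln x) --> (\<Sum>m\<in>smooth_set {p. prime p & real p <= x powr (1 / real j)} (nat \<lfloor>x\<rfloor>). rankin_weight f v (real j / ln x) m * (\<phi> (g m) + \<phi> (g m + 1))) <= Z) ==>
  (\<Sum>n\<in>sifted_set x R - exceptional x. f n * \<phi> (g n)) <= C1 * (x / ln x * exp (- sieve_mean R x)) * Z"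
  using C1(2) by atomize_elim (elim exE conjE, rule exI, assumption)
 obtain C4 where C4: "C4 > 0" "!!f g E x lam j. f : mult_class A1 A2 ==> additive_fun g E ==> exp 100 <= x ==> 1 <= lam ==> lam <= sqrt (prime_mean f x E) / 10 ==>
  1 <= j ==> real j <= sqrt (ln x) ==>
  (\<Sum>m\<in>smooth_set {p. prime p & real p <= x powr (1 / real j)} (nat \<lfloor>x\<rfloor>). rankin_weight f v (real j / ln x) m *
   (of_bool (lam * sqrt (prime_mean f x E) <= \<bar>real (g m) - prime_mean f x E\<bar>) +
   of_bool (lam * sqrt (prime_mean f x E) <= \<bar>real (g m + 1) - prime_mean f x E\<bar>)))
  <= C4 * exp (prime_mean f x UNIV) * (inverse lam * exp (- (lam\<^sup>2 / 2) + lam ^ 3 / sqrt (prime_mean f x E)))"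
  using smooth_deviation[where ?A1.0 = A1 and ?A2.0 = A2 and v = v, OF A(1) a2] by atomize_elim
 obtain Cg where Cg: "Cg > 0" "\<exists>X0\<ge>2. \<forall>f x. f : mult_class A1 A2 --> X0 <= x --> (\<Sum>n\<in>exceptional x. f n) <= Cg * (x * ln x powr (-N))"
  using exceptional_mass[where ?A1.0 = A1 and ?A2.0 = A2 and N = N, OF A] by atomize_elim
 obtain Xg where Xg: "!!f x. f : mult_class A1 A2 ==> Xg <= x ==> (\<Sum>n\<in>exceptional x. f n) <= Cg * (x * ln x powr (-N))"
  using Cg(2) by atomize_elim (elim exE conjE, rule exI, assumption)
 define C where "C = C1 * C4 + Cg * exp (9 * real v + A1)"
 define X0 where "X0 = max (exp 100) (max X1 Xg)"
 have Cpos: "0 < C" using C1(1) C4(1) Cg(1) by (simp add: C_def add_pos_pos)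
 have X02: "2 <= X0" using exp_ge_add_one_self[of "100::real"] by (simp add: X0_def)
 have H: "(\<Sum>n | n : sifted_set x R & lam * sqrt (prime_mean f x E) <= \<bar>real (g n) - prime_mean f x E\<bar>. f n) \<le>
   C * (x / ln x * exp (prime_mean f x UNIV - sieve_mean R x)) *
   (inverse lam * exp (- (lam\<^sup>2 / 2) + lam ^ 3 / sqrt (prime_mean f x E)))"
  if f: "f : mult_class A1 A2" and g: "additive_fun g E" and R: "residue_system v R"
   and x: "X0 <= x" and lam: "1 <= lam" "lam <= sqrt (prime_mean f x E) / 10" for f g E R x lam
 proof -
  define M where "M = prime_mean f x E"
  define Mf where "Mf = prime_mean f x UNIV"
  define Mn where "Mn = sieve_mean R x"
  define e where "e = inverse lam * exp (- (lam\<^sup>2 / 2) + lam ^ 3 / sqrt M)"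
  define bad where "bad = (%k::nat. lam * sqrt M <= \<bar>real k - M\<bar>)"
  have xx: "exp 100 <= x" "X1 <= x" "Xg <= x" using x by (auto simp: X0_def)
  have x1: "x >= 101" using xx exp_ge_add_one_self[of "100::real"] by linarith
  have L: "ln x >= 100" using xx x1 by (simp add: ln_ge_iff)
  have lam': "lam <= sqrt M / 10" using lam by (simp add: M_def)
  have "0 < sqrt M" using lam lam' by linarith
  hence M0: "0 < M" by simp
  have f0: "0 <= f n" if "0 < n" for n using mult_classD(2)[OF f that] .
  have fin: "finite (sifted_set x R)" by (rule finite_sifted_set)
  have fe: "finite (exceptional x)" by (rule finite_subset[OF _ finite_nat_real_le[of x]]) (auto simp: exceptional_def)
  have spos: "0 < n" if "n : sifted_set x R" for n using that by (simp add: sifted_set_def)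
  have good: "(\<Sum>n\<in>sifted_set x R - exceptional x. f n * of_bool (bad (g n))) <= C1 * (x / ln x * exp (- Mn)) * (C4 * exp Mf * e)"
   unfolding Mn_def
  proof (rule X1[OF f g R xx(2)])
   show "\<forall>j\<ge>1. real j <= sqrt (ln x) --> (\<Sum>m\<in>smooth_set {p. prime p & real p <= x powr (1 / real j)} (nat \<lfloor>x\<rfloor>). rankin_weight f v (real j / ln x) m * (of_bool (bad (g m)) + of_bool (bad (g m + 1)))) <= C4 * exp Mf * e"
   unfolding bad_def e_def M_def Mf_def using C4(2)[OF f g xx(1) lam] by blast
  qed simp
  have "(\<Sum>n | n : sifted_set x R & bad (g n). f n) = (\<Sum>n\<in>sifted_set x R. f n * of_bool (bad (g n)))"
   using sum.inter_filter[OF fin, of f "%n. bad (g n)"] by (simp add: of_bool_def if_distrib cong: if_cong)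
  also have "\<dots> = (\<Sum>n\<in>sifted_set x R \<inter> exceptional x. f n * of_bool (bad (g n))) + (\<Sum>n\<in>sifted_set x R - exceptional x. f n * of_bool (bad (g n)))"
   by (rule sum.Int_Diff[OF fin])
  also have "(\<Sum>n\<in>sifted_set x R \<inter> exceptional x. f n * of_bool (bad (g n))) <= (\<Sum>n\<in>sifted_set x R \<inter> exceptional x. f n)"
   using f0 spos by (intro sum_mono) auto
  also have "\<dots> <= (\<Sum>n\<in>exceptional x. f n)" using fe f0 by (intro sum_mono2) (auto simp: exceptional_def)
  also have "\<dots> <= Cg * (x * ln x powr (-N))" by (rule Xg[OF f xx(3)])
  also have "\<dots> <= Cg * (exp (9 * real v + A1) * (x / ln x * exp (Mf - Mn) * e))"
  proof (rule mult_left_mono)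
   have x2: "2 <= x" using x1 by simp
   note pm = prime_mean_le[OF f A(1) x2]
   have MA: "M <= A1 * (ln (ln x) + 9)" using pm(2)[of E] pm(3) unfolding M_def by linarith
   have Mf0: "0 <= Mf" unfolding Mf_def by (rule pm(1))
   have Mn: "Mn <= v * (ln (ln x) + 9)" unfolding Mn_def by (rule prime_mean_count_le[OF _ x2]) (use R in auto)
   have e1: "exp (- (M / 10)) <= e"
   proof -
   have "exp (- (M / 10)) <= inverse lam * exp (- (lam\<^sup>2 / 2))" by (rule exp_minus_tenth_le[OF lam(1) lam'])
   also have "\<dots> <= e" unfolding e_def using lam M0 by (intro mult_left_mono) auto
   finally show ?thesis .
   qed
   have l: "0 < ln x" using L by simp
   have "x * ln x powr (-N) = x / ln x * exp (- (real v + A1 / 10) * ln (ln x))"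
   proof -
   have nN: "- N = - 1 + - (real v + A1 / 10)" by (simp add: N_def)
   have "ln x powr (-N) = ln x powr (-1) * ln x powr (- (real v + A1 / 10))" unfolding nN by (rule powr_add)
   also have "ln x powr (-1) = 1 / ln x" using l by (simp add: powr_minus_divide)
   also have "ln x powr (- (real v + A1 / 10)) = exp (- (real v + A1 / 10) * ln (ln x))" using l by (simp add: powr_def)
   finally show ?thesis by simp
   qed
   also have "\<dots> <= x / ln x * exp ((9 * real v + A1) + (Mf - Mn) + - (M / 10))"
   proof (rule mult_left_mono)
   define a b where "a = real v * ln (ln x)" and "b = A1 * ln (ln x)"
   have "Mn <= a + 9 * real v" using Mn by (simp add: a_def algebra_simps)
   moreover have "M <= b + 9 * A1" using MA by (simp add: b_def algebra_simps)
   moreover have "(real v + A1 / 10) * ln (ln x) = a + b / 10" by (simp add: a_def b_def algebra_simps)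
   ultimately have "- ((real v + A1 / 10) * ln (ln x)) <= (9 * real v + A1) + (Mf - Mn) + - (M / 10)" using Mf0 A(1) by linarith
   thus "exp (- (real v + A1 / 10) * ln (ln x)) <= exp ((9 * real v + A1) + (Mf - Mn) + - (M / 10))"
   by (simp only: exp_le_cancel_iff mult_minus_left)
   qed (use x1 l in auto)
   also have "\<dots> = exp (9 * real v + A1) * (x / ln x * exp (Mf - Mn) * exp (- (M / 10)))" by (simp only: exp_add mult_ac)
   also have "\<dots> <= exp (9 * real v + A1) * (x / ln x * exp (Mf - Mn) * e)" using e1 x1 l by (intro mult_left_mono) auto
   finally show "x * ln x powr (-N) <= exp (9 * real v + A1) * (x / ln x * exp (Mf - Mn) * e)" .
  qed (use Cg in simp)
  finally have "(\<Sum>n | n : sifted_set x R & bad (g n). f n) <= Cg * (exp (9 * real v + A1) * (x / ln x * exp (Mf - Mn) * e)) + C1 * (x / ln x * exp (- Mn)) * (C4 * exp Mf * e)"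
   using good by simp
  also have "\<dots> = C * (x / ln x * exp (Mf - Mn)) * e"
  proof -
   have "exp (Mf - Mn) = exp (- Mn) * exp Mf" by (simp flip: exp_add)
   thus ?thesis unfolding C_def by (simp only: distrib_right) (simp only: mult_ac add_ac)
  qed
  finally show ?thesis by (simp only: bad_def e_def M_def Mf_def Mn_def)
 qed
 show ?thesis
  by (rule exI[of _ C], rule conjI, rule Cpos, rule exI[of _ X0], rule conjI, rule X02, intro allI impI, rule H, assumption+)
qed

text \<open>Since the sum of \<open>f\<close> is at least
  \<open>c1 * (x / ln x) * exp (prime_mean f x UNIV)\<close>, an error small against the latter is
  small against the sifted main term, as \<open>sieve_lower\<close> requires.\<close>

lemma sifted_mass_lower:
 fixes A1 B x0 :: real and A2 :: "real => real" and v :: nat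
 assumes A: "0 < A1" "0 < A2 (1/2)" and B: "0 < B"
 shows "\<exists>c>0. \<exists>\<delta>>0. \<exists>X0\<ge>2. \<forall>f R D x. f : mult_class A1 A2 -->
  (\<forall>t\<ge>x0. B * (t / ln (2 * t)) <= (\<Sum>p | prime p & real p <= t. f p)) -->
  residue_system v R -->
  (\<forall>p\<in>sieving_primes R. real p <= D powr (1 / sieve_exponent v)) --> 1 <= D --> (\<forall>p\<in>sieving_primes R. card (R p) < p - 1) --> X0 <= x -->
  level_error f R D x <= \<delta> * (x / ln x * exp (prime_mean f x UNIV - sieve_mean R x)) -->
  c * (x / ln x * exp (prime_mean f x UNIV - sieve_mean R x)) <= (\<Sum>n\<in>sifted_set x R. f n)"
proof -
 obtain c1 X1 where c1: "c1 > 0" "!!f A2 x. f : mult_class A1 A2 ==>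
  (\<forall>t\<ge>x0. B * (t / ln (2 * t)) <= (\<Sum>p | prime p & real p <= t. f p)) ==> X1 <= x ==>
  c1 * (x / ln x) * exp (prime_mean f x UNIV) <= (total f x)"
  using mult_sum_lower[OF A(1) B, of x0] by atomize_elim (elim exE conjE, intro exI conjI, assumption, assumption)
 obtain c2 \<epsilon> X2 where c2: "c2 > 0" "\<epsilon> > 0" "!!f R D x. f : mult_class A1 A2 ==> residue_system v R ==>
  (\<forall>p\<in>sieving_primes R. real p <= D powr (1 / sieve_exponent v)) ==> 1 <= D ==> (\<forall>p\<in>sieving_primes R. card (R p) < p - 1) ==> X2 <= x ==>
  level_error f R D x <= \<epsilon> * ((total f x) * exp (- sieve_mean R x)) ==>
  c2 * ((total f x) * exp (- sieve_mean R x)) <= (\<Sum>n\<in>sifted_set x R. f n)"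
  using sieve_lower[where ?A1.0 = A1 and ?A2.0 = A2 and v = v, OF A(2)] by atomize_elim (elim exE conjE, intro exI conjI, assumption, assumption, assumption)
 define X0 where "X0 = max 2 (max X1 X2)"
 have H: "c2 * c1 * (x / ln x * exp (prime_mean f x UNIV - sieve_mean R x)) <= (\<Sum>n\<in>sifted_set x R. f n)"
  if f: "f : mult_class A1 A2" and d: "\<forall>t\<ge>x0. B * (t / ln (2 * t)) <= (\<Sum>p | prime p & real p <= t. f p)"
   and R: "residue_system v R"
   and PD: "\<forall>p\<in>sieving_primes R. real p <= D powr (1 / sieve_exponent v)" "1 <= D" "\<forall>p\<in>sieving_primes R. card (R p) < p - 1" and x: "X0 <= x"
   and le: "level_error f R D x <= (\<epsilon> * c1) * (x / ln x * exp (prime_mean f x UNIV - sieve_mean R x))" for f R D x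
 proof -
  define X where "X = (total f x)"
  define Mf where "Mf = prime_mean f x UNIV"
  define Mn where "Mn = sieve_mean R x"
  have xx: "X1 <= x" "X2 <= x" using x by (auto simp: X0_def)
  have "c1 * (x / ln x) * exp Mf <= X" unfolding X_def Mf_def by (rule c1(2)[OF f d xx(1)])
  hence "c1 * (x / ln x) * exp Mf * exp (- Mn) <= X * exp (- Mn)" by (intro mult_right_mono) auto
  moreover have "c1 * (x / ln x) * exp Mf * exp (- Mn) = c1 * (x / ln x * exp (Mf - Mn))"
  proof -
   have "exp (Mf - Mn) = exp Mf * exp (- Mn)" by (simp flip: exp_add)
   thus ?thesis by (simp only: mult.assoc)
  qed
  ultimately have m: "c1 * (x / ln x * exp (Mf - Mn)) <= X * exp (- Mn)" by (simp only:)
  have "level_error f R D x <= \<epsilon> * (c1 * (x / ln x * exp (Mf - Mn)))" using le unfolding Mf_def Mn_def by (simp only: mult.assoc)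
  also have "\<dots> <= \<epsilon> * (X * exp (- Mn))" using m c2(2) by (intro mult_left_mono) auto
  finally have "level_error f R D x <= \<epsilon> * (X * exp (- Mn))" .
  from c2(3)[OF f R PD xx(2) this[unfolded X_def Mn_def]] have "c2 * (X * exp (- Mn)) <= (\<Sum>n\<in>sifted_set x R. f n)" by (simp only: X_def Mn_def)
  moreover have "c2 * (c1 * (x / ln x * exp (Mf - Mn))) <= c2 * (X * exp (- Mn))" using m c2(1) by (intro mult_left_mono) auto
  ultimately have "c2 * (c1 * (x / ln x * exp (Mf - Mn))) <= (\<Sum>n\<in>sifted_set x R. f n)" by linarith
  thus ?thesis by (simp only: Mf_def Mn_def mult.assoc)
 qed
 have pos: "0 < c2 * c1" "0 < \<epsilon> * c1" "2 <= X0" using c1(1) c2(1,2) by (auto simp: X0_def)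
 show ?thesis
  by (rule exI[of _ "c2 * c1"], rule conjI, rule pos(1), rule exI[of _ "\<epsilon> * c1"], rule conjI, rule pos(2),
   rule exI[of _ X0], rule conjI, rule pos(3), intro allI impI, rule H, assumption+)
qed

section \<open>Trivial ranges and conclusion\<close>

lemma subsum_ratio_le_1:
 fixes f :: "nat => real"
 assumes "finite S" "!!n. n : S ==> 0 <= f n"
 shows "inverse (\<Sum>n\<in>S. f n) * (\<Sum>n | n : S & Q n. f n) <= 1"
proof -
 have "(\<Sum>n | n : S & Q n. f n) <= (\<Sum>n\<in>S. f n)" using assms by (intro sum_mono2) auto
 moreover have "0 <= (\<Sum>n\<in>S. f n)" using assms by (intro sum_nonneg)
 ultimately show ?thesis by (cases "(\<Sum>n\<in>S. f n) = 0") (auto simp: field_simps)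
qed

text \<open>The bound is trivial unless \<open>1 <= lam <= sqrt M / 10\<close> and \<open>M\<close> is large: the term \<open>20 * lam ^ 3 / sqrt M\<close>
 dominates for large \<open>lam\<close>.\<close>

lemma trivial_range:
 assumes M: "0 < M" "M <= M1" and lam: "0 < lam" "lam <= sqrt M / 2" and C: "2 <= C"
  and triv: "lam < 1 \<or> sqrt M / 10 < lam \<or> exp M1 <= C"
 shows "1 <= C * inverse lam * exp (- (lam\<^sup>2 / 2) + 20 * (lam ^ 3 / sqrt M))"
proof -
 have s: "0 < sqrt M" using M by simp
 have t0: "0 <= lam ^ 3 / sqrt M" using lam s by simp
 consider "lam < 1" | "1 <= lam" "sqrt M / 10 < lam" | "1 <= lam" "exp M1 <= C" using triv by linarith
 thus ?thesis
 proof cases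
  case 1
  have "lam\<^sup>2 <= 1" using 1 lam by (simp add: power_le_one)
  hence "- (1/2) <= - (lam\<^sup>2 / 2) + 20 * (lam ^ 3 / sqrt M)" using t0 by linarith
  hence "exp (- (1/2)) <= exp (- (lam\<^sup>2 / 2) + 20 * (lam ^ 3 / sqrt M))" by (simp only: exp_le_cancel_iff)
  hence b: "1/2 <= exp (- (lam\<^sup>2 / 2) + 20 * (lam ^ 3 / sqrt M))" using exp_ge_add_one_self[of "- (1/2) :: real"] by linarith
  have a: "2 * 1 <= C * inverse lam" using C lam 1 by (intro mult_mono) (auto simp: one_le_inverse_iff)
  have "2 * 1 * (1/2) <= C * inverse lam * exp (- (lam\<^sup>2 / 2) + 20 * (lam ^ 3 / sqrt M))"
   by (rule mult_mono[OF a b]) (use C lam in auto)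
  thus ?thesis by linarith
 next
  case 2
  \<comment> \<open>Here \<open>20 * lam ^ 3 / sqrt M >= 2 * lam^2\<close>, so the exponent is at
    least \<open>lam^2\<close> and the right side exceeds 1.\<close>
  have "1 / 10 <= lam / sqrt M" using 2 s by (simp add: field_simps)
  hence "lam\<^sup>2 * (1 / 10) <= lam\<^sup>2 * (lam / sqrt M)" by (intro mult_left_mono) auto
  also have "\<dots> = lam ^ 3 / sqrt M" by (simp add: power2_eq_square power3_eq_cube)
  finally have l: "lam\<^sup>2 <= - (lam\<^sup>2 / 2) + 20 * (lam ^ 3 / sqrt M)" using zero_le_power2[of lam] by linarith
  have "lam * 1 <= lam * lam" using 2 by (intro mult_left_mono) auto
  hence "lam <= lam\<^sup>2" by (simp add: power2_eq_square)
  hence "lam <= exp (lam\<^sup>2)" using exp_ge_add_one_self[of "lam\<^sup>2"] by linarith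
  also have "\<dots> <= exp (- (lam\<^sup>2 / 2) + 20 * (lam ^ 3 / sqrt M))" using l by simp
  finally have "inverse lam * lam <= inverse lam * exp (- (lam\<^sup>2 / 2) + 20 * (lam ^ 3 / sqrt M))" using lam by (intro mult_left_mono) auto
  hence "1 <= inverse lam * exp (- (lam\<^sup>2 / 2) + 20 * (lam ^ 3 / sqrt M))" using lam by simp
  hence "1 * 1 <= C * (inverse lam * exp (- (lam\<^sup>2 / 2) + 20 * (lam ^ 3 / sqrt M)))" using C by (intro mult_mono) auto
  thus ?thesis by (simp only: mult.assoc mult_1_left)
 next
  case 3
  have "lam\<^sup>2 <= (sqrt M / 2)\<^sup>2" using lam by (intro power_mono) auto
  also have "\<dots> = M / 4" using M by (simp add: power_divide)
  \<comment> \<open>A bounded mean bounds \<open>lam\<close>, and \<open>exp M1\<close> outweighs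
    both \<open>lam\<close> and the Gaussian decay.\<close>
  finally have l2: "lam\<^sup>2 <= M1 / 4" using M by linarith
  have "lam * 1 <= lam * lam" using 3 by (intro mult_left_mono) auto
  hence l1: "lam <= lam\<^sup>2" by (simp add: power2_eq_square)
  have "lam <= exp lam" using exp_ge_add_one_self[of lam] by linarith
  also have "\<dots> <= exp (M1 + (- (lam\<^sup>2 / 2) + 20 * (lam ^ 3 / sqrt M)))"
   unfolding exp_le_cancel_iff using l1 l2 t0 zero_le_power2[of lam] by linarith
  also have "\<dots> = exp M1 * exp (- (lam\<^sup>2 / 2) + 20 * (lam ^ 3 / sqrt M))" by (rule exp_add)
  also have "\<dots> <= C * exp (- (lam\<^sup>2 / 2) + 20 * (lam ^ 3 / sqrt M))" using 3 by (intro mult_right_mono) auto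
  finally have "inverse lam * lam <= inverse lam * (C * exp (- (lam\<^sup>2 / 2) + 20 * (lam ^ 3 / sqrt M)))" using lam by (intro mult_left_mono) auto
  thus ?thesis using lam by (simp add: mult_ac)
 qed
qed

text \<open>The quotient of \<open>large_deviation_upper\<close> by
  \<open>sifted_mass_lower\<close>, in which \<open>x / ln x\<close> and both exponential means
  cancel. Whatever lies outside their common range is left to \<open>trivial_range\<close>.\<close>

lemma normal_tail_bound:
 fixes A1 B c0 x0 \<theta> :: real and A2 T :: "real => real" and v :: nat
 assumes A: "0 < A1" "\<forall>\<epsilon>>0. 0 < A2 \<epsilon>" and B: "0 < B" and c0: "0 < c0" and x0: "2 <= x0" and \<theta>: "1/2 < \<theta>" "\<theta> < 1"
 shows "\<exists>C>0. \<forall>f E g R D. f : mult_class A1 A2 --> (\<forall>p\<in>E. prime p) --> g : {omega_in, Omega_in} -->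
  (\<forall>x\<ge>2. \<forall>p. prime p --> R x p \<subseteq> totatives p & card (R x p) <= v) --> (\<forall>x\<ge>2. 1 <= D x) -->
  (\<forall>x\<ge>x0. \<forall>p\<in>sieving_primes (R x). real p <= D x powr (1 / sieve_exponent v)) -->
  (\<forall>x\<ge>x0. \<forall>p\<in>sieving_primes (R x). card (R x p) < p - 1) -->
  (\<forall>x\<ge>x0. c0 <= prime_mean f x E) -->
  (\<forall>x\<ge>x0. \<forall>t\<in>{x powr \<theta>..x}. B * (t / ln (2 * t)) <= (\<Sum>p | prime p & real p <= t. f p)) -->
  smallo_rate T (%x. level_error f (R x) (D x) x) (%x. x / ln x * exp (prime_mean f x UNIV - prime_mean (%p. real (card (R x p))) x UNIV)) -->
  (\<forall>x\<ge>x0. \<forall>lam::real. 0 < lam & lam <= sqrt (prime_mean f x E) / 2 -->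
   inverse (\<Sum>n\<in>sifted_set x (R x). f n) *
   (\<Sum>n | n : sifted_set x (R x) & lam * sqrt (prime_mean f x E) <= \<bar>real (g n E) - prime_mean f x E\<bar>. f n)
   <= C * inverse lam * exp (- (lam\<^sup>2 / 2) + 20 * (lam ^ 3 / sqrt (prime_mean f x E))))"
proof -
 have a2: "0 < A2 (1/2)" using A(2)[rule_format, of "1/2"] by simp
 obtain C1 X1 where U: "C1 > 0" "!!f g E R x lam. f : mult_class A1 A2 ==> additive_fun g E ==>
  residue_system v R ==> X1 <= x ==> 1 <= lam ==> lam <= sqrt (prime_mean f x E) / 10 ==>
  (\<Sum>n | n : sifted_set x R & lam * sqrt (prime_mean f x E) <= \<bar>real (g n) - prime_mean f x E\<bar>. f n) \<le>
   C1 * (x / ln x * exp (prime_mean f x UNIV - sieve_mean R x)) *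
   (inverse lam * exp (- (lam\<^sup>2 / 2) + lam ^ 3 / sqrt (prime_mean f x E)))"
  using large_deviation_upper[where ?A1.0 = A1 and ?A2.0 = A2 and v = v, OF A] by atomize_elim (elim exE conjE, intro exI conjI, assumption, assumption)
 obtain c \<delta> X2 where W: "c > 0" "\<delta> > 0" "!!f R D x. f : mult_class A1 A2 ==>
  (\<forall>t\<ge>x0. B * (t / ln (2 * t)) <= (\<Sum>p | prime p & real p <= t. f p)) ==>
  residue_system v R ==>
  (\<forall>p\<in>sieving_primes R. real p <= D powr (1 / sieve_exponent v)) ==> 1 <= D ==> (\<forall>p\<in>sieving_primes R. card (R p) < p - 1) ==> X2 <= x ==>
  level_error f R D x <= \<delta> * (x / ln x * exp (prime_mean f x UNIV - sieve_mean R x)) ==>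
  c * (x / ln x * exp (prime_mean f x UNIV - sieve_mean R x)) <= (\<Sum>n\<in>sifted_set x R. f n)"
  using sifted_mass_lower[where ?A1.0 = A1 and ?A2.0 = A2 and v = v and ?x0.0 = x0, OF A(1) a2 B] by atomize_elim (elim exE conjE, intro exI conjI, assumption, assumption, assumption)
 \<comment> \<open>Of the rate \<open>T\<close> only the value at the single tolerance \<delta>
   enters. For \<open>x < X0\<close> the mean is at most \<open>M1\<close>, so the constant
   \<open>exp M1\<close> makes the bound trivial there.\<close>
 define X0 where "X0 = max 2 (max X1 (max X2 (T \<delta>)))"
 define M1 where "M1 = max 0 (A1 * (ln (ln X0) + 9))"
 define C where "C = 2 + exp M1 + C1 / c"
 have C: "2 <= C" "exp M1 <= C" "C1 / c <= C" using U(1) W(1) by (auto simp: C_def add_nonneg_nonneg)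
 have H: "inverse (\<Sum>n\<in>sifted_set x (R x). f n) *
   (\<Sum>n | n : sifted_set x (R x) & lam * sqrt (prime_mean f x E) <= \<bar>real (g n E) - prime_mean f x E\<bar>. f n)
   <= C * inverse lam * exp (- (lam\<^sup>2 / 2) + 20 * (lam ^ 3 / sqrt (prime_mean f x E)))"
  if f: "f : mult_class A1 A2" and E: "\<forall>p\<in>E. prime p" and g: "g : {omega_in, Omega_in}"
   and R: "\<forall>x\<ge>2. \<forall>p. prime p --> R x p \<subseteq> totatives p & card (R x p) <= v" and D: "\<forall>x\<ge>2. 1 <= D x"
   and PD: "\<forall>x\<ge>x0. \<forall>p\<in>sieving_primes (R x). real p <= D x powr (1 / sieve_exponent v)"
   and nu: "\<forall>x\<ge>x0. \<forall>p\<in>sieving_primes (R x). card (R x p) < p - 1"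
   and c0': "\<forall>x\<ge>x0. c0 <= prime_mean f x E"
   and d: "\<forall>x\<ge>x0. \<forall>t\<in>{x powr \<theta>..x}. B * (t / ln (2 * t)) <= (\<Sum>p | prime p & real p <= t. f p)"
   and o: "smallo_rate T (%x. level_error f (R x) (D x) x) (%x. x / ln x * exp (prime_mean f x UNIV - prime_mean (%p. real (card (R x p))) x UNIV))"
   and x: "x0 <= x" and lam: "0 < lam & lam <= sqrt (prime_mean f x E) / 2" for f E g R D x lam
 proof -
  define M where "M = prime_mean f x E"
  have x2: "2 <= x" using x x0 by linarith
  have "c0 <= M" unfolding M_def using c0' x by blast
  hence M0: "0 < M" using c0 by linarith
  have f0: "0 <= f n" if "n : sifted_set x (R x)" for n using mult_classD(2)[OF f, of n] that by (simp add: sifted_set_def)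
  define S where "S = (\<Sum>n\<in>sifted_set x (R x). f n)"
  define Sb where "Sb = (\<Sum>n | n : sifted_set x (R x) & lam * sqrt M <= \<bar>real (g n E) - M\<bar>. f n)"
  define G where "G = x / ln x * exp (prime_mean f x UNIV - prime_mean (%p. real (card (R x p))) x UNIV)"
  have le1: "inverse S * Sb <= 1" unfolding S_def Sb_def by (rule subsum_ratio_le_1[OF finite_sifted_set f0])
  have "inverse S * Sb <= C * inverse lam * exp (- (lam\<^sup>2 / 2) + 20 * (lam ^ 3 / sqrt M))"
  proof (cases "lam < 1 \<or> sqrt M / 10 < lam \<or> x < X0")
   case True
   define M' where "M' = (if x < X0 then M1 else M)"
   have "M <= M1" if "x < X0"
   proof -
   have "ln (ln x) <= ln (ln X0)" using that x2 by simp
   hence "A1 * (ln (ln x) + 9) <= A1 * (ln (ln X0) + 9)" using A(1) by (intro mult_left_mono) auto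
   thus ?thesis using prime_mean_le(2)[OF f A(1) x2, of E] prime_mean_le(3)[OF f A(1) x2] unfolding M1_def M_def by linarith
   qed
   hence "M <= M'" by (simp add: M'_def)
   moreover have "lam < 1 \<or> sqrt M / 10 < lam \<or> exp M' <= C" using True C(2) by (auto simp: M'_def)
   ultimately have "1 <= C * inverse lam * exp (- (lam\<^sup>2 / 2) + 20 * (lam ^ 3 / sqrt M))"
   using lam C(1) M0 by (intro trivial_range) (auto simp: M_def)
   thus ?thesis using le1 by linarith
  next
   case False
   hence l: "1 <= lam" "lam <= sqrt M / 10" and xX: "X0 <= x" by auto
   have xx: "X1 <= x" "X2 <= x" "T \<delta> <= x" using xX by (auto simp: X0_def)
   have Rx: "\<forall>p. prime p --> R x p \<subseteq> totatives p & card (R x p) <= v" using R x2 by blast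
   have af: "additive_fun (%n. g n E) E" using g
   proof
   assume "g = omega_in"
   thus ?thesis using additive_fun_omega[OF E] by (simp only:)
   next
   assume "g : {Omega_in}"
   hence "g = Omega_in" by (rule singletonD)
   thus ?thesis using additive_fun_Omega[OF E] by (simp only:)
   qed
   have G0: "0 < G" using x2 by (simp add: G_def)
   have up: "Sb <= C1 * G * (inverse lam * exp (- (lam\<^sup>2 / 2) + lam ^ 3 / sqrt M))"
   unfolding Sb_def G_def M_def by (rule U(2)[OF f af Rx xx(1) l(1) l(2)[unfolded M_def]])
   \<comment> \<open>Taking the hypothesis on prime sums with \<open>x\<close> equal to
     \<open>t\<close> frees it from the range \<open>x powr \<theta> <= t\<close>.\<close>
   have dt: "\<forall>t\<ge>x0. B * (t / ln (2 * t)) <= (\<Sum>p | prime p & real p <= t. f p)"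
   proof (intro allI impI)
   fix t assume t: "x0 <= t"
   have "t powr \<theta> <= t powr 1" using t x0 \<theta> by (intro powr_mono) auto
   hence "t : {t powr \<theta>..t}" using t x0 by simp
   thus "B * (t / ln (2 * t)) <= (\<Sum>p | prime p & real p <= t. f p)" using d t by blast
   qed
   have "\<bar>level_error f (R x) (D x) x\<bar> <= \<delta> * \<bar>G\<bar>"
   unfolding G_def by (rule o[unfolded smallo_rate_def, rule_format, OF W(2) xx(3)])
   hence le: "level_error f (R x) (D x) x <= \<delta> * G" using G0 by simp
   have PDx: "\<forall>p\<in>sieving_primes (R x). real p <= D x powr (1 / sieve_exponent v)" using PD x by blast
   have nux: "\<forall>p\<in>sieving_primes (R x). card (R x p) < p - 1" using nu x by blast
   have Dx: "1 <= D x" using D x2 by blast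
   have lo: "c * G <= S" unfolding S_def G_def
   by (rule W(3)[OF f dt Rx PDx Dx nux xx(2) le[unfolded G_def]])
   have cG: "0 < c * G" using W(1) G0 by simp
   have S0: "0 < S" using lo cG by linarith
   let ?e = "inverse lam * exp (- (lam\<^sup>2 / 2) + lam ^ 3 / sqrt M)"
   have e0: "0 <= ?e" using l by simp
   have "inverse S * Sb <= inverse S * (C1 * G * ?e)" using up S0 by (intro mult_left_mono) auto
   also have "\<dots> <= inverse (c * G) * (C1 * G * ?e)"
   by (rule mult_right_mono[OF le_imp_inverse_le[OF lo cG]], rule mult_nonneg_nonneg[OF _ e0]) (use U(1) G0 in simp)
   also have "\<dots> = C1 / c * ?e" using G0 W(1) by (simp add: field_simps)
   also have "\<dots> <= C * ?e" using C(3) e0 by (intro mult_right_mono)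
   also have "\<dots> <= C * (inverse lam * exp (- (lam\<^sup>2 / 2) + 20 * (lam ^ 3 / sqrt M)))"
   proof (intro mult_left_mono)
   have "0 <= lam ^ 3 / sqrt M" using l M0 by simp
   hence "- (lam\<^sup>2 / 2) + lam ^ 3 / sqrt M <= - (lam\<^sup>2 / 2) + 20 * (lam ^ 3 / sqrt M)" by linarith
   thus "exp (- (lam\<^sup>2 / 2) + lam ^ 3 / sqrt M) <= exp (- (lam\<^sup>2 / 2) + 20 * (lam ^ 3 / sqrt M))" by (simp only: exp_le_cancel_iff)
   qed (use l C(1) in auto)
   finally show ?thesis by (simp only: mult.assoc)
  qed
  thus ?thesis by (simp only: S_def Sb_def M_def)
 qed
 have Cp: "0 < C" using C(1) by linarith
 show ?thesis by (rule exI[of _ C], rule conjI, rule Cp, intro allI impI, rule H, assumption+)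
qed

theorem corollary1p2:
  "\<exists>K::real. 0 < K \<and>
    (\<forall>(A1::real) (A2::real \<Rightarrow> real) (B::real) (c0::real) (v::nat) (x0::real) (\<theta>::real) (T::real \<Rightarrow> real).
       0 < A1 \<and> (\<forall>\<epsilon>>0. 0 < A2 \<epsilon>) \<and> 0 < B \<and> 0 < c0 \<and> 2 \<le> x0 \<and> 1 / 2 < \<theta> \<and> \<theta> < 1 \<longrightarrow>
       (\<exists>C::real. 0 < C \<and>
         (\<forall>(p0::nat) (f::nat \<Rightarrow> real) (E::nat set) (g::nat \<Rightarrow> nat set \<Rightarrow> nat)
            (R::real \<Rightarrow> nat \<Rightarrow> nat set) (D::real \<Rightarrow> real).
            prime p0 \<longrightarrow>
            f \<in> mult_class A1 A2 \<longrightarrow>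
            (\<forall>p\<in>E. prime p \<and> p0 \<le> p) \<longrightarrow>
            g \<in> {omega_in, Omega_in} \<longrightarrow>
            (\<forall>x\<ge>2. \<forall>p. prime p \<longrightarrow> R x p \<subseteq> totatives p \<and> residue_count (R x) p \<le> v) \<longrightarrow>
            (\<forall>x\<ge>2. 1 \<le> D x) \<longrightarrow>
            (\<forall>x\<ge>x0. \<forall>p\<in>sieving_primes (R x). real p \<le> D x powr (1 / sieve_exponent v)) \<longrightarrow>
            (\<forall>x\<ge>x0. \<forall>p\<in>sieving_primes (R x). residue_count (R x) p < p - 1) \<longrightarrow>
            (\<forall>x\<ge>x0. c0 \<le> prime_mean f x E) \<longrightarrow>
            (\<forall>x\<ge>x0. \<forall>t\<in>{x powr \<theta>..x}.
               B * (t / ln (2 * t)) \<le> (\<Sum>p | prime p \<and> real p \<le> t. f p)) \<longrightarrow>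
            smallo_rate T
              (\<lambda>x. level_error f (R x) (D x) x)
              (\<lambda>x. x / ln x *
                 exp (prime_mean f x UNIV - prime_mean (\<lambda>p. real (residue_count (R x) p)) x UNIV)) \<longrightarrow>
            (\<forall>x\<ge>x0. \<forall>lam::real. 0 < lam \<and> lam \<le> sqrt (prime_mean f x E) / 2 \<longrightarrow>
               inverse (\<Sum>n\<in>sifted_set x (R x). f n) *
                 (\<Sum>n | n \<in> sifted_set x (R x) \<and>
                        lam * sqrt (prime_mean f x E) \<le> \<bar>real (g n E) - prime_mean f x E\<bar>. f n)
               \<le> C * inverse lam *
                   exp (- (lam\<^sup>2 / 2) + K * (lam ^ 3 / sqrt (prime_mean f x E)))))))"
proof (rule exI[of _ 20], rule conjI, simp, intro allI impI, elim conjE, goal_cases)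
  case (1 A1 A2 B c0 v x0 \<theta> T)
  obtain C where C: "C > 0" and H: "\<forall>f E g R D. f \<in> mult_class A1 A2 \<longrightarrow> (\<forall>p\<in>E. prime p) \<longrightarrow> g \<in> {omega_in, Omega_in} \<longrightarrow>
    (\<forall>x\<ge>2. \<forall>p. prime p \<longrightarrow> R x p \<subseteq> totatives p \<and> card (R x p) \<le> v) \<longrightarrow> (\<forall>x\<ge>2. 1 \<le> D x) \<longrightarrow>
    (\<forall>x\<ge>x0. \<forall>p\<in>sieving_primes (R x). real p \<le> D x powr (1 / sieve_exponent v)) \<longrightarrow>
    (\<forall>x\<ge>x0. \<forall>p\<in>sieving_primes (R x). card (R x p) < p - 1) \<longrightarrow>
    (\<forall>x\<ge>x0. c0 \<le> prime_mean f x E) \<longrightarrow>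
    (\<forall>x\<ge>x0. \<forall>t\<in>{x powr \<theta>..x}. B * (t / ln (2 * t)) \<le> (\<Sum>p | prime p \<and> real p \<le> t. f p)) \<longrightarrow>
    smallo_rate T (\<lambda>x. level_error f (R x) (D x) x) (\<lambda>x. x / ln x * exp (prime_mean f x UNIV - prime_mean (\<lambda>p. real (card (R x p))) x UNIV)) \<longrightarrow>
    (\<forall>x\<ge>x0. \<forall>lam::real. 0 < lam \<and> lam \<le> sqrt (prime_mean f x E) / 2 \<longrightarrow>
      inverse (\<Sum>n\<in>sifted_set x (R x). f n) *
        (\<Sum>n | n \<in> sifted_set x (R x) \<and> lam * sqrt (prime_mean f x E) \<le> \<bar>real (g n E) - prime_mean f x E\<bar>. f n)
      \<le> C * inverse lam * exp (- (lam\<^sup>2 / 2) + 20 * (lam ^ 3 / sqrt (prime_mean f x E))))"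
    using normal_tail_bound[where v = v and T = T, OF 1] by (elim exE conjE) (rule that, assumption, assumption)
  show ?case
  proof (rule exI[of _ C], rule conjI, rule C, intro allI impI, goal_cases)
    case (1 p0 f E g R D x lam)
    have E: "\<forall>p\<in>E. prime p" using 1(3) by blast
    show ?case
      by (rule H[rule_format (no_asm), OF 1(2) E 1(4) 1(5)[unfolded residue_count_def] 1(6) 1(7) 1(8)[unfolded residue_count_def] 1(9,10) 1(11)[unfolded residue_count_def] 1(12,13)])
  qed
qed

end
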